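(* The category $\overline{\Omega}$ of closed trees is a strict test category (in particular a test category).
   Context: **Test categories.** A functor $u:A\to B$ between small categories is a weak equivalence if its nerve $N(u)$ is a weak homotopy equivalence of simplicial sets. For a small category $A$, write $\widehat{A}$ for the category of presheaves of sets on $A$, and for a presheaf $F$ on $A$ write $A/F$ for its category of elements. There is an adjoint pair $i_A:\widehat{A}\to \mathrm{Cat}$, $F\mapsto A/F$, and $i_A^*:\mathrm{Cat}\to\widehat{A}$, $C\mapsto (a\mapsto \mathrm{Hom}_{\mathrm{Cat}}(A/a,C))$, where $\mathrm{Cat}$ is the category of small categories and $A/a$ is the slice category. The category $A$ is a weak test category if for every small category $C$ the counit $i_A i_A^* C\to C$ is a weak equivalence; it is a local test category if for every object $a$ of $A$ the slice $A/a$ is a weak test category; it is a test category if it is both. A test category $A$ is strict if for all presheaves $X,Y$ on $A$ the canonical functor $A/(X\times Y)\to A/X\times A/Y$ is a weak equivalence (equivalently, for a test category, if the product in $\widehat{A}$ of any two representable presheaves has an aspherical category of elements, i.e. one with weakly contractible nerve). **Trees.** A tree means a finite non-planar rooted tree (in the sense of dendroidal sets): it has a finite non-empty set of edges and a finite set of vertices; each vertex has exactly one output edge and a finite, possibly empty, set of input edges; every edge is the output of at most one vertex and an input of at most one vertex; exactly one edge, the root, is not an input of any vertex, and going downwards from any edge one reaches the root. Edges which are not the output of any vertex are called leaves. The tree $\eta$ with one edge and no vertex is allowed. **The categories $\Omega$ and $\overline{\Omega}$.** "Operad" means symmetric coloured operad (in sets). Each tree $T$ generates an operad $\Omega(T)$: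 its colours are the edges of $T$, and it is the free operad generated by the vertices of $T$, a vertex being regarded as an operation from its input edges (ordered by a chosen planar structure; the result does not depend on the choice) to its output edge. Thus $\Omega(T)(e_1,\dots,e_n;e)$ has one element if $e_1,\dots,e_n$ are distinct and are exactly the leaves of a subtree of $T$ with root $e$, and is empty otherwise. The objects of $\Omega$ are trees, and morphisms $S\to T$ are morphisms of operads $\Omega(S)\to\Omega(T)$. A tree is closed if it has no leaves; $\overline{\Omega}$ is the full subcategory of $\Omega$ consisting of closed trees. *)

theory Defs
  imports
    "HOL-Analysis.Analysis"
    "HOL-Homology.Homology"
    "HOL-Combinatorics.Permutations"
    "HOL-Library.Infinite_Typeclass"
begin

section \<open>Small categories, functors, presheaves\<close>

record ('o, 'm) cat =
  Obj :: "'o set"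
  Arr :: "'m set"
  Dom :: "'m \<Rightarrow> 'o"
  Cod :: "'m \<Rightarrow> 'o"
  Ident  :: "'o \<Rightarrow> 'm"
  Comp :: "'m \<Rightarrow> 'm \<Rightarrow> 'm"   \<comment> \<open>\<open>Comp C g f\<close> is \<open>g\<close> after \<open>f\<close>\<close>

locale category =
  fixes C :: "('o, 'm) cat"
  assumes dom_cod: "f \<in> Arr C \<Longrightarrow> Dom C f \<in> Obj C \<and> Cod C f \<in> Obj C"
    and id_arr: "a \<in> Obj C \<Longrightarrow> Ident C a \<in> Arr C \<and> Dom C (Ident C a) = a \<and> Cod C (Ident C a) = a"
    and comp_arr: "\<lbrakk>f \<in> Arr C; g \<in> Arr C; Dom C g = Cod C f\<rbrakk> \<Longrightarrow>
          Comp C g f \<in> Arr C \<and> Dom C (Comp C g f) = Dom C f \<and> Cod C (Comp C g f) = Cod C g"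
    and comp_id_right: "f \<in> Arr C \<Longrightarrow> Comp C f (Ident C (Dom C f)) = f"
    and comp_id_left: "f \<in> Arr C \<Longrightarrow> Comp C (Ident C (Cod C f)) f = f"
    and comp_assoc: "\<lbrakk>f \<in> Arr C; g \<in> Arr C; h \<in> Arr C; Dom C g = Cod C f; Dom C h = Cod C g\<rbrakk> \<Longrightarrow>
          Comp C h (Comp C g f) = Comp C (Comp C h g) f"

definition full_subcategory :: "('o, 'm) cat \<Rightarrow> 'o set \<Rightarrow> ('o, 'm) cat" where
  "full_subcategory C P =
    C \<lparr>Obj := Obj C \<inter> P, Arr := {f \<in> Arr C. Dom C f \<in> P \<and> Cod C f \<in> P}\<rparr>"

definition product_category :: "('o, 'm) cat \<Rightarrow> ('p, 'n) cat \<Rightarrow> ('o \<times> 'p, 'm \<times> 'n) cat" where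
  "product_category C D =
    \<lparr>Obj = Obj C \<times> Obj D, Arr = Arr C \<times> Arr D,
     Dom = (\<lambda>(f, g). (Dom C f, Dom D g)), Cod = (\<lambda>(f, g). (Cod C f, Cod D g)),
     Ident = (\<lambda>(a, b). (Ident C a, Ident D b)),
     Comp = (\<lambda>(f', g') (f, g). (Comp C f' f, Comp D g' g))\<rparr>"

text \<open>The slice \<open>C / a\<close>. Its arrow \<open>(f, h, g)\<close> is the arrow \<open>h\<close> from the domain of \<open>f\<close> to the
  domain of \<open>g\<close>, with \<open>g \<circ> h = f\<close>, regarded as an arrow from \<open>f\<close> to \<open>g\<close>.\<close>

definition slice :: "('o, 'm) cat \<Rightarrow> 'o \<Rightarrow> ('m, 'm \<times> 'm \<times> 'm) cat" where
  "slice C a =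
    \<lparr>Obj = {f \<in> Arr C. Cod C f = a},
     Arr = {(f, h, g). f \<in> Arr C \<and> Cod C f = a \<and> g \<in> Arr C \<and> Cod C g = a \<and>
                       h \<in> Arr C \<and> Dom C h = Dom C f \<and> Cod C h = Dom C g \<and> Comp C g h = f},
     Dom = (\<lambda>(f, h, g). f), Cod = (\<lambda>(f, h, g). g),
     Ident = (\<lambda>f. (f, Ident C (Dom C f), f)),
     Comp = (\<lambda>(g', k, l) (f, h, g). (f, Comp C k h, l))\<rparr>"

record ('o, 'm, 'p, 'n) fnctr =
  omap :: "'o \<Rightarrow> 'p"
  amap :: "'m \<Rightarrow> 'n"

definition is_functor ::
  "('o, 'm) cat \<Rightarrow> ('p, 'n) cat \<Rightarrow> ('o, 'm, 'p, 'n) fnctr \<Rightarrow> bool" where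
  "is_functor C D F \<longleftrightarrow>
    (\<forall>a \<in> Obj C. omap F a \<in> Obj D) \<and>
    (\<forall>f \<in> Arr C. amap F f \<in> Arr D \<and> Dom D (amap F f) = omap F (Dom C f)
                  \<and> Cod D (amap F f) = omap F (Cod C f)) \<and>
    (\<forall>a \<in> Obj C. amap F (Ident C a) = Ident D (omap F a)) \<and>
    (\<forall>f \<in> Arr C. \<forall>g \<in> Arr C. Dom C g = Cod C f \<longrightarrow>
        amap F (Comp C g f) = Comp D (amap F g) (amap F f))"

text \<open>The set of functors: here the values outside \<open>C\<close> are normalised to \<open>undefined\<close>, so that
  equality of elements of this set is equality of functors.\<close>

definition functors ::
  "('o, 'm) cat \<Rightarrow> ('p, 'n) cat \<Rightarrow> ('o, 'm, 'p, 'n) fnctr set" where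
  "functors C D =
    {F. is_functor C D F \<and> omap F \<in> extensional (Obj C) \<and> amap F \<in> extensional (Arr C)}"

definition functor_comp ::
  "('o, 'm) cat \<Rightarrow> ('p, 'n, 'q, 'k) fnctr \<Rightarrow> ('o, 'm, 'p, 'n) fnctr \<Rightarrow> ('o, 'm, 'q, 'k) fnctr" where
  "functor_comp C G F =
    \<lparr>omap = compose (Obj C) (omap G) (omap F), amap = compose (Arr C) (amap G) (amap F)\<rparr>"

record ('o, 'm, 'x) psh =
  sections :: "'o \<Rightarrow> 'x set"
  restr :: "'m \<Rightarrow> 'x \<Rightarrow> 'x"

definition presheaf :: "('o, 'm) cat \<Rightarrow> ('o, 'm, 'x) psh \<Rightarrow> bool" where
  "presheaf C X \<longleftrightarrow>
    (\<forall>f \<in> Arr C. restr X f \<in> sections X (Cod C f) \<rightarrow> sections X (Dom C f)) \<and>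
    (\<forall>a \<in> Obj C. \<forall>x \<in> sections X a. restr X (Ident C a) x = x) \<and>
    (\<forall>f \<in> Arr C. \<forall>g \<in> Arr C. Dom C g = Cod C f \<longrightarrow>
        (\<forall>x \<in> sections X (Cod C g). restr X (Comp C g f) x = restr X f (restr X g x)))"

definition product_presheaf ::
  "('o, 'm, 'x) psh \<Rightarrow> ('o, 'm, 'y) psh \<Rightarrow> ('o, 'm, 'x \<times> 'y) psh" where
  "product_presheaf X Y =
    \<lparr>sections = (\<lambda>a. sections X a \<times> sections Y a),
     restr = (\<lambda>f (x, y). (restr X f x, restr Y f y))\<rparr>"

text \<open>The category of elements \<open>A / X\<close>; an arrow from \<open>(a, x)\<close> to \<open>(b, y)\<close> is an arrow
  \<open>f : a \<rightarrow> b\<close> of \<open>A\<close> with \<open>x = X(f) y\<close>.\<close>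

definition elements ::
  "('o, 'm) cat \<Rightarrow> ('o, 'm, 'x) psh \<Rightarrow> ('o \<times> 'x, ('o \<times> 'x) \<times> 'm \<times> ('o \<times> 'x)) cat" where
  "elements A X =
    \<lparr>Obj = {(a, x). a \<in> Obj A \<and> x \<in> sections X a},
     Arr = {((a, x), f, (b, y)). f \<in> Arr A \<and> a = Dom A f \<and> b = Cod A f \<and>
              y \<in> sections X b \<and> x = restr X f y},
     Dom = (\<lambda>(p, f, q). p), Cod = (\<lambda>(p, f, q). q),
     Ident = (\<lambda>(a, x). ((a, x), Ident A a, (a, x))),
     Comp = (\<lambda>(q', g, r) (p, f, q). (p, Comp A g f, r))\<rparr>"


section \<open>Weak homotopy equivalences of spaces\<close>

definition cube :: "nat \<Rightarrow> (nat \<Rightarrow> real) topology" where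
  "cube n = product_topology (\<lambda>_. top_of_set {0..1}) {..<n}"

definition cube_boundary :: "nat \<Rightarrow> (nat \<Rightarrow> real) set" where
  "cube_boundary n = {t \<in> topspace (cube n). \<exists>i<n. t i = 0 \<or> t i = 1}"

definition based_cubes :: "nat \<Rightarrow> 'a topology \<Rightarrow> 'a \<Rightarrow> ((nat \<Rightarrow> real) \<Rightarrow> 'a) set" where
  "based_cubes n X x = {g. continuous_map (cube n) X g \<and> (\<forall>t \<in> cube_boundary n. g t = x)}"

definition based_homotopic ::
  "nat \<Rightarrow> 'a topology \<Rightarrow> 'a \<Rightarrow> (((nat \<Rightarrow> real) \<Rightarrow> 'a) \<times> ((nat \<Rightarrow> real) \<Rightarrow> 'a)) set" where
  "based_homotopic n X x =
    {(g, h). g \<in> based_cubes n X x \<and> h \<in> based_cubes n X x \<and>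
             homotopic_with (\<lambda>k. \<forall>t \<in> cube_boundary n. k t = x) (cube n) X g h}"

definition homotopy_group :: "nat \<Rightarrow> 'a topology \<Rightarrow> 'a \<Rightarrow> ((nat \<Rightarrow> real) \<Rightarrow> 'a) set set" where
  "homotopy_group n X x = based_cubes n X x // based_homotopic n X x"

definition homotopy_group_map ::
  "nat \<Rightarrow> 'b topology \<Rightarrow> ('a \<Rightarrow> 'b) \<Rightarrow> 'a \<Rightarrow> ((nat \<Rightarrow> real) \<Rightarrow> 'a) set \<Rightarrow> ((nat \<Rightarrow> real) \<Rightarrow> 'b) set" where
  "homotopy_group_map n Y f x c = based_homotopic n Y (f x) `` ((\<lambda>g. f \<circ> g) ` c)"

definition path_components_map :: "'b topology \<Rightarrow> ('a \<Rightarrow> 'b) \<Rightarrow> 'a set \<Rightarrow> 'b set" where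
  "path_components_map Y f c = (\<Union>x\<in>c. path_component_of_set Y (f x))"

text \<open>The maps induced on homotopy groups are always homomorphisms, so they are isomorphisms
  as soon as they are bijective; the group structure need not be spelled out.\<close>

definition weak_homotopy_equivalence ::
  "'a topology \<Rightarrow> 'b topology \<Rightarrow> ('a \<Rightarrow> 'b) \<Rightarrow> bool" where
  "weak_homotopy_equivalence X Y f \<longleftrightarrow>
    continuous_map X Y f \<and>
    bij_betw (path_components_map Y f) (path_components_of X) (path_components_of Y) \<and>
    (\<forall>n\<ge>1. \<forall>x \<in> topspace X.
       bij_betw (homotopy_group_map n Y f x) (homotopy_group n X x) (homotopy_group n Y (f x)))"


section \<open>Simplicial sets and geometric realization\<close>

definition simplex_category :: "(nat, nat \<times> (nat \<Rightarrow> nat) \<times> nat) cat" where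
  "simplex_category =
    \<lparr>Obj = UNIV,
     Arr = {(m, f, n). f \<in> {..m} \<rightarrow>\<^sub>E {..n} \<and> mono_on {..m} f},
     Dom = (\<lambda>(m, f, n). m), Cod = (\<lambda>(m, f, n). n),
     Ident = (\<lambda>n. (n, \<lambda>i\<in>{..n}. i, n)),
     Comp = (\<lambda>(n', g, k) (m, f, n). (m, compose {..m} g f, k))\<rparr>"

type_synonym 'x sset = "(nat, nat \<times> (nat \<Rightarrow> nat) \<times> nat, 'x) psh"

definition quotient_space :: "'a topology \<Rightarrow> ('a \<times> 'a) set \<Rightarrow> 'a set topology" where
  "quotient_space X r = topology (\<lambda>U. U \<subseteq> topspace X // r \<and> openin X (\<Union>U))"

text \<open>An equivalence relation is needed for the union of an intersection of families of
  classes to be the intersection of the unions.\<close>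

lemma istopology_quotient_space:
  assumes "equiv (topspace X) r"
  shows "istopology (\<lambda>U. U \<subseteq> topspace X // r \<and> openin X (\<Union>U))"
proof -
  have "\<Union>(S \<inter> T) = \<Union>S \<inter> \<Union>T" if "S \<subseteq> topspace X // r" "T \<subseteq> topspace X // r" for S T
    using that quotient_disj[OF assms] by blast
  moreover have "openin X (\<Union>(\<Union>K))" if "\<forall>S\<in>K. openin X (\<Union>S)" for K :: "'a set set set"
  proof -
    have "\<Union>(\<Union>K) = \<Union>(Union ` K)"
      by blast
    then show ?thesis
      using that by (simp only:) (rule openin_Union, blast)
  qed
  ultimately show ?thesis
    unfolding istopology_def by (simp add: openin_Int le_infI1) blast
qed

text \<open>The disjoint union of one copy of the standard simplex of dimension \<open>n\<close> for each
  \<open>n\<close>-simplex \<open>x\<close>; points are written \<open>((n, x), t)\<close>.\<close>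

definition simplices_space :: "'x sset \<Rightarrow> ((nat \<times> 'x) \<times> (nat \<Rightarrow> real)) topology" where
  "simplices_space X =
    sum_topology (\<lambda>(n, x). subtopology (powertop_real UNIV) (standard_simplex n))
                 {(n, x). x \<in> sections X n}"

text \<open>The affine map of standard simplices induced by \<open>\<theta> : {..m} \<rightarrow> {..n}\<close>.\<close>

definition simplex_push :: "nat \<Rightarrow> (nat \<Rightarrow> nat) \<Rightarrow> (nat \<Rightarrow> real) \<Rightarrow> nat \<Rightarrow> real" where
  "simplex_push m \<theta> t = (\<lambda>j. \<Sum>i | i \<le> m \<and> \<theta> i = j. t i)"

definition realization_glue ::
  "'x sset \<Rightarrow> (((nat \<times> 'x) \<times> (nat \<Rightarrow> real)) \<times> ((nat \<times> 'x) \<times> (nat \<Rightarrow> real))) set" where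
  "realization_glue X =
    {(((m, restr X (m, \<theta>, n) x), t), ((n, x), simplex_push m \<theta> t)) | m \<theta> n x t.
       (m, \<theta>, n) \<in> Arr simplex_category \<and> x \<in> sections X n \<and> t \<in> standard_simplex m}"

definition realization_rel ::
  "'x sset \<Rightarrow> (((nat \<times> 'x) \<times> (nat \<Rightarrow> real)) \<times> ((nat \<times> 'x) \<times> (nat \<Rightarrow> real))) set" where
  "realization_rel X =
    (realization_glue X \<union> (realization_glue X)\<inverse>)\<^sup>* \<inter> (topspace (simplices_space X) \<times> topspace (simplices_space X))"

lemma equiv_realization_rel: "equiv (topspace (simplices_space X)) (realization_rel X)"
proof -
  have "sym ((realization_glue X \<union> (realization_glue X)\<inverse>)\<^sup>*)"
    by (intro sym_rtrancl) (auto simp: sym_def)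
  then show ?thesis
    unfolding realization_rel_def
    by (intro equivI) (auto simp: refl_on_def sym_def intro!: transI intro: rtrancl_trans)
qed

definition realization :: "'x sset \<Rightarrow> ((nat \<times> 'x) \<times> (nat \<Rightarrow> real)) set topology" where
  "realization X = quotient_space (simplices_space X) (realization_rel X)"

text \<open>A map of simplicial sets is given by a family of maps \<open>f n\<close> on \<open>n\<close>-simplices.\<close>

definition sset_map :: "'x sset \<Rightarrow> 'y sset \<Rightarrow> (nat \<Rightarrow> 'x \<Rightarrow> 'y) \<Rightarrow> bool" where
  "sset_map X Y f \<longleftrightarrow>
    (\<forall>n. f n \<in> sections X n \<rightarrow> sections Y n) \<and>
    (\<forall>m \<theta> n. (m, \<theta>, n) \<in> Arr simplex_category \<longrightarrow>
       (\<forall>x \<in> sections X n. f m (restr X (m, \<theta>, n) x) = restr Y (m, \<theta>, n) (f n x)))"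

definition realization_map ::
  "'y sset \<Rightarrow> (nat \<Rightarrow> 'x \<Rightarrow> 'y) \<Rightarrow>
    ((nat \<times> 'x) \<times> (nat \<Rightarrow> real)) set \<Rightarrow> ((nat \<times> 'y) \<times> (nat \<Rightarrow> real)) set" where
  "realization_map Y f c = realization_rel Y `` ((\<lambda>((n, x), t). ((n, f n x), t)) ` c)"

definition sset_weak_equivalence :: "'x sset \<Rightarrow> 'y sset \<Rightarrow> (nat \<Rightarrow> 'x \<Rightarrow> 'y) \<Rightarrow> bool" where
  "sset_weak_equivalence X Y f \<longleftrightarrow>
    sset_map X Y f \<and>
    weak_homotopy_equivalence (realization X) (realization Y) (realization_map Y f)"


section \<open>Nerves and weak equivalences of categories\<close>

text \<open>The poset \<open>{0, \<dots>, n}\<close> as a category, and the functor induced by a monotone map.\<close>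

definition ordinal :: "nat \<Rightarrow> (nat, nat \<times> nat) cat" where
  "ordinal n =
    \<lparr>Obj = {..n}, Arr = {(i, j). i \<le> j \<and> j \<le> n}, Dom = fst, Cod = snd,
     Ident = (\<lambda>i. (i, i)), Comp = (\<lambda>(j', k) (i, j). (i, k))\<rparr>"

definition ordinal_map :: "(nat \<Rightarrow> nat) \<Rightarrow> (nat, nat \<times> nat, nat, nat \<times> nat) fnctr" where
  "ordinal_map \<theta> = \<lparr>omap = \<theta>, amap = (\<lambda>(i, j). (\<theta> i, \<theta> j))\<rparr>"

definition nerve :: "('o, 'm) cat \<Rightarrow> (nat, nat \<times> nat, 'o, 'm) fnctr sset" where
  "nerve C =
    \<lparr>sections = (\<lambda>n. functors (ordinal n) C),
     restr = (\<lambda>(m, \<theta>, n) x. functor_comp (ordinal m) x (ordinal_map \<theta>))\<rparr>"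

definition nerve_map ::
  "('o, 'm, 'p, 'n) fnctr \<Rightarrow>
    nat \<Rightarrow> (nat, nat \<times> nat, 'o, 'm) fnctr \<Rightarrow> (nat, nat \<times> nat, 'p, 'n) fnctr" where
  "nerve_map u n x = functor_comp (ordinal n) u x"

definition weak_equivalence ::
  "('o, 'm) cat \<Rightarrow> ('p, 'n) cat \<Rightarrow> ('o, 'm, 'p, 'n) fnctr \<Rightarrow> bool" where
  "weak_equivalence C D u \<longleftrightarrow>
    is_functor C D u \<and> sset_weak_equivalence (nerve C) (nerve D) (nerve_map u)"


section \<open>Test categories\<close>

text \<open>The functor \<open>A / a \<rightarrow> A / b\<close> given by composition with \<open>f : a \<rightarrow> b\<close>.\<close>

definition slice_map ::
  "('o, 'm) cat \<Rightarrow> 'm \<Rightarrow> ('m, 'm \<times> 'm \<times> 'm, 'm, 'm \<times> 'm \<times> 'm) fnctr" where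
  "slice_map A f =
    \<lparr>omap = (\<lambda>g. Comp A f g), amap = (\<lambda>(g, h, g'). (Comp A f g, h, Comp A f g'))\<rparr>"

text \<open>The presheaf \<open>i\<^sub>A\<^sup>* C\<close> and the counit \<open>A / i\<^sub>A\<^sup>* C \<rightarrow> C\<close>, which sends \<open>(a, u : A / a \<rightarrow> C)\<close> to
  \<open>u(id\<^sub>a)\<close>. An arrow \<open>f : (a, u) \<rightarrow> (b, v)\<close> has \<open>u = v \<circ> A/f\<close>, so \<open>u(id\<^sub>a) = v(f)\<close>; it is sent to
  the value of \<open>v\<close> on the arrow \<open>f : f \<rightarrow> id\<^sub>b\<close> of \<open>A / b\<close>.\<close>

definition slice_functors ::
  "('o, 'm) cat \<Rightarrow> ('c, 'd) cat \<Rightarrow> ('o, 'm, ('m, 'm \<times> 'm \<times> 'm, 'c, 'd) fnctr) psh" where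
  "slice_functors A C =
    \<lparr>sections = (\<lambda>a. functors (slice A a) C),
     restr = (\<lambda>f v. functor_comp (slice A (Dom A f)) v (slice_map A f))\<rparr>"

definition counit ::
  "('o, 'm) cat \<Rightarrow>
    ('o \<times> ('m, 'm \<times> 'm \<times> 'm, 'c, 'd) fnctr,
     ('o \<times> ('m, 'm \<times> 'm \<times> 'm, 'c, 'd) fnctr) \<times> 'm \<times> ('o \<times> ('m, 'm \<times> 'm \<times> 'm, 'c, 'd) fnctr),
     'c, 'd) fnctr" where
  "counit A =
    \<lparr>omap = (\<lambda>(a, u). omap u (Ident A a)),
     amap = (\<lambda>((a, u), f, (b, v)). amap v (f, f, Ident A b))\<rparr>"

text \<open>HOL cannot quantify over types inside a definition. The types of the objects and arrows of
  the small categories \<open>C\<close>, and of the elements of the presheaves \<open>X\<close> and \<open>Y\<close>, are therefore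
  parameters; a theorem in which these are type variables is about all of them.\<close>

definition weak_test_category :: "('c \<times> 'd) itself \<Rightarrow> ('o, 'm) cat \<Rightarrow> bool" where
  "weak_test_category _ A \<longleftrightarrow>
    category A \<and>
    (\<forall>C :: ('c, 'd) cat. category C \<longrightarrow>
       weak_equivalence (elements A (slice_functors A C)) C (counit A))"

definition local_test_category :: "('c \<times> 'd) itself \<Rightarrow> ('o, 'm) cat \<Rightarrow> bool" where
  "local_test_category T A \<longleftrightarrow>
    category A \<and> (\<forall>a \<in> Obj A. weak_test_category T (slice A a))"

definition test_category :: "('c \<times> 'd) itself \<Rightarrow> ('o, 'm) cat \<Rightarrow> bool" where
  "test_category T A \<longleftrightarrow> weak_test_category T A \<and> local_test_category T A"

definition elements_product_map ::
  "('o \<times> 'x \<times> 'y, ('o \<times> 'x \<times> 'y) \<times> 'm \<times> ('o \<times> 'x \<times> 'y),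
    ('o \<times> 'x) \<times> ('o \<times> 'y),
    (('o \<times> 'x) \<times> 'm \<times> ('o \<times> 'x)) \<times> (('o \<times> 'y) \<times> 'm \<times> ('o \<times> 'y))) fnctr" where
  "elements_product_map =
    \<lparr>omap = (\<lambda>(a, x, y). ((a, x), (a, y))),
     amap = (\<lambda>((a, x, y), f, (b, x', y')). (((a, x), f, (b, x')), ((a, y), f, (b, y'))))\<rparr>"

definition strict_test_category ::
  "('c \<times> 'd) itself \<Rightarrow> ('x \<times> 'y) itself \<Rightarrow> ('o, 'm) cat \<Rightarrow> bool" where
  "strict_test_category T _ A \<longleftrightarrow>
    test_category T A \<and>
    (\<forall>(X :: ('o, 'm, 'x) psh) (Y :: ('o, 'm, 'y) psh). presheaf A X \<longrightarrow> presheaf A Y \<longrightarrow>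
       weak_equivalence (elements A (product_presheaf X Y))
         (product_category (elements A X) (elements A Y)) elements_product_map)"


section \<open>Symmetric coloured operads\<close>

text \<open>An operation \<open>p\<close> carries its list of input colours \<open>Ins p\<close> and its output colour \<open>Out p\<close>.
  \<open>Graft p [q\<^sub>1, \<dots>, q\<^sub>n]\<close> is the total composite \<open>p \<circ> (q\<^sub>1, \<dots>, q\<^sub>n)\<close>, and \<open>Perm p \<sigma>\<close> is the right
  action of the symmetric groups.\<close>

record ('c, 'p) operad_data =
  Colours :: "'c set"
  Ops :: "'p set"
  Ins :: "'p \<Rightarrow> 'c list"
  Out :: "'p \<Rightarrow> 'c"
  Unit :: "'c \<Rightarrow> 'p"
  Graft :: "'p \<Rightarrow> 'p list \<Rightarrow> 'p"
  Perm :: "'p \<Rightarrow> (nat \<Rightarrow> nat) \<Rightarrow> 'p"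

definition graftable :: "('c, 'p) operad_data \<Rightarrow> 'p \<Rightarrow> 'p list \<Rightarrow> bool" where
  "graftable P p qs \<longleftrightarrow> p \<in> Ops P \<and> set qs \<subseteq> Ops P \<and> map (Out P) qs = Ins P p"

text \<open>\<open>blocks m ks\<close> cuts the positions \<open>m, m + 1, \<dots>\<close> into consecutive blocks of the lengths
  \<open>ks\<close>; \<open>index_perm js\<close> is the permutation \<open>i \<mapsto> js ! i\<close>. They express the block permutations in the
  two equivariance axioms.\<close>

fun blocks :: "nat \<Rightarrow> nat list \<Rightarrow> nat list list" where
  "blocks m [] = []"
| "blocks m (k # ks) = [m..<m + k] # blocks (m + k) ks"

definition index_perm :: "nat list \<Rightarrow> nat \<Rightarrow> nat" where
  "index_perm js = (\<lambda>i. if i < length js then js ! i else i)"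

definition input_counts :: "('c, 'p) operad_data \<Rightarrow> 'p list \<Rightarrow> nat list" where
  "input_counts P qs = map (\<lambda>q. length (Ins P q)) qs"

locale operad =
  fixes P :: "('c, 'p) operad_data"
  assumes colours: "p \<in> Ops P \<Longrightarrow> set (Ins P p) \<subseteq> Colours P \<and> Out P p \<in> Colours P"
    and unit: "c \<in> Colours P \<Longrightarrow>
          Unit P c \<in> Ops P \<and> Ins P (Unit P c) = [c] \<and> Out P (Unit P c) = c"
    and graft: "graftable P p qs \<Longrightarrow>
          Graft P p qs \<in> Ops P \<and> Ins P (Graft P p qs) = concat (map (Ins P) qs) \<and>
          Out P (Graft P p qs) = Out P p"
    and perm: "\<lbrakk>p \<in> Ops P; \<sigma> permutes {..<length (Ins P p)}\<rbrakk> \<Longrightarrow>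
          Perm P p \<sigma> \<in> Ops P \<and> Ins P (Perm P p \<sigma>) = permute_list \<sigma> (Ins P p) \<and>
          Out P (Perm P p \<sigma>) = Out P p"
    and graft_unit_left: "p \<in> Ops P \<Longrightarrow> Graft P (Unit P (Out P p)) [p] = p"
    and graft_unit_right: "p \<in> Ops P \<Longrightarrow> Graft P p (map (Unit P) (Ins P p)) = p"
    and graft_assoc: "\<lbrakk>graftable P p qs; list_all2 (graftable P) qs rss\<rbrakk> \<Longrightarrow>
          Graft P (Graft P p qs) (concat rss) = Graft P p (map2 (Graft P) qs rss)"
    and perm_id: "p \<in> Ops P \<Longrightarrow> Perm P p id = p"
    and perm_comp: "\<lbrakk>p \<in> Ops P; \<sigma> permutes {..<length (Ins P p)};
            \<tau> permutes {..<length (Ins P p)}\<rbrakk> \<Longrightarrow> Perm P (Perm P p \<sigma>) \<tau> = Perm P p (\<sigma> \<circ> \<tau>)"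
    and perm_graft: "\<lbrakk>graftable P p qs; \<sigma> permutes {..<length qs}\<rbrakk> \<Longrightarrow>
          Graft P (Perm P p \<sigma>) (permute_list \<sigma> qs) =
          Perm P (Graft P p qs)
            (index_perm (concat (permute_list \<sigma> (blocks 0 (input_counts P qs)))))"
    and graft_perm: "\<lbrakk>graftable P p qs;
            list_all2 (\<lambda>q \<tau>. \<tau> permutes {..<length (Ins P q)}) qs \<tau>s\<rbrakk> \<Longrightarrow>
          Graft P p (map2 (Perm P) qs \<tau>s) =
          Perm P (Graft P p qs)
            (index_perm (concat (map2 permute_list \<tau>s (blocks 0 (input_counts P qs)))))"

text \<open>A morphism of operads is a pair of maps on colours and on operations, normalised to
  \<open>undefined\<close> elsewhere.\<close>

definition operad_homs ::
  "('c, 'p) operad_data \<Rightarrow> ('d, 'q) operad_data \<Rightarrow> (('c \<Rightarrow> 'd) \<times> ('p \<Rightarrow> 'q)) set" where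
  "operad_homs P Q =
    {(f, g). f \<in> Colours P \<rightarrow>\<^sub>E Colours Q \<and> g \<in> Ops P \<rightarrow>\<^sub>E Ops Q \<and>
       (\<forall>p \<in> Ops P. Ins Q (g p) = map f (Ins P p) \<and> Out Q (g p) = f (Out P p)) \<and>
       (\<forall>c \<in> Colours P. g (Unit P c) = Unit Q (f c)) \<and>
       (\<forall>p qs. graftable P p qs \<longrightarrow> g (Graft P p qs) = Graft Q (g p) (map g qs)) \<and>
       (\<forall>p \<in> Ops P. \<forall>\<sigma>. \<sigma> permutes {..<length (Ins P p)} \<longrightarrow> g (Perm P p \<sigma>) = Perm Q (g p) \<sigma>)}"


section \<open>Trees and the categories of trees\<close>

text \<open>Since every edge is the output of at most one vertex, a vertex is determined by its output;
  it is encoded as the pair of its set of input edges and its output edge.\<close>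

record 'e tree =
  Edges :: "'e set"
  Vertices :: "('e set \<times> 'e) set"

definition is_root :: "'e tree \<Rightarrow> 'e \<Rightarrow> bool" where
  "is_root T r \<longleftrightarrow> r \<in> Edges T \<and> (\<forall>v \<in> Vertices T. r \<notin> fst v)"

definition leaves :: "'e tree \<Rightarrow> 'e set" where
  "leaves T = {e \<in> Edges T. \<forall>v \<in> Vertices T. e \<noteq> snd v}"

definition downwards :: "'e tree \<Rightarrow> ('e \<times> 'e) set" where
  "downwards T = {(e, snd v) | e v. v \<in> Vertices T \<and> e \<in> fst v}"

definition is_tree :: "'e tree \<Rightarrow> bool" where
  "is_tree T \<longleftrightarrow>
    finite (Edges T) \<and> Edges T \<noteq> {} \<and> finite (Vertices T) \<and>
    (\<forall>v \<in> Vertices T. fst v \<subseteq> Edges T \<and> snd v \<in> Edges T) \<and>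
    (\<forall>v \<in> Vertices T. \<forall>w \<in> Vertices T. snd v = snd w \<longrightarrow> v = w) \<and>
    (\<forall>v \<in> Vertices T. \<forall>w \<in> Vertices T. fst v \<inter> fst w \<noteq> {} \<longrightarrow> v = w) \<and>
    (\<exists>!r. is_root T r) \<and>
    (\<forall>e \<in> Edges T. \<forall>r. is_root T r \<longrightarrow> (e, r) \<in> (downwards T)\<^sup>*)"

definition subtree :: "'e tree \<Rightarrow> 'e tree \<Rightarrow> bool" where
  "subtree S T \<longleftrightarrow> is_tree S \<and> Edges S \<subseteq> Edges T \<and> Vertices S \<subseteq> Vertices T"

text \<open>The operad \<open>\<Omega>(T)\<close>. There is at most one operation \<open>e\<^sub>1, \<dots>, e\<^sub>n \<rightarrow> e\<close>, so it is identified
  with its profile \<open>([e\<^sub>1, \<dots>, e\<^sub>n], e)\<close>; it exists when \<open>e\<^sub>1, \<dots>, e\<^sub>n\<close> are distinct and are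
  exactly the leaves of a subtree with root \<open>e\<close>.\<close>

definition tree_operad :: "'e tree \<Rightarrow> ('e, 'e list \<times> 'e) operad_data" where
  "tree_operad T =
    \<lparr>Colours = Edges T,
     Ops = {(es, e). distinct es \<and> (\<exists>S. subtree S T \<and> is_root S e \<and> leaves S = set es)},
     Ins = fst, Out = snd,
     Unit = (\<lambda>e. ([e], e)),
     Graft = (\<lambda>(es, e) qs. (concat (map fst qs), e)),
     Perm = (\<lambda>(es, e) \<sigma>. (permute_list \<sigma> es, e))\<rparr>"

subsection \<open>The axioms of an operad hold for \<open>\<Omega>(T)\<close>\<close>

lemma downwards_mono: "Vertices S \<subseteq> Vertices T \<Longrightarrow> downwards S \<subseteq> downwards T"
  by (auto simp: downwards_def)

lemma tree_vertex: "is_tree T \<Longrightarrow> v \<in> Vertices T \<Longrightarrow> fst v \<subseteq> Edges T \<and> snd v \<in> Edges T"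
  by (simp add: is_tree_def)

lemma tree_root: "is_tree T \<Longrightarrow> \<exists>!r. is_root T r"
  by (simp add: is_tree_def)

lemma tree_root_reach:
  "is_tree S \<Longrightarrow> is_root S r \<Longrightarrow> x \<in> Edges S \<Longrightarrow> (x, r) \<in> (downwards S)\<^sup>*"
  by (simp add: is_tree_def)

lemma tree_inputs:
  "is_tree T \<Longrightarrow> v \<in> Vertices T \<Longrightarrow> w \<in> Vertices T \<Longrightarrow> e \<in> fst v \<Longrightarrow> e \<in> fst w \<Longrightarrow> v = w"
  unfolding is_tree_def by (metis IntI emptyE)

lemma tree_outputs:
  "is_tree T \<Longrightarrow> v \<in> Vertices T \<Longrightarrow> w \<in> Vertices T \<Longrightarrow> snd v = snd w \<Longrightarrow> v = w"
  by (simp add: is_tree_def)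

lemma downwards_unique:
  assumes "is_tree T" "(e, x) \<in> downwards T" "(e, y) \<in> downwards T" shows "x = y"
  using assms(2,3) tree_inputs[OF assms(1)] unfolding downwards_def by blast

lemma root_no_down: "is_root T r \<Longrightarrow> (r, x) \<notin> downwards T"
  by (auto simp: is_root_def downwards_def)

lemma downwards_edges:
  "is_tree T \<Longrightarrow> (x, y) \<in> downwards T \<Longrightarrow> x \<in> Edges T \<and> y \<in> Edges T"
  using tree_vertex[of T] unfolding downwards_def by blast

lemma tree_acyclic:
  assumes "is_tree T" shows "(e, e) \<notin> (downwards T)\<^sup>+"
proof
  assume c: "(e, e) \<in> (downwards T)\<^sup>+"
  obtain r where r: "is_root T r" using tree_root[OF assms] by blast
  have e: "e \<in> Edges T" using c downwards_edges[OF assms] by (meson converse_tranclE)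
  then have "(e, r) \<in> (downwards T)\<^sup>*" using r assms by (simp add: tree_root_reach)
  then have "(r, r) \<in> (downwards T)\<^sup>+"
    using c
  proof (induction rule: converse_rtrancl_induct)
    case (step y z)
    obtain w where w: "(y, w) \<in> downwards T" "(w, y) \<in> (downwards T)\<^sup>*"
      using step.prems by (metis tranclD)
    then have "w = z" using step.hyps downwards_unique[OF assms] by blast
    then have "(z, z) \<in> (downwards T)\<^sup>+" using w step.hyps by (meson rtrancl_into_trancl1)
    then show ?case using step.IH by blast
  qed
  then show False using root_no_down[OF r] by (meson tranclD)
qed

lemma subtree_leaf:
  assumes T: "is_tree T" and S: "subtree S T" and l: "l \<in> Edges S" and f: "f \<in> leaves S"
    and p: "(l, f) \<in> (downwards T)\<^sup>*"
  shows "l = f"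
  using p l
proof (induction rule: converse_rtrancl_induct)
  case base then show ?case by simp
next
  case (step l l')
  have St: "is_tree S" and sub: "downwards S \<subseteq> downwards T"
    using S downwards_mono unfolding subtree_def by auto
  obtain r where r: "is_root S r" using tree_root[OF St] by blast
  have fE: "f \<in> Edges S" using f unfolding leaves_def by simp
  have "(f, r) \<in> (downwards S)\<^sup>*" "(l, r) \<in> (downwards S)\<^sup>*"
    using St fE step.prems r by (simp_all add: tree_root_reach)
  then have fr: "(f, r) \<in> (downwards T)\<^sup>*" and lr: "(l, r) \<in> (downwards S)\<^sup>*"
    using rtrancl_mono[OF sub] by blast+
  show ?case
  proof (cases "l = r")
    case True
    have "(l, l) \<in> (downwards T)\<^sup>+"
      using step.hyps fr True by (meson rtrancl_into_trancl2 rtrancl_trans)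
    then show ?thesis using tree_acyclic[OF T] by blast
  next
    case False
    then obtain w where w: "(l, w) \<in> downwards S" using lr by (metis converse_rtranclE)
    then have "w = l'" using sub downwards_unique[OF T] step.hyps(1) by blast
    then have "(l, l') \<in> downwards S" using w by simp
    moreover from this have "l' \<in> Edges S" using downwards_edges[OF St] by blast
    ultimately have "(l, f) \<in> downwards S" using step.IH by simp
    then show ?thesis using f unfolding leaves_def downwards_def by blast
  qed
qed

lemma subtree_reach:
  assumes "subtree S T" "is_root S r" "x \<in> Edges S"
  shows "(x, r) \<in> (downwards T)\<^sup>*"
proof -
  have St: "is_tree S" and V: "Vertices S \<subseteq> Vertices T"
    using assms(1) by (auto simp: subtree_def)
  note sub = downwards_mono[OF V]
  have "(x, r) \<in> (downwards S)\<^sup>*"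
    using tree_root_reach[OF St assms(2,3)] .
  then show ?thesis using rtrancl_mono[OF sub] by (rule rev_subsetD)
qed

lemma down_linear:
  assumes T: "is_tree T" and p: "(x, a) \<in> (downwards T)\<^sup>*" and q: "(x, b) \<in> (downwards T)\<^sup>*"
  shows "(a, b) \<in> (downwards T)\<^sup>* \<or> (b, a) \<in> (downwards T)\<^sup>*"
  using p q
proof (induction rule: converse_rtrancl_induct)
  case base then show ?case by simp
next
  case (step y z)
  show ?case
  proof (cases "y = b")
    case True then show ?thesis using step by (meson converse_rtrancl_into_rtrancl)
  next
    case False
    then obtain w where "(y, w) \<in> downwards T" "(w, b) \<in> (downwards T)\<^sup>*"
      using step.prems by (metis converse_rtranclE)
    then show ?thesis using step downwards_unique[OF T] by metis
  qed
qed

text \<open>Grafting subtrees on all leaves of a subtree.\<close>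

lemma subtree_grafting:
  assumes T: "is_tree T" and S: "subtree S T" and e: "is_root S e"
    and R: "\<And>l. l \<in> leaves S \<Longrightarrow> subtree (R l) T \<and> is_root (R l) l"
  defines "U \<equiv> \<lparr>Edges = Edges S \<union> (\<Union>l\<in>leaves S. Edges (R l)),
                 Vertices = Vertices S \<union> (\<Union>l\<in>leaves S. Vertices (R l))\<rparr>"
  shows "subtree U T" "is_root U e" "leaves U = (\<Union>l\<in>leaves S. leaves (R l))"
    "\<And>l l'. l \<in> leaves S \<Longrightarrow> l' \<in> leaves S \<Longrightarrow> l \<noteq> l' \<Longrightarrow> leaves (R l) \<inter> leaves (R l') = {}"
proof -
  have R1: "\<And>l. l \<in> leaves S \<Longrightarrow> subtree (R l) T"
    and R2: "\<And>l. l \<in> leaves S \<Longrightarrow> is_root (R l) l"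
    using R by blast+
  have St: "is_tree S" and Rt: "\<And>l. l \<in> leaves S \<Longrightarrow> is_tree (R l)"
    using S R1 by (auto simp: subtree_def)
  have lS: "leaves S \<subseteq> Edges S" by (auto simp: leaves_def)
  have EU: "Edges U \<subseteq> Edges T" and VU: "Vertices U \<subseteq> Vertices T"
    using S R1 by (auto simp: U_def subtree_def)
  have disj: "l = l'" if "l \<in> leaves S" "l' \<in> leaves S" "x \<in> Edges (R l)" "x \<in> Edges (R l')"
    for l l' x
  proof -
    have "(x, l) \<in> (downwards T)\<^sup>*" "(x, l') \<in> (downwards T)\<^sup>*"
      using subtree_reach[OF R1 R2] that by blast+
    then have "(l, l') \<in> (downwards T)\<^sup>* \<or> (l', l) \<in> (downwards T)\<^sup>*"
      using down_linear[OF T] by blast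
    then show ?thesis using subtree_leaf[OF T S] that(1,2) lS by (metis subsetD)
  qed
  have above: "x = l" if "l \<in> leaves S" "x \<in> Edges (R l)" "x \<in> Edges S" for l x
  proof -
    have "(x, l) \<in> (downwards T)\<^sup>*"
      using subtree_reach[OF R1 R2] that by blast
    then show ?thesis using subtree_leaf[OF T S that(3,1)] by blast
  qed
  have in_S: "v \<in> Vertices S \<Longrightarrow> fst v \<subseteq> Edges S \<and> snd v \<in> Edges S" for v
    using tree_vertex[OF St] .
  have in_R: "l \<in> leaves S \<Longrightarrow> v \<in> Vertices (R l) \<Longrightarrow> fst v \<subseteq> Edges (R l) \<and> snd v \<in> Edges (R l)" for v l
    using tree_vertex[OF Rt] .
  have root: "is_root U e"
  proof -
    have "e \<notin> fst v" if l: "l \<in> leaves S" and v: "v \<in> Vertices (R l)" for l v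
    proof
      assume "e \<in> fst v"
      moreover from this have "e \<in> Edges (R l)" using in_R l v by blast
      moreover have "e \<in> Edges S" using e by (simp add: is_root_def)
      ultimately have "e = l" "l \<in> fst v" using above l by auto
      then show False using R[OF l] v by (auto simp: is_root_def)
    qed
    then show ?thesis using e by (auto simp: U_def is_root_def)
  qed
  have uniq: "x = e" if xr: "is_root U x" for x
  proof -
    have "x \<in> Edges S"
    proof (rule ccontr)
      assume "x \<notin> Edges S"
      then obtain l where l: "l \<in> leaves S" "x \<in> Edges (R l)" using xr by (auto simp: is_root_def U_def)
      then have "is_root (R l) x" using xr by (auto simp: is_root_def U_def)
      then have "x = l" using R[OF l(1)] tree_root[OF Rt[OF l(1)]] by blast
      then show False using l lS \<open>x \<notin> Edges S\<close> by blast
    qed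
    then have "is_root S x" using xr by (auto simp: is_root_def U_def)
    then show ?thesis using e tree_root[OF St] by blast
  qed
  have dS: "downwards S \<subseteq> downwards U" by (rule downwards_mono) (auto simp: U_def)
  have dR: "downwards (R l) \<subseteq> downwards U" if "l \<in> leaves S" for l
    by (rule downwards_mono) (use that in \<open>auto simp: U_def\<close>)
  have reach: "(x, e) \<in> (downwards U)\<^sup>*" if "x \<in> Edges U" for x
  proof -
    have 1: "(y, e) \<in> (downwards U)\<^sup>*" if "y \<in> Edges S" for y
      using rev_subsetD[OF tree_root_reach[OF St e that] rtrancl_mono[OF dS]] .
    have "(x, l) \<in> (downwards U)\<^sup>*" if "l \<in> leaves S" "x \<in> Edges (R l)" for l
      using rev_subsetD[OF tree_root_reach[OF Rt[OF that(1)] R2[OF that(1)] that(2)]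
          rtrancl_mono[OF dR[OF that(1)]]] .
    moreover have "(l, e) \<in> (downwards U)\<^sup>*" if "l \<in> leaves S" for l
      using lS that by (intro 1) auto
    ultimately have 2: "(x, e) \<in> (downwards U)\<^sup>*" if "l \<in> leaves S" "x \<in> Edges (R l)" for l
      using that by (meson rtrancl_trans)
    have "x \<in> Edges S \<or> (\<exists>l\<in>leaves S. x \<in> Edges (R l))"
      using that by (simp add: U_def)
    then show ?thesis using 1 2 by blast
  qed
  have fin: "finite (Edges U)" "finite (Vertices U)"
    using EU VU T finite_subset by (auto simp: is_tree_def)
  have "is_tree U"
    unfolding is_tree_def
  proof (intro conjI)
    show "Edges U \<noteq> {}" using root by (auto simp: is_root_def)
    show "\<forall>v\<in>Vertices U. fst v \<subseteq> Edges U \<and> snd v \<in> Edges U"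
      using in_S in_R by (fastforce simp: U_def)
    show "\<exists>!r. is_root U r" using root uniq by blast
    show "\<forall>x\<in>Edges U. \<forall>r. is_root U r \<longrightarrow> (x, r) \<in> (downwards U)\<^sup>*" using reach uniq by blast
  next
    show "\<forall>v\<in>Vertices U. \<forall>w\<in>Vertices U. snd v = snd w \<longrightarrow> v = w"
      using VU tree_outputs[OF T] by blast
  next
    show "\<forall>v\<in>Vertices U. \<forall>w\<in>Vertices U. fst v \<inter> fst w \<noteq> {} \<longrightarrow> v = w"
      using VU tree_inputs[OF T] by blast
  qed (use fin in auto)
  then show "subtree U T" "is_root U e" using EU VU root by (auto simp: subtree_def)
  show "leaves U = (\<Union>l\<in>leaves S. leaves (R l))"
  proof (intro equalityI subsetI)
    fix x assume x: "x \<in> leaves U"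
    have "\<exists>l\<in>leaves S. x \<in> Edges (R l)"
    proof (cases "x \<in> Edges S")
      case True
      then have "x \<in> leaves S" using x by (auto simp: leaves_def U_def)
      then show ?thesis using R by (auto simp: is_root_def)
    next
      case False
      then show ?thesis using x by (auto simp: leaves_def U_def)
    qed
    then show "x \<in> (\<Union>l\<in>leaves S. leaves (R l))"
      using x by (auto simp: leaves_def U_def)
  next
    fix x assume "x \<in> (\<Union>l\<in>leaves S. leaves (R l))"
    then obtain l where l: "l \<in> leaves S" "x \<in> leaves (R l)" by blast
    then have xE: "x \<in> Edges (R l)" by (simp add: leaves_def)
    have "x \<noteq> snd v" if "v \<in> Vertices S" for v
    proof
      assume "x = snd v"
      moreover from this have "x = l" using above l xE in_S that by blast
      ultimately show False using l(1) that by (auto simp: leaves_def)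
    qed
    moreover have "x \<noteq> snd v" if "l' \<in> leaves S" "v \<in> Vertices (R l')" for v l'
    proof
      assume "x = snd v"
      moreover from this have "l' = l" using disj l xE in_R that by blast
      ultimately show False using l that by (auto simp: leaves_def)
    qed
    ultimately have "\<forall>v\<in>Vertices U. x \<noteq> snd v" by (simp add: U_def) blast
    moreover have "x \<in> Edges U" using l(1) xE by (auto simp: U_def)
    ultimately show "x \<in> leaves U" by (simp add: leaves_def)
  qed
  show "leaves (R l) \<inter> leaves (R l') = {}" if "l \<in> leaves S" "l' \<in> leaves S" "l \<noteq> l'" for l l'
    using disj that by (auto simp: leaves_def)
qed

lemma permute_list_index_perm:
  assumes "length js = length xs"
  shows "permute_list (index_perm js) xs = map ((!) xs) js"
  using assms by (auto simp: permute_list_def index_perm_def intro!: nth_equalityI)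

lemma map_blocks:
  "map (map ((!) (ys @ concat xss))) (blocks (length ys) (map length xss)) = xss"
proof (induction xss arbitrary: ys)
  case (Cons xs xss)
  have "map ((!) (ys @ xs @ concat xss)) [length ys..<length ys + length xs] = xs"
    by (auto intro!: nth_equalityI simp: nth_append)
  moreover have "map (map ((!) ((ys @ xs) @ concat xss))) (blocks (length (ys @ xs)) (map length xss)) = xss"
    by (rule Cons.IH)
  ultimately show ?case by simp
qed simp

lemma length_blocks [simp]: "length (blocks m ks) = length ks"
  by (induction ks arbitrary: m) auto

lemma map_length_blocks: "map length (blocks m ks) = ks"
  by (induction ks arbitrary: m) auto

lemma map_blocks0: "map (map ((!) (concat xss))) (blocks 0 (map length xss)) = xss"
  using map_blocks[of "[]" xss] by simp

lemma block_perm: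
  assumes "\<sigma> permutes {..<length xss}"
  shows "permute_list (index_perm (concat (permute_list \<sigma> (blocks 0 (map length xss))))) (concat xss)
         = concat (permute_list \<sigma> xss)"
proof -
  let ?B = "blocks 0 (map length xss)"
  have "mset (permute_list \<sigma> ?B) = mset ?B" using assms by (intro mset_permute_list) simp
  then have "length (concat (permute_list \<sigma> ?B)) = length (concat ?B)"
    by (metis (no_types, lifting) length_concat mset_map sum_mset_sum_list)
  also have "\<dots> = length (concat xss)" by (simp add: length_concat map_length_blocks)
  finally show ?thesis
    by (subst permute_list_index_perm) (use assms in \<open>simp_all add: map_concat permute_list_map map_blocks0 flip: permute_list_map\<close>)
qed

lemma block_sum_perm:
  assumes "list_all2 (\<lambda>xs \<tau>. \<tau> permutes {..<length xs}) xss \<tau>s"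
  shows "permute_list (index_perm (concat (map2 permute_list \<tau>s (blocks 0 (map length xss))))) (concat xss)
         = concat (map2 permute_list \<tau>s xss)"
proof -
  let ?B = "blocks 0 (map length xss)"
  have len: "length \<tau>s = length xss" using assms by (simp add: list_all2_lengthD)
  have "map length (map2 permute_list \<tau>s ?B) = map length ?B"
    using len by (auto intro!: nth_equalityI)
  then have *: "length (concat (map2 permute_list \<tau>s ?B)) = length (concat xss)"
    by (simp only: length_concat map_length_blocks)
  have "map (map ((!) (concat xss))) (map2 permute_list \<tau>s ?B) = map2 permute_list \<tau>s xss"
  proof (rule nth_equalityI)
    fix i assume "i < length (map (map ((!) (concat xss))) (map2 permute_list \<tau>s ?B))"
    then have i: "i < length xss" using len by simp
    have Bi: "map ((!) (concat xss)) (?B ! i) = xss ! i"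
      using map_blocks0[of xss] i by (metis length_blocks length_map nth_map)
    then have "length (?B ! i) = length (xss ! i)" by (metis length_map)
    moreover have "(\<tau>s ! i) permutes {..<length (xss ! i)}"
      using assms i by (simp add: list_all2_conv_all_nth)
    ultimately have "map ((!) (concat xss)) (permute_list (\<tau>s ! i) (?B ! i)) = permute_list (\<tau>s ! i) (xss ! i)"
      by (metis Bi permute_list_map)
    then show "map (map ((!) (concat xss))) (map2 permute_list \<tau>s ?B) ! i = map2 permute_list \<tau>s xss ! i"
      using i len by simp
  qed (use len in simp)
  then show ?thesis by (subst permute_list_index_perm[OF *]) (simp add: map_concat)
qed

lemma eta_subtree:
  assumes "e \<in> Edges T"
  shows "subtree \<lparr>Edges = {e}, Vertices = {}\<rparr> T" "is_root \<lparr>Edges = {e}, Vertices = {}\<rparr> e"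
    "leaves \<lparr>Edges = {e}, Vertices = {}\<rparr> = {e}"
  using assms by (auto simp: subtree_def is_tree_def is_root_def leaves_def downwards_def)

lemma graftable_tree_operad:
  assumes T: "is_tree T" and g: "graftable (tree_operad T) p qs"
  shows "(concat (map fst qs), snd p) \<in> Ops (tree_operad T)"
proof -
  obtain es e where p: "p = (es, e)" by fastforce
  have es: "es = map snd qs" "distinct es" and qs: "set qs \<subseteq> Ops (tree_operad T)"
    using g p by (auto simp: graftable_def tree_operad_def)
  obtain S where S: "subtree S T" "is_root S e" "leaves S = set es"
    using g p by (auto simp: graftable_def tree_operad_def)
  have "\<forall>q \<in> set qs. \<exists>R. subtree R T \<and> is_root R (snd q) \<and> leaves R = set (fst q)"
    and dq: "\<And>q. q \<in> set qs \<Longrightarrow> distinct (fst q)"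
    using qs by (auto simp: tree_operad_def)
  then obtain R' where R': "\<And>q. q \<in> set qs \<Longrightarrow> subtree (R' q) T \<and> is_root (R' q) (snd q) \<and> leaves (R' q) = set (fst q)"
    by metis
  have inj: "inj_on snd (set qs)" and dqs: "distinct qs" using es by (auto simp: distinct_map)
  define R where "R l = R' (inv_into (set qs) snd l)" for l
  have Rq: "R (snd q) = R' q" if "q \<in> set qs" for q using that inj by (simp add: R_def)
  have lS: "leaves S = snd ` set qs" using S(3) es by simp
  have R: "subtree (R l) T \<and> is_root (R l) l" if "l \<in> leaves S" for l
    using that R' Rq lS by auto
  note gr = subtree_grafting[OF T S(1,2) R]
  have un: "(\<Union>l\<in>leaves S. leaves (R l)) = set (concat (map fst qs))"
    using lS R' Rq by auto
  have "set (fst q) \<inter> set (fst q') = {}" if "q \<in> set qs" "q' \<in> set qs" "q \<noteq> q'" for q q'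
    using gr(4)[of "snd q" "snd q'"] that inj lS Rq R' by (auto simp: inj_on_def)
  then have "distinct (concat (map fst qs))"
    using dq dqs by (induction qs) (auto, blast+)
  then show ?thesis
    unfolding tree_operad_def using gr(1-3) un p by auto
qed

lemma operad_tree_operad:
  assumes T: "is_tree T" shows "operad (tree_operad T)"
proof
  let ?P = "tree_operad T"
  note d = tree_operad_def
  show "set (Ins ?P p) \<subseteq> Colours ?P \<and> Out ?P p \<in> Colours ?P" if "p \<in> Ops ?P" for p
    using that by (auto simp: d subtree_def is_root_def leaves_def)
  show "Unit ?P c \<in> Ops ?P \<and> Ins ?P (Unit ?P c) = [c] \<and> Out ?P (Unit ?P c) = c" if "c \<in> Colours ?P" for c
    using that eta_subtree[of c T] by (auto simp: d)
  show "Graft ?P p qs \<in> Ops ?P \<and> Ins ?P (Graft ?P p qs) = concat (map (Ins ?P) qs) \<and> Out ?P (Graft ?P p qs) = Out ?P p"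
    if "graftable ?P p qs" for p qs
    using graftable_tree_operad[OF T that] by (auto simp: d split: prod.splits)
  show "Perm ?P p \<sigma> \<in> Ops ?P \<and> Ins ?P (Perm ?P p \<sigma>) = permute_list \<sigma> (Ins ?P p) \<and> Out ?P (Perm ?P p \<sigma>) = Out ?P p"
    if "p \<in> Ops ?P" "\<sigma> permutes {..<length (Ins ?P p)}" for p \<sigma>
    using that by (auto simp: d)
  show "Graft ?P (Unit ?P (Out ?P p)) [p] = p" for p
    by (cases p) (simp add: d)
  show "Graft ?P p (map (Unit ?P) (Ins ?P p)) = p" for p
    by (cases p) (simp add: d comp_def)
  show "Graft ?P (Graft ?P p qs) (concat rss) = Graft ?P p (map2 (Graft ?P) qs rss)"
    if "list_all2 (graftable ?P) qs rss" for p qs rss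
  proof -
    have "concat (map fst (concat rss)) = concat (map fst (map2 (Graft ?P) qs rss))"
      using that by (induction rule: list_all2_induct) (auto simp: d split: prod.splits)
    then show ?thesis by (cases p) (simp add: d)
  qed
  show "Perm ?P p id = p" for p by (cases p) (simp add: d)
  show "Perm ?P (Perm ?P p \<sigma>) \<tau> = Perm ?P p (\<sigma> \<circ> \<tau>)"
    if "\<tau> permutes {..<length (Ins ?P p)}" for p \<sigma> \<tau>
    using that by (cases p) (simp add: d permute_list_compose)
  show "Graft ?P (Perm ?P p \<sigma>) (permute_list \<sigma> qs) =
          Perm ?P (Graft ?P p qs) (index_perm (concat (permute_list \<sigma> (blocks 0 (input_counts ?P qs)))))"
    if "\<sigma> permutes {..<length qs}" for p \<sigma> qs
    using block_perm[of \<sigma> "map fst qs"] that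
    by (cases p) (simp add: d input_counts_def comp_def permute_list_map)
  show "Graft ?P p (map2 (Perm ?P) qs \<tau>s) =
          Perm ?P (Graft ?P p qs) (index_perm (concat (map2 permute_list \<tau>s (blocks 0 (input_counts ?P qs)))))"
    if "list_all2 (\<lambda>q \<tau>. \<tau> permutes {..<length (Ins ?P q)}) qs \<tau>s" for p qs \<tau>s
  proof -
    have "map fst (map2 (Perm ?P) qs \<tau>s) = map2 permute_list \<tau>s (map fst qs)"
      using that by (induction rule: list_all2_induct) (auto simp: d split: prod.splits)
    moreover have "list_all2 (\<lambda>xs \<tau>. \<tau> permutes {..<length xs}) (map fst qs) \<tau>s"
      using that by (simp add: d list.rel_map)
    ultimately show ?thesis
      using block_sum_perm[of "map fst qs" \<tau>s] by (cases p) (simp add: d input_counts_def comp_def)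
  qed
qed


subsection \<open>The categories of all trees and of closed trees\<close>

type_synonym 'e tree_arrow =
  "'e tree \<times> (('e \<Rightarrow> 'e) \<times> ('e list \<times> 'e \<Rightarrow> 'e list \<times> 'e)) \<times> 'e tree"

text \<open>The trees with edges in a fixed infinite type \<open>'e\<close> represent all finite trees up to
  isomorphism.\<close>

definition Omega :: "('e tree, 'e tree_arrow) cat" where
  "Omega =
    \<lparr>Obj = {T. is_tree T},
     Arr = {(S, h, T). is_tree S \<and> is_tree T \<and> h \<in> operad_homs (tree_operad S) (tree_operad T)},
     Dom = (\<lambda>(S, h, T). S), Cod = (\<lambda>(S, h, T). T),
     Ident = (\<lambda>T. (T, (\<lambda>e\<in>Colours (tree_operad T). e, \<lambda>p\<in>Ops (tree_operad T). p), T)),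
     Comp = (\<lambda>(T', (f', g'), U) (S, (f, g), T).
       (S, (compose (Colours (tree_operad S)) f' f, compose (Ops (tree_operad S)) g' g), U))\<rparr>"

definition closed_Omega :: "('e tree, 'e tree_arrow) cat" where
  "closed_Omega = full_subcategory Omega {T. leaves T = {}}"

end

theory Submission
  imports Defs
begin

text \<open>Adding a new edge below the root is a functor \<open>P\<close> on closed trees, with natural maps
  \<open>id \<Rightarrow> P \<Leftarrow> stump\<close>: the inclusion of the old tree, and the new edge with everything above it
  contracted to a nullary operation, which exists because the tree is closed. The inclusion
  identifies the trees over \<open>T\<close> with a sieve in the trees over \<open>P T\<close>, and the new edge avoids this
  sieve. Hence a functor \<open>A / T \<rightarrow> C\<close> with an arrow \<open>v(id) \<rightarrow> c\<close> extends to \<open>A / P T\<close> by the constant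
  \<open>c\<close>, and it is connected through this extension to the constant functor at \<open>c\<close>; so the comma
  category of the counit \<open>A / i\<^sub>A\<^sup>* C \<rightarrow> C\<close> over \<open>c\<close> is contracted by a zigzag of two natural
  transformations. As the inclusion \<open>T \<rightarrow> P T\<close> is moreover split by the map that sends the new edge
  to the root, the spans \<open>a \<leftarrow> T \<rightarrow> b\<close> are contracted in the same way, which settles products. Slices
  of \<open>A\<close> inherit the structure. Contractible comma categories give homotopy equivalences of
  classifying spaces by Quillen's Theorem A, proved here by acyclic carriers: maps out of the nerve
  into a diagram of contractible spaces are constructed simplex by simplex.\<close>

section \<open>Homotopy equivalences are weak homotopy equivalences\<close>

text \<open>Weak equivalence is defined through homotopy groups of realizations at all base points.
  Every weak equivalence is obtained here from a homotopy equivalence with an explicit continuous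
  inverse, so that neither cell structures nor Whitehead's theorem enter. The price is that maps out
  of a realization must be built continuously by recursion over simplices. Degenerate simplices make
  such a recursion ambiguous, and unique normal forms of points remove the ambiguity. One
  construction then serves three purposes: the inverse in Theorem A, the homotopies that show it to
  be one, and the homotopy attached to a natural transformation. The only contraction written down
  by hand is the cone over a terminal object. On the side of trees the obstacle is that a map
  \<open>S \<rightarrow> T\<close> need not send root to root. The vertex added below
  \<open>S\<close> must go to an operation from the image of the old root to the new root of
  \<open>T\<close>. In a closed tree every edge has a unary operation to the root, because all side
  branches can be capped; this is what makes \<open>P\<close> functorial.\<close>

abbreviation interval :: "real topology" where "interval \<equiv> top_of_set {0..1}"

lemma continuous_map_real_Max:
  assumes "finite I" "I \<noteq> {}" "\<And>i. i \<in> I \<Longrightarrow> continuous_map X euclideanreal (\<lambda>x. f i x)"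
  shows "continuous_map X euclideanreal (\<lambda>x. Max ((\<lambda>i. f i x) ` I))"
  using assms
proof (induction I rule: finite_ne_induct)
  case (insert i I)
  then have "continuous_map X euclideanreal (\<lambda>x. max (f i x) (Max ((\<lambda>i. f i x) ` I)))"
    by (intro continuous_map_real_max) auto
  moreover have "max (f i x) (Max ((\<lambda>i. f i x) ` I)) = Max ((\<lambda>i. f i x) ` insert i I)" for x
    using insert by simp
  ultimately show ?case by simp
qed auto

section \<open>Cubes and the filling of boxes\<close>

lemma topspace_cube: "topspace (cube n) = {..<n} \<rightarrow>\<^sub>E {0..1}"
  by (simp add: cube_def)

lemma cube_boundary_subset: "cube_boundary n \<subseteq> topspace (cube n)"
  by (auto simp: cube_boundary_def)

lemma continuous_map_cube_coord: "i < n \<Longrightarrow> continuous_map (cube n) euclideanreal (\<lambda>t. t i)"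
  unfolding cube_def
  by (rule continuous_map_compose[OF continuous_map_product_projection, unfolded o_def, where g = "\<lambda>x. x"])
     (auto simp: continuous_map_from_subtopology)

lemma closedin_cube_boundary: "closedin (cube n) (cube_boundary n)"
proof -
  have "cube_boundary n = (\<Union>i<n. {t \<in> topspace (cube n). t i \<in> {0, 1}})"
    by (auto simp: cube_boundary_def)
  moreover have "closedin (cube n) {t \<in> topspace (cube n). t i \<in> {0, 1}}" if "i < n" for i
    by (rule closedin_continuous_map_preimage[OF continuous_map_cube_coord[OF that]]) auto
  ultimately show ?thesis by (simp only:) (rule closedin_Union, auto)
qed

text \<open>With \<open>J\<close> the interval this is the cylinder over a cube; with \<open>J\<close> the single point \<open>1/2\<close> it
  is the cube itself, since no point of \<open>J\<close> is then an end of the interval.\<close>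

definition box_gauge :: "nat \<Rightarrow> real \<Rightarrow> (nat \<Rightarrow> real) \<Rightarrow> real" where
  "box_gauge n u t = Max (insert \<bar>2 * u - 1\<bar> ((\<lambda>i. \<bar>2 * t i - 1\<bar>) ` {..<n}))"

text \<open>The radial projection of the box from the point \<open>(2, 1/2, \<dots>, 1/2)\<close> above it.\<close>

definition box_scale :: "nat \<Rightarrow> real \<Rightarrow> real \<Rightarrow> (nat \<Rightarrow> real) \<Rightarrow> real" where
  "box_scale n s u t = 1 / max (1 - s / 2) (box_gauge n u t)"

text \<open>The first coordinate is the height. The ray through a point leaves the box through the
  bottom when the scale is \<open>1 / (1 - s / 2)\<close> and through a side when it is
  \<open>1 / box_gauge n u t\<close>; \<open>box_scale\<close> is the smaller of the two. The image
  is the bottom together with the sides, and the interior of the lid \<open>s = 1\<close> is left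
  free.\<close>

definition box_retract :: "nat \<Rightarrow> real \<times> real \<times> (nat \<Rightarrow> real) \<Rightarrow> real \<times> real \<times> (nat \<Rightarrow> real)" where
  "box_retract n = (\<lambda>(s, u, t). (2 - (2 - s) * box_scale n s u t,
      1/2 + (u - 1/2) * box_scale n s u t, \<lambda>i\<in>{..<n}. 1/2 + (t i - 1/2) * box_scale n s u t))"

lemma box_gauge_le:
  assumes u: "u \<in> {0..1}" and t: "t \<in> {..<n} \<rightarrow>\<^sub>E {0..1}"
  shows "box_gauge n u t \<le> 1"
proof -
  have "\<bar>2 * a - 1\<bar> \<le> 1" if "a \<in> {0..1}" for a :: real using that by (simp add: abs_le_iff)
  then show ?thesis using t u PiE_mem[OF t] unfolding box_gauge_def by (subst Max_le_iff) auto
qed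

lemma box_gauge_boundary:
  assumes u: "u \<in> {0..1}" and t: "t \<in> topspace (cube n)" and b: "u = 0 \<or> u = 1 \<or> t \<in> cube_boundary n"
  shows "box_gauge n u t = 1"
proof (rule antisym)
  show "box_gauge n u t \<le> 1" using box_gauge_le u t by (simp add: topspace_cube)
  have "1 \<in> insert \<bar>2 * u - 1\<bar> ((\<lambda>i. \<bar>2 * t i - 1\<bar>) ` {..<n})"
    using b by (force simp: cube_boundary_def image_iff)
  then show "1 \<le> box_gauge n u t" unfolding box_gauge_def by (intro Max_ge) auto
qed

text \<open>The scale is at least \<open>1\<close> because both terms of its denominator are at most
  \<open>1\<close>. Coordinates stay in range because the scale exceeds neither of the two bounds,
  and the face on which the image lies belongs to the bound that is attained. The last claim keeps
  the one-point case \<open>J = {1/2}\<close> inside itself.\<close>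

lemma box_scale_bounds:
  assumes s: "s \<in> {0..1}" and u: "u \<in> {0..1}" and t: "t \<in> {..<n} \<rightarrow>\<^sub>E {0..1}"
  defines "l \<equiv> box_scale n s u t"
  shows "2 - (2 - s) * l \<in> {0..1}" "1/2 + (u - 1/2) * l \<in> {0..1}" "\<forall>i<n. 1/2 + (t i - 1/2) * l \<in> {0..1}"
    "2 - (2 - s) * l = 0 \<or> 1/2 + (u - 1/2) * l \<in> {0, 1} \<or> (\<exists>i<n. 1/2 + (t i - 1/2) * l \<in> {0, 1})"
    "u = 1/2 \<Longrightarrow> 1/2 + (u - 1/2) * l = 1/2"
proof -
  let ?m = "box_gauge n u t"
  define D where "D = max (1 - s / 2) ?m"
  have Dm: "1 - s / 2 \<le> D" "?m \<le> D" by (simp_all only: D_def max.cobounded1 max.cobounded2)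
  have D0: "D > 0" using Dm(1) s by simp
  have l: "l = 1 / D" by (simp only: D_def l_def box_scale_def)
  have lD: "D * l = 1" and l0: "l > 0" using D0 unfolding l by simp_all
  have m1: "?m \<le> 1" using box_gauge_le[OF u t] .
  have "D \<le> 1" unfolding D_def by (rule max.boundedI) (use s m1 in auto)
  then have l1: "1 \<le> l" using D0 by (simp add: l)
  have 1: "(1 - s / 2) * l \<le> 1" using mult_right_mono[OF Dm(1), of l] lD l0 by simp
  have "(2 - s) * 1 \<le> (2 - s) * l" using l1 s by (intro mult_left_mono) auto
  then show "2 - (2 - s) * l \<in> {0..1}" using 1 s by (simp add: left_diff_distrib)
  have q: "1/2 + (a - 1/2) * l \<in> {0..1}" if "\<bar>2 * a - 1\<bar> \<le> ?m" for a
  proof -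
    have "\<bar>2 * a - 1\<bar> * l \<le> 1"
      using mult_right_mono[OF order_trans[OF that Dm(2)], of l] lD l0 by simp
    then have "\<bar>(2 * a - 1) * l\<bar> \<le> 1" using l0 by (simp add: abs_mult)
    then show ?thesis by (simp add: left_diff_distrib abs_le_iff)
  qed
  have q1: "1/2 + (a - 1/2) * l \<in> {0, 1}" if "\<bar>2 * a - 1\<bar> = ?m" "D = ?m" for a
  proof -
    have "\<bar>(2 * a - 1) * l\<bar> = 1" using that lD l0 by (simp add: abs_mult)
    then have "(2 * a - 1) * l = 1 \<or> (2 * a - 1) * l = -1"
      by (rule abs_eq_iff'[THEN iffD1, THEN conjunct2])
    then show ?thesis by (auto simp: left_diff_distrib)
  qed
  show "1/2 + (u - 1/2) * l \<in> {0..1}" "\<forall>i<n. 1/2 + (t i - 1/2) * l \<in> {0..1}"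
    by (auto intro!: q[simplified] simp: box_gauge_def)
  show "2 - (2 - s) * l = 0 \<or> 1/2 + (u - 1/2) * l \<in> {0, 1} \<or> (\<exists>i<n. 1/2 + (t i - 1/2) * l \<in> {0, 1})"
  proof (cases "D = ?m")
    case True
    have "?m \<in> insert \<bar>2 * u - 1\<bar> ((\<lambda>i. \<bar>2 * t i - 1\<bar>) ` {..<n})"
      unfolding box_gauge_def by (rule Max_in) auto
    then show ?thesis using q1[OF _ True] by (metis (no_types, lifting) imageE insertE lessThan_iff)
  next
    case False
    then have "D = 1 - s / 2" unfolding D_def max_def by meson
    then show ?thesis using lD by (simp add: left_diff_distrib)
  qed
qed simp

text \<open>Homotopy extension for a cube and its boundary, in the form needed to change base
  points: values on the bottom (\<open>f0\<close>), on those ends of \<open>J\<close> that exist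
  (\<open>g\<close>) and over the boundary of the cube (\<open>\<gamma>\<close>) extend over the
  whole box by composition with the radial retraction.\<close>

lemma box_fill:
  fixes J :: "real set"
  assumes J: "J = {1/2} \<or> J = {0..1}"
    and f0: "continuous_map (prod_topology (top_of_set J) (cube n)) X f0"
    and g: "\<And>e. e \<in> {0, 1} \<inter> J \<Longrightarrow> continuous_map (prod_topology interval (cube n)) X (g e)"
    and \<gamma>: "continuous_map interval X \<gamma>"
    and f0g: "\<And>e t. e \<in> {0, 1} \<inter> J \<Longrightarrow> t \<in> topspace (cube n) \<Longrightarrow> f0 (e, t) = g e (0, t)"
    and f0\<gamma>: "\<And>u t. u \<in> J \<Longrightarrow> t \<in> cube_boundary n \<Longrightarrow> f0 (u, t) = \<gamma> 0"
    and g\<gamma>: "\<And>e s t. e \<in> {0, 1} \<inter> J \<Longrightarrow> s \<in> {0..1} \<Longrightarrow> t \<in> cube_boundary n \<Longrightarrow> g e (s, t) = \<gamma> s"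
  obtains F where "continuous_map (prod_topology interval (prod_topology (top_of_set J) (cube n))) X F"
    "\<And>u t. u \<in> J \<Longrightarrow> t \<in> topspace (cube n) \<Longrightarrow> F (0, u, t) = f0 (u, t)"
    "\<And>e s t. e \<in> {0, 1} \<inter> J \<Longrightarrow> s \<in> {0..1} \<Longrightarrow> t \<in> topspace (cube n) \<Longrightarrow> F (s, e, t) = g e (s, t)"
    "\<And>u s t. u \<in> J \<Longrightarrow> s \<in> {0..1} \<Longrightarrow> t \<in> cube_boundary n \<Longrightarrow> F (s, u, t) = \<gamma> s"
proof -
  define P where "P = prod_topology interval (prod_topology (top_of_set J) (cube n))"
  \<comment> \<open>\<open>T 0\<close> is the bottom, \<open>T 1\<close> and \<open>T 2\<close> are
    the ends \<open>u = 0\<close> and \<open>u = 1\<close>, and \<open>T 3\<close> is the part over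
    the boundary of the cube. For \<open>J = {1/2}\<close> the two ends are empty.\<close>
  define T :: "nat \<Rightarrow> (real \<times> real \<times> (nat \<Rightarrow> real)) set" where
    "T k = {(s, u, t). s \<in> {0..1} \<and> u \<in> J \<and> t \<in> topspace (cube n) \<and>
      (if k = 0 then s = 0 else if k = 1 then u = 0 else if k = 2 then u = 1 else t \<in> cube_boundary n)}" for k
  define L where "L = (\<Union>k<4. T k)"
  \<comment> \<open>On overlaps the prescribed values agree, so the order of the tests does not
    matter.\<close>
  define f where "f = (\<lambda>(s, u, t). if s = 0 then f0 (u, t) else if u = 0 \<or> u = 1 then g u (s, t) else \<gamma> s)"
  have J01: "J \<subseteq> {0..1}" using J by auto
  have cs: "continuous_map P euclideanreal (\<lambda>(s, u, t). s)"
    unfolding P_def case_prod_unfold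
    using continuous_map_compose[OF continuous_map_fst continuous_map_from_subtopology[OF continuous_map_id]]
    by (simp add: o_def id_def)
  have cu: "continuous_map P euclideanreal (\<lambda>(s, u, t). u)"
    unfolding P_def case_prod_unfold
    using continuous_map_compose[OF continuous_map_snd continuous_map_compose[OF continuous_map_fst continuous_map_from_subtopology[OF continuous_map_id]]]
    by (simp add: o_def id_def)
  have ct: "continuous_map P (cube n) (\<lambda>(s, u, t). t)"
    unfolding P_def case_prod_unfold
    using continuous_map_compose[OF continuous_map_snd continuous_map_snd] by (simp add: o_def)
  have cti: "continuous_map P euclideanreal (\<lambda>(s, u, t). t i)" if "i < n" for i
    using continuous_map_compose[OF ct continuous_map_cube_coord[OF that]] by (simp add: o_def case_prod_unfold)
  have top: "topspace P = {0..1} \<times> J \<times> topspace (cube n)" by (simp add: P_def)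
  have T: "closedin P (T k)" for k
  proof -
    have u: "closedin P {x \<in> topspace P. (case x of (s, u, t) \<Rightarrow> u) = e}" for e
      using closedin_continuous_map_preimage[OF cu, of "{e}"] by simp
    consider "k = 0" | "k = 1" | "k = 2" | "k > 2" by linarith
    then show ?thesis
    proof cases
      case 1
      then have "T k = {x \<in> topspace P. (case x of (s, u, t) \<Rightarrow> s) = 0}" unfolding T_def top by auto
      then show ?thesis using closedin_continuous_map_preimage[OF cs, of "{0}"] by (simp add: case_prod_unfold)
    next
      case 2
      then have "T k = {x \<in> topspace P. (case x of (s, u, t) \<Rightarrow> u) = 0}" unfolding T_def top by auto
      then show ?thesis using u by simp
    next
      case 3
      then have "T k = {x \<in> topspace P. (case x of (s, u, t) \<Rightarrow> u) = 1}" unfolding T_def top by auto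
      then show ?thesis using u by simp
    next
      case 4
      then have "T k = {x \<in> topspace P. (case x of (s, u, t) \<Rightarrow> t) \<in> cube_boundary n}" unfolding T_def top by auto
      then show ?thesis using closedin_continuous_map_preimage[OF ct closedin_cube_boundary] by simp
    qed
  qed
  define h where "h k = (\<lambda>(s, u, t). if k = 0 then f0 (u, t) else if k = 1 then g 0 (s, t) else if k = 2 then g 1 (s, t) else \<gamma> s)" for k :: nat
  have cf: "continuous_map (subtopology P L) X f"
  proof (rule pasting_lemma_closed[where I = "{..<4}" and T = T and f = h])
    show "closedin (subtopology P L) (T i)" if "i \<in> {..<4}" for i
      using T that by (auto simp: L_def closedin_subtopology)
    have st: "subtopology (subtopology P L) (T i) = subtopology P (T i)" if "i \<in> {..<4}" for i
      using that by (auto simp: subtopology_subtopology L_def intro!: arg_cong[where f = "subtopology P"])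
    show "continuous_map (subtopology (subtopology P L) (T i)) X (h i)" if i: "i \<in> {..<4}" for i
    proof -
      have su: "continuous_map P (prod_topology (top_of_set J) (cube n)) (\<lambda>(s, u, t). (u, t))"
        unfolding P_def case_prod_unfold using continuous_map_snd by (simp add: continuous_map_eq[OF continuous_map_snd])
      have "continuous_map P interval (\<lambda>(s, u, t). s)"
        unfolding P_def case_prod_unfold by (simp add: continuous_map_fst)
      then have ss: "continuous_map P (prod_topology interval (cube n)) (\<lambda>(s, u, t). (s, t))"
        using ct by (simp add: continuous_map_pairwise o_def case_prod_unfold)
      have 0: "continuous_map P X (h 0)"
        using continuous_map_compose[OF su f0] by (simp add: h_def o_def case_prod_unfold)
      have g': "continuous_map P X (\<lambda>(s, u, t). g e (s, t))" if "e \<in> {0, 1} \<inter> J" for e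
        using continuous_map_compose[OF ss g[OF that]] by (simp add: o_def case_prod_unfold)
      have 3: "continuous_map P X (h 3)"
        using continuous_map_compose[OF \<open>continuous_map P interval (\<lambda>(s, u, t). s)\<close> \<gamma>] by (simp add: h_def o_def case_prod_unfold)
      have e: "subtopology P (T i) = trivial_topology" if "i = 1 \<or> i = 2" "J = {1/2}"
      proof -
        have "T i = {}" using that by (auto simp: T_def)
        then show ?thesis by simp
      qed
      consider "i = 0" | "i = 3" | "i = 1 \<or> i = 2" "J = {1/2}" | "i = 1" "J = {0..1}" | "i = 2" "J = {0..1}"
        using i J by fastforce
      then show ?thesis
      proof cases
        case 1 then show ?thesis using 0 st[OF i] continuous_map_from_subtopology by metis
      next
        case 2 then show ?thesis using 3 st[OF i] continuous_map_from_subtopology by metis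
      next
        case 3 then show ?thesis using e st[OF i] by simp
      next
        case 4
        then have "continuous_map P X (h i)" using g'[of 0] by (simp add: h_def)
        then show ?thesis using st[OF i] continuous_map_from_subtopology by metis
      next
        case 5
        then have "continuous_map P X (h i)" using g'[of 1] by (simp add: h_def)
        then show ?thesis using st[OF i] continuous_map_from_subtopology by metis
      qed
    qed
    have fh: "f x = h i x" if "i < 4" "x \<in> T i" for i x
    proof -
      obtain s u t where x: "x = (s, u, t)" by (cases x)
      have a: "s \<in> {0..1}" "u \<in> J" "t \<in> topspace (cube n)" using that by (auto simp: T_def x)
      have "i = 0 \<or> i = 1 \<or> i = 2 \<or> i = 3" using that by auto
      then show ?thesis
        using that(2) a f0g[of u t] f0\<gamma>[of u t] g\<gamma>[of u s t] by (auto simp: T_def x f_def h_def)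
    qed
    show "h i x = h j x" if "i \<in> {..<4}" "j \<in> {..<4}" "x \<in> topspace (subtopology P L) \<inter> T i \<inter> T j" for i j x
      using fh[of i x] fh[of j x] that by auto
    show "\<exists>j. j \<in> {..<4} \<and> x \<in> T j \<and> f x = h j x" if "x \<in> topspace (subtopology P L)" for x
    proof -
      from that obtain j where "j < 4" "x \<in> T j" by (auto simp: L_def)
      then show ?thesis using fh[of j x] by auto
    qed
  qed auto
  have cg: "continuous_map P euclideanreal (\<lambda>(s, u, t). box_gauge n u t)"
  proof -
    \<comment> \<open>\<open>None\<close> stands for the coordinate \<open>u\<close> and
      \<open>Some i\<close> for \<open>t i\<close>, so that the gauge becomes one maximum over a
      finite index set.\<close>
    have "continuous_map P euclideanreal (\<lambda>x. Max ((\<lambda>i. case i of None \<Rightarrow> \<bar>2 * (case x of (s, u, t) \<Rightarrow> u) - 1\<bar> | Some i \<Rightarrow> \<bar>2 * (case x of (s, u, t) \<Rightarrow> t i) - 1\<bar>) ` (insert None (Some ` {..<n}))))"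
      using cu cti by (intro continuous_map_real_Max) (auto intro!: continuous_intros split: option.splits)
    then show ?thesis by (simp add: box_gauge_def image_image case_prod_unfold)
  qed
  have dpos: "max (1 - s / 2) (box_gauge n u t) > 0" if "s \<in> {0..1}" for s u t
    using that by (simp add: less_max_iff_disj)
  have csc: "continuous_map P euclideanreal (\<lambda>(s, u, t). box_scale n s u t)"
  proof -
    have s: "continuous_map P euclideanreal (\<lambda>x. 1 - fst x * (1 / 2))"
      using cs unfolding case_prod_unfold by (intro continuous_map_diff continuous_map_real_mult_right) auto
    have g: "continuous_map P euclideanreal (\<lambda>x. box_gauge n (fst (snd x)) (snd (snd x)))"
      using cg unfolding case_prod_unfold .
    have m: "continuous_map P euclideanreal (\<lambda>x. max (1 - fst x * (1 / 2)) (box_gauge n (fst (snd x)) (snd (snd x))))"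
      by (rule continuous_map_real_max[OF s g])
    have "continuous_map P euclideanreal (\<lambda>x. 1 / max (1 - fst x * (1 / 2)) (box_gauge n (fst (snd x)) (snd (snd x))))"
    proof (rule continuous_map_real_divide[OF _ m])
      show "max (1 - fst x * (1 / 2)) (box_gauge n (fst (snd x)) (snd (snd x))) \<noteq> 0" if "x \<in> topspace P" for x
      proof -
        have "fst x \<in> {0..1}" using that top by auto
        then show ?thesis using dpos[of "fst x" "fst (snd x)" "snd (snd x)"] by auto
      qed
    qed simp
    then show ?thesis by (simp add: box_scale_def case_prod_unfold)
  qed
  have bounds: "2 - (2 - s) * l \<in> {0..1} \<and> 1/2 + (u - 1/2) * l \<in> J \<and> (\<forall>i<n. 1/2 + (t i - 1/2) * l \<in> {0..1})
     \<and> (2 - (2 - s) * l = 0 \<or> 1/2 + (u - 1/2) * l \<in> {0, 1} \<or> (\<exists>i<n. 1/2 + (t i - 1/2) * l \<in> {0, 1}))"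
    if "s \<in> {0..1}" "u \<in> J" "t \<in> topspace (cube n)" and l: "l = box_scale n s u t" for s u t l
  proof -
    have u: "u \<in> {0..1}" using that(2) J01 by blast
    note b = box_scale_bounds[OF that(1) u that(3)[unfolded topspace_cube], folded l]
    have "1/2 + (u - 1/2) * l \<in> J" using J
    proof
      assume J: "J = {1/2}"
      then have "u = 1/2" using that(2) by simp
      then show ?thesis using b(5) J by simp
    next
      assume J: "J = {0..1}"
      show ?thesis unfolding J by (rule b(2))
    qed
    then show ?thesis using b(1) b(3) b(4) by (intro conjI)
  qed
  have cr: "continuous_map P (subtopology P L) (box_retract n)"
  proof -
    have "continuous_map P P (box_retract n)"
    proof -
      have a: "continuous_map P interval (\<lambda>x. case x of (s, u, t) \<Rightarrow> 2 - (2 - s) * box_scale n s u t)"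
      proof -
        have "continuous_map P euclideanreal (\<lambda>x. 2 - (2 - (case x of (s, u, t) \<Rightarrow> s)) * (case x of (s, u, t) \<Rightarrow> box_scale n s u t))"
          by (intro continuous_intros cs csc)
        moreover have "2 - (2 - s) * box_scale n s u t \<in> {0..1}" if "(s, u, t) \<in> topspace P" for s u t
          using bounds[OF _ _ _ refl, of s u t] that unfolding top by blast
        ultimately show ?thesis unfolding continuous_map_in_subtopology by (simp add: case_prod_unfold Pi_iff)
      qed
      have b: "continuous_map P (top_of_set J) (\<lambda>x. case x of (s, u, t) \<Rightarrow> 1/2 + (u - 1/2) * box_scale n s u t)"
      proof -
        have "continuous_map P euclideanreal (\<lambda>x. 1/2 + ((case x of (s, u, t) \<Rightarrow> u) - 1/2) * (case x of (s, u, t) \<Rightarrow> box_scale n s u t))"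
          by (intro continuous_intros cu csc)
        moreover have "1/2 + (u - 1/2) * box_scale n s u t \<in> J" if "(s, u, t) \<in> topspace P" for s u t
          using bounds[OF _ _ _ refl, of s u t] that unfolding top by blast
        ultimately show ?thesis unfolding continuous_map_in_subtopology by (simp add: case_prod_unfold Pi_iff)
      qed
      have c: "continuous_map P (cube n) (\<lambda>x. case x of (s, u, t) \<Rightarrow> \<lambda>i\<in>{..<n}. 1/2 + (t i - 1/2) * box_scale n s u t)"
      proof -
        have "continuous_map P interval (\<lambda>x. case x of (s, u, t) \<Rightarrow> 1/2 + (t i - 1/2) * box_scale n s u t)" if "i < n" for i
        proof -
          have "continuous_map P euclideanreal (\<lambda>x. 1/2 + ((case x of (s, u, t) \<Rightarrow> t i) - 1/2) * (case x of (s, u, t) \<Rightarrow> box_scale n s u t))"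
            by (intro continuous_intros cti csc that)
          moreover have "1/2 + (t i - 1/2) * box_scale n s u t \<in> {0..1}" if "(s, u, t) \<in> topspace P" for s u t
            using bounds[OF _ _ _ refl, of s u t] that \<open>i < n\<close> unfolding top by blast
          ultimately show ?thesis unfolding continuous_map_in_subtopology by (simp add: case_prod_unfold Pi_iff)
        qed
        then show ?thesis unfolding cube_def by (auto simp: continuous_map_componentwise case_prod_unfold)
      qed
      show ?thesis
        unfolding box_retract_def
        by (subst P_def, unfold continuous_map_pairwise) (use a b c in \<open>simp add: o_def case_prod_unfold\<close>)
    qed
    moreover have "box_retract n x \<in> L" if x: "x \<in> topspace P" for x
    proof -
      obtain s u t where x: "x = (s, u, t)" and a: "s \<in> {0..1}" "u \<in> J" "t \<in> topspace (cube n)" using x unfolding top by blast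
      note bd = bounds[OF a refl]
      let ?t = "\<lambda>i\<in>{..<n}. 1/2 + (t i - 1/2) * box_scale n s u t"
      have t: "?t \<in> topspace (cube n)" using bd unfolding topspace_cube by (simp add: PiE_iff)
      have "(\<exists>i<n. 1/2 + (t i - 1/2) * box_scale n s u t \<in> {0, 1}) \<Longrightarrow> ?t \<in> cube_boundary n"
        using t by (auto simp: cube_boundary_def)
      then have "box_retract n x \<in> T 0 \<or> box_retract n x \<in> T 1 \<or> box_retract n x \<in> T 2 \<or> box_retract n x \<in> T 3"
        using bd t unfolding T_def x box_retract_def by auto
      then show ?thesis unfolding L_def by force
    qed
    ultimately show ?thesis by (auto simp: continuous_map_in_subtopology)
  qed
  have ret: "box_retract n (s, u, t) = (s, u, t)" if "(s, u, t) \<in> L" for s u t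
  proof -
    have a: "s \<in> {0..1}" "u \<in> J" "t \<in> topspace (cube n)" using that by (auto simp: L_def T_def)
    have "s = 0 \<or> u = 0 \<or> u = 1 \<or> t \<in> cube_boundary n"
      using that unfolding L_def T_def by (fastforce split: if_splits)
    \<comment> \<open>On the bottom the term \<open>1 - s / 2\<close> equals \<open>1\<close>, on
      the sides the gauge does; either way the scale is \<open>1\<close> and the retraction fixes
      the point.\<close>
    then have "box_gauge n u t = 1" if "s \<noteq> 0"
      using that box_gauge_boundary[of u t n] a J01 by blast
    moreover have "box_gauge n u t \<le> 1" using box_gauge_le[of u t n] a J01 by (auto simp: topspace_cube)
    ultimately have "max (1 - s / 2) (box_gauge n u t) = 1"
      using a(1) by (cases "s = 0") (simp_all add: max_absorb1 max_absorb2)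
    then have "box_scale n s u t = 1" by (simp add: box_scale_def)
    moreover have "(\<lambda>i\<in>{..<n}. t i) = t" using a(3) by (simp add: topspace_cube PiE_def extensional_restrict)
    ultimately show ?thesis by (simp add: box_retract_def)
  qed
  have inL: "(s, u, t) \<in> L" if "s \<in> {0..1}" "u \<in> J" "t \<in> topspace (cube n)" "s = 0 \<or> u = 0 \<or> u = 1 \<or> t \<in> cube_boundary n" for s u t
  proof -
    have "(s, u, t) \<in> T 0 \<or> (s, u, t) \<in> T 1 \<or> (s, u, t) \<in> T 2 \<or> (s, u, t) \<in> T 3"
      using that by (auto simp: T_def)
    then show ?thesis unfolding L_def by force
  qed
  show ?thesis
  proof
    show "continuous_map (prod_topology interval (prod_topology (top_of_set J) (cube n))) X (f \<circ> box_retract n)"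
      using continuous_map_compose[OF cr cf] by (simp add: P_def)
    show "(f \<circ> box_retract n) (0, u, t) = f0 (u, t)" if "u \<in> J" "t \<in> topspace (cube n)" for u t
      using inL[of 0 u t] ret that by (simp add: f_def)
    show "(f \<circ> box_retract n) (s, e, t) = g e (s, t)" if "e \<in> {0, 1} \<inter> J" "s \<in> {0..1}" "t \<in> topspace (cube n)" for e s t
      using inL[of s e t] ret that f0g by (auto simp: f_def)
    show "(f \<circ> box_retract n) (s, u, t) = \<gamma> s" if "u \<in> J" "s \<in> {0..1}" "t \<in> cube_boundary n" for u s t
      using inL[of s u t] ret that f0\<gamma> g\<gamma>[of u s t] subsetD[OF cube_boundary_subset that(3)] by (auto simp: f_def)
  qed
qed

section \<open>Based homotopies and change of base point\<close>

lemma based_homotopicI: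
  assumes "continuous_map (prod_topology interval (cube n)) X h"
    and "\<And>t. t \<in> topspace (cube n) \<Longrightarrow> h (0, t) = a t" "\<And>t. t \<in> topspace (cube n) \<Longrightarrow> h (1, t) = b t"
    and "\<And>s t. s \<in> {0..1} \<Longrightarrow> t \<in> cube_boundary n \<Longrightarrow> h (s, t) = x"
  shows "(a, b) \<in> based_homotopic n X x"
proof -
  have "homotopic_with (\<lambda>k. \<forall>t \<in> cube_boundary n. k t = x) (cube n) X a b"
  proof (subst homotopic_with)
    show "(\<forall>t\<in>cube_boundary n. h t = x) = (\<forall>t\<in>cube_boundary n. k t = x)"
      if "\<And>t. t \<in> topspace (cube n) \<Longrightarrow> h t = k t" for h k :: "(nat \<Rightarrow> real) \<Rightarrow> 'a"
      using that subsetD[OF cube_boundary_subset] by auto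
    show "\<exists>h. continuous_map (prod_topology interval (cube n)) X h \<and>
        (\<forall>x\<in>topspace (cube n). h (0, x) = a x) \<and> (\<forall>x\<in>topspace (cube n). h (1, x) = b x) \<and>
        (\<forall>t\<in>{0..1}. \<forall>s\<in>cube_boundary n. h (t, s) = x)"
      using assms by blast
  qed
  moreover have "a \<in> based_cubes n X x \<and> b \<in> based_cubes n X x"
  proof
    show "a \<in> based_cubes n X x"
      using homotopic_with_imp_continuous_maps[OF calculation] assms(2) assms(4)[of 0] cube_boundary_subset[of n]
      by (auto simp: based_cubes_def subset_iff)
    show "b \<in> based_cubes n X x"
      using homotopic_with_imp_continuous_maps[OF calculation] assms(3) assms(4)[of 1] cube_boundary_subset[of n]
      by (auto simp: based_cubes_def subset_iff)
  qed
  ultimately show ?thesis by (simp add: based_homotopic_def)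
qed

lemma based_homotopicE:
  assumes "(a, b) \<in> based_homotopic n X x"
  obtains h where "continuous_map (prod_topology interval (cube n)) X h"
    "\<And>t. h (0, t) = a t" "\<And>t. h (1, t) = b t"
    "\<And>s t. s \<in> {0..1} \<Longrightarrow> t \<in> cube_boundary n \<Longrightarrow> h (s, t) = x"
  using assms unfolding based_homotopic_def homotopic_with_def by auto

lemma equiv_based_homotopic: "equiv (based_cubes n X x) (based_homotopic n X x)"
proof (rule equivI)
  show "refl_on (based_cubes n X x) (based_homotopic n X x)"
    by (auto simp: refl_on_def based_homotopic_def based_cubes_def)
  show "sym (based_homotopic n X x)"
    by (auto simp: sym_def based_homotopic_def homotopic_with_sym)
  show "trans (based_homotopic n X x)"
    by (auto simp: trans_def based_homotopic_def intro: homotopic_with_trans)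
qed (auto simp: based_homotopic_def)

lemma based_cubes_compose:
  assumes "continuous_map X Y f" "a \<in> based_cubes n X x"
  shows "f \<circ> a \<in> based_cubes n Y (f x)"
  using assms continuous_map_compose[of _ X a Y f] unfolding based_cubes_def by simp

lemma based_homotopic_compose:
  assumes f: "continuous_map X Y f" and ab: "(a, b) \<in> based_homotopic n X x"
  shows "(f \<circ> a, f \<circ> b) \<in> based_homotopic n Y (f x)"
proof -
  obtain h where h: "continuous_map (prod_topology interval (cube n)) X h"
    "\<And>t. h (0, t) = a t" "\<And>t. h (1, t) = b t"
    "\<And>s t. s \<in> {0..1} \<Longrightarrow> t \<in> cube_boundary n \<Longrightarrow> h (s, t) = x"
    by (rule based_homotopicE[OF ab]) (rule that)
  show ?thesis
    by (rule based_homotopicI[where h = "f \<circ> h"]) (use continuous_map_compose[OF h(1) f] h in auto)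
qed

text \<open>A free homotopy from \<open>a\<close> to \<open>c\<close> during which the boundary of the cube follows \<open>\<gamma>\<close>. It
  expresses the change of base point along \<open>\<gamma>\<close>.\<close>

definition drags :: "nat \<Rightarrow> 'a topology \<Rightarrow> (real \<Rightarrow> 'a) \<Rightarrow> ((nat \<Rightarrow> real) \<Rightarrow> 'a) \<Rightarrow> ((nat \<Rightarrow> real) \<Rightarrow> 'a) \<Rightarrow> bool" where
  "drags n X \<gamma> a c \<longleftrightarrow> (\<exists>G. continuous_map (prod_topology interval (cube n)) X G \<and>
     (\<forall>t \<in> topspace (cube n). G (0, t) = a t \<and> G (1, t) = c t) \<and>
     (\<forall>s \<in> {0..1}. \<forall>t \<in> cube_boundary n. G (s, t) = \<gamma> s))"

lemma dragsE:
  assumes "drags n X \<gamma> a c"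
  obtains G where "continuous_map (prod_topology interval (cube n)) X G"
    "\<And>t. t \<in> topspace (cube n) \<Longrightarrow> G (0, t) = a t" "\<And>t. t \<in> topspace (cube n) \<Longrightarrow> G (1, t) = c t"
    "\<And>s t. s \<in> {0..1} \<Longrightarrow> t \<in> cube_boundary n \<Longrightarrow> G (s, t) = \<gamma> s"
  using assms unfolding drags_def by blast

lemma continuous_map_interval_flip: "continuous_map interval interval (\<lambda>s. 1 - s)"
  by (auto intro!: continuous_intros simp: continuous_map_in_subtopology)

lemma drags_reverse:
  assumes "drags n X \<gamma> a c" shows "drags n X (\<lambda>s. \<gamma> (1 - s)) c a"
proof -
  obtain G where G: "continuous_map (prod_topology interval (cube n)) X G"
     "\<forall>t \<in> topspace (cube n). G (0, t) = a t \<and> G (1, t) = c t"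
     "\<forall>s \<in> {0..1}. \<forall>t \<in> cube_boundary n. G (s, t) = \<gamma> s"
    using assms by (auto simp: drags_def)
  have "continuous_map (prod_topology interval (cube n)) (prod_topology interval (cube n)) (\<lambda>(s, t). (1 - s, t))"
    using continuous_map_compose[OF continuous_map_fst continuous_map_interval_flip]
    by (simp add: continuous_map_pairwise o_def case_prod_unfold continuous_map_snd)
  from continuous_map_compose[OF this G(1)] have "continuous_map (prod_topology interval (cube n)) X (\<lambda>(s, t). G (1 - s, t))"
    by (simp add: o_def case_prod_unfold)
  then show ?thesis
    unfolding drags_def using G(2,3) by (intro exI[of _ "\<lambda>(s, t). G (1 - s, t)"]) auto
qed

text \<open>With a one-point \<open>J\<close> the box is a cylinder over the cube. The cube
  \<open>c\<close> is its bottom, the boundary follows the reversed path, and the lid is the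
  transported cube \<open>a\<close>.\<close>

lemma drags_exists:
  assumes \<gamma>: "continuous_map interval X \<gamma>" and c: "c \<in> based_cubes n X (\<gamma> 1)"
  obtains a where "a \<in> based_cubes n X (\<gamma> 0)" "drags n X \<gamma> a c"
proof -
  have c': "continuous_map (cube n) X c" "\<And>t. t \<in> cube_boundary n \<Longrightarrow> c t = \<gamma> 1"
    using c by (auto simp: based_cubes_def)
  obtain F where F: "continuous_map (prod_topology interval (prod_topology (top_of_set {1/2::real}) (cube n))) X F"
    "\<And>u t. u \<in> {1/2} \<Longrightarrow> t \<in> topspace (cube n) \<Longrightarrow> F (0, u, t) = (\<lambda>(u, t). c t) (u, t)"
    "\<And>u s t. u \<in> {1/2} \<Longrightarrow> s \<in> {0..1} \<Longrightarrow> t \<in> cube_boundary n \<Longrightarrow> F (s, u, t) = \<gamma> (1 - s)"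
  \<comment> \<open>The path of \<open>box_fill\<close> starts at the bottom, where \<open>c\<close>
    sits over \<open>\<gamma> 1\<close>; hence the reversal. As \<open>1/2\<close> is not an end of
    the interval, \<open>g\<close> may be \<open>undefined\<close>.\<close>
  proof (rule box_fill[where J = "{1/2}" and ?f0.0 = "\<lambda>(u, t). c t" and g = undefined
        and \<gamma> = "\<lambda>s. \<gamma> (1 - s)" and X = X and n = n])
    show "continuous_map (prod_topology (top_of_set {1/2::real}) (cube n)) X (\<lambda>(u, t). c t)"
      using continuous_map_compose[OF continuous_map_snd c'(1)] by (simp add: o_def case_prod_unfold)
    show "continuous_map interval X (\<lambda>s. \<gamma> (1 - s))"
      using continuous_map_compose[OF continuous_map_interval_flip \<gamma>] by (simp add: o_def)
    show "(case (u, t) of (u, t) \<Rightarrow> c t) = \<gamma> (1 - 0)" if "t \<in> cube_boundary n" for u :: real and t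
      using c'(2)[OF that] by simp
  qed (rule disjI1, rule refl, simp, simp, simp, (rule that; assumption))
  define G where "G = (\<lambda>(s, t). F (s, 1/2::real, t))"
  have "continuous_map (prod_topology interval (cube n)) (prod_topology interval (prod_topology (top_of_set {1/2::real}) (cube n))) (\<lambda>(s, t). (s, 1/2::real, t))"
    by (simp add: continuous_map_pairwise o_def case_prod_unfold continuous_map_snd continuous_map_fst)
  from continuous_map_compose[OF this F(1)] have G: "continuous_map (prod_topology interval (cube n)) X G"
    by (simp add: G_def o_def case_prod_unfold)
  have bd: "\<And>t. t \<in> cube_boundary n \<Longrightarrow> t \<in> topspace (cube n)" using cube_boundary_subset by blast
  have d: "drags n X (\<lambda>s. \<gamma> (1 - s)) c (\<lambda>t. G (1, t))"
    unfolding drags_def using G F(2)[of "1/2"] F(3)[of "1/2"] by (intro exI[of _ G]) (simp add: G_def bd)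
  have "continuous_map (cube n) X (\<lambda>t. G (1, t))"
  proof -
    have "continuous_map (cube n) (prod_topology interval (cube n)) (\<lambda>t. (1, t))"
      by (simp add: continuous_map_pairwise o_def)
    from continuous_map_compose[OF this G] show ?thesis by (simp add: o_def)
  qed
  then have "(\<lambda>t. G (1, t)) \<in> based_cubes n X (\<gamma> 0)"
    using F(3)[of "1/2" 1] by (simp add: based_cubes_def G_def)
  moreover have "drags n X \<gamma> (\<lambda>t. G (1, t)) c" using drags_reverse[OF d] by simp
  ultimately show ?thesis by (rule that)
qed

text \<open>The homotopy from \<open>c\<close> to \<open>d\<close> is the bottom of a box and the
  two reversed transports are its ends; the lid is a homotopy from \<open>a\<close> to
  \<open>b\<close>. For \<open>c = d\<close> this is uniqueness of transport, in general its
  compatibility with homotopy.\<close>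

lemma drags_homotopic:
  assumes \<gamma>: "continuous_map interval X \<gamma>" and a: "drags n X \<gamma> a c" and b: "drags n X \<gamma> b d"
    and cd: "(c, d) \<in> based_homotopic n X (\<gamma> 1)"
  shows "(a, b) \<in> based_homotopic n X (\<gamma> 0)"
proof -
  let ?I = "prod_topology interval (cube n)"
  obtain L where L: "continuous_map ?I X L" "\<And>t. L (0, t) = c t" "\<And>t. L (1, t) = d t"
    "\<And>s t. s \<in> {0..1} \<Longrightarrow> t \<in> cube_boundary n \<Longrightarrow> L (s, t) = \<gamma> 1"
    by (rule based_homotopicE[OF cd]) (rule that)
  obtain Ga where Ga: "continuous_map ?I X Ga"
     "\<And>t. t \<in> topspace (cube n) \<Longrightarrow> Ga (0, t) = c t" "\<And>t. t \<in> topspace (cube n) \<Longrightarrow> Ga (1, t) = a t"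
     "\<And>s t. s \<in> {0..1} \<Longrightarrow> t \<in> cube_boundary n \<Longrightarrow> Ga (s, t) = \<gamma> (1 - s)"
    by (rule dragsE[OF drags_reverse[OF a]]) (rule that)
  obtain Gb where Gb: "continuous_map ?I X Gb"
     "\<And>t. t \<in> topspace (cube n) \<Longrightarrow> Gb (0, t) = d t" "\<And>t. t \<in> topspace (cube n) \<Longrightarrow> Gb (1, t) = b t"
     "\<And>s t. s \<in> {0..1} \<Longrightarrow> t \<in> cube_boundary n \<Longrightarrow> Gb (s, t) = \<gamma> (1 - s)"
    by (rule dragsE[OF drags_reverse[OF b]]) (rule that)
  obtain F where F: "continuous_map (prod_topology interval ?I) X F"
    "\<And>e s t. e \<in> {0, 1} \<inter> {0..1} \<Longrightarrow> s \<in> {0..1} \<Longrightarrow> t \<in> topspace (cube n) \<Longrightarrow> F (s, e, t) = (if e = 0 then Ga else Gb) (s, t)"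
    "\<And>u s t. u \<in> {0..1} \<Longrightarrow> s \<in> {0..1} \<Longrightarrow> t \<in> cube_boundary n \<Longrightarrow> F (s, u, t) = \<gamma> (1 - s)"
  proof (rule box_fill[where J = "{0..1}" and ?f0.0 = L and g = "\<lambda>e. if e = 0 then Ga else Gb"
        and \<gamma> = "\<lambda>s. \<gamma> (1 - s)" and X = X and n = n])
    show "continuous_map interval X (\<lambda>s. \<gamma> (1 - s))"
      using continuous_map_compose[OF continuous_map_interval_flip \<gamma>] by (simp add: o_def)
    fix e :: real assume e: "e \<in> {0, 1} \<inter> {0..1}"
    then have e: "e = 0 \<or> e = 1" by blast
    then show "continuous_map ?I X (if e = 0 then Ga else Gb)" using Ga(1) Gb(1) by simp
    show "L (e, t) = (if e = 0 then Ga else Gb) (0, t)" if "t \<in> topspace (cube n)" for t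
      using e L(2)[of t] L(3)[of t] Ga(2)[OF that] Gb(2)[OF that] by (elim disjE) simp_all
    show "(if e = 0 then Ga else Gb) (s, t) = \<gamma> (1 - s)" if "s \<in> {0..1}" "t \<in> cube_boundary n" for s t
      using Ga(4)[OF that] Gb(4)[OF that] by simp
  next
    show "L (u, t) = \<gamma> (1 - 0)" if "u \<in> {0..1}" "t \<in> cube_boundary n" for u t
      using L(4)[OF that] by simp
  qed (rule disjI2, rule refl, rule L(1), (rule that; assumption))
  have "continuous_map ?I (prod_topology interval ?I) (\<lambda>x. (1, x))"
    by (simp add: continuous_map_pairwise o_def)
  from continuous_map_compose[OF this F(1)] have "continuous_map ?I X (\<lambda>x. F (1, x))"
    by (simp add: o_def)
  then show ?thesis
  proof (rule based_homotopicI)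
    show "F (1, 0, t) = a t" "F (1, 1, t) = b t" if "t \<in> topspace (cube n)" for t
      using F(2)[of 0 1 t] F(2)[of 1 1 t] Ga(3)[OF that] Gb(3)[OF that] that by simp_all
    show "F (1, s, t) = \<gamma> 0" if "s \<in> {0..1}" "t \<in> cube_boundary n" for s t
      using F(3)[OF that(1) _ that(2), of 1] by simp
  qed
qed

text \<open>The base point is transported along the tracks of the homotopy.\<close>

lemma homotopic_id_based_cubes:
  assumes "homotopic_with (\<lambda>_. True) X X id \<phi>" and x: "x \<in> topspace X"
  shows "\<And>a b. \<lbrakk>a \<in> based_cubes n X x; b \<in> based_cubes n X x;
           (\<phi> \<circ> a, \<phi> \<circ> b) \<in> based_homotopic n X (\<phi> x)\<rbrakk> \<Longrightarrow> (a, b) \<in> based_homotopic n X x"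
    and "\<And>c. c \<in> based_cubes n X (\<phi> x) \<Longrightarrow>
           \<exists>a \<in> based_cubes n X x. (\<phi> \<circ> a, c) \<in> based_homotopic n X (\<phi> x)"
proof -
  obtain h where h: "continuous_map (prod_topology interval X) X h" "\<And>x. h (0, x) = x" "\<And>x. h (1, x) = \<phi> x"
    using assms(1) by (auto simp: homotopic_with_def)
  define \<gamma> where "\<gamma> s = h (s, x)" for s
  have "continuous_map interval (prod_topology interval X) (\<lambda>s. (s, x))"
    using x by (simp add: continuous_map_pairwise o_def)
  then have \<gamma>: "continuous_map interval X \<gamma>"
    unfolding \<gamma>_def using continuous_map_compose[OF _ h(1), of interval "\<lambda>s. (s, x)"] by (simp add: o_def)
  have ends: "\<gamma> 0 = x" "\<gamma> 1 = \<phi> x" by (simp_all add: \<gamma>_def h)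
  have d: "drags n X \<gamma> a (\<phi> \<circ> a)" if "a \<in> based_cubes n X x" for a
  proof -
    have a: "continuous_map (cube n) X a" "\<And>t. t \<in> cube_boundary n \<Longrightarrow> a t = x"
      using that by (auto simp: based_cubes_def)
    have "continuous_map (prod_topology interval (cube n)) (prod_topology interval X) (\<lambda>(s, t). (s, a t))"
      using continuous_map_compose[OF continuous_map_snd a(1)]
      by (simp add: continuous_map_pairwise o_def case_prod_unfold continuous_map_fst)
    from continuous_map_compose[OF this h(1)] have "continuous_map (prod_topology interval (cube n)) X (\<lambda>(s, t). h (s, a t))"
      by (simp add: o_def case_prod_unfold)
    then show ?thesis
      unfolding drags_def using a(2) h by (intro exI[of _ "\<lambda>(s, t). h (s, a t)"]) (auto simp: \<gamma>_def)
  qed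
  show "(a, b) \<in> based_homotopic n X x"
    if "a \<in> based_cubes n X x" "b \<in> based_cubes n X x" "(\<phi> \<circ> a, \<phi> \<circ> b) \<in> based_homotopic n X (\<phi> x)" for a b
    using drags_homotopic[OF \<gamma> d[OF that(1)] d[OF that(2)]] that(3) ends by simp
  show "\<exists>a \<in> based_cubes n X x. (\<phi> \<circ> a, c) \<in> based_homotopic n X (\<phi> x)" if "c \<in> based_cubes n X (\<phi> x)" for c
  proof -
    have "c \<in> based_cubes n X (\<gamma> 1)" using that ends by simp
    then obtain a where a: "a \<in> based_cubes n X x" "drags n X \<gamma> a c"
      using drags_exists[OF \<gamma>] ends by metis
    have "(a, a) \<in> based_homotopic n X x"
      using a(1) equiv_based_homotopic by (metis equivE refl_onD)
    \<comment> \<open>Both \<open>\<phi> \<circ> a\<close> and \<open>c\<close> arise from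
      \<open>a\<close> by transport along \<open>\<gamma>\<close>, so transport along the reversed
      path compares them.\<close>
    moreover have "continuous_map interval X (\<lambda>s. \<gamma> (1 - s))"
      using continuous_map_compose[OF continuous_map_interval_flip \<gamma>] by (simp add: o_def)
    ultimately have "(\<phi> \<circ> a, c) \<in> based_homotopic n X (\<phi> x)"
      using drags_homotopic[OF _ drags_reverse[OF d[OF a(1)]] drags_reverse[OF a(2)]] ends by simp
    then show ?thesis using a(1) by blast
  qed
qed

section \<open>Homotopy equivalences on path components and homotopy groups\<close>

lemma homotopy_group_map_class:
  assumes f: "continuous_map X Y f" and a: "a \<in> based_cubes n X x"
  shows "homotopy_group_map n Y f x (based_homotopic n X x `` {a}) = based_homotopic n Y (f x) `` {f \<circ> a}"
proof -
  let ?R = "based_homotopic n Y (f x)"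
  have "?R `` {f \<circ> g} = ?R `` {f \<circ> a}" if "(a, g) \<in> based_homotopic n X x" for g
    using equiv_class_eq[OF equiv_based_homotopic based_homotopic_compose[OF f that]] by simp
  moreover have "(a, a) \<in> based_homotopic n X x"
    using a equiv_based_homotopic by (metis equivE refl_onD)
  ultimately show ?thesis
    unfolding homotopy_group_map_def by blast
qed

lemma homotopic_id_path_component:
  assumes "homotopic_with (\<lambda>_. True) X X id \<phi>" and "x \<in> topspace X"
  shows "path_component_of X x (\<phi> x)"
proof -
  obtain h where h: "continuous_map (prod_topology interval X) X h" "\<And>x. h (0, x) = x" "\<And>x. h (1, x) = \<phi> x"
    using assms(1) by (auto simp: homotopic_with_def)
  have "continuous_map interval (prod_topology interval X) (\<lambda>s. (s, x))"
    using assms(2) by (simp add: continuous_map_pairwise o_def)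
  from continuous_map_compose[OF this h(1)] have "pathin X (\<lambda>s. h (s, x))"
    by (simp add: o_def pathin_def)
  then show ?thesis unfolding path_component_of_def using h by (intro exI[of _ "\<lambda>s. h (s, x)"]) simp
qed

lemma path_component_of_image:
  assumes "continuous_map X Y f" "path_component_of X x y"
  shows "path_component_of Y (f x) (f y)"
proof -
  obtain p where p: "pathin X p" "p 0 = x" "p 1 = y" using assms(2) by (auto simp: path_component_of_def)
  then have "pathin Y (f \<circ> p)" using assms(1) by (auto simp: pathin_def intro: continuous_map_compose)
  then show ?thesis unfolding path_component_of_def using p by (intro exI[of _ "f \<circ> p"]) auto
qed

text \<open>The inverse \<open>g\<close> need not respect base points, so the composites need not be
  homotopic to identities relative to them; transport along the tracks takes the place of this. It
  makes \<open>g \<circ> f\<close> bijective and \<open>f \<circ> g\<close> injective on classes of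
  cubes. Hence \<open>f\<close> and \<open>g\<close> are injective, and surjectivity of
  \<open>f\<close> follows from that of \<open>g \<circ> f\<close>.\<close>

lemma homotopy_equivalence_imp_weak:
  assumes f: "continuous_map X Y f" and g: "continuous_map Y X g"
    and gf: "homotopic_with (\<lambda>_. True) X X id (g \<circ> f)"
    and fg: "homotopic_with (\<lambda>_. True) Y Y id (f \<circ> g)"
  shows "weak_homotopy_equivalence X Y f"
  unfolding weak_homotopy_equivalence_def
proof (intro conjI allI ballI impI)
  show "continuous_map X Y f" by (rule f)
  have fx: "f x \<in> topspace Y" if "x \<in> topspace X" for x using continuous_map_funspace[OF f] that by blast
  have gy: "g y \<in> topspace X" if "y \<in> topspace Y" for y using continuous_map_funspace[OF g] that by blast
  have cl: "path_components_map Y f (path_component_of_set X x) = path_component_of_set Y (f x)" if "x \<in> topspace X" for x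
    unfolding path_components_map_def
  proof (intro equalityI subsetI)
    fix y assume "y \<in> (\<Union>z\<in>path_component_of_set X x. path_component_of_set Y (f z))"
    then show "y \<in> path_component_of_set Y (f x)"
      using path_component_of_image[OF f] by (auto intro: path_component_of_trans)
  qed (use that path_component_of_refl[of X x] in blast)
  show "bij_betw (path_components_map Y f) (path_components_of X) (path_components_of Y)"
    unfolding bij_betw_def
  proof
    show "inj_on (path_components_map Y f) (path_components_of X)"
    proof (rule inj_onI)
      fix C D assume "C \<in> path_components_of X" "D \<in> path_components_of X"
        and eq: "path_components_map Y f C = path_components_map Y f D"
      then obtain x y where x: "x \<in> topspace X" "C = path_component_of_set X x"
        and y: "y \<in> topspace X" "D = path_component_of_set X y"
        by (auto simp: path_components_of_def)
      have "path_component_of_set Y (f x) = path_component_of_set Y (f y)" using eq x y cl by metis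
      then have "path_component_of Y (f x) (f y)" using fx[OF y(1)] path_component_of_refl by (metis mem_Collect_eq)
      then have "path_component_of X (g (f x)) (g (f y))" by (rule path_component_of_image[OF g])
      then have "path_component_of X x y"
        using homotopic_id_path_component[OF gf x(1)] homotopic_id_path_component[OF gf y(1)] by (metis comp_apply path_component_of_sym path_component_of_trans)
      then show "C = D" using x y path_component_of_equiv by (metis (mono_tags))
    qed
    show "path_components_map Y f ` path_components_of X = path_components_of Y"
    proof (intro equalityI subsetI)
      fix D assume "D \<in> path_components_map Y f ` path_components_of X"
      then show "D \<in> path_components_of Y" using cl fx by (auto simp: path_components_of_def)
    next
      fix D assume "D \<in> path_components_of Y"
      then obtain y where y: "y \<in> topspace Y" "D = path_component_of_set Y y" by (auto simp: path_components_of_def)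
      have "path_component_of Y y (f (g y))" using homotopic_id_path_component[OF fg y(1)] by simp
      then have "D = path_component_of_set Y (f (g y))" using y path_component_of_equiv by (metis (mono_tags))
      then have "D = path_components_map Y f (path_component_of_set X (g y))" using cl gy y by simp
      then show "D \<in> path_components_map Y f ` path_components_of X" using gy y by (auto simp: path_components_of_def)
    qed
  qed
  fix n :: nat and x assume x: "x \<in> topspace X"
  note GF = homotopic_id_based_cubes[OF gf x, of _ n]
  have FG: "(a, b) \<in> based_homotopic n Y (f x)"
    if "a \<in> based_cubes n Y (f x)" "b \<in> based_cubes n Y (f x)"
      "(g \<circ> a, g \<circ> b) \<in> based_homotopic n X (g (f x))" for a b
    using homotopic_id_based_cubes(1)[OF fg fx[OF x] that(1,2)] based_homotopic_compose[OF f that(3)]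
    by (simp add: o_assoc)
  have inj: "(a, b) \<in> based_homotopic n X x"
    if "a \<in> based_cubes n X x" "b \<in> based_cubes n X x" "(f \<circ> a, f \<circ> b) \<in> based_homotopic n Y (f x)" for a b
    using GF(1)[OF that(1,2)] based_homotopic_compose[OF g that(3)] by (simp add: o_assoc)
  have sur: "\<exists>a \<in> based_cubes n X x. (f \<circ> a, c) \<in> based_homotopic n Y (f x)" if "c \<in> based_cubes n Y (f x)" for c
  proof -
    have "g \<circ> c \<in> based_cubes n X ((g \<circ> f) x)" using based_cubes_compose[OF g that] by simp
    \<comment> \<open>The equation is solved after applying \<open>g\<close>; injectivity of
      \<open>g\<close> on classes then removes \<open>g\<close> again.\<close>
    then obtain a where a: "a \<in> based_cubes n X x" "(g \<circ> f \<circ> a, g \<circ> c) \<in> based_homotopic n X ((g \<circ> f) x)"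
      using homotopic_id_based_cubes(2)[OF gf x] by blast
    then show ?thesis using FG[OF based_cubes_compose[OF f a(1)] that] by (auto simp: o_assoc)
  qed
  note E = equiv_based_homotopic
  show "bij_betw (homotopy_group_map n Y f x) (homotopy_group n X x) (homotopy_group n Y (f x))"
    unfolding bij_betw_def homotopy_group_def
  proof
    show "inj_on (homotopy_group_map n Y f x) (based_cubes n X x // based_homotopic n X x)"
    proof (rule inj_onI)
      fix C D assume "C \<in> based_cubes n X x // based_homotopic n X x" "D \<in> based_cubes n X x // based_homotopic n X x"
        and eq: "homotopy_group_map n Y f x C = homotopy_group_map n Y f x D"
      then obtain a b where a: "a \<in> based_cubes n X x" "C = based_homotopic n X x `` {a}"
        and b: "b \<in> based_cubes n X x" "D = based_homotopic n X x `` {b}"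
        by (auto elim!: quotientE)
      have "based_homotopic n Y (f x) `` {f \<circ> a} = based_homotopic n Y (f x) `` {f \<circ> b}"
        using eq a b homotopy_group_map_class[OF f] by metis
      then have "(f \<circ> a, f \<circ> b) \<in> based_homotopic n Y (f x)"
        using eq_equiv_class[OF _ E based_cubes_compose[OF f b(1)]] by blast
      then show "C = D" using equiv_class_eq[OF E inj] a b by simp
    qed
    show "homotopy_group_map n Y f x ` (based_cubes n X x // based_homotopic n X x) = based_cubes n Y (f x) // based_homotopic n Y (f x)"
    proof (intro equalityI subsetI)
      fix D assume "D \<in> homotopy_group_map n Y f x ` (based_cubes n X x // based_homotopic n X x)"
      then show "D \<in> based_cubes n Y (f x) // based_homotopic n Y (f x)"
        using homotopy_group_map_class[OF f] based_cubes_compose[OF f] by (auto elim!: quotientE intro!: quotientI)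
    next
      fix D assume "D \<in> based_cubes n Y (f x) // based_homotopic n Y (f x)"
      then obtain c where c: "c \<in> based_cubes n Y (f x)" "D = based_homotopic n Y (f x) `` {c}" by (auto elim!: quotientE)
      then obtain a where a: "a \<in> based_cubes n X x" "(f \<circ> a, c) \<in> based_homotopic n Y (f x)" using sur by blast
      then have "D = homotopy_group_map n Y f x (based_homotopic n X x `` {a})"
        using c equiv_class_eq[OF E a(2)] homotopy_group_map_class[OF f a(1)] by simp
      then show "D \<in> homotopy_group_map n Y f x ` (based_cubes n X x // based_homotopic n X x)"
        using a(1) by (auto intro!: quotientI)
    qed
  qed
qed

section \<open>Realizations of simplicial sets and nerves\<close>

abbreviation std :: "nat \<Rightarrow> (nat \<Rightarrow> real) topology" where
  "std n \<equiv> subtopology (powertop_real UNIV) (standard_simplex n)"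

definition cls :: "'x sset \<Rightarrow> nat \<Rightarrow> 'x \<Rightarrow> (nat \<Rightarrow> real) \<Rightarrow> ((nat \<times> 'x) \<times> (nat \<Rightarrow> real)) set" where
  "cls X n x t = realization_rel X `` {((n, x), t)}"

lemma continuous_map_std:
  "continuous_map X (std n) f \<longleftrightarrow>
    (\<forall>i. continuous_map X euclideanreal (\<lambda>x. f x i)) \<and> (\<forall>x \<in> topspace X. f x \<in> standard_simplex n)"
  by (auto simp: continuous_map_in_subtopology continuous_map_componentwise_UNIV)

lemma continuous_map_std_coord: "continuous_map (std n) euclideanreal (\<lambda>t. t i)"
  by (intro continuous_map_from_subtopology) (metis UNIV_I continuous_map_product_projection)

lemma topspace_simplices_space:
  "topspace (simplices_space X) = {((n, x), t). x \<in> sections X n \<and> t \<in> standard_simplex n}"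
  by (auto simp: simplices_space_def topspace_standard_simplex)

lemma openin_realization:
  "openin (realization X) U \<longleftrightarrow> U \<subseteq> topspace (simplices_space X) // realization_rel X \<and> openin (simplices_space X) (\<Union>U)"
  unfolding realization_def quotient_space_def
  by (subst topology_inverse'[OF istopology_quotient_space[OF equiv_realization_rel]]) (rule refl)

lemma topspace_realization: "topspace (realization X) = topspace (simplices_space X) // realization_rel X"
proof (rule antisym)
  show "topspace (realization X) \<subseteq> topspace (simplices_space X) // realization_rel X"
    using openin_realization[of X "topspace (realization X)"] by simp
  have "openin (realization X) (topspace (simplices_space X) // realization_rel X)"
    unfolding openin_realization Union_quotient[OF equiv_realization_rel] by simp
  then show "topspace (simplices_space X) // realization_rel X \<subseteq> topspace (realization X)"
    by (rule openin_subset)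
qed

lemma quotient_map_realization:
  "quotient_map (simplices_space X) (realization X) (\<lambda>p. realization_rel X `` {p})"
  unfolding quotient_map_def
proof (intro conjI allI impI)
  let ?S = "topspace (simplices_space X)" and ?r = "realization_rel X"
  show "(\<lambda>p. ?r `` {p}) ` ?S = topspace (realization X)"
    by (auto simp: topspace_realization quotient_def)
  fix U assume "U \<subseteq> topspace (realization X)"
  then have U: "U \<subseteq> ?S // ?r" by (simp add: topspace_realization)
  have "{x \<in> ?S. ?r `` {x} \<in> U} = \<Union>U"
  proof (intro equalityI subsetI)
    fix x assume "x \<in> {x \<in> ?S. ?r `` {x} \<in> U}"
    then show "x \<in> \<Union>U" using equiv_class_self[OF equiv_realization_rel] by blast
  next
    fix x assume "x \<in> \<Union>U"
    then obtain c where c: "c \<in> U" "x \<in> c" by blast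
    then have "c \<in> ?S // ?r" using U by blast
    moreover from this have "x \<in> ?S" using c(2) in_quotient_imp_subset[OF equiv_realization_rel] by blast
    moreover have "?r `` {x} = c"
    proof -
      obtain y where y: "c = ?r `` {y}" using \<open>c \<in> ?S // ?r\<close> by (rule quotientE)
      then show ?thesis using equiv_class_eq[OF equiv_realization_rel, of y x X] c(2) by simp
    qed
    ultimately show "x \<in> {x \<in> ?S. ?r `` {x} \<in> U}" using c(1) by simp
  qed
  then show "openin (simplices_space X) {x \<in> ?S. ?r `` {x} \<in> U} = openin (realization X) U"
    using U by (simp add: openin_realization)
qed

lemma topspace_realization_cls:
  "topspace (realization X) = {cls X n x t | n x t. x \<in> sections X n \<and> t \<in> standard_simplex n}"
  unfolding topspace_realization quotient_def topspace_simplices_space cls_def by blast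

lemma cls_in_realization:
  "x \<in> sections X n \<Longrightarrow> t \<in> standard_simplex n \<Longrightarrow> cls X n x t \<in> topspace (realization X)"
  unfolding topspace_realization_cls by blast

lemma continuous_map_cls:
  assumes "x \<in> sections X n" shows "continuous_map (std n) (realization X) (cls X n x)"
proof -
  have "continuous_map ((\<lambda>(n, x). std n) (n, x)) (simplices_space X) (\<lambda>t. ((n, x), t))"
    unfolding simplices_space_def by (rule continuous_map_component_injection) (use assms in simp)
  from continuous_map_compose[OF this quotient_imp_continuous_map[OF quotient_map_realization]]
  show ?thesis by (simp add: o_def cls_def[abs_def])
qed

lemma simplex_push_in:
  assumes "(m, \<theta>, n) \<in> Arr simplex_category" "t \<in> standard_simplex m"
  shows "simplex_push m \<theta> t \<in> standard_simplex n"
proof -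
  have \<theta>: "\<And>i. i \<le> m \<Longrightarrow> \<theta> i \<le> n" using assms(1) by (auto simp: simplex_category_def)
  have t: "\<And>i. 0 \<le> t i" "(\<Sum>i\<le>m. t i) = 1" using assms(2) by (auto simp: standard_simplex_def)
  have sum: "(\<Sum>j\<le>n. simplex_push m \<theta> t j) = 1"
  proof -
    have "(\<Sum>j\<in>{..n}. \<Sum>i\<in>{i \<in> {..m}. \<theta> i = j}. t i) = (\<Sum>i\<in>{..m}. t i)"
      by (rule sum.group) (use \<theta> in auto)
    then show ?thesis using t(2) by (simp add: simplex_push_def)
  qed
  have nn: "0 \<le> simplex_push m \<theta> t j" for j using t(1) by (simp add: simplex_push_def sum_nonneg)
  moreover have z: "simplex_push m \<theta> t j = 0" if "j > n" for j
  proof -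
    have "{i. i \<le> m \<and> \<theta> i = j} = {}" using \<theta> that by force
    then show ?thesis by (simp only: simplex_push_def sum.empty)
  qed
  moreover have "simplex_push m \<theta> t j \<le> 1" for j
  proof (cases "j \<le> n")
    case True
    then have "simplex_push m \<theta> t j \<le> (\<Sum>j\<le>n. simplex_push m \<theta> t j)" using nn by (intro member_le_sum) auto
    then show ?thesis using sum by simp
  qed (use z in simp)
  ultimately show ?thesis using sum by (simp add: standard_simplex_def)
qed

lemma continuous_map_simplex_push:
  assumes "(m, \<theta>, n) \<in> Arr simplex_category"
  shows "continuous_map (std m) (std n) (simplex_push m \<theta>)"
  unfolding continuous_map_std
  using simplex_push_in[OF assms] continuous_map_std_coord[of m]
  by (auto simp: simplex_push_def topspace_standard_simplex intro!: continuous_map_sum)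

lemma cls_glue:
  assumes X: "presheaf simplex_category X" and \<theta>: "(m, \<theta>, n) \<in> Arr simplex_category"
    and x: "x \<in> sections X n" and t: "t \<in> standard_simplex m"
  shows "cls X m (restr X (m, \<theta>, n) x) t = cls X n x (simplex_push m \<theta> t)"
proof -
  have "restr X (m, \<theta>, n) x \<in> sections X m"
  proof -
    have "restr X (m, \<theta>, n) \<in> sections X (Cod simplex_category (m, \<theta>, n)) \<rightarrow> sections X (Dom simplex_category (m, \<theta>, n))"
      using X \<theta> unfolding presheaf_def by blast
    then show ?thesis using x by (auto simp: simplex_category_def)
  qed
  moreover have "(((m, restr X (m, \<theta>, n) x), t), ((n, x), simplex_push m \<theta> t)) \<in> realization_glue X"
    unfolding realization_glue_def using assms by blast
  ultimately have "(((m, restr X (m, \<theta>, n) x), t), ((n, x), simplex_push m \<theta> t)) \<in> realization_rel X"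
    using x t simplex_push_in[OF \<theta> t] by (auto simp: realization_rel_def topspace_simplices_space)
  then show ?thesis unfolding cls_def by (rule equiv_class_eq[OF equiv_realization_rel])
qed

section \<open>Continuous maps out of a realization\<close>

text \<open>Every summand is open in the sum, so its product with \<open>Z\<close> is open in the
  product, and continuity is a local matter.\<close>

lemma continuous_map_prod_sum_topology:
  assumes "\<And>i. i \<in> I \<Longrightarrow> continuous_map (prod_topology Z (X i)) Y (\<lambda>(z, x). h (z, (i, x)))"
  shows "continuous_map (prod_topology Z (sum_topology X I)) Y h"
proof (rule pasting_lemma[where I = I and T = "\<lambda>i. topspace Z \<times> {i} \<times> topspace (X i)" and f = "\<lambda>_. h"])
  fix i assume i: "i \<in> I"
  let ?T = "topspace Z \<times> {i} \<times> topspace (X i)" and ?P = "prod_topology Z (sum_topology X I)"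
  have op: "openin (sum_topology X I) ({i} \<times> V)" if "openin (X i) V" for V
  proof -
    have "{x. (j, x) \<in> {i} \<times> V} = (if j = i then V else {})" for j by auto
    then show ?thesis using that i openin_subset[OF that] by (auto simp: openin_sum_topology)
  qed
  show "openin ?P ?T" using op[OF openin_topspace] by (simp add: openin_prod_Times_iff)
  have 1: "continuous_map (subtopology ?P ?T) Z (\<lambda>p. fst p)"
    by (simp add: continuous_map_from_subtopology continuous_map_fst)
  have 2: "continuous_map (subtopology ?P ?T) (X i) (\<lambda>p. snd (snd p))"
    unfolding continuous_map_def
  proof (intro conjI allI impI)
    show "(\<lambda>p. snd (snd p)) \<in> topspace (subtopology ?P ?T) \<rightarrow> topspace (X i)" by auto
    fix V assume V: "openin (X i) V"
    have "openin ?P (topspace Z \<times> {i} \<times> V)" using op[OF V] by (simp add: openin_prod_Times_iff)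
    moreover have "{p \<in> topspace (subtopology ?P ?T). snd (snd p) \<in> V} = (topspace Z \<times> {i} \<times> V) \<inter> ?T"
      using i openin_subset[OF V] by auto
    ultimately show "openin (subtopology ?P ?T) {p \<in> topspace (subtopology ?P ?T). snd (snd p) \<in> V}"
      by (auto simp: openin_subtopology)
  qed
  have "continuous_map (subtopology ?P ?T) (prod_topology Z (X i)) (\<lambda>p. (fst p, snd (snd p)))"
    using 1 2 by (simp add: continuous_map_pairwise o_def)
  from continuous_map_compose[OF this assms[OF i]]
  have c: "continuous_map (subtopology ?P ?T) Y (\<lambda>p. h (fst p, (i, snd (snd p))))" by (simp add: o_def)
  show "continuous_map (subtopology ?P ?T) Y h"
    by (rule continuous_map_eq[OF c]) auto
qed auto

text \<open>The product of a quotient map with the identity of \<open>J\<close> is again a quotient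
  map, because a compact set of reals is locally compact and Hausdorff. This is what allows
  homotopies on a realization to be defined simplex by simplex.\<close>

lemma realization_lift_product:
  fixes J :: "real set"
  assumes J: "compact J"
    and cont: "\<And>n x. x \<in> sections X n \<Longrightarrow> continuous_map (prod_topology (top_of_set J) (std n)) Z (\<lambda>(s, t). \<phi> s n x t)"
    and nat: "\<And>m \<theta> n x s t. \<lbrakk>(m, \<theta>, n) \<in> Arr simplex_category; x \<in> sections X n; t \<in> standard_simplex m; s \<in> J\<rbrakk>
        \<Longrightarrow> \<phi> s m (restr X (m, \<theta>, n) x) t = \<phi> s n x (simplex_push m \<theta> t)"
  obtains h where "continuous_map (prod_topology (top_of_set J) (realization X)) Z h"
    "\<And>s n x t. \<lbrakk>s \<in> J; x \<in> sections X n; t \<in> standard_simplex n\<rbrakk> \<Longrightarrow> h (s, cls X n x t) = \<phi> s n x t"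
proof -
  let ?J = "top_of_set J"
  define f where "f = (\<lambda>(s, p). case p of ((n, x), t) \<Rightarrow> \<phi> s n x t)"
  have q: "quotient_map (prod_topology ?J (simplices_space X)) (prod_topology ?J (realization X))
      (\<lambda>(s, p). (s, realization_rel X `` {p}))"
    by (rule quotient_map_prod_right)
      (use J quotient_map_realization in \<open>auto simp: compact_imp_locally_compact_space compact_space_subtopology Hausdorff_space_subtopology\<close>)
  have f: "continuous_map (prod_topology ?J (simplices_space X)) Z f"
    unfolding simplices_space_def
    by (rule continuous_map_prod_sum_topology) (use cont in \<open>auto simp: f_def\<close>)
  have const: "f (s, p) = f (s, p')" if "(p, p') \<in> realization_rel X" "s \<in> J" for s p p'
  proof -
    have g: "f (s, a) = f (s, b)" if "(a, b) \<in> realization_glue X" for a b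
      using that nat \<open>s \<in> J\<close> by (auto simp: realization_glue_def f_def)
    have "(p, p') \<in> (realization_glue X \<union> (realization_glue X)\<inverse>)\<^sup>*"
      using that by (simp add: realization_rel_def)
    then show ?thesis
      by (induction rule: rtrancl_induct) (auto dest: g)
  qed
  obtain h where h: "continuous_map (prod_topology ?J (realization X)) Z h"
    "\<And>x. x \<in> topspace (prod_topology ?J (simplices_space X)) \<Longrightarrow> h ((\<lambda>(s, p). (s, realization_rel X `` {p})) x) = f x"
  proof (rule quotient_map_lift_exists[OF q f])
    fix x y assume x: "x \<in> topspace (prod_topology ?J (simplices_space X))" and y: "y \<in> topspace (prod_topology ?J (simplices_space X))"
      and eq: "(\<lambda>(s, p). (s, realization_rel X `` {p})) x = (\<lambda>(s, p). (s, realization_rel X `` {p})) y"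
    obtain s p p' where xy: "x = (s, p)" "y = (s, p')" "realization_rel X `` {p} = realization_rel X `` {p'}"
      using eq by (cases x; cases y) auto
    have "(p, p') \<in> realization_rel X"
      using x y xy eq_equiv_class[OF xy(3) equiv_realization_rel] by simp
    then show "f x = f y" using const x xy by simp
  qed (rule that)
  show ?thesis
  proof (rule that[OF h(1)])
    show "h (s, cls X n x t) = \<phi> s n x t" if "s \<in> J" "x \<in> sections X n" "t \<in> standard_simplex n" for s n x t
      using h(2)[of "(s, ((n, x), t))"] that by (simp add: topspace_simplices_space cls_def f_def)
  qed
qed

lemma realization_lift:
  assumes cont: "\<And>n x. x \<in> sections X n \<Longrightarrow> continuous_map (std n) Z (\<phi> n x)"
    and nat: "\<And>m \<theta> n x t. \<lbrakk>(m, \<theta>, n) \<in> Arr simplex_category; x \<in> sections X n; t \<in> standard_simplex m\<rbrakk>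
        \<Longrightarrow> \<phi> m (restr X (m, \<theta>, n) x) t = \<phi> n x (simplex_push m \<theta> t)"
  obtains h where "continuous_map (realization X) Z h"
    "\<And>n x t. \<lbrakk>x \<in> sections X n; t \<in> standard_simplex n\<rbrakk> \<Longrightarrow> h (cls X n x t) = \<phi> n x t"
proof -
  obtain h where h: "continuous_map (prod_topology (top_of_set {0::real}) (realization X)) Z h"
    "\<And>s n x t. \<lbrakk>s \<in> {0}; x \<in> sections X n; t \<in> standard_simplex n\<rbrakk> \<Longrightarrow> h (s, cls X n x t) = (\<lambda>_::real. \<phi>) s n x t"
  proof (rule realization_lift_product[where J = "{0}" and \<phi> = "\<lambda>_. \<phi>"])
    show "continuous_map (prod_topology (top_of_set {0}) (std n)) Z (\<lambda>(s, t). \<phi> n x t)" if "x \<in> sections X n" for n x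
      using continuous_map_compose[OF continuous_map_snd cont[OF that]] by (simp add: o_def case_prod_unfold)
  qed (simp, rule nat, assumption+, rule that)
  have "continuous_map (realization X) (prod_topology (top_of_set {0::real}) (realization X)) (\<lambda>c. (0, c))"
    by (simp add: continuous_map_pairwise o_def)
  from continuous_map_compose[OF this h(1)] have "continuous_map (realization X) Z (\<lambda>c. h (0, c))"
    by (simp add: o_def)
  then show ?thesis by (rule that) (use h(2) in simp)
qed

text \<open>A simplicial map sends generating pairs of the relation to generating pairs, hence
  zigzags to zigzags.\<close>

lemma sset_map_glue_closed:
  assumes f: "sset_map X Y f" and r: "(p, q) \<in> realization_rel X"
  shows "((\<lambda>((n, x), t). ((n, f n x), t)) p, (\<lambda>((n, x), t). ((n, f n x), t)) q) \<in> realization_rel Y"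
proof -
  let ?F = "\<lambda>((n, x), t). ((n, f n x), t)"
  let ?G = "realization_glue X \<union> (realization_glue X)\<inverse>" and ?H = "realization_glue Y \<union> (realization_glue Y)\<inverse>"
  have s: "f n x \<in> sections Y n" if "x \<in> sections X n" for n x using f that by (auto simp: sset_map_def)
  have g: "(?F a, ?F b) \<in> realization_glue Y" if ab: "(a, b) \<in> realization_glue X" for a b
  proof -
    obtain m \<theta> n x t where *: "(m, \<theta>, n) \<in> Arr simplex_category" "x \<in> sections X n" "t \<in> standard_simplex m"
      "a = ((m, restr X (m, \<theta>, n) x), t)" "b = ((n, x), simplex_push m \<theta> t)"
      using ab unfolding realization_glue_def by blast
    have "f m (restr X (m, \<theta>, n) x) = restr Y (m, \<theta>, n) (f n x)" using f * by (auto simp: sset_map_def)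
    then show ?thesis unfolding realization_glue_def using * s[OF *(2)] by fastforce
  qed
  have "(p, q) \<in> ?G\<^sup>*" using r by (simp add: realization_rel_def)
  then have "(?F p, ?F q) \<in> ?H\<^sup>*"
  proof (induction rule: rtrancl_induct)
    case (step y z)
    have "(?F y, ?F z) \<in> ?H" using step.hyps(2) g by blast
    with step.IH show ?case by (rule rtrancl_into_rtrancl)
  qed simp
  moreover have "?F p \<in> topspace (simplices_space Y)" "?F q \<in> topspace (simplices_space Y)"
    using r s by (auto simp: realization_rel_def topspace_simplices_space)
  ultimately show ?thesis by (simp add: realization_rel_def)
qed

lemma realization_map_cls:
  assumes f: "sset_map X Y f" and x: "x \<in> sections X n" and t: "t \<in> standard_simplex n"
  shows "realization_map Y f (cls X n x t) = cls Y n (f n x) t"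
proof -
  have "realization_rel Y `` {(\<lambda>((n, x), t). ((n, f n x), t)) q} = cls Y n (f n x) t"
    if "(((n, x), t), q) \<in> realization_rel X" for q
    using equiv_class_eq[OF equiv_realization_rel sset_map_glue_closed[OF f that]] by (simp add: cls_def)
  moreover have "(((n, x), t), ((n, x), t)) \<in> realization_rel X"
    using x t by (simp add: realization_rel_def topspace_simplices_space)
  ultimately show ?thesis unfolding realization_map_def cls_def by blast
qed

lemma continuous_map_realization_map:
  assumes X: "presheaf simplex_category X" and Y: "presheaf simplex_category Y" and f: "sset_map X Y f"
  shows "continuous_map (realization X) (realization Y) (realization_map Y f)"
proof -
  have s: "f n x \<in> sections Y n" if "x \<in> sections X n" for n x using f that by (auto simp: sset_map_def)
  obtain h where h: "continuous_map (realization X) (realization Y) h"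
    "\<And>n x t. \<lbrakk>x \<in> sections X n; t \<in> standard_simplex n\<rbrakk> \<Longrightarrow> h (cls X n x t) = cls Y n (f n x) t"
  proof (rule realization_lift[where \<phi> = "\<lambda>n x. cls Y n (f n x)" and X = X and Z = "realization Y"])
    show "cls Y m (f m (restr X (m, \<theta>, n) x)) t = cls Y n (f n x) (simplex_push m \<theta> t)"
      if "(m, \<theta>, n) \<in> Arr simplex_category" "x \<in> sections X n" "t \<in> standard_simplex m" for m \<theta> n x t
      using cls_glue[OF Y that(1) s[OF that(2)] that(3)] f that by (simp add: sset_map_def)
  qed (rule continuous_map_cls, erule s, rule that)
  show ?thesis
    by (rule continuous_map_eq[OF h(1)])
      (auto simp: topspace_realization_cls h(2) realization_map_cls[OF f])
qed

section \<open>Simplices of the nerve as chains of arrows\<close>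

lemma simplex_arrD:
  assumes "(m, \<theta>, n) \<in> Arr simplex_category"
  shows "i \<le> m \<Longrightarrow> \<theta> i \<le> n" "i \<le> j \<Longrightarrow> j \<le> m \<Longrightarrow> \<theta> i \<le> \<theta> j"
  using assms by (auto simp: simplex_category_def mono_on_def)

lemma simplex_arrI:
  assumes "\<And>i. i \<le> m \<Longrightarrow> \<theta> i \<le> n" "\<And>i j. i \<le> j \<Longrightarrow> j \<le> m \<Longrightarrow> \<theta> i \<le> \<theta> j"
  shows "(m, restrict \<theta> {..m}, n) \<in> Arr simplex_category"
  using assms by (auto simp: simplex_category_def mono_on_def)

lemma simplex_push_restrict: "simplex_push m (restrict \<theta> {..m}) t = simplex_push m \<theta> t"
  unfolding simplex_push_def by (rule ext, rule sum.cong) auto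

lemma sections_nerve [simp]: "sections (nerve C) n = functors (ordinal n) C"
  by (simp add: nerve_def)

lemma simplexD:
  assumes "x \<in> functors (ordinal n) C"
  shows "i \<le> n \<Longrightarrow> omap x i \<in> Obj C"
    and "i \<le> j \<Longrightarrow> j \<le> n \<Longrightarrow> amap x (i, j) \<in> Arr C"
    and "i \<le> j \<Longrightarrow> j \<le> n \<Longrightarrow> Dom C (amap x (i, j)) = omap x i"
    and "i \<le> j \<Longrightarrow> j \<le> n \<Longrightarrow> Cod C (amap x (i, j)) = omap x j"
    and "i \<le> n \<Longrightarrow> amap x (i, i) = Ident C (omap x i)"
    and "i \<le> j \<Longrightarrow> j \<le> k \<Longrightarrow> k \<le> n \<Longrightarrow> amap x (i, k) = Comp C (amap x (j, k)) (amap x (i, j))"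
proof -
  have F: "is_functor (ordinal n) C x" using assms by (simp add: functors_def)
  have A: "f \<in> Arr (ordinal n) \<Longrightarrow> amap x f \<in> Arr C \<and> Dom C (amap x f) = omap x (Dom (ordinal n) f)
    \<and> Cod C (amap x f) = omap x (Cod (ordinal n) f)" for f
    using F unfolding is_functor_def by blast
  have K: "f \<in> Arr (ordinal n) \<Longrightarrow> g \<in> Arr (ordinal n) \<Longrightarrow> Dom (ordinal n) g = Cod (ordinal n) f \<Longrightarrow>
      amap x (Comp (ordinal n) g f) = Comp C (amap x g) (amap x f)" for f g
    using F unfolding is_functor_def by blast
  show "i \<le> n \<Longrightarrow> omap x i \<in> Obj C" "i \<le> n \<Longrightarrow> amap x (i, i) = Ident C (omap x i)"
    using F by (auto simp: is_functor_def ordinal_def)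
  show "i \<le> j \<Longrightarrow> j \<le> n \<Longrightarrow> amap x (i, j) \<in> Arr C" "i \<le> j \<Longrightarrow> j \<le> n \<Longrightarrow> Dom C (amap x (i, j)) = omap x i"
    "i \<le> j \<Longrightarrow> j \<le> n \<Longrightarrow> Cod C (amap x (i, j)) = omap x j"
    using A[of "(i, j)"] by (auto simp: ordinal_def)
  show "i \<le> j \<Longrightarrow> j \<le> k \<Longrightarrow> k \<le> n \<Longrightarrow> amap x (i, k) = Comp C (amap x (j, k)) (amap x (i, j))"
    using K[of "(i, j)" "(j, k)"] by (simp add: ordinal_def)
qed

text \<open>Elements of \<open>functors\<close> are \<open>undefined\<close> outside their source.
  Restricting both maps builds this normalisation in, so that chains given by formulas are literally
  simplices of the nerve.\<close>

definition mk_simplex :: "nat \<Rightarrow> (nat \<Rightarrow> 'o) \<Rightarrow> (nat \<Rightarrow> nat \<Rightarrow> 'm) \<Rightarrow> (nat, nat \<times> nat, 'o, 'm) fnctr" where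
  "mk_simplex n f g = \<lparr>omap = restrict f {..n}, amap = restrict (\<lambda>(i, j). g i j) {(i, j). i \<le> j \<and> j \<le> n}\<rparr>"

lemma omap_mk_simplex [simp]: "i \<le> n \<Longrightarrow> omap (mk_simplex n f g) i = f i"
  by (simp add: mk_simplex_def)

lemma amap_mk_simplex [simp]: "i \<le> j \<Longrightarrow> j \<le> n \<Longrightarrow> amap (mk_simplex n f g) (i, j) = g i j"
  by (simp add: mk_simplex_def)

lemma mk_simplexI:
  assumes "\<And>i. i \<le> n \<Longrightarrow> f i \<in> Obj C"
    and "\<And>i j. i \<le> j \<Longrightarrow> j \<le> n \<Longrightarrow> g i j \<in> Arr C \<and> Dom C (g i j) = f i \<and> Cod C (g i j) = f j"
    and "\<And>i. i \<le> n \<Longrightarrow> g i i = Ident C (f i)"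
    and "\<And>i j k. i \<le> j \<Longrightarrow> j \<le> k \<Longrightarrow> k \<le> n \<Longrightarrow> g i k = Comp C (g j k) (g i j)"
  shows "mk_simplex n f g \<in> functors (ordinal n) C"
  unfolding functors_def is_functor_def mem_Collect_eq
proof (intro conjI ballI impI)
  fix a assume "a \<in> Obj (ordinal n)"
  then have "a \<le> n" by (simp add: ordinal_def)
  then show "omap (mk_simplex n f g) a \<in> Obj C"
    "amap (mk_simplex n f g) (Ident (ordinal n) a) = Ident C (omap (mk_simplex n f g) a)"
    using assms(1,3) by (simp_all add: ordinal_def)
next
  fix p assume "p \<in> Arr (ordinal n)"
  then obtain i j where p: "p = (i, j)" "i \<le> j" "j \<le> n" by (auto simp: ordinal_def)
  then show "amap (mk_simplex n f g) p \<in> Arr C" "Dom C (amap (mk_simplex n f g) p) = omap (mk_simplex n f g) (Dom (ordinal n) p)"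
    "Cod C (amap (mk_simplex n f g) p) = omap (mk_simplex n f g) (Cod (ordinal n) p)"
    using assms(2)[OF p(2,3)] by (simp_all add: ordinal_def)
  fix q assume "q \<in> Arr (ordinal n)" "Dom (ordinal n) q = Cod (ordinal n) p"
  then obtain k where q: "q = (j, k)" "j \<le> k" "k \<le> n" using p by (auto simp: ordinal_def)
  then show "amap (mk_simplex n f g) (Comp (ordinal n) q p) = Comp C (amap (mk_simplex n f g) q) (amap (mk_simplex n f g) p)"
    using p assms(4)[OF p(2) q(2,3)] by (simp add: ordinal_def)
qed (auto simp: mk_simplex_def ordinal_def)

lemma mk_simplex_cong:
  assumes "\<And>i. i \<le> n \<Longrightarrow> f i = f' i" "\<And>i j. i \<le> j \<Longrightarrow> j \<le> n \<Longrightarrow> g i j = g' i j"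
  shows "mk_simplex n f g = mk_simplex n f' g'"
  using assms by (auto simp: mk_simplex_def fun_eq_iff restrict_def)

lemma simplex_eqI:
  assumes "x \<in> functors (ordinal n) C" "y \<in> functors (ordinal n) C"
    and o: "\<And>i. i \<le> n \<Longrightarrow> omap x i = omap y i"
    and a: "\<And>i j. i \<le> j \<Longrightarrow> j \<le> n \<Longrightarrow> amap x (i, j) = amap y (i, j)"
  shows "x = y"
proof -
  have "omap x = omap y"
    by (rule extensionalityI[of _ "{..n}"]) (use assms o in \<open>auto simp: functors_def ordinal_def\<close>)
  moreover have "amap x = amap y"
    by (rule extensionalityI[of _ "{(i, j). i \<le> j \<and> j \<le> n}"]) (use assms a in \<open>auto simp: functors_def ordinal_def\<close>)
  ultimately show ?thesis by simp
qed

lemma mk_simplex_eta: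
  assumes "x \<in> functors (ordinal n) C"
  shows "mk_simplex n (omap x) (\<lambda>i j. amap x (i, j)) = x"
  using assms extensional_restrict[of "omap x" "{..n}"]
    extensional_restrict[of "amap x" "{(i, j). i \<le> j \<and> j \<le> n}"]
  by (simp add: functors_def ordinal_def mk_simplex_def case_prod_unfold)

lemma restr_nerve:
  assumes "(m, \<theta>, n) \<in> Arr simplex_category"
  shows "restr (nerve C) (m, \<theta>, n) x = mk_simplex m (\<lambda>i. omap x (\<theta> i)) (\<lambda>i j. amap x (\<theta> i, \<theta> j))"
  by (auto simp: nerve_def functor_comp_def mk_simplex_def ordinal_map_def ordinal_def compose_def restrict_def fun_eq_iff)

lemma restr_nerve_in:
  assumes \<theta>: "(m, \<theta>, n) \<in> Arr simplex_category" and x: "x \<in> functors (ordinal n) C"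
  shows "restr (nerve C) (m, \<theta>, n) x \<in> functors (ordinal m) C"
  unfolding restr_nerve[OF \<theta>]
  by (rule mk_simplexI) (simp_all add: simplexD(1-5)[OF x] simplexD(6)[OF x, symmetric] simplex_arrD[OF \<theta>])

lemma presheaf_nerve: "presheaf simplex_category (nerve C)"
  unfolding presheaf_def
proof (intro conjI ballI impI)
  fix f assume f: "f \<in> Arr simplex_category"
  obtain m \<theta> n where [simp]: "f = (m, \<theta>, n)" by (cases f)
  show "restr (nerve C) f \<in> sections (nerve C) (Cod simplex_category f) \<rightarrow> sections (nerve C) (Dom simplex_category f)"
    using restr_nerve_in[of m \<theta> n] f by (auto simp: simplex_category_def)
next
  fix a x assume "x \<in> sections (nerve C) a"
  then have x: "x \<in> functors (ordinal a) C" by simp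
  have \<theta>: "(a, restrict (\<lambda>i. i) {..a}, a) \<in> Arr simplex_category" by (rule simplex_arrI) auto
  have "restr (nerve C) (a, restrict (\<lambda>i. i) {..a}, a) x = mk_simplex a (omap x) (\<lambda>i j. amap x (i, j))"
    unfolding restr_nerve[OF \<theta>] by (rule mk_simplex_cong) simp_all
  then have "restr (nerve C) (a, restrict (\<lambda>i. i) {..a}, a) x = x" by (simp add: mk_simplex_eta[OF x])
  then show "restr (nerve C) (Ident simplex_category a) x = x" by (simp add: simplex_category_def)
next
  fix f g x assume f: "f \<in> Arr simplex_category" and g: "g \<in> Arr simplex_category"
    and eq: "Dom simplex_category g = Cod simplex_category f" and x: "x \<in> sections (nerve C) (Cod simplex_category g)"
  obtain m \<theta> n where [simp]: "f = (m, \<theta>, n)" by (cases f)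
  obtain \<phi> k where [simp]: "g = (n, \<phi>, k)" using eq by (cases g) (simp add: simplex_category_def)
  have x: "x \<in> functors (ordinal k) C" using x by (simp add: simplex_category_def)
  have \<theta>: "(m, \<theta>, n) \<in> Arr simplex_category" and \<phi>: "(n, \<phi>, k) \<in> Arr simplex_category" using f g by auto
  have "(m, restrict (\<lambda>i. \<phi> (\<theta> i)) {..m}, k) \<in> Arr simplex_category"
    by (rule simplex_arrI) (auto simp: simplex_arrD[OF \<theta>] simplex_arrD[OF \<phi>])
  then have c: "(m, compose {..m} \<phi> \<theta>, k) \<in> Arr simplex_category" by (simp add: compose_def)
  show "restr (nerve C) (Comp simplex_category g f) x = restr (nerve C) f (restr (nerve C) g x)"
    using simplex_arrD[OF \<theta>]
    using restr_nerve[OF c, of C x]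
    by (simp add: simplex_category_def restr_nerve[OF \<theta>] restr_nerve[OF \<phi>] compose_def cong: mk_simplex_cong)
qed

lemma functorD:
  assumes "is_functor C D F"
  shows "a \<in> Obj C \<Longrightarrow> omap F a \<in> Obj D" "f \<in> Arr C \<Longrightarrow> amap F f \<in> Arr D"
    "f \<in> Arr C \<Longrightarrow> Dom D (amap F f) = omap F (Dom C f)" "f \<in> Arr C \<Longrightarrow> Cod D (amap F f) = omap F (Cod C f)"
    "a \<in> Obj C \<Longrightarrow> amap F (Ident C a) = Ident D (omap F a)"
    "f \<in> Arr C \<Longrightarrow> g \<in> Arr C \<Longrightarrow> Dom C g = Cod C f \<Longrightarrow> amap F (Comp C g f) = Comp D (amap F g) (amap F f)"
  using assms by (auto simp: is_functor_def)

lemma nerve_map_eq: "nerve_map u n x = mk_simplex n (\<lambda>i. omap u (omap x i)) (\<lambda>i j. amap u (amap x (i, j)))"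
  by (auto simp: nerve_map_def functor_comp_def mk_simplex_def ordinal_def compose_def restrict_def fun_eq_iff)

lemma nerve_map_in:
  assumes u: "is_functor C D u" and x: "x \<in> functors (ordinal n) C"
  shows "nerve_map u n x \<in> functors (ordinal n) D"
  unfolding nerve_map_eq
  by (rule mk_simplexI) (simp_all add: simplexD(1-5)[OF x] functorD(1-5)[OF u] functorD(6)[OF u, symmetric] simplexD(6)[OF x, symmetric])

lemma sset_map_nerve_map:
  assumes u: "is_functor C D u" shows "sset_map (nerve C) (nerve D) (nerve_map u)"
  unfolding sset_map_def
proof (intro conjI allI impI ballI)
  show "nerve_map u n \<in> sections (nerve C) n \<rightarrow> sections (nerve D) n" for n
    using nerve_map_in[OF u] by auto
  fix m \<theta> n x assume \<theta>: "(m, \<theta>, n) \<in> Arr simplex_category" and "x \<in> sections (nerve C) n"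
  then have x: "x \<in> functors (ordinal n) C" by simp
  show "nerve_map u m (restr (nerve C) (m, \<theta>, n) x) = restr (nerve D) (m, \<theta>, n) (nerve_map u n x)"
    using simplex_arrD[OF \<theta>]
    by (simp add: restr_nerve[OF \<theta>] nerve_map_eq cong: mk_simplex_cong)
qed

section \<open>Classifying spaces of categories and functors\<close>

abbreviation "BC C \<equiv> realization (nerve C)"
abbreviation "Bcls C \<equiv> cls (nerve C)"
abbreviation "Bmap D u \<equiv> realization_map (nerve D) (nerve_map u)"

lemma Bmap_cls:
  "is_functor C D u \<Longrightarrow> x \<in> functors (ordinal n) C \<Longrightarrow> t \<in> standard_simplex n \<Longrightarrow>
    Bmap D u (Bcls C n x t) = Bcls D n (nerve_map u n x) t"
  by (rule realization_map_cls[OF sset_map_nerve_map]) auto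

lemma continuous_map_Bmap: "is_functor C D u \<Longrightarrow> continuous_map (BC C) (BC D) (Bmap D u)"
  by (intro continuous_map_realization_map presheaf_nerve sset_map_nerve_map)

lemma BC_cases:
  assumes "p \<in> topspace (BC C)"
  obtains n x t where "x \<in> functors (ordinal n) C" "t \<in> standard_simplex n" "p = Bcls C n x t"
  using assms by (auto simp: topspace_realization_cls)

lemma Bcls_in: "x \<in> functors (ordinal n) C \<Longrightarrow> t \<in> standard_simplex n \<Longrightarrow> Bcls C n x t \<in> topspace (BC C)"
  by (intro cls_in_realization) auto

lemma Bcls_glue:
  "(m, \<theta>, n) \<in> Arr simplex_category \<Longrightarrow> x \<in> functors (ordinal n) C \<Longrightarrow> t \<in> standard_simplex m \<Longrightarrow>
    Bcls C m (restr (nerve C) (m, \<theta>, n) x) t = Bcls C n x (simplex_push m \<theta> t)"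
  by (rule cls_glue[OF presheaf_nerve]) auto

text \<open>The composite is represented by any functor \<open>w\<close> with the right values on
  \<open>C\<close>, so that composites given by formulas can be inserted without normalising
  them.\<close>

lemma Bmap_compose:
  assumes u: "is_functor C D u" and v: "is_functor D E v" and w: "is_functor C E w"
    and o: "\<And>a. a \<in> Obj C \<Longrightarrow> omap w a = omap v (omap u a)"
    and a: "\<And>f. f \<in> Arr C \<Longrightarrow> amap w f = amap v (amap u f)"
    and p: "p \<in> topspace (BC C)"
  shows "Bmap E v (Bmap D u p) = Bmap E w p"
proof -
  obtain n x t where x: "x \<in> functors (ordinal n) C" "t \<in> standard_simplex n" "p = Bcls C n x t"
    by (rule BC_cases[OF p])
  have "nerve_map v n (nerve_map u n x) = nerve_map w n x"
    by (simp add: nerve_map_eq o a simplexD(1,2)[OF x(1)] cong: mk_simplex_cong)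
  then show ?thesis
    by (simp add: x(3) Bmap_cls[OF u x(1,2)] Bmap_cls[OF v nerve_map_in[OF u x(1)] x(2)] Bmap_cls[OF w x(1,2)])
qed

lemma Bmap_id:
  assumes u: "is_functor C C u" and o: "\<And>a. a \<in> Obj C \<Longrightarrow> omap u a = a"
    and a: "\<And>f. f \<in> Arr C \<Longrightarrow> amap u f = f" and p: "p \<in> topspace (BC C)"
  shows "Bmap C u p = p"
proof -
  obtain n x t where x: "x \<in> functors (ordinal n) C" "t \<in> standard_simplex n" "p = Bcls C n x t"
    by (rule BC_cases[OF p])
  have "nerve_map u n x = mk_simplex n (omap x) (\<lambda>i j. amap x (i, j))"
    by (simp add: nerve_map_eq o a simplexD(1,2)[OF x(1)] cong: mk_simplex_cong)
  then have "nerve_map u n x = x" by (simp add: mk_simplex_eta[OF x(1)])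
  then show ?thesis by (simp add: x(3) Bmap_cls[OF u x(1,2)])
qed

definition terminal :: "('o, 'm) cat \<Rightarrow> 'o \<Rightarrow> bool" where
  "terminal C e \<longleftrightarrow> e \<in> Obj C \<and> (\<forall>a \<in> Obj C. \<exists>!f. f \<in> Arr C \<and> Dom C f = a \<and> Cod C f = e)"

text \<open>The cone on the nerve: the last vertex of every simplex is joined to the terminal object.\<close>

lemma contractible_terminal:
  fixes C :: "('o, 'm) cat"
  assumes C: "category C" and e: "terminal C e"
  shows "contractible_space (BC C)"
proof -
  interpret category C by (rule C)
  have eO: "e \<in> Obj C" using e by (simp add: terminal_def)
  obtain \<tau> where \<tau>: "\<And>a. a \<in> Obj C \<Longrightarrow> \<tau> a \<in> Arr C \<and> Dom C (\<tau> a) = a \<and> Cod C (\<tau> a) = e"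
    using e unfolding terminal_def by metis
  have uniq: "f = \<tau> (Dom C f)" if "f \<in> Arr C" "Cod C f = e" for f
    using e \<tau>[of "Dom C f"] that dom_cod[OF that(1)] unfolding terminal_def by metis
  have \<tau>e: "\<tau> e = Ident C e" using uniq[of "Ident C e"] id_arr[OF eO] by simp
  define cone :: "nat \<Rightarrow> (nat, nat \<times> nat, 'o, 'm) fnctr \<Rightarrow> (nat, nat \<times> nat, 'o, 'm) fnctr" where "cone n x = mk_simplex (Suc n) (\<lambda>i. if i \<le> n then omap x i else e)
    (\<lambda>i j. if j \<le> n then amap x (i, j) else if i \<le> n then \<tau> (omap x i) else Ident C e)" for n x
  have cone: "cone n x \<in> functors (ordinal (Suc n)) C" if x: "x \<in> functors (ordinal n) C" for n x
    unfolding cone_def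
  proof (rule mk_simplexI)
    fix i j k :: nat assume ijk: "i \<le> j" "j \<le> k" "k \<le> Suc n"
    note X = simplexD[OF x]
    have "\<tau> (omap x i) = Comp C (\<tau> (omap x j)) (amap x (i, j))" if "j \<le> n"
      using uniq[of "Comp C (\<tau> (omap x j)) (amap x (i, j))"] comp_arr[of "amap x (i, j)" "\<tau> (omap x j)"]
        X(1)[of j] X(2,3,4)[of i j] \<tau>[of "omap x j"] ijk that by simp
    moreover have "\<tau> (omap x i) = Comp C (Ident C e) (\<tau> (omap x i))" if "i \<le> n"
      using comp_id_left[of "\<tau> (omap x i)"] \<tau>[of "omap x i"] X(1)[OF that] by simp
    moreover have "Ident C e = Comp C (Ident C e) (Ident C e)"
      using comp_id_left[of "Ident C e"] id_arr[OF eO] by simp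
    ultimately show "(if k \<le> n then amap x (i, k) else if i \<le> n then \<tau> (omap x i) else Ident C e) =
      Comp C (if k \<le> n then amap x (j, k) else if j \<le> n then \<tau> (omap x j) else Ident C e)
        (if j \<le> n then amap x (i, j) else if i \<le> n then \<tau> (omap x i) else Ident C e)"
      using ijk X(6)[of i j k] by auto
  qed (auto simp: simplexD(1-5)[OF x] \<tau> eO id_arr[OF eO])
  \<comment> \<open>Barycentric coordinates of the point that has moved the fraction
    \<open>s\<close> of the way to the cone vertex \<open>Suc n\<close>.\<close>
  define pt where "pt s n t = (\<lambda>i. if i \<le> n then (1 - s) * t i else if i = Suc n then s else (0::real))" for s n t
  have pt: "pt s n t \<in> standard_simplex (Suc n)" if "s \<in> {0..1}" "t \<in> standard_simplex n" for s n t
  proof -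
    have t: "\<And>i. 0 \<le> t i" "\<And>i. t i \<le> 1" "(\<Sum>i\<le>n. t i) = 1" using that(2) by (auto simp: standard_simplex_def)
    have "(\<Sum>i\<le>Suc n. pt s n t i) = (\<Sum>i\<le>n. (1 - s) * t i) + s" by (simp add: pt_def)
    also have "\<dots> = 1" using t(3) by (simp flip: sum_distrib_left)
    finally show ?thesis using that(1) t(1,2) by (auto simp: standard_simplex_def pt_def intro: mult_le_one)
  qed
  obtain h where h: "continuous_map (prod_topology (top_of_set {0..1}) (BC C)) (BC C) h"
    "\<And>s n x t. \<lbrakk>s \<in> {0..1}; x \<in> sections (nerve C) n; t \<in> standard_simplex n\<rbrakk> \<Longrightarrow>
        h (s, Bcls C n x t) = Bcls C (Suc n) (cone n x) (pt s n t)"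
  proof (rule realization_lift_product[where J = "{0..1}" and X = "nerve C" and Z = "BC C" and
        \<phi> = "\<lambda>s n x t. Bcls C (Suc n) (cone n x) (pt s n t)"])
    fix n and x :: "(nat, nat \<times> nat, 'o, 'm) fnctr" assume x: "x \<in> sections (nerve C) n"
    have "continuous_map (prod_topology (top_of_set {0..1}) (std n)) (std (Suc n)) (\<lambda>q. pt (fst q) n (snd q))"
      unfolding continuous_map_std
    proof (intro conjI allI ballI)
      have s: "continuous_map (prod_topology (top_of_set {0..1}) (std n)) euclideanreal fst"
        using continuous_map_compose[OF continuous_map_fst continuous_map_from_subtopology[OF continuous_map_id]]
        by (simp add: o_def id_def)
      have t: "continuous_map (prod_topology (top_of_set {0..1::real}) (std n)) euclideanreal (\<lambda>q. snd q i)" for i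
        using continuous_map_compose[OF continuous_map_snd continuous_map_std_coord] by (simp add: o_def)
      fix i
      consider "i \<le> n" | "i = Suc n" | "i > Suc n" by linarith
      then show "continuous_map (prod_topology (top_of_set {0..1}) (std n)) euclideanreal (\<lambda>q. pt (fst q) n (snd q) i)"
        by cases (auto simp: pt_def intro!: continuous_map_real_mult continuous_map_diff s t)
    qed (use pt in \<open>auto simp: topspace_standard_simplex\<close>)
    from continuous_map_compose[OF this continuous_map_cls, of "cone n x"] cone x
    show "continuous_map (prod_topology (top_of_set {0..1}) (std n)) (BC C) (\<lambda>(s, t). Bcls C (Suc n) (cone n x) (pt s n t))"
      by (simp add: o_def case_prod_unfold)
  next
    fix m \<theta> n and x :: "(nat, nat \<times> nat, 'o, 'm) fnctr" and s :: real and t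
    assume \<theta>: "(m, \<theta>, n) \<in> Arr simplex_category" and "x \<in> sections (nerve C) n" and t: "t \<in> standard_simplex m" and s: "s \<in> {0..1}"
    then have x: "x \<in> functors (ordinal n) C" by simp
    \<comment> \<open>\<open>\<theta>\<close> extended by sending cone vertex to cone vertex; it
      expresses that coning commutes with the simplicial operators.\<close>
    define \<theta>' where "\<theta>' i = (if i \<le> m then \<theta> i else Suc n)" for i
    have \<theta>': "(Suc m, restrict \<theta>' {..Suc m}, Suc n) \<in> Arr simplex_category"
      by (rule simplex_arrI) (use simplex_arrD[OF \<theta>] in \<open>auto simp: \<theta>'_def le_Suc_eq\<close>)
    have "cone m (restr (nerve C) (m, \<theta>, n) x) = restr (nerve C) (Suc m, restrict \<theta>' {..Suc m}, Suc n) (cone n x)"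
    proof (rule simplex_eqI[OF cone[OF restr_nerve_in[OF \<theta> x]] restr_nerve_in[OF \<theta>' cone[OF x]]])
      note A = simplex_arrD[OF \<theta>]
      have A': "\<And>i. i \<le> m \<Longrightarrow> \<theta> i \<le> Suc n" using A(1) by (simp add: le_SucI)
      show "omap (cone m (restr (nerve C) (m, \<theta>, n) x)) i = omap (restr (nerve C) (Suc m, restrict \<theta>' {..Suc m}, Suc n) (cone n x)) i"
        if "i \<le> Suc m" for i
        using that A A' by (auto simp: restr_nerve[OF \<theta>'] restr_nerve[OF \<theta>] cone_def \<theta>'_def)
      show "amap (cone m (restr (nerve C) (m, \<theta>, n) x)) (i, j) = amap (restr (nerve C) (Suc m, restrict \<theta>' {..Suc m}, Suc n) (cone n x)) (i, j)"
        if "i \<le> j" "j \<le> Suc m" for i j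
        using that A A' by (auto simp: restr_nerve[OF \<theta>'] restr_nerve[OF \<theta>] cone_def \<theta>'_def)
    qed
    moreover have "simplex_push (Suc m) \<theta>' (pt s m t) = pt s n (simplex_push m \<theta> t)"
    proof
      fix j
      have "simplex_push (Suc m) \<theta>' (pt s m t) j = (\<Sum>i\<in>{..Suc m}. if \<theta>' i = j then pt s m t i else 0)"
        unfolding simplex_push_def by (subst sum.inter_filter[symmetric]) (auto intro!: sum.cong)
      also have "\<dots> = (\<Sum>i\<in>{..m}. if \<theta> i = j then (1 - s) * t i else 0) + (if j = Suc n then s else 0)"
        by (auto simp: pt_def \<theta>'_def intro!: sum.cong)
      also have "(\<Sum>i\<in>{..m}. if \<theta> i = j then (1 - s) * t i else 0) = (1 - s) * simplex_push m \<theta> t j"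
        unfolding simplex_push_def sum_distrib_left by (subst sum.inter_filter[symmetric]) (auto intro!: sum.cong)
      also have "(1 - s) * simplex_push m \<theta> t j + (if j = Suc n then s else 0) = pt s n (simplex_push m \<theta> t) j"
        using simplex_push_in[OF \<theta> t] by (auto simp: pt_def standard_simplex_def)
      finally show "simplex_push (Suc m) \<theta>' (pt s m t) j = pt s n (simplex_push m \<theta> t) j" .
    qed
    ultimately show "Bcls C (Suc m) (cone m (restr (nerve C) (m, \<theta>, n) x)) (pt s m t) =
      Bcls C (Suc n) (cone n x) (pt s n (simplex_push m \<theta> t))"
      using Bcls_glue[OF \<theta>' cone[OF x] pt[OF s t]] by (simp add: simplex_push_restrict)
  qed (simp, rule that)
  define v where "v = mk_simplex 0 (\<lambda>_. e) (\<lambda>_ _. Ident C e)"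
  define one where "one = (\<lambda>j::nat. if j = 0 then 1 else (0::real))"
  have v: "v \<in> functors (ordinal 0) C"
    unfolding v_def by (rule mk_simplexI) (use eO id_arr[OF eO] comp_id_left[of "Ident C e"] in auto)
  have one: "one \<in> standard_simplex 0" by (simp add: standard_simplex_0 one_def)
  have h0: "h (0, p) = p" and h1: "h (1, p) = Bcls C 0 v one" if pB: "p \<in> topspace (BC C)" for p
  proof -
    obtain n x t where x: "x \<in> functors (ordinal n) C" and t: "t \<in> standard_simplex n" and p: "p = Bcls C n x t"
      by (rule BC_cases[OF pB])
    have hs: "h (s, p) = Bcls C (Suc n) (cone n x) (pt s n t)" if "s \<in> {0..1}" for s
      using h(2)[of s x n t] x t that p by simp
    \<comment> \<open>At time \<open>0\<close> the point lies in the face opposite to the cone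
      vertex, and this face is \<open>x\<close> itself.\<close>
    have \<theta>: "(n, restrict (\<lambda>i. i) {..n}, Suc n) \<in> Arr simplex_category" by (rule simplex_arrI) auto
    have "restr (nerve C) (n, restrict (\<lambda>i. i) {..n}, Suc n) (cone n x) = x"
      by (rule simplex_eqI[OF restr_nerve_in[OF \<theta> cone[OF x]] x]) (auto simp: restr_nerve[OF \<theta>] cone_def)
    moreover have "simplex_push n (\<lambda>i. i) t = pt 0 n t"
    proof
      fix j
      have "{i. i \<le> n \<and> i = j} = (if j \<le> n then {j} else {})" by auto
      then show "simplex_push n (\<lambda>i. i) t j = pt 0 n t j" by (simp add: simplex_push_def pt_def)
    qed
    ultimately show "h (0, p) = p"
      using Bcls_glue[OF \<theta> cone[OF x] t] hs[of 0] p by (simp add: simplex_push_restrict)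
    \<comment> \<open>At time \<open>1\<close> the point is the cone vertex, whose class is the same
      for all simplices.\<close>
    have \<theta>: "(0, restrict (\<lambda>i. Suc n) {..0}, Suc n) \<in> Arr simplex_category" by (rule simplex_arrI) auto
    have "restr (nerve C) (0, restrict (\<lambda>i. Suc n) {..0}, Suc n) (cone n x) = v"
      unfolding restr_nerve[OF \<theta>] v_def by (rule mk_simplex_cong) (simp_all add: cone_def)
    moreover have "simplex_push 0 (\<lambda>i. Suc n) one = pt 1 n t"
    proof
      fix j
      have "{i::nat. i \<le> 0 \<and> Suc n = j} = (if j = Suc n then {0} else {})" by auto
      then show "simplex_push 0 (\<lambda>i. Suc n) one j = pt 1 n t j" by (simp add: simplex_push_def pt_def one_def)
    qed
    ultimately show "h (1, p) = Bcls C 0 v one"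
      using Bcls_glue[OF \<theta> cone[OF x] one] hs[of 1] unfolding simplex_push_restrict by simp
  qed
  have "homotopic_with (\<lambda>_. True) (BC C) (BC C) id (\<lambda>_. Bcls C 0 v one)"
    using h(1) h0 h1 by (subst homotopic_with) auto
  then show ?thesis unfolding contractible_space_def by blast
qed

section \<open>Normal forms of points of the realization of a nerve\<close>

text \<open>A point \<open>t\<close> of the standard simplex cuts the unit interval into consecutive blocks of lengths
  \<open>t 0, t 1, \<dots>\<close>; \<open>block t u\<close> is the index of the block containing \<open>u\<close>.\<close>

definition block :: "(nat \<Rightarrow> real) \<Rightarrow> real \<Rightarrow> nat" where
  "block t u = (LEAST i. u < sum t {..i})"

lemma standard_simplexD:
  assumes "t \<in> standard_simplex n"
  shows "0 \<le> t i" "i > n \<Longrightarrow> t i = 0" "sum t {..n} = 1" "t i \<le> 1"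
  using assms by (auto simp: standard_simplex_def)

text \<open>Blocks are closed on the left and open on the right; an empty block therefore contains
  no point and is skipped.\<close>

lemma block_eqI:
  assumes t: "\<And>i. 0 \<le> t i" and u: "u < sum t {..i}" "sum t {..<i} \<le> u"
  shows "block t u = i"
  unfolding block_def
proof (rule Least_equality)
  show "u < sum t {..i}" by (rule u(1))
  fix j assume j: "u < sum t {..j}"
  show "i \<le> j"
  proof (rule ccontr)
    assume "\<not> i \<le> j"
    then have "sum t {..j} \<le> sum t {..<i}" using t by (intro sum_mono2) auto
    then show False using j u(2) by simp
  qed
qed

lemma blockD:
  assumes t: "t \<in> standard_simplex n" and u: "0 \<le> u" "u < 1"
  shows "u < sum t {..block t u}" "sum t {..<block t u} \<le> u" "block t u \<le> n"
proof -
  have n: "u < sum t {..n}" using standard_simplexD(3)[OF t] u by simp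
  show "u < sum t {..block t u}" unfolding block_def using n by (rule LeastI)
  show "block t u \<le> n" unfolding block_def using n by (rule Least_le)
  show "sum t {..<block t u} \<le> u"
  proof (cases "block t u")
    case (Suc j)
    then have "\<not> u < sum t {..j}" unfolding block_def by (metis lessI not_less_Least)
    then show ?thesis using Suc by (simp add: lessThan_Suc_atMost)
  qed (use u in simp)
qed

lemma block_mono:
  assumes t: "t \<in> standard_simplex n" and u: "0 \<le> u" "u \<le> v" "v < 1"
  shows "block t u \<le> block t v"
proof -
  have "v < sum t {..block t v}" using blockD(1)[OF t, of v] u by simp
  then show ?thesis unfolding block_def[of t u] using u by (intro Least_le) simp
qed

lemma block_start:
  assumes t: "t \<in> standard_simplex n" and i: "0 < t i"
  shows "block t (sum t {..<i}) = i" "0 \<le> sum t {..<i}" "sum t {..<i} < 1"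
proof -
  note T = standard_simplexD[OF t]
  have s: "sum t {..i} = sum t {..<i} + t i" by (simp add: lessThan_Suc_atMost[symmetric])
  show "block t (sum t {..<i}) = i" by (rule block_eqI) (use T i s in auto)
  show "0 \<le> sum t {..<i}" using T(1) by (simp add: sum_nonneg)
  have "i \<le> n" using i T(2)[of i] by (cases "i \<le> n") auto
  then have "sum t {..i} \<le> sum t {..n}" using T(1) by (intro sum_mono2) auto
  then show "sum t {..<i} < 1" using s i T(3) by simp
qed

lemma sum_simplex_push:
  assumes \<theta>: "(m, \<theta>, n) \<in> Arr simplex_category" and "finite A"
  shows "sum (simplex_push m \<theta> t) A = sum t {i. i \<le> m \<and> \<theta> i \<in> A}"
proof -
  have "(\<Sum>j\<in>A. sum t {i \<in> {i. i \<le> m \<and> \<theta> i \<in> A}. \<theta> i = j}) = sum t {i. i \<le> m \<and> \<theta> i \<in> A}"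
    by (rule sum.group) (use assms in auto)
  moreover have "sum t {i \<in> {i. i \<le> m \<and> \<theta> i \<in> A}. \<theta> i = j} = simplex_push m \<theta> t j" if "j \<in> A" for j
    unfolding simplex_push_def by (rule sum.cong) (use that in auto)
  ultimately show ?thesis by simp
qed

text \<open>A monotone map merges adjacent blocks, adding the lengths of those with a common image,
  and keeps their order; the block that contains \<open>u\<close> is only renamed.\<close>

lemma block_push:
  assumes \<theta>: "(m, \<theta>, n) \<in> Arr simplex_category" and t: "t \<in> standard_simplex m" and u: "0 \<le> u" "u < 1"
  shows "block (simplex_push m \<theta> t) u = \<theta> (block t u)"
proof (rule block_eqI)
  let ?i = "block t u"
  note b = blockD[OF t u] and A = simplex_arrD[OF \<theta>] and T = standard_simplexD[OF t]
  show "0 \<le> simplex_push m \<theta> t i" for i using standard_simplexD(1)[OF simplex_push_in[OF \<theta> t]] .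
  have "sum t {..?i} \<le> sum t {i. i \<le> m \<and> \<theta> i \<in> {..\<theta> ?i}}"
    by (rule sum_mono2) (use T(1) A(2) b(3) in auto)
  then show "u < sum (simplex_push m \<theta> t) {..\<theta> ?i}"
    unfolding sum_simplex_push[OF \<theta> finite_atMost] using b(1) by simp
  have "i < ?i" if "i \<le> m" "\<theta> i < \<theta> ?i" for i
    using A(2)[of ?i i] that by (cases "i < ?i") auto
  then have "sum t {i. i \<le> m \<and> \<theta> i \<in> {..<\<theta> ?i}} \<le> sum t {..<?i}"
    by (intro sum_mono2) (use T(1) in auto)
  then show "sum (simplex_push m \<theta> t) {..<\<theta> ?i} \<le> u"
    unfolding sum_simplex_push[OF \<theta> finite_lessThan] using b(2) by simp
qed

text \<open>The last vertex of the smallest face that contains the point. The value of a compatible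
  family is determined there and then pushed on to the last vertex of the simplex.\<close>

definition top_index :: "nat \<Rightarrow> (nat \<Rightarrow> real) \<Rightarrow> nat" where
  "top_index n t = Max {i. i \<le> n \<and> 0 < t i}"

lemma top_index:
  assumes t: "t \<in> standard_simplex n"
  shows "top_index n t \<le> n" "0 < t (top_index n t)" "i \<le> n \<Longrightarrow> 0 < t i \<Longrightarrow> i \<le> top_index n t"
proof -
  have "{i. i \<le> n \<and> 0 < t i} \<noteq> {}"
  proof
    assume "{i. i \<le> n \<and> 0 < t i} = {}"
    then have "sum t {..n} = 0" using standard_simplexD(1)[OF t] by (intro sum.neutral) (force intro: antisym)
    then show False using standard_simplexD(3)[OF t] by simp
  qed
  then have "top_index n t \<in> {i. i \<le> n \<and> 0 < t i}" unfolding top_index_def by (intro Max_in) auto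
  then show "top_index n t \<le> n" "0 < t (top_index n t)" by auto
  show "i \<le> n \<Longrightarrow> 0 < t i \<Longrightarrow> i \<le> top_index n t" unfolding top_index_def by (intro Max_ge) auto
qed

lemma top_index_push:
  assumes \<theta>: "(m, \<theta>, n) \<in> Arr simplex_category" and t: "t \<in> standard_simplex m"
  shows "top_index n (simplex_push m \<theta> t) = \<theta> (top_index m t)"
  unfolding top_index_def[of n]
proof (rule Max_eqI)
  note A = simplex_arrD[OF \<theta>] and T = standard_simplexD[OF t] and I = top_index[OF t]
  let ?i = "top_index m t"
  have "t ?i \<le> simplex_push m \<theta> t (\<theta> ?i)"
    unfolding simplex_push_def by (rule member_le_sum) (use I(1) T(1) in auto)
  then show "\<theta> ?i \<in> {i. i \<le> n \<and> 0 < simplex_push m \<theta> t i}" using A(1)[OF I(1)] I(2) by simp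
  fix j assume "j \<in> {i. i \<le> n \<and> 0 < simplex_push m \<theta> t i}"
  then have "sum t {i. i \<le> m \<and> \<theta> i = j} \<noteq> 0" by (simp add: simplex_push_def)
  then obtain i where i: "i \<le> m" "\<theta> i = j" "t i \<noteq> 0" by (rule sum.not_neutral_contains_not_neutral) (rule that, auto)
  then have "i \<le> ?i" using I(3)[of i] T(1)[of i] by (simp add: less_le)
  then show "j \<le> \<theta> ?i" using A(2)[of i ?i] I(1) i(2) by simp
qed simp

text \<open>The functor from the unit interval, as a poset, that a point of a simplex of the nerve
  represents. It only depends on the point of the realization.\<close>

definition step :: "(nat, nat \<times> nat, 'o, 'm) fnctr \<Rightarrow> (nat \<Rightarrow> real) \<Rightarrow> real \<times> real \<Rightarrow> 'm" where
  "step x t = restrict (\<lambda>(u, v). amap x (block t u, block t v)) {(u, v). 0 \<le> u \<and> u \<le> v \<and> v < 1}"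

lemma step_apply: "0 \<le> u \<Longrightarrow> u \<le> v \<Longrightarrow> v < 1 \<Longrightarrow> step x t (u, v) = amap x (block t u, block t v)"
  by (simp add: step_def)

text \<open>Since such pairs generate the gluing relation, \<open>step\<close> is an invariant of
  points of the realization.\<close>

lemma step_restr:
  assumes \<theta>: "(m, \<theta>, n) \<in> Arr simplex_category" and t: "t \<in> standard_simplex m"
  shows "step (restr (nerve C) (m, \<theta>, n) x) t = step x (simplex_push m \<theta> t)"
proof
  fix p :: "real \<times> real"
  obtain u v where p: "p = (u, v)" by fastforce
  show "step (restr (nerve C) (m, \<theta>, n) x) t p = step x (simplex_push m \<theta> t) p"
  proof (cases "0 \<le> u \<and> u \<le> v \<and> v < 1")
    case True
    then show ?thesis
      using blockD(3)[OF t, of v] block_mono[OF t, of u v] block_push[OF \<theta> t]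
      by (simp add: p step_apply restr_nerve[OF \<theta>])
  qed (auto simp: step_def p)
qed

section \<open>Nondegenerate simplices and uniqueness of the normal form\<close>

definition nondegenerate :: "('o, 'm) cat \<Rightarrow> nat \<Rightarrow> (nat, nat \<times> nat, 'o, 'm) fnctr \<Rightarrow> bool" where
  "nondegenerate C n x \<longleftrightarrow> (\<forall>i<n. amap x (i, Suc i) \<noteq> Ident C (omap x i))"

definition normal :: "('o, 'm) cat \<Rightarrow> nat \<Rightarrow> (nat, nat \<times> nat, 'o, 'm) fnctr \<Rightarrow> (nat \<Rightarrow> real) \<Rightarrow> bool" where
  "normal C n x t \<longleftrightarrow> x \<in> functors (ordinal n) C \<and> nondegenerate C n x \<and> t \<in> standard_simplex n \<and> (\<forall>i\<le>n. 0 < t i)"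

text \<open>Positive weights mean that no block is empty, so the number of blocks met up to
  \<open>u\<close> determines the index of the block of \<open>u\<close>.\<close>

lemma block_surj:
  assumes t: "t \<in> standard_simplex n" and pos: "\<forall>i\<le>n. 0 < t i" and u: "0 \<le> u" "u < 1"
  shows "block t ` {0..u} = {..block t u}"
proof (intro equalityI subsetI)
  fix i assume "i \<in> block t ` {0..u}"
  then show "i \<in> {..block t u}" using block_mono[OF t, of _ u] u by auto
next
  fix i assume "i \<in> {..block t u}"
  then have i: "i \<le> block t u" by simp
  note b = blockD[OF t u]
  have "sum t {..<i} \<le> sum t {..<block t u}" using i standard_simplexD(1)[OF t] by (intro sum_mono2) auto
  then have "sum t {..<i} \<le> u" using b(2) by simp
  moreover have "0 < t i" using pos i b(3) by simp
  ultimately show "i \<in> block t ` {0..u}"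
    using block_start[OF t, of i] by (metis atLeastAtMost_iff image_eqI)
qed

lemma card_image_eqI:
  assumes "\<And>x y. x \<in> S \<Longrightarrow> y \<in> S \<Longrightarrow> f x = f y \<longleftrightarrow> g x = g y"
  shows "card (f ` S) = card (g ` S)"
proof (rule bij_betw_same_card)
  have h: "g (inv_into S f (f x)) = g x" if "x \<in> S" for x
    using assms[of "inv_into S f (f x)" x] that by (simp add: f_inv_into_f inv_into_into)
  show "bij_betw (\<lambda>y. g (inv_into S f y)) (f ` S) (g ` S)"
    unfolding bij_betw_def
  proof
    show "inj_on (\<lambda>y. g (inv_into S f y)) (f ` S)"
      by (rule inj_onI) (use h assms in \<open>auto\<close>)
    show "(\<lambda>y. g (inv_into S f y)) ` f ` S = g ` S" using h by force
  qed
qed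

text \<open>Consecutive vertices of a nondegenerate simplex are joined by arrows that are not
  identities, so leaving a block shows in \<open>step\<close>. All \<open>w\<close> between
  \<open>u\<close> and \<open>v\<close> are tested, as a composite of several such arrows may well
  be an identity.\<close>

lemma block_eq_iff:
  assumes x: "normal C n x t" and u: "0 \<le> u" "u \<le> v" "v < 1"
  shows "block t u = block t v \<longleftrightarrow> (\<forall>w\<in>{u..v}. step x t (u, w) = Ident C (Dom C (step x t (u, w))))"
proof -
  have xs: "x \<in> functors (ordinal n) C" and t: "t \<in> standard_simplex n" and pos: "\<And>i. i \<le> n \<Longrightarrow> 0 < t i"
    and nd: "\<And>i. i < n \<Longrightarrow> amap x (i, Suc i) \<noteq> Ident C (omap x i)"
    using x by (auto simp: normal_def nondegenerate_def)
  have vn: "block t v \<le> n" using blockD(3)[OF t] u by simp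
  show ?thesis
  proof
    assume eq: "block t u = block t v"
    show "\<forall>w\<in>{u..v}. step x t (u, w) = Ident C (Dom C (step x t (u, w)))"
    proof
      fix w assume w: "w \<in> {u..v}"
      have "block t u \<le> block t w" "block t w \<le> block t v" using w u by (auto intro!: block_mono[OF t])
      then have "block t w = block t u" using eq by simp
      then show "step x t (u, w) = Ident C (Dom C (step x t (u, w)))"
        using w u eq step_apply[of u w x t] simplexD(3)[OF xs order_refl vn] simplexD(5)[OF xs vn]
          by (metis atLeastAtMost_iff order_le_less_trans)
    qed
  next
    assume id: "\<forall>w\<in>{u..v}. step x t (u, w) = Ident C (Dom C (step x t (u, w)))"
    show "block t u = block t v"
    proof (rule ccontr)
      assume "block t u \<noteq> block t v"
      then have lt: "block t u < block t v" using block_mono[OF t u] by simp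
      define i where "i = block t u"
      have i: "i < n" using lt vn by (simp add: i_def)
      \<comment> \<open>\<open>w\<close> is the start of the block after that of \<open>u\<close>;
        there \<open>step\<close> shows the single arrow from vertex \<open>i\<close> to vertex
        \<open>Suc i\<close>.\<close>
      define w where "w = sum t {..<Suc i}"
      have "u < w" using blockD(1)[OF t, of u] u by (simp add: w_def i_def lessThan_Suc_atMost)
      moreover have "w \<le> v"
      proof -
        have "w \<le> sum t {..<block t v}" unfolding w_def using lt standard_simplexD(1)[OF t] by (intro sum_mono2) (auto simp: i_def)
        then show ?thesis using blockD(2)[OF t, of v] u by simp
      qed
      moreover have "block t w = Suc i" unfolding w_def using i by (intro block_start(1)[OF t] pos) simp
      ultimately have "amap x (i, Suc i) = Ident C (Dom C (amap x (i, Suc i)))"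
        using id[rule_format, of w] u by (simp add: step_apply i_def)
      then show False using nd[OF i] simplexD(3)[OF xs, of i "Suc i"] i by simp
    qed
  qed
qed

text \<open>Uniqueness in the Eilenberg-Zilber lemma. \<open>step\<close> decides which points share
  a block, hence counts the blocks met before each \<open>u\<close>, and so determines the block
  functions. The weights are the lengths of the blocks, and the arrows are values of
  \<open>step\<close> at the starts of blocks.\<close>

lemma normal_unique:
  assumes x: "normal C n x t" and y: "normal C m y s" and eq: "step x t = step y s"
  shows "n = m \<and> x = y \<and> t = s"
proof -
  have xs: "x \<in> functors (ordinal n) C" and t: "t \<in> standard_simplex n" and pt: "\<forall>i\<le>n. 0 < t i"
    using x by (auto simp: normal_def)
  have ys: "y \<in> functors (ordinal m) C" and s: "s \<in> standard_simplex m" and ps: "\<forall>i\<le>m. 0 < s i"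
    using y by (auto simp: normal_def)
  have b: "block t u = block s u" if u: "0 \<le> u" "u < 1" for u
  proof -
    have "block t v = block t w \<longleftrightarrow> block s v = block s w" if "v \<in> {0..u}" "w \<in> {0..u}" for v w
    proof (cases "v \<le> w")
      case True
      then show ?thesis using block_eq_iff[OF x, of v w] block_eq_iff[OF y, of v w] eq that u by simp
    next
      case False
      then show ?thesis using block_eq_iff[OF x, of w v] block_eq_iff[OF y, of w v] eq that u by auto
    qed
    then have "card (block t ` {0..u}) = card (block s ` {0..u})" by (rule card_image_eqI)
    then show ?thesis using block_surj[OF t pt u] block_surj[OF s ps u] by simp
  qed
  have nm: "n \<le> m" using block_start[OF t, of n] pt b blockD(3)[OF s, of "sum t {..<n}"] by simp
  have "m \<le> n" using block_start[OF s, of m] ps b blockD(3)[OF t, of "sum s {..<m}"] by simp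
  with nm have n: "n = m" by simp
  have st: "sum t {..<i} = sum s {..<i}" if i: "i \<le> n" for i
  proof (rule antisym)
    show "sum s {..<i} \<le> sum t {..<i}"
      using block_start[OF t, of i] pt b[of "sum t {..<i}"] blockD(2)[OF s, of "sum t {..<i}"] i by simp
    show "sum t {..<i} \<le> sum s {..<i}"
      using block_start[OF s, of i] ps b[of "sum s {..<i}"] blockD(2)[OF t, of "sum s {..<i}"] i n by simp
  qed
  have "t = s"
  proof
    fix i
    consider "i < n" | "i = n" | "i > n" by linarith
    then show "t i = s i"
    proof cases
      case 1
      then show ?thesis using st[of i] st[of "Suc i"] by simp
    next
      case 2
      have "sum t {..n} = sum s {..n}" using standard_simplexD(3)[OF t] standard_simplexD(3)[OF s] n by simp
      then show ?thesis using 2 st[of n] by (simp add: lessThan_Suc_atMost[symmetric])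
    next
      case 3
      then show ?thesis using standard_simplexD(2)[OF t] standard_simplexD(2)[OF s] n by simp
    qed
  qed
  have a: "amap x (i, j) = amap y (i, j)" if "i \<le> j" "j \<le> n" for i j
  proof -
    have "0 < t i" "0 < t j" using pt that by auto
    moreover have "sum t {..<i} \<le> sum t {..<j}" using that standard_simplexD(1)[OF t] by (intro sum_mono2) auto
    ultimately show ?thesis
      using fun_cong[OF eq, of "(sum t {..<i}, sum t {..<j})"] block_start[OF t, of i] block_start[OF t, of j] \<open>t = s\<close>
      by (simp add: step_apply)
  qed
  have "x = y"
  proof (rule simplex_eqI[OF xs])
    show "y \<in> functors (ordinal n) C" using ys n by simp
    show "omap x i = omap y i" if "i \<le> n" for i
      using a[of i i] that simplexD(3)[OF xs, of i i] simplexD(3)[OF ys, of i i] n by simp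
  qed (rule a)
  then show ?thesis using n \<open>t = s\<close> by simp
qed

text \<open>Close to \<open>1\<close> every \<open>u\<close> lies in the block of the last vertex
  with positive weight, so the source of \<open>step\<close> there is the object at that
  vertex.\<close>

lemma step_top_omap:
  assumes x: "x \<in> functors (ordinal n) C" "t \<in> standard_simplex n"
    and y: "y \<in> functors (ordinal m) C" "s \<in> standard_simplex m" and eq: "step x t = step y s"
  shows "omap x (top_index n t) = omap y (top_index m s)"
proof -
  \<comment> \<open>The threshold is the start of the last nonempty block: all later weights vanish,
    so this block reaches up to \<open>1\<close>.\<close>
  have ex: "\<exists>u<1. 0 \<le> u \<and> (\<forall>v. u \<le> v \<and> v < 1 \<longrightarrow> block t v = top_index n t)"
    if t: "t \<in> standard_simplex n" for t n
  proof (intro exI[of _ "sum t {..<top_index n t}"] conjI allI impI)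
    note I = top_index[OF t] and T = standard_simplexD[OF t]
    show "sum t {..<top_index n t} < 1" "0 \<le> sum t {..<top_index n t}" using block_start[OF t I(2)] by auto
    fix v assume v: "sum t {..<top_index n t} \<le> v \<and> v < 1"
    have "t i = 0" if "i \<in> {..n} - {..top_index n t}" for i
      using I(3)[of i] T(1)[of i] that by (cases "t i = 0") auto
    then have "sum t {..top_index n t} = sum t {..n}" using I(1) by (intro sum.mono_neutral_left) auto
    then show "block t v = top_index n t" using v T(1,3) by (intro block_eqI) auto
  qed
  obtain u where u: "u < 1" "0 \<le> u" "\<And>v. u \<le> v \<Longrightarrow> v < 1 \<Longrightarrow> block t v = top_index n t" using ex[OF x(2)] by blast
  obtain w where w: "w < 1" "0 \<le> w" "\<And>v. w \<le> v \<Longrightarrow> v < 1 \<Longrightarrow> block s v = top_index m s" using ex[OF y(2)] by blast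
  have "step x t (max u w, max u w) = step y s (max u w, max u w)" using eq by simp
  then have "amap x (top_index n t, top_index n t) = amap y (top_index m s, top_index m s)"
    using u w by (simp add: step_apply)
  then show ?thesis
    using simplexD(3)[OF x(1), of "top_index n t" "top_index n t"] simplexD(3)[OF y(1), of "top_index m s" "top_index m s"]
      top_index(1)[OF x(2)] top_index(1)[OF y(2)] by simp
qed

lemma normal_top: "normal C n x t \<Longrightarrow> top_index n t = n"
  unfolding normal_def using top_index(1,3)[of t n] by (meson le_antisym le_refl)

section \<open>Faces and degeneracies\<close>

definition coface :: "nat \<Rightarrow> nat \<Rightarrow> nat \<Rightarrow> nat" where
  "coface n i = (\<lambda>j\<in>{..n}. if j < i then j else Suc j)"

definition codegeneracy :: "nat \<Rightarrow> nat \<Rightarrow> nat \<Rightarrow> nat" where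
  "codegeneracy n i = (\<lambda>j\<in>{..Suc n}. if j \<le> i then j else j - 1)"

lemma coface_arr: "(n, coface n i, Suc n) \<in> Arr simplex_category"
  unfolding coface_def by (rule simplex_arrI) auto

lemma codegeneracy_arr: "i \<le> n \<Longrightarrow> (Suc n, codegeneracy n i, n) \<in> Arr simplex_category"
  unfolding codegeneracy_def by (rule simplex_arrI) auto

text \<open>The omitted weight is \<open>0\<close>, so renumbering the remaining weights loses
  nothing.\<close>

lemma coface_push:
  assumes t: "t \<in> standard_simplex (Suc n)" and i: "i \<le> Suc n" "t i = 0"
  defines "t' \<equiv> \<lambda>j. if j \<le> n then t (coface n i j) else 0"
  shows "t' \<in> standard_simplex n" "simplex_push n (coface n i) t' = t"
proof -
  note T = standard_simplexD[OF t]
  have p: "simplex_push n (coface n i) t' j = t j" for j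
  proof -
    have "{k. k \<le> n \<and> coface n i k = j} = (if j = i \<or> j > Suc n then {} else if j < i then {j} else {j - 1})"
      using i(1) by (auto simp: coface_def)
    then show ?thesis using i T(2)[of j] by (auto simp: simplex_push_def t'_def coface_def)
  qed
  then show "simplex_push n (coface n i) t' = t" by blast
  have "sum t' {..n} = sum t {..Suc n}"
  proof -
    have "{k. k \<le> n \<and> coface n i k \<in> {..Suc n}} = {..n}" using simplex_arrD(1)[OF coface_arr] by auto
    then show ?thesis using sum_simplex_push[OF coface_arr, of "{..Suc n}" n i t'] p by simp
  qed
  then show "t' \<in> standard_simplex n" using T by (auto simp: standard_simplex_def t'_def)
qed

text \<open>Deleting vertex \<open>Suc i\<close> and doubling vertex \<open>i\<close> changes
  nothing when the arrow between them is an identity, since identities are absorbed by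
  composition.\<close>

lemma (in category) degenerate_simplex:
  assumes x: "x \<in> functors (ordinal (Suc n)) C" and i: "i \<le> n" "amap x (i, Suc i) = Ident C (omap x i)"
  shows "restr (nerve C) (Suc n, codegeneracy n i, n) (restr (nerve C) (n, coface n (Suc i), Suc n) x) = x"
proof -
  note X = simplexD[OF x]
  let ?f = "\<lambda>j. if j = Suc i then i else j"
  have f: "coface n (Suc i) (codegeneracy n i j) = ?f j" "codegeneracy n i j \<le> n" if "j \<le> Suc n" for j
    using that i(1) by (auto simp: coface_def codegeneracy_def)
  have o: "omap x (Suc i) = omap x i"
    using X(4)[of i "Suc i"] i id_arr[of "omap x i"] X(1)[of i] by simp
  have fo: "omap x (?f j) = omap x j" for j using o by simp
  have fa: "amap x (?f j, ?f k) = amap x (j, k)" if jk: "j \<le> k" "k \<le> Suc n" for j k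
  proof -
    have 1: "amap x (i, k) = amap x (Suc i, k)" if "Suc i \<le> k" "k \<le> Suc n" for k
      using X(6)[of i "Suc i" k] that i(2) comp_id_right[of "amap x (Suc i, k)"] X(2,3)[of "Suc i" k] o by simp
    have 2: "amap x (j, i) = amap x (j, Suc i)" if "j \<le> i" for j
      using X(6)[of j i "Suc i"] that i comp_id_left[of "amap x (j, i)"] X(2,4)[of j i] by simp
    show ?thesis
      using 1[of k] 2[of j] jk i X(5)[of "Suc i"] X(5)[of i] o by (auto simp: le_Suc_eq)
  qed
  have le: "codegeneracy n i j \<le> codegeneracy n i k" if "j \<le> k" "k \<le> Suc n" for j k
    using simplex_arrD(2)[OF codegeneracy_arr[OF i(1)]] that .
  have "restr (nerve C) (Suc n, codegeneracy n i, n) (restr (nerve C) (n, coface n (Suc i), Suc n) x)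
    = mk_simplex (Suc n) (omap x) (\<lambda>j k. amap x (j, k))"
    unfolding restr_nerve[OF codegeneracy_arr[OF i(1)]] restr_nerve[OF coface_arr]
  proof (rule mk_simplex_cong)
    fix j assume "j \<le> Suc n"
    then show "omap (mk_simplex n (\<lambda>i'. omap x (coface n (Suc i) i')) (\<lambda>i' j. amap x (coface n (Suc i) i', coface n (Suc i) j)))
       (codegeneracy n i j) = omap x j" using f fo by simp
  next
    fix j k assume jk: "j \<le> k" "k \<le> Suc n"
    then have j: "j \<le> Suc n" by simp
    show "amap (mk_simplex n (\<lambda>i'. omap x (coface n (Suc i) i')) (\<lambda>i' j. amap x (coface n (Suc i) i', coface n (Suc i) j)))
       (codegeneracy n i j, codegeneracy n i k) = amap x (j, k)"
      using f(1)[OF j] f[OF jk(2)] fa[OF jk] le[OF jk] by (simp only: amap_mk_simplex)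
  qed
  then show ?thesis by (simp add: mk_simplex_eta[OF x])
qed

section \<open>Acyclic carriers\<close>

text \<open>The radial projection of the prism \<open>[0, 1] \<times> \<Delta>\<^sup>n\<close> from its centre to its boundary. The depth is
  \<open>0\<close> on the boundary and \<open>1\<close> in the centre.\<close>

definition depth :: "nat \<Rightarrow> real \<Rightarrow> (nat \<Rightarrow> real) \<Rightarrow> real" where
  "depth n s t = - Max (insert (- (2 * s)) (insert (- (2 * (1 - s))) ((\<lambda>i. - (real (Suc n) * t i)) ` {..n})))"

text \<open>With the centre at \<open>s = 1/2\<close> and all weights \<open>1 / (n + 1)\<close>, a
  point of depth \<open>d\<close> is \<open>1 - d\<close> times its projection plus \<open>d\<close>
  times the centre. Solving for the projection gives this formula and that of
  \<open>proj_simplex\<close>. In the centre itself, where \<open>d = 1\<close>, the quotient is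
  only a default value.\<close>

definition proj_ends :: "nat \<Rightarrow> real \<Rightarrow> (nat \<Rightarrow> real) \<Rightarrow> real" where
  "proj_ends n s t = (2 * s - depth n s t) / (2 * (1 - depth n s t))"

definition proj_simplex :: "nat \<Rightarrow> real \<Rightarrow> (nat \<Rightarrow> real) \<Rightarrow> nat \<Rightarrow> real" where
  "proj_simplex n s t = (\<lambda>i. if i \<le> n then (t i - depth n s t / real (Suc n)) / (1 - depth n s t) else 0)"

text \<open>A negated maximum of negated terms is a minimum; the factors \<open>2\<close> and
  \<open>n + 1\<close> normalise each term to \<open>1\<close> at the centre.\<close>

lemma depth_le: "depth n s t \<le> 2 * s" "depth n s t \<le> 2 * (1 - s)" "i \<le> n \<Longrightarrow> depth n s t \<le> real (Suc n) * t i"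
  using Max_ge[of "insert (- (2 * s)) (insert (- (2 * (1 - s))) ((\<lambda>i. - (real (Suc n) * t i)) ` {..n}))"]
  unfolding depth_def by (auto simp: minus_le_iff simp del: of_nat_Suc)

lemma depth_attained: "depth n s t = 2 * s \<or> depth n s t = 2 * (1 - s) \<or> (\<exists>i\<le>n. depth n s t = real (Suc n) * t i)"
  using Max_in[of "insert (- (2 * s)) (insert (- (2 * (1 - s))) ((\<lambda>i. - (real (Suc n) * t i)) ` {..n}))"]
  unfolding depth_def by (auto simp del: of_nat_Suc)

lemma depth_nonneg: "s \<in> {0..1} \<Longrightarrow> t \<in> standard_simplex n \<Longrightarrow> 0 \<le> depth n s t"
  using depth_attained[of n s t] standard_simplexD(1)[of t n] by auto

lemma depth_eq_0_iff:
  assumes "s \<in> {0..1}" "t \<in> standard_simplex n"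
  shows "depth n s t = 0 \<longleftrightarrow> s = 0 \<or> s = 1 \<or> (\<exists>i\<le>n. t i = 0)"
proof
  assume "depth n s t = 0"
  then show "s = 0 \<or> s = 1 \<or> (\<exists>i\<le>n. t i = 0)" using depth_attained[of n s t] by auto
next
  assume "s = 0 \<or> s = 1 \<or> (\<exists>i\<le>n. t i = 0)"
  then show "depth n s t = 0"
    using depth_nonneg[OF assms] depth_le[where n = n and s = s and t = t] by fastforce
qed

lemma proj_boundary:
  assumes "depth n s t = 0" "t \<in> standard_simplex n"
  shows "proj_ends n s t = s" "proj_simplex n s t = t"
  using assms standard_simplexD(2)[OF assms(2)] by (auto simp: proj_ends_def proj_simplex_def fun_eq_iff)

text \<open>The projection stays in the prism because the depth is below every rescaled coordinate.
  It lies on the boundary because the coordinate that attains the minimum becomes \<open>0\<close>,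
  or \<open>1\<close> in the case of the upper end. The clause for \<open>s = 1/2\<close> keeps the
  prism over that single time invariant.\<close>

lemma proj_in:
  assumes s: "s \<in> {0..1}" and t: "t \<in> standard_simplex n" and d: "depth n s t < 1"
  shows "proj_ends n s t \<in> {0..1}" "s = 1/2 \<Longrightarrow> proj_ends n s t = 1/2" "proj_simplex n s t \<in> standard_simplex n"
    "depth n (proj_ends n s t) (proj_simplex n s t) = 0"
proof -
  define r where "r = depth n s t"
  have r: "r \<le> 2 * s" "r \<le> 2 * (1 - s)" "\<And>i. i \<le> n \<Longrightarrow> r / real (Suc n) \<le> t i" "r < 1"
    using depth_le[where n = n and s = s and t = t] d by (auto simp: r_def divide_le_eq mult.commute simp del: of_nat_Suc)
  have e: "proj_ends n s t = (2 * s - r) / (2 * (1 - r))" by (simp add: proj_ends_def r_def)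
  have e1: "1 - proj_ends n s t = (2 * (1 - s) - r) / (2 * (1 - r))" unfolding e using r(4) by (simp add: field_simps)
  have "0 \<le> proj_ends n s t" "0 \<le> 1 - proj_ends n s t" unfolding e1 unfolding e using r by simp_all
  then show E: "proj_ends n s t \<in> {0..1}" by simp
  show "s = 1/2 \<Longrightarrow> proj_ends n s t = 1/2" unfolding e using r(4) by simp
  have p: "proj_simplex n s t i = (t i - r / real (Suc n)) / (1 - r)" if "i \<le> n" for i
    using that by (simp add: proj_simplex_def r_def)
  have nn: "0 \<le> proj_simplex n s t i" for i
  proof (cases "i \<le> n")
    case True
    then show ?thesis unfolding p[OF True] using r(3)[OF True] r(4) by (intro divide_nonneg_nonneg) linarith+
  qed (simp add: proj_simplex_def)
  have "sum (proj_simplex n s t) {..n} = (\<Sum>i\<le>n. (t i - r / real (Suc n)) / (1 - r))"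
    by (rule sum.cong) (auto simp: p)
  also have "\<dots> = ((\<Sum>i\<le>n. t i) - (\<Sum>i\<le>n. r / real (Suc n))) / (1 - r)"
    by (simp add: sum_subtractf flip: sum_divide_distrib)
  also have "(\<Sum>i\<le>n. r / real (Suc n)) = r" by (simp add: field_simps del: of_nat_Suc)
  also have "((\<Sum>i\<le>n. t i) - r) / (1 - r) = 1" using standard_simplexD(3)[OF t] r(4) by simp
  finally have sum: "sum (proj_simplex n s t) {..n} = 1" .
  have le: "proj_simplex n s t i \<le> 1" for i
  proof (cases "i \<le> n")
    case True
    then have "proj_simplex n s t i \<le> sum (proj_simplex n s t) {..n}" using nn by (intro member_le_sum) auto
    then show ?thesis using sum by simp
  qed (simp add: proj_simplex_def)
  show S: "proj_simplex n s t \<in> standard_simplex n"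
    using nn le sum by (auto simp: standard_simplex_def proj_simplex_def)
  have "proj_ends n s t = 0 \<or> proj_ends n s t = 1 \<or> (\<exists>i\<le>n. proj_simplex n s t i = 0)"
    using depth_attained[of n s t]
  proof (elim disjE exE conjE)
    assume "depth n s t = 2 * s" then show ?thesis by (simp add: proj_ends_def)
  next
    assume "depth n s t = 2 * (1 - s)"
    then have "1 - proj_ends n s t = 0" unfolding e1 by (simp add: r_def)
    then show ?thesis by simp
  next
    fix i assume i: "i \<le> n" "depth n s t = real (Suc n) * t i"
    then have "proj_simplex n s t i = 0" unfolding p[OF i(1)] by (simp add: r_def field_simps)
    then show ?thesis using i(1) by blast
  qed
  then show "depth n (proj_ends n s t) (proj_simplex n s t) = 0" using depth_eq_0_iff[OF E S] by blast
qed

section \<open>Diagrams of spaces and compatible families\<close>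

locale space_diagram = category B for B :: "('o, 'm) cat" +
  fixes W :: "'o \<Rightarrow> 'w topology" and Wm :: "'m \<Rightarrow> 'w \<Rightarrow> 'w"
  assumes Wm_cont: "f \<in> Arr B \<Longrightarrow> continuous_map (W (Dom B f)) (W (Cod B f)) (Wm f)"
    and Wm_id: "a \<in> Obj B \<Longrightarrow> w \<in> topspace (W a) \<Longrightarrow> Wm (Ident B a) w = w"
    and Wm_comp: "\<lbrakk>f \<in> Arr B; g \<in> Arr B; Dom B g = Cod B f; w \<in> topspace (W (Dom B f))\<rbrakk> \<Longrightarrow>
        Wm (Comp B g f) w = Wm g (Wm f w)"
begin

text \<open>A compatible family assigns to a point of a simplex of the nerve a point of the space at the
  last vertex of the simplex.\<close>

definition compatible :: "(nat \<Rightarrow> (nat, nat \<times> nat, 'o, 'm) fnctr \<Rightarrow> (nat \<Rightarrow> real) \<Rightarrow> 'w) \<Rightarrow> bool" where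
  "compatible g \<longleftrightarrow>
    (\<forall>n. \<forall>x \<in> functors (ordinal n) B. \<forall>t \<in> standard_simplex n. g n x t \<in> topspace (W (omap x n))) \<and>
    (\<forall>m \<theta> n. \<forall>x \<in> functors (ordinal n) B. \<forall>t \<in> standard_simplex m. (m, \<theta>, n) \<in> Arr simplex_category \<longrightarrow>
       Wm (amap x (\<theta> m, n)) (g m (restr (nerve B) (m, \<theta>, n) x) t) = g n x (simplex_push m \<theta> t))"

text \<open>A homotopy of compatible families parametrised by \<open>J\<close>; a one-point
  \<open>J\<close> gives a single continuous family.\<close>

definition family :: "real set \<Rightarrow> (real \<Rightarrow> nat \<Rightarrow> (nat, nat \<times> nat, 'o, 'm) fnctr \<Rightarrow> (nat \<Rightarrow> real) \<Rightarrow> 'w) \<Rightarrow> bool" where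
  "family J h \<longleftrightarrow> (\<forall>s\<in>J. compatible (h s)) \<and>
    (\<forall>n. \<forall>x \<in> functors (ordinal n) B.
       continuous_map (prod_topology (top_of_set J) (std n)) (W (omap x n)) (\<lambda>(s, t). h s n x t))"

lemma compatibleD:
  assumes "compatible g" "x \<in> functors (ordinal n) B"
  shows "t \<in> standard_simplex n \<Longrightarrow> g n x t \<in> topspace (W (omap x n))"
    "t \<in> standard_simplex m \<Longrightarrow> (m, \<theta>, n) \<in> Arr simplex_category \<Longrightarrow>
      Wm (amap x (\<theta> m, n)) (g m (restr (nerve B) (m, \<theta>, n) x) t) = g n x (simplex_push m \<theta> t)"
  using assms unfolding compatible_def by blast+

lemma Wm_amap_trans:
  assumes x: "x \<in> functors (ordinal n) B" and "i \<le> j" "j \<le> k" "k \<le> n" "w \<in> topspace (W (omap x i))"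
  shows "Wm (amap x (j, k)) (Wm (amap x (i, j)) w) = Wm (amap x (i, k)) w"
  using Wm_comp[of "amap x (i, j)" "amap x (j, k)" w] simplexD(2-4)[OF x, of i j] simplexD(2,3)[OF x, of j k]
    simplexD(6)[OF x, of i j k] assms by simp

lemma Wm_amap_refl:
  assumes "x \<in> functors (ordinal n) B" "i \<le> n" "w \<in> topspace (W (omap x i))"
  shows "Wm (amap x (i, i)) w = w"
  using Wm_id[of "omap x i" w] simplexD(1,5)[OF assms(1,2)] assms(3) by simp

lemma Wm_amap_in:
  assumes "x \<in> functors (ordinal n) B" "i \<le> j" "j \<le> n" "w \<in> topspace (W (omap x i))"
  shows "Wm (amap x (i, j)) w \<in> topspace (W (omap x j))"
  using continuous_map_funspace[OF Wm_cont[of "amap x (i, j)"]] simplexD(2-4)[OF assms(1-3)] assms(4) by auto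

text \<open>Existence in the Eilenberg-Zilber lemma, by passing to a face when a weight vanishes and
  through a degeneracy when an arrow is an identity. The last clause says that a compatible family
  has no freedom outside normal forms. The strict bound on the boundary lets a recursion on the
  dimension of the normal form go down.\<close>

lemma normal_form_exists:
  assumes "x \<in> functors (ordinal n) B" "t \<in> standard_simplex n"
  shows "\<exists>k y t'. normal B k y t' \<and> step y t' = step x t \<and> k \<le> n \<and> ((\<exists>i\<le>n. t i = 0) \<longrightarrow> k < n) \<and>
    (\<forall>g. compatible g \<longrightarrow> g n x t = Wm (amap x (top_index n t, n)) (g k y t'))"
  using assms
proof (induction n arbitrary: x t)
  case 0
  have t0: "t 0 = 1" using standard_simplexD(3)[OF 0(2)] by simp
  then have n: "normal B 0 x t" using 0 by (simp add: normal_def nondegenerate_def)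
  have "g 0 x t = Wm (amap x (top_index 0 t, 0)) (g 0 x t)" if "compatible g" for g
    using normal_top[OF n] Wm_amap_refl[OF 0(1), of 0] compatibleD(1)[OF that 0] by simp
  then show ?case using n t0 by (intro exI[of _ 0] exI[of _ x] exI[of _ t]) auto
next
  case (Suc n)
  note x = Suc.prems(1) and t = Suc.prems(2)
  show ?case
  proof (cases "\<exists>i\<le>Suc n. t i = 0")
    case True
    \<comment> \<open>A weight vanishes, so the point lies in the face without vertex
      \<open>i\<close>.\<close>
    then obtain i where i: "i \<le> Suc n" "t i = 0" by blast
    define t' where "t' = (\<lambda>j. if j \<le> n then t (coface n i j) else 0)"
    note t' = coface_push[OF t i, folded t'_def]
    define y where "y = restr (nerve B) (n, coface n i, Suc n) x"
    note A = simplex_arrD[OF coface_arr[of n i]]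
    have y: "y \<in> functors (ordinal n) B" unfolding y_def by (rule restr_nerve_in[OF coface_arr x])
    obtain k z s where z: "normal B k z s" "step z s = step y t'" "k \<le> n"
      "\<And>g. compatible g \<Longrightarrow> g n y t' = Wm (amap y (top_index n t', n)) (g k z s)"
      using Suc.IH[OF y t'(1)] by blast
    have st: "step y t' = step x t" unfolding y_def step_restr[OF coface_arr t'(1)] t'(2) ..
    have "g (Suc n) x t = Wm (amap x (top_index (Suc n) t, Suc n)) (g k z s)" if g: "compatible g" for g
    proof -
      let ?j = "top_index n t'"
      note I = top_index(1)[OF t'(1)]
      have top: "top_index (Suc n) t = coface n i ?j" using top_index_push[OF coface_arr t'(1), of i] t'(2) by simp
      have zs: "z \<in> functors (ordinal k) B" "s \<in> standard_simplex k" using z(1) by (auto simp: normal_def)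
      have "omap y ?j = omap z k"
        using step_top_omap[OF y t'(1) zs z(2)[symmetric]] normal_top[OF z(1)] by simp
      moreover have "omap y ?j = omap x (coface n i ?j)" using I by (simp add: y_def restr_nerve[OF coface_arr])
      ultimately have w: "g k z s \<in> topspace (W (omap x (coface n i ?j)))" using compatibleD(1)[OF g zs] by simp
      have "g (Suc n) x t = Wm (amap x (coface n i n, Suc n)) (g n y t')"
        using compatibleD(2)[OF g x t'(1) coface_arr, of i] t'(2) by (simp add: y_def)
      also have "g n y t' = Wm (amap x (coface n i ?j, coface n i n)) (g k z s)"
        using z(4)[OF g] I by (simp add: y_def restr_nerve[OF coface_arr])
      also have "Wm (amap x (coface n i n, Suc n)) (Wm (amap x (coface n i ?j, coface n i n)) (g k z s))
          = Wm (amap x (coface n i ?j, Suc n)) (g k z s)"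
        by (rule Wm_amap_trans[OF x _ _ _ w]) (use A(2)[OF I] A(1)[of n] in auto)
      finally show ?thesis using top by simp
    qed
    then show ?thesis using z st by (intro exI[of _ k] exI[of _ z] exI[of _ s]) auto
  next
    case False
    then have pos: "\<forall>i\<le>Suc n. 0 < t i" using standard_simplexD(1)[OF t] less_eq_real_def by metis
    show ?thesis
    proof (cases "nondegenerate B (Suc n) x")
      case True
      then have nm: "normal B (Suc n) x t" using x t pos by (simp add: normal_def)
      have "g (Suc n) x t = Wm (amap x (top_index (Suc n) t, Suc n)) (g (Suc n) x t)" if "compatible g" for g
        using normal_top[OF nm] Wm_amap_refl[OF x, of "Suc n"] compatibleD(1)[OF that x t] by simp
      then show ?thesis using nm False by (intro exI[of _ "Suc n"] exI[of _ x] exI[of _ t]) auto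
    next
      \<comment> \<open>All weights are positive but some arrow is an identity, so the simplex is a
        degeneracy of one of lower dimension.\<close>
      case nd: False
      then obtain i where i: "i \<le> n" "amap x (i, Suc i) = Ident B (omap x i)"
        by (auto simp: nondegenerate_def less_Suc_eq_le)
      define y where "y = restr (nerve B) (n, coface n (Suc i), Suc n) x"
      have y: "y \<in> functors (ordinal n) B" unfolding y_def by (rule restr_nerve_in[OF coface_arr x])
      note A = codegeneracy_arr[OF i(1)]
      have xy: "restr (nerve B) (Suc n, codegeneracy n i, n) y = x"
        unfolding y_def by (rule degenerate_simplex[OF x i])
      define t' where "t' = simplex_push (Suc n) (codegeneracy n i) t"
      have t': "t' \<in> standard_simplex n" unfolding t'_def by (rule simplex_push_in[OF A t])
      obtain k z s where z: "normal B k z s" "step z s = step y t'" "k \<le> n"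
        "\<And>g. compatible g \<Longrightarrow> g n y t' = Wm (amap y (top_index n t', n)) (g k z s)"
        using Suc.IH[OF y t'] by blast
      have st: "step y t' = step x t" using step_restr[OF A t, of B y] xy by (simp add: t'_def)
      have last: "codegeneracy n i (Suc n) = n" using i by (simp add: codegeneracy_def)
      have "omap y n = omap (restr (nerve B) (Suc n, codegeneracy n i, n) y) (Suc n)"
        by (simp add: restr_nerve[OF A] last)
      then have oy: "omap y n = omap x (Suc n)" by (simp add: xy)
      have ptop: "top_index (Suc n) t = Suc n" using top_index(1,3)[OF t] pos by (meson le_antisym le_refl)
      then have ptop': "top_index n t' = n" using top_index_push[OF A t] last by (simp add: t'_def)
      have "g (Suc n) x t = Wm (amap x (top_index (Suc n) t, Suc n)) (g k z s)" if g: "compatible g" for g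
      proof -
        have zs: "z \<in> functors (ordinal k) B" "s \<in> standard_simplex k" using z(1) by (auto simp: normal_def)
        have "omap y n = omap z k"
          using step_top_omap[OF y t' zs z(2)[symmetric]] normal_top[OF z(1)] ptop' by simp
        then have w: "g k z s \<in> topspace (W (omap y n))" using compatibleD(1)[OF g zs] by simp
        have "g (Suc n) x t = Wm (amap y (n, n)) (g (Suc n) x t)"
          using Wm_amap_refl[OF y, of n] compatibleD(1)[OF g x t] oy by simp
        also have "\<dots> = g n y t'"
          using compatibleD(2)[OF g y t A] last xy by (simp add: t'_def)
        also have "\<dots> = g k z s" using z(4)[OF g] ptop' Wm_amap_refl[OF y, of n] w by simp
        also have "\<dots> = Wm (amap x (Suc n, Suc n)) (g k z s)"
          using Wm_amap_refl[OF x, of "Suc n"] w oy by simp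
        finally show ?thesis using ptop by simp
      qed
      then show ?thesis using z st False by (intro exI[of _ k] exI[of _ z] exI[of _ s]) auto
    qed
  qed
qed

text \<open>Chosen from \<open>step\<close> rather than from a simplex and a point, so that glued
  points have the same normal form by construction.\<close>

definition normal_form where
  "normal_form \<Phi> = (SOME p. normal B (fst p) (fst (snd p)) (snd (snd p)) \<and> step (fst (snd p)) (snd (snd p)) = \<Phi>)"

lemma normal_form_eq:
  assumes "normal B k y t" shows "normal_form (step y t) = (k, y, t)"
  unfolding normal_form_def
proof (rule some_equality)
  fix p assume "normal B (fst p) (fst (snd p)) (snd (snd p)) \<and> step (fst (snd p)) (snd (snd p)) = step y t"
  then show "p = (k, y, t)" using normal_unique[OF _ assms] by (metis prod.collapse)
qed (use assms in simp)

end

section \<open>Extension over the prism\<close>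

text \<open>The data of one extension problem. For \<open>J = {1/2}\<close> no end is prescribed and
  a family is created; for \<open>J = {0..1}\<close> the families \<open>g 0\<close> and
  \<open>g 1\<close> are to be joined. Each \<open>K a\<close> is a contraction of
  \<open>W a\<close> to the point \<open>c a\<close>.\<close>

locale carrier = space_diagram B W Wm for B :: "('o, 'm) cat" and W :: "'o \<Rightarrow> 'w topology" and Wm :: "'m \<Rightarrow> 'w \<Rightarrow> 'w" +
  fixes J :: "real set"
    and g :: "real \<Rightarrow> nat \<Rightarrow> (nat, nat \<times> nat, 'o, 'm) fnctr \<Rightarrow> (nat \<Rightarrow> real) \<Rightarrow> 'w"
    and K :: "'o \<Rightarrow> real \<times> 'w \<Rightarrow> 'w" and c :: "'o \<Rightarrow> 'w"
  assumes J: "J = {1/2} \<or> J = {0..1}"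
    and g: "e \<in> {0, 1} \<inter> J \<Longrightarrow> compatible (g e)"
    and g_cont: "e \<in> {0, 1} \<inter> J \<Longrightarrow> x \<in> functors (ordinal n) B \<Longrightarrow> continuous_map (std n) (W (omap x n)) (g e n x)"
    and K: "a \<in> Obj B \<Longrightarrow> continuous_map (prod_topology interval (W a)) (W a) (K a)"
    and K0: "a \<in> Obj B \<Longrightarrow> w \<in> topspace (W a) \<Longrightarrow> K a (0, w) = w"
    and K1: "a \<in> Obj B \<Longrightarrow> w \<in> topspace (W a) \<Longrightarrow> K a (1, w) = c a"
    and c: "a \<in> Obj B \<Longrightarrow> c a \<in> topspace (W a)"
begin

text \<open>The contraction of \<open>W a\<close>, run at double speed: it has arrived at depth \<open>1/2\<close>, so that the value
  of the radial projection at the centre of the prism does not matter.\<close>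

definition contract :: "'o \<Rightarrow> real \<Rightarrow> 'w \<Rightarrow> 'w" where
  "contract a r w = (if r \<ge> 1/2 then c a else K a (2 * r, w))"

abbreviation "nf_dim \<Phi> \<equiv> fst (normal_form \<Phi>)"
abbreviation "nf_simplex \<Phi> \<equiv> fst (snd (normal_form \<Phi>))"
abbreviation "nf_point \<Phi> \<equiv> snd (snd (normal_form \<Phi>))"

text \<open>On the interior of a nondegenerate simplex the value is obtained from the value at the radial
  projection by the contraction; all other values are forced by compatibility. The second
  conditional only serves termination.\<close>

function ext :: "real \<Rightarrow> nat \<Rightarrow> (nat, nat \<times> nat, 'o, 'm) fnctr \<Rightarrow> (nat \<Rightarrow> real) \<Rightarrow> 'w" where
  "ext s n x t =
    Wm (amap x (top_index n t, n))
      (contract (omap (nf_simplex (step x t)) (nf_dim (step x t)))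
        (depth (nf_dim (step x t)) s (nf_point (step x t)))
        (if proj_ends (nf_dim (step x t)) s (nf_point (step x t)) \<in> {0, 1}
         then g (proj_ends (nf_dim (step x t)) s (nf_point (step x t))) (nf_dim (step x t)) (nf_simplex (step x t))
           (proj_simplex (nf_dim (step x t)) s (nf_point (step x t)))
         else if nf_dim (step (nf_simplex (step x t)) (proj_simplex (nf_dim (step x t)) s (nf_point (step x t)))) < nf_dim (step x t)
         then ext (proj_ends (nf_dim (step x t)) s (nf_point (step x t))) (nf_dim (step x t)) (nf_simplex (step x t))
           (proj_simplex (nf_dim (step x t)) s (nf_point (step x t)))
         else undefined))"
  by pat_completeness auto
termination by (relation "Wellfounded.measure (\<lambda>(s, n, x, t). nf_dim (step x t))") auto

declare ext.simps [simp del]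

text \<open>The value at the normal form itself, before it is pushed to the last vertex of the
  simplex in which the point was presented.\<close>

definition ext_body :: "real \<Rightarrow> nat \<Rightarrow> (nat, nat \<times> nat, 'o, 'm) fnctr \<Rightarrow> (nat \<Rightarrow> real) \<Rightarrow> 'w" where
  "ext_body s k y t = contract (omap y k) (depth k s t)
    (if proj_ends k s t \<in> {0, 1} then g (proj_ends k s t) k y (proj_simplex k s t)
     else if nf_dim (step y (proj_simplex k s t)) < k then ext (proj_ends k s t) k y (proj_simplex k s t)
     else undefined)"

lemma ext_eq:
  assumes "normal B k y t'" "step x t = step y t'"
  shows "ext s n x t = Wm (amap x (top_index n t, n)) (ext_body s k y t')"
  using normal_form_eq[OF assms(1)] unfolding ext.simps[of s n x t] assms(2) by (simp add: ext_body_def)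

lemma J01: "J \<subseteq> {0..1}" using J by auto

lemma proj_ends_in_J:
  assumes "s \<in> J" "t \<in> standard_simplex n" "depth n s t < 1"
  shows "proj_ends n s t \<in> J"
  using J
proof
  assume "J = {1/2}"
  then show ?thesis using proj_in(2)[OF _ assms(2,3)] assms(1) by auto
next
  assume J: "J = {0..1}"
  show ?thesis using proj_in(1)[OF _ assms(2,3)] assms(1) unfolding J by blast
qed

lemma contract_in:
  assumes "a \<in> Obj B" "0 \<le> r" "r < 1/2 \<Longrightarrow> w \<in> topspace (W a)"
  shows "contract a r w \<in> topspace (W a)"
  using assms c[OF assms(1)] continuous_map_funspace[OF K[OF assms(1)]] by (auto simp: contract_def Pi_iff)

text \<open>Justifies the guard in \<open>ext\<close>: a radial projection that is not at an end of
  the interval has a vanishing weight, and then its normal form has smaller dimension.\<close>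

lemma normal_form_smaller:
  assumes y: "y \<in> functors (ordinal k) B" and t: "t \<in> standard_simplex k" and z: "i \<le> k" "t i = 0"
  shows "nf_dim (step y t) < k"
proof -
  obtain k' y' t' where n: "normal B k' y' t'" "step y' t' = step y t" and "(\<exists>i\<le>k. t i = 0) \<longrightarrow> k' < k"
    using normal_form_exists[OF y t] by blast
  then have "k' < k" using z by blast
  then show ?thesis using normal_form_eq[OF n(1)] n(2) by simp
qed

text \<open>The value and its body are treated in one induction on the dimension of the normal form,
  because the body refers to values at points with a smaller normal form.\<close>

lemma ext_in:
  assumes "s \<in> J" "x \<in> functors (ordinal n) B" "t \<in> standard_simplex n"
  shows "ext s n x t \<in> topspace (W (omap x n))"
    and "\<And>k y t'. normal B k y t' \<Longrightarrow> step x t = step y t' \<Longrightarrow> ext_body s k y t' \<in> topspace (W (omap y k))"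
proof -
  have "ext s n x t \<in> topspace (W (omap x n)) \<and>
    (\<forall>k y t'. normal B k y t' \<longrightarrow> step x t = step y t' \<longrightarrow> ext_body s k y t' \<in> topspace (W (omap y k)))"
    using assms
  proof (induction "nf_dim (step x t)" arbitrary: s n x t rule: less_induct)
    case less
    note s = less.prems(1) and x = less.prems(2) and t = less.prems(3)
    have body: "ext_body s k y t' \<in> topspace (W (omap y k))" if n: "normal B k y t'" "step x t = step y t'" for k y t'
    proof -
      have y: "y \<in> functors (ordinal k) B" and t': "t' \<in> standard_simplex k" using n(1) by (auto simp: normal_def)
      have s01: "s \<in> {0..1}" using s J01 by blast
      have nf: "nf_dim (step x t) = k" using normal_form_eq[OF n(1)] n(2) by simp
      show ?thesis
        unfolding ext_body_def
      proof (rule contract_in)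
        show "omap y k \<in> Obj B" using simplexD(1)[OF y, of k] by simp
        show "0 \<le> depth k s t'" by (rule depth_nonneg[OF s01 t'])
        \<comment> \<open>From depth \<open>1/2\<close> on the contraction has arrived at
          \<open>c\<close>, so nothing has to be known about the projection there.\<close>
        assume "depth k s t' < 1/2"
        then have d: "depth k s t' < 1" by simp
        note p = proj_in(1,3,4)[OF s01 t' d]
        have pJ: "proj_ends k s t' \<in> J" by (rule proj_ends_in_J[OF s t' d])
        show "(if proj_ends k s t' \<in> {0, 1} then g (proj_ends k s t') k y (proj_simplex k s t')
          else if nf_dim (step y (proj_simplex k s t')) < k then ext (proj_ends k s t') k y (proj_simplex k s t')
          else undefined) \<in> topspace (W (omap y k))"
        proof (cases "proj_ends k s t' \<in> {0, 1}")
          case True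
          then show ?thesis using compatibleD(1)[OF g y p(2)] pJ by simp
        next
          case False
          then obtain i where "i \<le> k" "proj_simplex k s t' i = 0"
            using depth_eq_0_iff[OF p(1,2)] p(3) by blast
          then have lt: "nf_dim (step y (proj_simplex k s t')) < k" by (rule normal_form_smaller[OF y p(2)])
          then have "ext (proj_ends k s t') k y (proj_simplex k s t') \<in> topspace (W (omap y k))"
            using less.hyps[OF _ pJ y p(2)] nf by simp
          then show ?thesis using False lt by simp
        qed
      qed
    qed
    obtain k y t' where n: "normal B k y t'" "step y t' = step x t" using normal_form_exists[OF x t] by blast
    have y: "y \<in> functors (ordinal k) B" "t' \<in> standard_simplex k" using n(1) by (auto simp: normal_def)
    have "omap x (top_index n t) = omap y k"
      using step_top_omap[OF x t y n(2)[symmetric]] normal_top[OF n(1)] by simp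
    then have "ext s n x t \<in> topspace (W (omap x n))"
      unfolding ext_eq[OF n(1) n(2)[symmetric]]
      using Wm_amap_in[OF x top_index(1)[OF t]] body[OF n(1) n(2)[symmetric]] by simp
    then show ?case using body by blast
  qed
  then show "ext s n x t \<in> topspace (W (omap x n))"
    "\<And>k y t'. normal B k y t' \<Longrightarrow> step x t = step y t' \<Longrightarrow> ext_body s k y t' \<in> topspace (W (omap y k))"
    by blast+
qed

text \<open>Gluing does not change \<open>step\<close>, so both sides push the same
  \<open>ext_body\<close> forward, once in two stages and once directly.\<close>

lemma compatible_ext:
  assumes s: "s \<in> J" shows "compatible (ext s)"
  unfolding compatible_def
proof (intro conjI allI ballI impI)
  show "ext s n x t \<in> topspace (W (omap x n))" if "x \<in> functors (ordinal n) B" "t \<in> standard_simplex n" for n x t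
    by (rule ext_in(1)[OF s that])
  fix m \<theta> n x t assume x: "x \<in> functors (ordinal n) B" and t: "t \<in> standard_simplex m" and \<theta>: "(m, \<theta>, n) \<in> Arr simplex_category"
  let ?x = "restr (nerve B) (m, \<theta>, n) x" and ?t = "simplex_push m \<theta> t" and ?i = "top_index m t"
  have x': "?x \<in> functors (ordinal m) B" by (rule restr_nerve_in[OF \<theta> x])
  obtain k y t' where n: "normal B k y t'" "step y t' = step ?x t" using normal_form_exists[OF x' t] by blast
  have y: "y \<in> functors (ordinal k) B" "t' \<in> standard_simplex k" using n(1) by (auto simp: normal_def)
  have n': "step x ?t = step y t'" using n(2) step_restr[OF \<theta> t, of B x] by simp
  note I = top_index(1)[OF t] and A = simplex_arrD[OF \<theta>]
  have "omap ?x ?i = omap y k"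
    using step_top_omap[OF x' t y n(2)[symmetric]] normal_top[OF n(1)] by simp
  then have w: "ext_body s k y t' \<in> topspace (W (omap x (\<theta> ?i)))"
    using ext_in(2)[OF s x' t n(1) n(2)[symmetric]] I by (simp add: restr_nerve[OF \<theta>])
  have "Wm (amap x (\<theta> m, n)) (ext s m ?x t) = Wm (amap x (\<theta> m, n)) (Wm (amap x (\<theta> ?i, \<theta> m)) (ext_body s k y t'))"
    unfolding ext_eq[OF n(1) n(2)[symmetric]] using I by (simp add: restr_nerve[OF \<theta>])
  also have "\<dots> = Wm (amap x (\<theta> ?i, n)) (ext_body s k y t')"
    by (rule Wm_amap_trans[OF x _ _ _ w]) (use A I in auto)
  also have "\<dots> = ext s n x ?t"
    unfolding ext_eq[OF n(1) n'] top_index_push[OF \<theta> t] ..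
  finally show "Wm (amap x (\<theta> m, n)) (ext s m ?x t) = ext s n x ?t" .
qed

text \<open>At an end the depth is \<open>0\<close>, the projection is the identity and the
  contraction has not started. This settles normal forms, to which both families reduce.\<close>

lemma ext_ends:
  assumes e: "e \<in> {0, 1} \<inter> J" and x: "x \<in> functors (ordinal n) B" and t: "t \<in> standard_simplex n"
  shows "ext e n x t = g e n x t"
proof -
  obtain k y t' where n: "normal B k y t'" "step y t' = step x t"
    and gn: "g e n x t = Wm (amap x (top_index n t, n)) (g e k y t')"
    using normal_form_exists[OF x t] g[OF e] by blast
  have y: "y \<in> functors (ordinal k) B" and t': "t' \<in> standard_simplex k" using n(1) by (auto simp: normal_def)
  have d: "depth k e t' = 0" using depth_eq_0_iff[OF _ t'] e J01 by blast
  have "ext_body e k y t' = K (omap y k) (0, g e k y t')"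
    unfolding ext_body_def using proj_boundary[OF d t'] e d by (simp add: contract_def)
  also have "\<dots> = g e k y t'"
    using K0 simplexD(1)[OF y, of k] compatibleD(1)[OF g[OF e] y t'] by simp
  finally show ?thesis unfolding ext_eq[OF n(1) n(2)[symmetric]] gn by simp
qed

text \<open>One formula for the whole closed prism over a nondegenerate simplex, from which
  continuity is deduced. On the boundary the depth is \<open>0\<close> and both sides coincide; in
  the interior the point is its own normal form.\<close>

lemma ext_nondegenerate:
  assumes s: "s \<in> J" and x: "x \<in> functors (ordinal n) B" "nondegenerate B n x" and t: "t \<in> standard_simplex n"
  shows "ext s n x t = contract (omap x n) (depth n s t) (ext (proj_ends n s t) n x (proj_simplex n s t))"
proof (cases "depth n s t = 0")
  case True
  then show ?thesis
    using proj_boundary[OF True t] K0[of "omap x n"] simplexD(1)[OF x(1), of n] ext_in(1)[OF s x(1) t]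
    by (simp add: contract_def)
next
  case False
  have s01: "s \<in> {0..1}" using s J01 by blast
  then have nz: "\<forall>i\<le>n. t i \<noteq> 0" using depth_eq_0_iff[OF _ t] False by blast
  have "0 < t i" if "i \<le> n" for i using nz standard_simplexD(1)[OF t, of i] that by (simp add: less_le)
  then have n: "normal B n x t" using x t by (simp add: normal_def)
  have e: "ext s n x t = ext_body s n x t"
    using ext_eq[OF n refl] normal_top[OF n] Wm_amap_refl[OF x(1)] ext_in(2)[OF s x(1) t n refl] by simp
  show ?thesis
  proof (cases "depth n s t < 1/2")
    case True
    then have d: "depth n s t < 1" by simp
    note p = proj_in(1,3,4)[OF s01 t d]
    have pJ: "proj_ends n s t \<in> J" by (rule proj_ends_in_J[OF s t d])
    show ?thesis
    proof (cases "proj_ends n s t \<in> {0, 1}")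
      case True
      then show ?thesis unfolding e ext_body_def using ext_ends[OF _ x(1) p(2)] pJ by simp
    next
      case False
      then obtain i where "i \<le> n" "proj_simplex n s t i = 0"
        using depth_eq_0_iff[OF p(1,2)] p(3) by blast
      then have "nf_dim (step x (proj_simplex n s t)) < n" by (rule normal_form_smaller[OF x(1) p(2)])
      then show ?thesis unfolding e ext_body_def using False by simp
    qed
  qed (simp add: e ext_body_def contract_def)
qed

section \<open>Continuity of the extension\<close>

lemma continuous_map_depth: "continuous_map (prod_topology (top_of_set J) (std n)) euclideanreal (\<lambda>q. depth n (fst q) (snd q))"
proof -
  let ?P = "prod_topology (top_of_set J) (std n)"
  have s: "continuous_map ?P euclideanreal fst"
    using continuous_map_compose[OF continuous_map_fst continuous_map_from_subtopology[OF continuous_map_id]]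
    by (simp add: o_def id_def)
  have t: "continuous_map ?P euclideanreal (\<lambda>q. snd q i)" for i
    using continuous_map_compose[OF continuous_map_snd continuous_map_std_coord] by (simp add: o_def)
  \<comment> \<open>Indices \<open>0\<close> and \<open>1\<close> are taken by the two ends of the
    interval, so the weights are shifted by \<open>2\<close>.\<close>
  define f where "f i q = (if i = 0 then - (2 * fst q) else if i = 1 then - (2 * (1 - fst q)) else - (real (Suc n) * snd q (i - 2)))"
    for i :: nat and q :: "real \<times> (nat \<Rightarrow> real)"
  have "continuous_map ?P euclideanreal (\<lambda>q. - Max ((\<lambda>i. f i q) ` {..Suc (Suc n)}))"
  proof (intro continuous_map_minus continuous_map_real_Max)
    fix i :: nat
    consider "i = 0" | "i = 1" | "i > 1" by linarith
    then show "continuous_map ?P euclideanreal (f i)"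
      by cases (auto simp: f_def[abs_def] intro!: continuous_map_minus continuous_map_real_mult continuous_map_diff s t)
  qed auto
  moreover have "(\<lambda>i. f i q) ` {..Suc (Suc n)} =
      insert (- (2 * fst q)) (insert (- (2 * (1 - fst q))) ((\<lambda>i. - (real (Suc n) * snd q i)) ` {..n}))" for q
  proof -
    have "{..Suc (Suc n)} = insert 0 (insert 1 ((\<lambda>i. i + 2) ` {..n}))"
    proof (intro equalityI subsetI)
      fix i assume "i \<in> {..Suc (Suc n)}"
      then show "i \<in> insert 0 (insert 1 ((\<lambda>i. i + 2) ` {..n}))"
        by (cases "i \<le> 1") (auto intro!: image_eqI[where x = "i - 2"])
    qed auto
    then show ?thesis by (simp only: image_insert image_image) (simp add: f_def)
  qed
  ultimately show ?thesis by (simp add: depth_def)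
qed

text \<open>Pasting along depth \<open>1/2\<close>. Up to there \<open>1 - depth\<close> stays away
  from \<open>0\<close>, so the projection is continuous; from there on the map is constant. The two
  pieces agree because the contraction reaches \<open>c a\<close> at time \<open>1\<close>.\<close>

lemma continuous_map_radial:
  assumes a: "a \<in> Obj B"
    and b: "continuous_map (subtopology (prod_topology (top_of_set J) (std n)) {q. depth n (fst q) (snd q) = 0}) (W a) b"
  shows "continuous_map (prod_topology (top_of_set J) (std n)) (W a)
    (\<lambda>(s, t). contract a (depth n s t) (b (proj_ends n s t, proj_simplex n s t)))"
proof -
  let ?P = "prod_topology (top_of_set J) (std n)" and ?d = "\<lambda>q. depth n (fst q) (snd q)"
  let ?Q = "subtopology ?P {q. ?d q = 0}"
  let ?A = "{q \<in> topspace ?P. ?d q \<in> {..1/2}}" and ?B = "{q \<in> topspace ?P. ?d q \<in> {1/2..}}"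
  let ?f = "\<lambda>q. K a (2 * ?d q, b (proj_ends n (fst q) (snd q), proj_simplex n (fst q) (snd q)))"
  have top: "topspace ?P = J \<times> standard_simplex n" by (simp add: topspace_standard_simplex)
  have pQ: "(proj_ends n s t, proj_simplex n s t) \<in> topspace ?Q" if "s \<in> J" "t \<in> standard_simplex n" "depth n s t < 1" for s t
    using proj_in(3,4)[OF _ that(2,3)] proj_ends_in_J[OF that] J01 that by (auto simp: topspace_standard_simplex)
  have cd: "continuous_map (subtopology ?P ?A) euclideanreal ?d"
    by (rule continuous_map_from_subtopology[OF continuous_map_depth])
  have cf: "continuous_map (subtopology ?P ?A) (W a) ?f"
  proof -
    have s: "continuous_map (subtopology ?P ?A) euclideanreal fst"
      using continuous_map_from_subtopology[OF continuous_map_compose[OF continuous_map_fst continuous_map_from_subtopology[OF continuous_map_id]]]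
      by (simp add: o_def id_def)
    have t: "continuous_map (subtopology ?P ?A) euclideanreal (\<lambda>q. snd q i)" for i
      using continuous_map_from_subtopology[OF continuous_map_compose[OF continuous_map_snd continuous_map_std_coord]] by (simp add: o_def)
    have d1: "1 - ?d q \<noteq> 0" if "q \<in> topspace (subtopology ?P ?A)" for q using that by auto
    have e: "continuous_map (subtopology ?P ?A) euclideanreal (\<lambda>q. proj_ends n (fst q) (snd q))"
      unfolding proj_ends_def
      by (intro continuous_map_real_divide continuous_map_diff continuous_map_real_mult s cd) (use d1 in auto)
    have p: "continuous_map (subtopology ?P ?A) euclideanreal (\<lambda>q. proj_simplex n (fst q) (snd q) i)" for i
    proof (cases "i \<le> n")
      case True
      have "continuous_map (subtopology ?P ?A) euclideanreal (\<lambda>q. (snd q i - ?d q * (1 / real (Suc n))) / (1 - ?d q))"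
        by (intro continuous_map_real_divide continuous_map_diff continuous_map_real_mult t cd) (use d1 in auto)
      then show ?thesis using True by (simp add: proj_simplex_def)
    qed (simp add: proj_simplex_def)
    have dA: "?d q < 1" if "q \<in> topspace (subtopology ?P ?A)" for q using that by auto
    have qA: "fst q \<in> J" "fst q \<in> {0..1}" "snd q \<in> standard_simplex n" if "q \<in> topspace (subtopology ?P ?A)" for q
      using that J01 by (auto simp: topspace_standard_simplex)
    have "continuous_map (subtopology ?P ?A) (top_of_set J) (\<lambda>q. proj_ends n (fst q) (snd q))"
      unfolding continuous_map_in_subtopology using e proj_ends_in_J qA dA by blast
    moreover have "continuous_map (subtopology ?P ?A) (std n) (\<lambda>q. proj_simplex n (fst q) (snd q))"
      unfolding continuous_map_std using p proj_in(3)[OF qA(2,3) dA] by blast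
    ultimately have "continuous_map (subtopology ?P ?A) ?P (\<lambda>q. (proj_ends n (fst q) (snd q), proj_simplex n (fst q) (snd q)))"
      by (simp add: continuous_map_pairwise o_def)
    then have "continuous_map (subtopology ?P ?A) ?Q (\<lambda>q. (proj_ends n (fst q) (snd q), proj_simplex n (fst q) (snd q)))"
      using pQ dA by (auto simp: continuous_map_in_subtopology top)
    from continuous_map_compose[OF this b]
    have b': "continuous_map (subtopology ?P ?A) (W a) (\<lambda>q. b (proj_ends n (fst q) (snd q), proj_simplex n (fst q) (snd q)))"
      by (simp add: o_def)
    have "continuous_map (subtopology ?P ?A) interval (\<lambda>q. 2 * ?d q)"
      unfolding continuous_map_in_subtopology
      using continuous_map_real_mult_left[OF cd, of 2] depth_nonneg J01 by (auto simp: top)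
    then have "continuous_map (subtopology ?P ?A) (prod_topology interval (W a))
        (\<lambda>q. (2 * ?d q, b (proj_ends n (fst q) (snd q), proj_simplex n (fst q) (snd q))))"
      using b' by (simp add: continuous_map_pairwise o_def)
    from continuous_map_compose[OF this K[OF a]] show ?thesis by (simp add: o_def)
  qed
  have "continuous_map ?P (W a) (\<lambda>q. contract a (?d q) (b (proj_ends n (fst q) (snd q), proj_simplex n (fst q) (snd q))))"
  proof (rule pasting_lemma_closed[where I = "{True, False}" and T = "\<lambda>i. if i then ?A else ?B" and f = "\<lambda>i q. if i then ?f q else c a"])
    show "closedin ?P (if i then ?A else ?B)" for i
      using closedin_continuous_map_preimage[OF continuous_map_depth, of "{..1/2}" n]
        closedin_continuous_map_preimage[OF continuous_map_depth, of "{1/2..}" n]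
      by (cases i) simp_all
    show "continuous_map (subtopology ?P (if i then ?A else ?B)) (W a) (\<lambda>q. if i then ?f q else c a)" for i
      using cf c[OF a] by (cases i) simp_all
    have half: "?f q = c a" if "q \<in> topspace ?P" "?d q = 1/2" for q
    proof -
      have "b (proj_ends n (fst q) (snd q), proj_simplex n (fst q) (snd q)) \<in> topspace (W a)"
        using continuous_map_funspace[OF b] pQ[of "fst q" "snd q"] that by (auto simp: topspace_standard_simplex)
      moreover have "2 * ?d q = 1" using that(2) by simp
      ultimately show ?thesis using K1[OF a] by (simp only:)
    qed
    show "(if i then ?f q else c a) = (if j then ?f q else c a)"
      if "i \<in> {True, False}" "j \<in> {True, False}" "q \<in> topspace ?P \<inter> (if i then ?A else ?B) \<inter> (if j then ?A else ?B)" for i j q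
      using half[of q] that by (cases i; cases j) auto
    show "\<exists>j. j \<in> {True, False} \<and> q \<in> (if j then ?A else ?B) \<and>
        contract a (?d q) (b (proj_ends n (fst q) (snd q), proj_simplex n (fst q) (snd q))) = (if j then ?f q else c a)"
      if "q \<in> topspace ?P" for q
    proof (cases "?d q < 1/2")
      case True
      then show ?thesis using that by (intro exI[of _ True]) (simp add: contract_def)
    next
      case False
      then show ?thesis using that by (intro exI[of _ False]) (simp add: contract_def)
    qed
  qed auto
  then show ?thesis by (simp add: case_prod_unfold)
qed

text \<open>Induction on the dimension. A degenerate simplex factors through a smaller one. For a
  nondegenerate simplex, compatibility gives continuity over the faces, \<open>g\<close> gives it at
  the ends, and the radial formula carries it into the interior of the prism.\<close>

lemma continuous_map_ext:
  assumes "x \<in> functors (ordinal n) B"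
  shows "continuous_map (prod_topology (top_of_set J) (std n)) (W (omap x n)) (\<lambda>(s, t). ext s n x t)"
  using assms
proof (induction n arbitrary: x rule: less_induct)
  case (less n)
  note x = less.prems
  let ?P = "prod_topology (top_of_set J) (std n)"
  have top: "topspace ?P = J \<times> standard_simplex n" by (simp add: topspace_standard_simplex)
  have on: "omap x n \<in> Obj B" using simplexD(1)[OF x, of n] by simp
  show ?case
  proof (cases "nondegenerate B n x")
    case False
    then obtain i where i: "i < n" "amap x (i, Suc i) = Ident B (omap x i)" by (auto simp: nondegenerate_def)
    then obtain m where n: "n = Suc m" "i \<le> m" by (metis less_Suc_eq_le less_imp_Suc_add)
    define y where "y = restr (nerve B) (m, coface m (Suc i), Suc m) x"
    have y: "y \<in> functors (ordinal m) B" unfolding y_def by (rule restr_nerve_in[OF coface_arr]) (use x n in simp)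
    note A = codegeneracy_arr[OF n(2)]
    have xy: "restr (nerve B) (Suc m, codegeneracy m i, m) y = x"
      unfolding y_def by (rule degenerate_simplex) (use x n i in auto)
    have last: "codegeneracy m i (Suc m) = m" using n by (simp add: codegeneracy_def)
    have "omap y m = omap (restr (nerve B) (Suc m, codegeneracy m i, m) y) (Suc m)"
      by (simp add: restr_nerve[OF A] last)
    then have oy: "omap y m = omap x n" by (simp add: xy n)
    have e: "ext s n x t = ext s m y (simplex_push (Suc m) (codegeneracy m i) t)"
      if "s \<in> J" "t \<in> standard_simplex n" for s t
      using compatibleD(2)[OF compatible_ext[OF that(1)] y _ A, of t] that(2) last xy
        Wm_amap_refl[OF y, of m] ext_in(1)[OF that(1) x that(2)] oy n(1) by simp
    have "continuous_map ?P (prod_topology (top_of_set J) (std m)) (\<lambda>q. (fst q, simplex_push (Suc m) (codegeneracy m i) (snd q)))"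
      using continuous_map_compose[OF continuous_map_snd continuous_map_simplex_push[OF A]]
      by (simp add: continuous_map_pairwise o_def n(1) continuous_map_fst)
    from continuous_map_compose[OF this less.IH[OF _ y]] n(1)
    have "continuous_map ?P (W (omap x n)) (\<lambda>q. ext (fst q) m y (simplex_push (Suc m) (codegeneracy m i) (snd q)))"
      by (simp add: o_def case_prod_unfold oy)
    then show ?thesis by (rule continuous_map_eq) (auto simp: top e)
  next
    case True
    \<comment> \<open>The closed pieces of the boundary of the prism: the faces for
      \<open>i \<le> n\<close>, followed by the two ends.\<close>
    define T where "T i = (if i \<le> n then {q \<in> topspace ?P. snd q i = 0} else if i = Suc n then {q \<in> topspace ?P. fst q = 0}
      else {q \<in> topspace ?P. fst q = 1})" for i
    have d0: "depth n (fst q) (snd q) = 0 \<longleftrightarrow> fst q = 0 \<or> fst q = 1 \<or> (\<exists>i\<le>n. snd q i = 0)" if "q \<in> topspace ?P" for q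
      by (rule depth_eq_0_iff) (use that J01 top in auto)
    have "continuous_map (subtopology ?P {q. depth n (fst q) (snd q) = 0}) (W (omap x n)) (\<lambda>(s, t). ext s n x t)"
    proof (rule pasting_lemma_closed[where I = "{..Suc (Suc n)}" and f = "\<lambda>_ (s, t). ext s n x t" and T = T])
      let ?D = "{q. depth n (fst q) (snd q) = 0}"
      have TD: "T i \<subseteq> ?D" for i
      proof
        fix q assume "q \<in> T i"
        then have "q \<in> topspace ?P" "fst q = 0 \<or> fst q = 1 \<or> (\<exists>i\<le>n. snd q i = 0)"
          by (auto simp: T_def split: if_splits)
        then show "q \<in> ?D" using d0 by blast
      qed
      have s: "continuous_map ?P euclideanreal fst"
        using continuous_map_compose[OF continuous_map_fst continuous_map_from_subtopology[OF continuous_map_id]]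
        by (simp add: o_def id_def)
      have t: "continuous_map ?P euclideanreal (\<lambda>q. snd q i)" for i
        using continuous_map_compose[OF continuous_map_snd continuous_map_std_coord] by (simp add: o_def)
      have t0: "closedin ?P {q \<in> topspace ?P. snd q i = 0}" for i
        using closedin_continuous_map_preimage[OF t[of i], of "{0}"] by simp
      have s0: "closedin ?P {q \<in> topspace ?P. fst q = e}" for e
        using closedin_continuous_map_preimage[OF s, of "{e}"] by simp
      have "closedin ?P (T i)" for i unfolding T_def using t0 s0 by simp
      then show "closedin (subtopology ?P ?D) (T i)" for i using TD[of i] by (rule closedin_subset_topspace)
      fix i :: nat
      have st: "subtopology (subtopology ?P ?D) (T i) = subtopology ?P (T i)"
        using TD[of i] by (simp add: subtopology_subtopology inf.absorb2)
      have "continuous_map (subtopology ?P (T i)) (W (omap x n)) (\<lambda>(s, t). ext s n x t)"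
      proof (cases "i \<le> n")
        case i: True
        show ?thesis
        proof (cases n)
          \<comment> \<open>A simplex of dimension \<open>0\<close> has no faces: its only weight is
            \<open>1\<close>.\<close>
          case 0
          have "t 0 \<noteq> 0" if "t \<in> standard_simplex 0" for t :: "nat \<Rightarrow> real" using standard_simplexD(3)[OF that] by simp
          then have "T i = {}" using 0 i by (auto simp: T_def topspace_standard_simplex)
          then show ?thesis by simp
        next
          case (Suc m)
          have i': "i \<le> Suc m" using i Suc by simp
          define y where "y = restr (nerve B) (m, coface m i, Suc m) x"
          have y: "y \<in> functors (ordinal m) B" unfolding y_def by (rule restr_nerve_in[OF coface_arr]) (use x Suc in simp)
          define p where "p t = (\<lambda>j. if j \<le> m then t (coface m i j) else 0)" for t :: "nat \<Rightarrow> real"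
          have p: "p t \<in> standard_simplex m" "simplex_push m (coface m i) (p t) = t"
            if "t \<in> standard_simplex n" "t i = 0" for t
            using coface_push[OF _ i', of t] that Suc unfolding p_def by simp_all
          have e: "ext s n x t = Wm (amap x (coface m i m, n)) (ext s m y (p t))"
            if "s \<in> J" "t \<in> standard_simplex n" "t i = 0" for s t
            using compatibleD(2)[OF compatible_ext[OF that(1)] x p(1)[OF that(2,3)], of "coface m i"] coface_arr[of m i]
              p(2)[OF that(2,3)] Suc by (simp add: y_def)
          have "continuous_map (subtopology ?P (T i)) (std m) (\<lambda>q. p (snd q))"
            unfolding continuous_map_std
          proof (intro conjI allI ballI)
            show "continuous_map (subtopology ?P (T i)) euclideanreal (\<lambda>q. p (snd q) j)" for j
              by (cases "j \<le> m") (simp_all add: p_def continuous_map_from_subtopology[OF t])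
            show "p (snd q) \<in> standard_simplex m" if "q \<in> topspace (subtopology ?P (T i))" for q
              using that i by (intro p(1)) (auto simp: T_def topspace_standard_simplex)
          qed
          then have "continuous_map (subtopology ?P (T i)) (prod_topology (top_of_set J) (std m)) (\<lambda>q. (fst q, p (snd q)))"
            by (simp add: continuous_map_pairwise o_def continuous_map_from_subtopology continuous_map_fst)
          from continuous_map_compose[OF this less.IH[OF _ y]] Suc
          have c1: "continuous_map (subtopology ?P (T i)) (W (omap y m)) (\<lambda>q. ext (fst q) m y (p (snd q)))"
            by (simp add: o_def case_prod_unfold)
          have oy: "omap y m = omap x (coface m i m)" by (simp add: y_def restr_nerve[OF coface_arr])
          have cm: "coface m i m \<le> n" using simplex_arrD(1)[OF coface_arr, of m m i] Suc by simp
          have "continuous_map (W (omap x (coface m i m))) (W (omap x n)) (Wm (amap x (coface m i m, n)))"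
            using Wm_cont[of "amap x (coface m i m, n)"] simplexD(2-4)[OF x cm] by simp
          from continuous_map_compose[OF c1[unfolded oy] this]
          have "continuous_map (subtopology ?P (T i)) (W (omap x n)) (\<lambda>q. Wm (amap x (coface m i m, n)) (ext (fst q) m y (p (snd q))))"
            by (simp add: o_def)
          then show ?thesis
            by (rule continuous_map_eq) (use i in \<open>auto simp: e T_def topspace_standard_simplex\<close>)
        qed
      next
        case i: False
        define e :: real where "e = (if i = Suc n then 0 else 1)"
        have Te: "T i = {q \<in> topspace ?P. fst q = e}" using i by (simp add: T_def e_def)
        show ?thesis
        proof (cases "e \<in> J")
          case True
          then have eJ: "e \<in> {0, 1} \<inter> J" by (simp add: e_def)
          from continuous_map_compose[OF continuous_map_from_subtopology[OF continuous_map_snd] g_cont[OF eJ x]]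
          have "continuous_map (subtopology ?P (T i)) (W (omap x n)) (\<lambda>q. g e n x (snd q))" by (simp add: o_def)
          then show ?thesis
            by (rule continuous_map_eq) (auto simp: Te topspace_standard_simplex ext_ends[OF eJ x])
        next
          case False
          then have "T i = {}" unfolding Te by auto
          then show ?thesis by simp
        qed
      qed
      then show "continuous_map (subtopology (subtopology ?P ?D) (T i)) (W (omap x n)) (\<lambda>(s, t). ext s n x t)"
        unfolding st .
    next
      fix q assume "q \<in> topspace (subtopology ?P {q. depth n (fst q) (snd q) = 0})"
      then have q: "q \<in> topspace ?P" "depth n (fst q) (snd q) = 0" by auto
      have "\<exists>j. j \<in> {..Suc (Suc n)} \<and> q \<in> T j"
      proof -
        consider "fst q = 0" | "fst q = 1" | i where "i \<le> n" "snd q i = 0" using d0[OF q(1)] q(2) by blast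
        then show ?thesis
        proof cases
          case 1 then show ?thesis using q by (intro exI[of _ "Suc n"]) (simp add: T_def)
        next
          case 2 then show ?thesis using q by (intro exI[of _ "Suc (Suc n)"]) (simp add: T_def)
        next
          case 3 then show ?thesis using q by (intro exI[of _ i]) (simp add: T_def)
        qed
      qed
      then show "\<exists>j. j \<in> {..Suc (Suc n)} \<and> q \<in> T j \<and> (case q of (s, t) \<Rightarrow> ext s n x t) = (case q of (s, t) \<Rightarrow> ext s n x t)"
        by blast
    qed auto
    from continuous_map_radial[OF on this]
    show ?thesis
      by (rule continuous_map_eq) (auto simp: topspace_standard_simplex ext_nondegenerate[OF _ x True])
  qed
qed

lemma family_ext: "family J ext"
  unfolding family_def using compatible_ext continuous_map_ext by blast

end

section \<open>Existence and homotopy uniqueness of compatible families\<close>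

context space_diagram
begin

lemma contractions_exist:
  assumes "\<And>a. a \<in> Obj B \<Longrightarrow> contractible_space (W a)" "\<And>a. a \<in> Obj B \<Longrightarrow> topspace (W a) \<noteq> {}"
  shows "\<exists>K c. \<forall>a \<in> Obj B. continuous_map (prod_topology interval (W a)) (W a) (K a) \<and>
    (\<forall>w. K a (0, w) = w) \<and> (\<forall>w. K a (1, w) = c a) \<and> c a \<in> topspace (W a)"
proof -
  have "\<exists>K c. continuous_map (prod_topology interval (W a)) (W a) K \<and> (\<forall>w. K (0, w) = w) \<and> (\<forall>w. K (1, w) = c) \<and> c \<in> topspace (W a)"
    if a: "a \<in> Obj B" for a
  proof -
    obtain c where c: "homotopic_with (\<lambda>_. True) (W a) (W a) id (\<lambda>_. c)"
      using assms(1)[OF a] by (auto simp: contractible_space_def)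
    then have "c \<in> topspace (W a)"
      using homotopic_with_imp_continuous_maps[OF c] assms(2)[OF a] continuous_map_funspace by fastforce
    then show ?thesis using c unfolding homotopic_with_def id_def by blast
  qed
  then show ?thesis by metis
qed

theorem compatible_family_exists:
  assumes "\<And>a. a \<in> Obj B \<Longrightarrow> contractible_space (W a)" "\<And>a. a \<in> Obj B \<Longrightarrow> topspace (W a) \<noteq> {}"
  obtains h where "compatible h"
    "\<And>n x. x \<in> functors (ordinal n) B \<Longrightarrow> continuous_map (std n) (W (omap x n)) (h n x)"
proof -
  obtain K c where K: "\<And>a. a \<in> Obj B \<Longrightarrow> continuous_map (prod_topology interval (W a)) (W a) (K a)"
    "\<And>a w. a \<in> Obj B \<Longrightarrow> K a (0, w) = w" "\<And>a w. a \<in> Obj B \<Longrightarrow> K a (1, w) = c a"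
    "\<And>a. a \<in> Obj B \<Longrightarrow> c a \<in> topspace (W a)"
    using contractions_exist[OF assms] by blast
  \<comment> \<open>The time \<open>1/2\<close> is fixed by the radial projection and is not an end,
    so that \<open>g\<close> may be \<open>undefined\<close>.\<close>
  interpret carrier B W Wm "{1/2}" undefined K c
    by unfold_locales (use K in auto)
  have F: "family {1/2} ext" by (rule family_ext)
  show ?thesis
  proof (rule that)
    show "compatible (ext (1/2))" using F by (simp add: family_def)
    fix n x assume x: "x \<in> functors (ordinal n) B"
    have "continuous_map (std n) (prod_topology (top_of_set {1/2::real}) (std n)) (\<lambda>t. (1/2, t))"
      by (simp add: continuous_map_pairwise o_def)
    from continuous_map_compose[OF this continuous_map_ext[OF x]]
    show "continuous_map (std n) (W (omap x n)) (ext (1/2) n x)" by (simp add: o_def)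
  qed
qed

theorem compatible_families_homotopic:
  assumes "\<And>a. a \<in> Obj B \<Longrightarrow> contractible_space (W a)" "\<And>a. a \<in> Obj B \<Longrightarrow> topspace (W a) \<noteq> {}"
    and g: "compatible g" "\<And>n x. x \<in> functors (ordinal n) B \<Longrightarrow> continuous_map (std n) (W (omap x n)) (g n x)"
    and g': "compatible g'" "\<And>n x. x \<in> functors (ordinal n) B \<Longrightarrow> continuous_map (std n) (W (omap x n)) (g' n x)"
  obtains h where "family {0..1} h"
    "\<And>n x t. x \<in> functors (ordinal n) B \<Longrightarrow> t \<in> standard_simplex n \<Longrightarrow> h 0 n x t = g n x t"
    "\<And>n x t. x \<in> functors (ordinal n) B \<Longrightarrow> t \<in> standard_simplex n \<Longrightarrow> h 1 n x t = g' n x t"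
proof -
  obtain K c where K: "\<And>a. a \<in> Obj B \<Longrightarrow> continuous_map (prod_topology interval (W a)) (W a) (K a)"
    "\<And>a w. a \<in> Obj B \<Longrightarrow> K a (0, w) = w" "\<And>a w. a \<in> Obj B \<Longrightarrow> K a (1, w) = c a"
    "\<And>a. a \<in> Obj B \<Longrightarrow> c a \<in> topspace (W a)"
    using contractions_exist[OF assms(1,2)] by blast
  interpret carrier B W Wm "{0..1}" "\<lambda>e. if e = 0 then g else g'" K c
    by unfold_locales (use K g g' in auto)
  show ?thesis
    by (rule that[OF family_ext]) (use ext_ends in auto)
qed

end

section \<open>Quillen's Theorem A\<close>

definition comma :: "('o, 'm) cat \<Rightarrow> ('p, 'n) cat \<Rightarrow> ('o, 'm, 'p, 'n) fnctr \<Rightarrow> 'p \<Rightarrow>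
    ('o \<times> 'n, ('o \<times> 'n) \<times> 'm \<times> ('o \<times> 'n)) cat" where
  "comma C D u d =
    \<lparr>Obj = {(a, p). a \<in> Obj C \<and> p \<in> Arr D \<and> Dom D p = omap u a \<and> Cod D p = d},
     Arr = {((a, p), f, (b, q)). f \<in> Arr C \<and> a = Dom C f \<and> b = Cod C f \<and> q \<in> Arr D \<and>
              Dom D q = omap u b \<and> Cod D q = d \<and> p = Comp D q (amap u f)},
     Dom = (\<lambda>(x, f, y). x), Cod = (\<lambda>(x, f, y). y),
     Ident = (\<lambda>(a, p). ((a, p), Ident C a, (a, p))),
     Comp = (\<lambda>(y', g, z) (x, f, y). (x, Comp C g f, z))\<rparr>"

definition comma_push :: "('p, 'n) cat \<Rightarrow> 'n \<Rightarrow> ('o \<times> 'n, ('o \<times> 'n) \<times> 'm \<times> ('o \<times> 'n), 'o \<times> 'n, ('o \<times> 'n) \<times> 'm \<times> ('o \<times> 'n)) fnctr" where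
  "comma_push D q = \<lparr>omap = (\<lambda>(a, p). (a, Comp D q p)),
     amap = (\<lambda>((a, p), f, (b, p')). ((a, Comp D q p), f, (b, Comp D q p')))\<rparr>"

definition comma_proj :: "('o \<times> 'n, ('o \<times> 'n) \<times> 'm \<times> ('o \<times> 'n), 'o, 'm) fnctr" where
  "comma_proj = \<lparr>omap = fst, amap = (\<lambda>(x, f, y). f)\<rparr>"

definition id_functor :: "('o, 'm, 'o, 'm) fnctr" where
  "id_functor = \<lparr>omap = (\<lambda>a. a), amap = (\<lambda>f. f)\<rparr>"

lemma id_functor_simps [simp]: "omap id_functor a = a" "amap id_functor f = f"
  by (simp_all add: id_functor_def)

lemma is_functor_id: "is_functor C C id_functor"
  by (auto simp: is_functor_def)

lemma comma_category:
  assumes C: "category C" and D: "category D" and u: "is_functor C D u"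
  shows "category (comma C D u d)"
proof -
  interpret C: category C by (rule C)
  interpret D: category D by (rule D)
  note F = functorD[OF u]
  show ?thesis
  proof
    fix f assume f: "f \<in> Arr (comma C D u d)"
    obtain a p h b q where [simp]: "f = ((a, p), h, (b, q))" by (metis prod.collapse)
    have h: "h \<in> Arr C" "a = Dom C h" "b = Cod C h" "q \<in> Arr D" "Dom D q = omap u b" "Cod D q = d" "p = Comp D q (amap u h)"
      using f by (auto simp: comma_def)
    have p: "p \<in> Arr D" "Dom D p = omap u a" "Cod D p = d"
      using D.comp_arr[of "amap u h" q] h F(2-4)[OF h(1)] by auto
    show "Dom (comma C D u d) f \<in> Obj (comma C D u d) \<and> Cod (comma C D u d) f \<in> Obj (comma C D u d)"
      using h p C.dom_cod[OF h(1)] by (auto simp: comma_def)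
    show "Comp (comma C D u d) f (Ident (comma C D u d) (Dom (comma C D u d) f)) = f"
      "Comp (comma C D u d) (Ident (comma C D u d) (Cod (comma C D u d) f)) f = f"
      using h C.comp_id_right[OF h(1)] C.comp_id_left[OF h(1)] by (auto simp: comma_def)
    fix g assume g: "g \<in> Arr (comma C D u d)" "Dom (comma C D u d) g = Cod (comma C D u d) f"
    then obtain k c r where [simp]: "g = ((b, q), k, (c, r))" by (cases g) (auto simp: comma_def)
    have k: "k \<in> Arr C" "b = Dom C k" "c = Cod C k" "r \<in> Arr D" "Dom D r = omap u c" "Cod D r = d" "q = Comp D r (amap u k)"
      using g by (auto simp: comma_def)
    have "p = Comp D r (amap u (Comp C k h))"
      using h(7) k(7) F(6)[OF h(1) k(1)] D.comp_assoc[of "amap u h" "amap u k" r] h(1-3) k(1-5) F(2-4)[OF h(1)] F(2-4)[OF k(1)]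
      by simp
    then show "Comp (comma C D u d) g f \<in> Arr (comma C D u d) \<and>
        Dom (comma C D u d) (Comp (comma C D u d) g f) = Dom (comma C D u d) f \<and>
        Cod (comma C D u d) (Comp (comma C D u d) g f) = Cod (comma C D u d) g"
      using C.comp_arr[OF h(1) k(1)] h(1-3) k(1-6) by (auto simp: comma_def)
    fix l assume l: "l \<in> Arr (comma C D u d)" "Dom (comma C D u d) l = Cod (comma C D u d) g"
    then obtain m z where [simp]: "l = ((c, r), m, z)" by (cases l) (auto simp: comma_def)
    have m: "m \<in> Arr C" "Dom C m = Cod C k" using l k by (auto simp: comma_def)
    show "Comp (comma C D u d) l (Comp (comma C D u d) g f) = Comp (comma C D u d) (Comp (comma C D u d) l g) f"
      using C.comp_assoc[OF h(1) k(1) m(1)] h(3) k(2) m(2) by (auto simp: comma_def)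
  next
    fix x assume "x \<in> Obj (comma C D u d)"
    then obtain a p where x: "x = (a, p)" "a \<in> Obj C" "p \<in> Arr D" "Dom D p = omap u a" "Cod D p = d"
      by (auto simp: comma_def)
    then show "Ident (comma C D u d) x \<in> Arr (comma C D u d) \<and> Dom (comma C D u d) (Ident (comma C D u d) x) = x \<and>
        Cod (comma C D u d) (Ident (comma C D u d) x) = x"
      using C.id_arr[OF x(2)] F(5)[OF x(2)] D.comp_id_right[OF x(3)] by (simp add: comma_def)
  qed
qed

lemma is_functor_comma_push:
  assumes D: "category D" and u: "is_functor C D u" and q: "q \<in> Arr D"
  shows "is_functor (comma C D u (Dom D q)) (comma C D u (Cod D q)) (comma_push D q)"
proof -
  interpret D: category D by (rule D)
  have 1: "Comp D q p \<in> Arr D" "Dom D (Comp D q p) = Dom D p" "Cod D (Comp D q p) = Cod D q" if "p \<in> Arr D" "Cod D p = Dom D q" for p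
    using D.comp_arr[OF that(1) q] that(2) by auto
  have 2: "Comp D q (Comp D p (amap u f)) = Comp D (Comp D q p) (amap u f)"
    if "p \<in> Arr D" "Cod D p = Dom D q" "f \<in> Arr C" "Dom D p = omap u (Cod C f)" for p f
    using D.comp_assoc[of "amap u f" p q] functorD(2,4)[OF u that(3)] that q by simp
  show ?thesis
    unfolding is_functor_def comma_def comma_push_def using 1 2 by auto
qed

lemma is_functor_comma_proj:
  assumes "category C" shows "is_functor (comma C D u d) C comma_proj"
  using category.dom_cod[OF assms] by (auto simp: is_functor_def comma_def comma_proj_def)

lemma BC_nonempty:
  assumes C: "category C" and a: "a \<in> Obj C"
  shows "topspace (BC C) \<noteq> {}"
proof -
  interpret category C by (rule C)
  have "mk_simplex 0 (\<lambda>_. a) (\<lambda>_ _. Ident C a) \<in> functors (ordinal 0) C"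
    by (rule mk_simplexI) (use a id_arr[OF a] comp_id_left[of "Ident C a"] in auto)
  moreover have "(\<lambda>j::nat. if j = 0 then 1 else 0) \<in> standard_simplex 0" by (simp add: standard_simplex_0)
  ultimately show ?thesis using Bcls_in by blast
qed

section \<open>Comma categories as carriers\<close>

text \<open>The carrier of the simplices that end in \<open>b\<close> is the comma category of
  \<open>u\<close> over \<open>v b\<close>. Three choices of \<open>u\<close> and \<open>v\<close>
  yield the inverse and the two homotopies of Theorem A; with \<open>u\<close> the identity and
  \<open>v\<close> arbitrary, natural transformations are covered.\<close>

locale comma_diagram =
  fixes B :: "('o, 'm) cat" and C :: "('p, 'n) cat" and D :: "('q, 'k) cat"
    and u :: "('p, 'n, 'q, 'k) fnctr" and v :: "('o, 'm, 'q, 'k) fnctr"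
  assumes B: "category B" and C: "category C" and D: "category D"
    and u: "is_functor C D u" and v: "is_functor B D v"
begin

sublocale B: category B by (rule B)
sublocale C: category C by (rule C)
sublocale D: category D by (rule D)

definition fibre :: "'o \<Rightarrow> ('p \<times> 'k, ('p \<times> 'k) \<times> 'n \<times> ('p \<times> 'k)) cat" where
  "fibre b = comma C D u (omap v b)"

lemma category_fibre: "category (fibre b)"
  unfolding fibre_def by (rule comma_category[OF C D u])

lemma is_functor_push: "f \<in> Arr B \<Longrightarrow> is_functor (fibre (Dom B f)) (fibre (Cod B f)) (comma_push D (amap v f))"
  using is_functor_comma_push[OF D u functorD(2)[OF v]] functorD(3,4)[OF v] by (simp add: fibre_def)

lemma is_functor_proj: "is_functor (fibre b) C comma_proj"
  unfolding fibre_def by (rule is_functor_comma_proj[OF C])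

sublocale space_diagram B "\<lambda>b. BC (fibre b)" "\<lambda>f. Bmap (fibre (Cod B f)) (comma_push D (amap v f))"
proof
  show "continuous_map (BC (fibre (Dom B f))) (BC (fibre (Cod B f))) (Bmap (fibre (Cod B f)) (comma_push D (amap v f)))"
    if "f \<in> Arr B" for f by (rule continuous_map_Bmap[OF is_functor_push[OF that]])
next
  fix a w assume a: "a \<in> Obj B" and w: "w \<in> topspace (BC (fibre a))"
  have i: "Ident B a \<in> Arr B" "Dom B (Ident B a) = a" "Cod B (Ident B a) = a" using B.id_arr[OF a] by auto
  have va: "amap v (Ident B a) = Ident D (omap v a)" by (rule functorD(5)[OF v a])
  have "Bmap (fibre a) (comma_push D (amap v (Ident B a))) w = w"
  proof (rule Bmap_id[OF _ _ _ w])
    show "is_functor (fibre a) (fibre a) (comma_push D (amap v (Ident B a)))" using is_functor_push[OF i(1)] i by simp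
    show "omap (comma_push D (amap v (Ident B a))) x = x" if "x \<in> Obj (fibre a)" for x
      using that by (auto simp: fibre_def comma_def comma_push_def va) (metis D.comp_id_left)
    show "amap (comma_push D (amap v (Ident B a))) x = x" if x: "x \<in> Arr (fibre a)" for x
    proof -
      obtain b p h c q where [simp]: "x = ((b, p), h, (c, q))" by (metis prod.collapse)
      have "(b, p) \<in> Obj (fibre a)" "(c, q) \<in> Obj (fibre a)"
        using category.dom_cod[OF category_fibre x] by (auto simp: fibre_def comma_def)
      then have "p \<in> Arr D" "Cod D p = omap v a" "q \<in> Arr D" "Cod D q = omap v a" by (auto simp: fibre_def comma_def)
      then show ?thesis using D.comp_id_left[of p] D.comp_id_left[of q] by (simp add: comma_push_def va)
    qed
  qed
  then show "Bmap (fibre (Cod B (Ident B a))) (comma_push D (amap v (Ident B a))) w = w" using i by simp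
next
  fix f g w assume f: "f \<in> Arr B" and g: "g \<in> Arr B" and fg: "Dom B g = Cod B f" and w: "w \<in> topspace (BC (fibre (Dom B f)))"
  note gf = B.comp_arr[OF f g fg]
  have vf: "amap v f \<in> Arr D" "amap v g \<in> Arr D" "Dom D (amap v g) = Cod D (amap v f)" "Dom D (amap v f) = omap v (Dom B f)"
    using functorD(2-4)[OF v f] functorD(2-4)[OF v g] fg by auto
  have vgf: "amap v (Comp B g f) = Comp D (amap v g) (amap v f)" by (rule functorD(6)[OF v f g fg])
  have o: "Comp D (Comp D (amap v g) (amap v f)) p = Comp D (amap v g) (Comp D (amap v f) p)"
    if "p \<in> Arr D" "Cod D p = omap v (Dom B f)" for p
    using D.comp_assoc[OF that(1) vf(1,2)] vf(3,4) that(2) by simp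
  have "Bmap (fibre (Cod B g)) (comma_push D (amap v g)) (Bmap (fibre (Cod B f)) (comma_push D (amap v f)) w) =
      Bmap (fibre (Cod B g)) (comma_push D (amap v (Comp B g f))) w"
  proof (rule Bmap_compose[OF is_functor_push[OF f] _ _ _ _ w])
    show "is_functor (fibre (Cod B f)) (fibre (Cod B g)) (comma_push D (amap v g))" using is_functor_push[OF g] fg by simp
    show "is_functor (fibre (Dom B f)) (fibre (Cod B g)) (comma_push D (amap v (Comp B g f)))"
      using is_functor_push[of "Comp B g f"] gf by simp
    show "omap (comma_push D (amap v (Comp B g f))) x = omap (comma_push D (amap v g)) (omap (comma_push D (amap v f)) x)"
      if "x \<in> Obj (fibre (Dom B f))" for x
      using that o by (auto simp: fibre_def comma_def comma_push_def vgf)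
    show "amap (comma_push D (amap v (Comp B g f))) x = amap (comma_push D (amap v g)) (amap (comma_push D (amap v f)) x)"
      if x: "x \<in> Arr (fibre (Dom B f))" for x
    proof -
      obtain b p h c q where [simp]: "x = ((b, p), h, (c, q))" by (metis prod.collapse)
      have "(b, p) \<in> Obj (fibre (Dom B f))" "(c, q) \<in> Obj (fibre (Dom B f))"
        using category.dom_cod[OF category_fibre x] by (auto simp: fibre_def comma_def)
      then have "p \<in> Arr D" "Cod D p = omap v (Dom B f)" "q \<in> Arr D" "Cod D q = omap v (Dom B f)" by (auto simp: fibre_def comma_def)
      then show ?thesis using o[of p] o[of q] by (simp add: comma_push_def vgf)
    qed
  qed
  then show "Bmap (fibre (Cod B (Comp B g f))) (comma_push D (amap v (Comp B g f))) w =
      Bmap (fibre (Cod B g)) (comma_push D (amap v g)) (Bmap (fibre (Cod B f)) (comma_push D (amap v f)) w)"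
    using gf by simp
qed

lemma proj_push:
  assumes f: "f \<in> Arr B" and w: "w \<in> topspace (BC (fibre (Dom B f)))"
  shows "Bmap C comma_proj (Bmap (fibre (Cod B f)) (comma_push D (amap v f)) w) = Bmap C comma_proj w"
  by (rule Bmap_compose[OF is_functor_push[OF f] is_functor_proj is_functor_proj _ _ w])
    (auto simp: fibre_def comma_def comma_proj_def comma_push_def)

text \<open>Pushing along an arrow of \<open>B\<close> leaves the underlying chain in
  \<open>C\<close> alone, so the projected family respects the gluing and descends to the
  realization.\<close>

lemma proj_compatible:
  assumes h: "compatible h" and \<theta>: "(m, \<theta>, n) \<in> Arr simplex_category" and x: "x \<in> functors (ordinal n) B" and t: "t \<in> standard_simplex m"
  shows "Bmap C comma_proj (h m (restr (nerve B) (m, \<theta>, n) x) t) = Bmap C comma_proj (h n x (simplex_push m \<theta> t))"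
proof -
  have \<theta>m: "\<theta> m \<le> n" using simplex_arrD(1)[OF \<theta>] by simp
  note X = simplexD(2-4)[OF x \<theta>m order_refl]
  have "h m (restr (nerve B) (m, \<theta>, n) x) t \<in> topspace (BC (fibre (Dom B (amap x (\<theta> m, n)))))"
    using compatibleD(1)[OF h restr_nerve_in[OF \<theta> x] t] X by (simp add: restr_nerve[OF \<theta>])
  then show ?thesis
    using compatibleD(2)[OF h x t \<theta>] proj_push[OF X(1)] X by metis
qed

lemma induced_map:
  assumes h: "compatible h" "\<And>n x. x \<in> functors (ordinal n) B \<Longrightarrow> continuous_map (std n) (BC (fibre (omap x n))) (h n x)"
  obtains G where "continuous_map (BC B) (BC C) G"
    "\<And>n x t. x \<in> functors (ordinal n) B \<Longrightarrow> t \<in> standard_simplex n \<Longrightarrow> G (Bcls B n x t) = Bmap C comma_proj (h n x t)"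
proof (rule realization_lift[where X = "nerve B" and Z = "BC C" and \<phi> = "\<lambda>n x t. Bmap C comma_proj (h n x t)"])
  fix n and x :: "(nat, nat \<times> nat, 'o, 'm) fnctr" assume "x \<in> sections (nerve B) n"
  then have "x \<in> functors (ordinal n) B" by simp
  from continuous_map_compose[OF h(2)[OF this] continuous_map_Bmap[OF is_functor_proj]]
  show "continuous_map (std n) (BC C) (\<lambda>t. Bmap C comma_proj (h n x t))" by (simp add: o_def)
qed (use proj_compatible[OF h(1)] that in auto)

lemma induced_homotopy:
  assumes h: "family {0..1} h"
  obtains H where "continuous_map (prod_topology interval (BC B)) (BC C) H"
    "\<And>s n x t. s \<in> {0..1} \<Longrightarrow> x \<in> functors (ordinal n) B \<Longrightarrow> t \<in> standard_simplex n \<Longrightarrow>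
       H (s, Bcls B n x t) = Bmap C comma_proj (h s n x t)"
proof (rule realization_lift_product[where J = "{0..1}" and X = "nerve B" and Z = "BC C" and
      \<phi> = "\<lambda>s n x t. Bmap C comma_proj (h s n x t)"])
  fix n and x :: "(nat, nat \<times> nat, 'o, 'm) fnctr" assume "x \<in> sections (nerve B) n"
  then have "continuous_map (prod_topology interval (std n)) (BC (fibre (omap x n))) (\<lambda>(s, t). h s n x t)"
    using h by (simp add: family_def)
  from continuous_map_compose[OF this continuous_map_Bmap[OF is_functor_proj]]
  show "continuous_map (prod_topology interval (std n)) (BC C) (\<lambda>(s, t). Bmap C comma_proj (h s n x t))"
    by (simp add: o_def case_prod_unfold)
next
  show "Bmap C comma_proj (h s m (restr (nerve B) (m, \<theta>, n) x) t) = Bmap C comma_proj (h s n x (simplex_push m \<theta> t))"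
    if "(m, \<theta>, n) \<in> Arr simplex_category" "x \<in> sections (nerve B) n" "t \<in> standard_simplex m" "s \<in> {0..1}" for m \<theta> n x s t
    using proj_compatible[OF _ that(1) _ that(3), of "h s" x] h that by (simp add: family_def)
qed (use that in auto)

text \<open>The acyclic carrier principle: two maps that lift to compatible families in the same
  contractible comma categories are homotopic.\<close>

lemma homotopic_induced:
  assumes contr: "\<And>b. b \<in> Obj B \<Longrightarrow> contractible_space (BC (fibre b))" "\<And>b. b \<in> Obj B \<Longrightarrow> Obj (fibre b) \<noteq> {}"
    and h: "compatible h" "\<And>n x. x \<in> functors (ordinal n) B \<Longrightarrow> continuous_map (std n) (BC (fibre (omap x n))) (h n x)"
    and h': "compatible h'" "\<And>n x. x \<in> functors (ordinal n) B \<Longrightarrow> continuous_map (std n) (BC (fibre (omap x n))) (h' n x)"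
    and G: "\<And>n x t. x \<in> functors (ordinal n) B \<Longrightarrow> t \<in> standard_simplex n \<Longrightarrow> G (Bcls B n x t) = Bmap C comma_proj (h n x t)"
    and G': "\<And>n x t. x \<in> functors (ordinal n) B \<Longrightarrow> t \<in> standard_simplex n \<Longrightarrow> G' (Bcls B n x t) = Bmap C comma_proj (h' n x t)"
  shows "homotopic_with (\<lambda>_. True) (BC B) (BC C) G G'"
proof -
  have ne: "topspace (BC (fibre b)) \<noteq> {}" if "b \<in> Obj B" for b
    using contr(2)[OF that] BC_nonempty[OF category_fibre] by blast
  obtain k where k: "family {0..1} k"
    "\<And>n x t. x \<in> functors (ordinal n) B \<Longrightarrow> t \<in> standard_simplex n \<Longrightarrow> k 0 n x t = h n x t"
    "\<And>n x t. x \<in> functors (ordinal n) B \<Longrightarrow> t \<in> standard_simplex n \<Longrightarrow> k 1 n x t = h' n x t"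
    using compatible_families_homotopic[OF contr(1) ne h h'] by blast
  obtain H where H: "continuous_map (prod_topology interval (BC B)) (BC C) H"
    "\<And>s n x t. s \<in> {0..1} \<Longrightarrow> x \<in> functors (ordinal n) B \<Longrightarrow> t \<in> standard_simplex n \<Longrightarrow>
       H (s, Bcls B n x t) = Bmap C comma_proj (k s n x t)"
    using induced_homotopy[OF k(1)] by blast
  have "H (0, p) = G p \<and> H (1, p) = G' p" if p: "p \<in> topspace (BC B)" for p
  proof -
    obtain n x t where x: "x \<in> functors (ordinal n) B" "t \<in> standard_simplex n" "p = Bcls B n x t" by (rule BC_cases[OF p])
    show ?thesis using H(2)[OF _ x(1,2)] k(2,3)[OF x(1,2)] G[OF x(1,2)] G'[OF x(1,2)] x(3) by simp
  qed
  then show ?thesis using H(1) by (subst homotopic_with) auto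
qed

text \<open>A functor \<open>F\<close> with a natural transformation from \<open>u \<circ> F\<close> to \<open>v\<close> sends a chain in \<open>B\<close> to
  a chain in the fibre over its last vertex.\<close>

definition chain_point where
  "chain_point F \<alpha> n x i = (omap F (omap x i), Comp D (amap v (amap x (i, n))) (\<alpha> (omap x i)))"

definition chain where
  "chain F \<alpha> n x = mk_simplex n (chain_point F \<alpha> n x)
     (\<lambda>i j. (chain_point F \<alpha> n x i, amap F (amap x (i, j)), chain_point F \<alpha> n x j))"

context
  fixes F :: "('o, 'm, 'p, 'n) fnctr" and \<alpha> :: "'o \<Rightarrow> 'k"
  assumes F: "is_functor B C F"
    and \<alpha>: "\<And>a. a \<in> Obj B \<Longrightarrow> \<alpha> a \<in> Arr D \<and> Dom D (\<alpha> a) = omap u (omap F a) \<and> Cod D (\<alpha> a) = omap v a"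
    and natural: "\<And>f. f \<in> Arr B \<Longrightarrow> Comp D (amap v f) (\<alpha> (Dom B f)) = Comp D (\<alpha> (Cod B f)) (amap u (amap F f))"
begin

text \<open>Naturality of \<open>\<alpha>\<close> identifies the structure arrow at vertex
  \<open>i\<close> with the one at a later vertex \<open>j\<close> composed with the image of the
  arrow between them.\<close>

lemma chain_in:
  assumes x: "x \<in> functors (ordinal n) B"
  shows "chain F \<alpha> n x \<in> functors (ordinal n) (fibre (omap x n))"
proof -
  note X = simplexD[OF x]
  have p: "Comp D (amap v (amap x (i, n))) (\<alpha> (omap x i)) \<in> Arr D \<and>
      Dom D (Comp D (amap v (amap x (i, n))) (\<alpha> (omap x i))) = omap u (omap F (omap x i)) \<and>
      Cod D (Comp D (amap v (amap x (i, n))) (\<alpha> (omap x i))) = omap v (omap x n)" if "i \<le> n" for i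
    using D.comp_arr[of "\<alpha> (omap x i)" "amap v (amap x (i, n))"] \<alpha>[OF X(1)[OF that]]
      X(2-4)[OF that order_refl] functorD(2-4)[OF v, of "amap x (i, n)"] by simp
  have q: "Comp D (amap v (amap x (i, n))) (\<alpha> (omap x i)) =
      Comp D (Comp D (amap v (amap x (j, n))) (\<alpha> (omap x j))) (amap u (amap F (amap x (i, j))))" if ij: "i \<le> j" "j \<le> n" for i j
  proof -
    let ?f = "amap x (i, j)" and ?g = "amap x (j, n)"
    have f: "?f \<in> Arr B" "Dom B ?f = omap x i" "Cod B ?f = omap x j" using X(2-4)[OF ij] .
    have g: "?g \<in> Arr B" "Dom B ?g = omap x j" using X(2,3)[OF ij(2) order_refl] .
    have vf: "amap v ?f \<in> Arr D" "Dom D (amap v ?f) = omap v (omap x i)" "Cod D (amap v ?f) = omap v (omap x j)"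
      using functorD(2-4)[OF v f(1)] f by auto
    have vg: "amap v ?g \<in> Arr D" "Dom D (amap v ?g) = omap v (omap x j)"
      using functorD(2,3)[OF v g(1)] g by auto
    have Ff: "amap u (amap F ?f) \<in> Arr D" "Cod D (amap u (amap F ?f)) = omap u (omap F (omap x j))"
      using functorD(2,4)[OF u functorD(2)[OF F f(1)]] functorD(4)[OF F f(1)] f by auto
    have ai: "i \<le> n" using ij by simp
    note ai = \<alpha>[OF X(1)[OF ai]] and aj = \<alpha>[OF X(1)[OF ij(2)]]
    have "amap v (amap x (i, n)) = Comp D (amap v ?g) (amap v ?f)"
      using X(6)[OF ij order_refl] functorD(6)[OF v f(1) g(1)] f g by simp
    then have "Comp D (amap v (amap x (i, n))) (\<alpha> (omap x i)) = Comp D (amap v ?g) (Comp D (amap v ?f) (\<alpha> (omap x i)))"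
      using D.comp_assoc[of "\<alpha> (omap x i)" "amap v ?f" "amap v ?g"] ai vf vg by simp
    also have "Comp D (amap v ?f) (\<alpha> (omap x i)) = Comp D (\<alpha> (omap x j)) (amap u (amap F ?f))"
      using natural[OF f(1)] f by simp
    also have "Comp D (amap v ?g) \<dots> = Comp D (Comp D (amap v ?g) (\<alpha> (omap x j))) (amap u (amap F ?f))"
      using D.comp_assoc[of "amap u (amap F ?f)" "\<alpha> (omap x j)" "amap v ?g"] aj Ff vg by simp
    finally show ?thesis .
  qed
  show ?thesis
    unfolding chain_def
  proof (rule mk_simplexI)
    show "chain_point F \<alpha> n x i \<in> Obj (fibre (omap x n))" if "i \<le> n" for i
      using p[OF that] functorD(1)[OF F X(1)[OF that]] by (simp add: chain_point_def fibre_def comma_def)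
    fix i j assume ij: "i \<le> j" "j \<le> n"
    show "(chain_point F \<alpha> n x i, amap F (amap x (i, j)), chain_point F \<alpha> n x j) \<in> Arr (fibre (omap x n)) \<and>
       Dom (fibre (omap x n)) (chain_point F \<alpha> n x i, amap F (amap x (i, j)), chain_point F \<alpha> n x j) = chain_point F \<alpha> n x i \<and>
       Cod (fibre (omap x n)) (chain_point F \<alpha> n x i, amap F (amap x (i, j)), chain_point F \<alpha> n x j) = chain_point F \<alpha> n x j"
      using p[OF ij(2)] q[OF ij] functorD(2-4)[OF F X(2)[OF ij]] X(3,4)[OF ij]
      by (simp add: chain_point_def fibre_def comma_def)
  next
    show "(chain_point F \<alpha> n x i, amap F (amap x (i, i)), chain_point F \<alpha> n x i) = Ident (fibre (omap x n)) (chain_point F \<alpha> n x i)"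
      if "i \<le> n" for i
      using functorD(5)[OF F X(1)[OF that]] X(5)[OF that] by (simp add: chain_point_def fibre_def comma_def)
    fix i j k assume "i \<le> j" "j \<le> k" "k \<le> n"
    then show "(chain_point F \<alpha> n x i, amap F (amap x (i, k)), chain_point F \<alpha> n x k) =
       Comp (fibre (omap x n)) (chain_point F \<alpha> n x j, amap F (amap x (j, k)), chain_point F \<alpha> n x k)
        (chain_point F \<alpha> n x i, amap F (amap x (i, j)), chain_point F \<alpha> n x j)"
      using X(6)[of i j k] functorD(6)[OF F, of "amap x (i, j)" "amap x (j, k)"] X(2,4)[of i j] X(2,3)[of j k]
      by (simp add: chain_point_def fibre_def comma_def)
  qed
qed

lemma proj_chain:
  assumes x: "x \<in> functors (ordinal n) B" and t: "t \<in> standard_simplex n"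
  shows "Bmap C comma_proj (Bcls (fibre (omap x n)) n (chain F \<alpha> n x) t) = Bmap C F (Bcls B n x t)"
proof -
  have "nerve_map comma_proj n (chain F \<alpha> n x) = nerve_map F n x"
    by (simp add: nerve_map_eq chain_def chain_point_def comma_proj_def cong: mk_simplex_cong)
  then show ?thesis
    by (simp add: Bmap_cls[OF is_functor_proj chain_in[OF x] t] Bmap_cls[OF F x t])
qed

lemma continuous_map_chain:
  "x \<in> functors (ordinal n) B \<Longrightarrow> continuous_map (std n) (BC (fibre (omap x n))) (Bcls (fibre (omap x n)) n (chain F \<alpha> n x))"
  by (rule continuous_map_cls) (simp add: chain_in)

lemma compatible_chain: "compatible (\<lambda>n x. Bcls (fibre (omap x n)) n (chain F \<alpha> n x))"
  unfolding compatible_def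
proof (intro conjI allI ballI impI)
  show "Bcls (fibre (omap x n)) n (chain F \<alpha> n x) t \<in> topspace (BC (fibre (omap x n)))"
    if "x \<in> functors (ordinal n) B" "t \<in> standard_simplex n" for n x t
    by (rule Bcls_in[OF chain_in]) (use that in auto)
  fix m \<theta> n x t assume x: "x \<in> functors (ordinal n) B" and t: "t \<in> standard_simplex m" and \<theta>: "(m, \<theta>, n) \<in> Arr simplex_category"
  note A = simplex_arrD[OF \<theta>] and X = simplexD[OF x]
  let ?x = "restr (nerve B) (m, \<theta>, n) x" and ?f = "amap x (\<theta> m, n)"
  have x': "?x \<in> functors (ordinal m) B" by (rule restr_nerve_in[OF \<theta> x])
  have om: "omap ?x m = omap x (\<theta> m)" by (simp add: restr_nerve[OF \<theta>])
  have f: "?f \<in> Arr B" "Dom B ?f = omap x (\<theta> m)" "Cod B ?f = omap x n" using X(2-4)[OF A(1) order_refl] by auto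
  have p: "Comp D (amap v ?f) (Comp D (amap v (amap x (\<theta> i, \<theta> m))) (\<alpha> (omap x (\<theta> i)))) =
      Comp D (amap v (amap x (\<theta> i, n))) (\<alpha> (omap x (\<theta> i)))" if i: "i \<le> m" for i
  proof -
    let ?g = "amap x (\<theta> i, \<theta> m)"
    have g: "?g \<in> Arr B" "Dom B ?g = omap x (\<theta> i)" "Cod B ?g = omap x (\<theta> m)" using X(2-4)[OF A(2)[OF i] A(1)] by auto
    have "amap v (amap x (\<theta> i, n)) = Comp D (amap v ?f) (amap v ?g)"
      using X(6)[OF A(2)[OF i] A(1) order_refl] functorD(6)[OF v g(1) f(1)] f g by simp
    then show ?thesis
      using D.comp_assoc[of "\<alpha> (omap x (\<theta> i))" "amap v ?g" "amap v ?f"] \<alpha>[OF X(1)[OF A(1)[OF i]]]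
        functorD(2-4)[OF v g(1)] functorD(2,3)[OF v f(1)] f g by simp
  qed
  have "nerve_map (comma_push D (amap v ?f)) m (chain F \<alpha> m ?x) = restr (nerve (fibre (omap x n))) (m, \<theta>, n) (chain F \<alpha> n x)"
    unfolding nerve_map_eq restr_nerve[OF \<theta>]
    by (rule mk_simplex_cong) (simp_all add: chain_def chain_point_def comma_push_def p A restr_nerve[OF \<theta>])
  then have "Bcls (fibre (omap x n)) m (nerve_map (comma_push D (amap v ?f)) m (chain F \<alpha> m ?x)) t =
      Bcls (fibre (omap x n)) n (chain F \<alpha> n x) (simplex_push m \<theta> t)"
    using Bcls_glue[OF \<theta> chain_in[OF x] t] by simp
  moreover have "is_functor (fibre (omap ?x m)) (fibre (omap x n)) (comma_push D (amap v ?f))"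
    using is_functor_push[OF f(1)] f om by simp
  note Bmap_cls[OF this chain_in[OF x'] t]
  ultimately show "Bmap (fibre (Cod B ?f)) (comma_push D (amap v ?f)) (Bcls (fibre (omap ?x m)) m (chain F \<alpha> m ?x) t) =
      Bcls (fibre (omap x n)) n (chain F \<alpha> n x) (simplex_push m \<theta> t)"
    unfolding f(3) by simp
qed

end

end

section \<open>Natural transformations and Theorem A\<close>

lemma Bmap_commute:
  assumes u: "is_functor C D u" "is_functor D E v" and u': "is_functor C D' u'" "is_functor D' E v'"
    and o: "\<And>a. a \<in> Obj C \<Longrightarrow> omap v (omap u a) = omap v' (omap u' a)"
    and a: "\<And>f. f \<in> Arr C \<Longrightarrow> amap v (amap u f) = amap v' (amap u' f)"
    and p: "p \<in> topspace (BC C)"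
  shows "Bmap E v (Bmap D u p) = Bmap E v' (Bmap D' u' p)"
proof -
  let ?w = "\<lparr>omap = \<lambda>a. omap v (omap u a), amap = \<lambda>f. amap v (amap u f)\<rparr>"
  have w: "is_functor C E ?w" using functorD[OF u(1)] functorD[OF u(2)] by (simp add: is_functor_def)
  have "Bmap E v (Bmap D u p) = Bmap E ?w p" by (rule Bmap_compose[OF u w _ _ p]) simp_all
  also have "\<dots> = Bmap E v' (Bmap D' u' p)" by (rule Bmap_compose[OF u' w _ _ p, symmetric]) (simp_all add: o a)
  finally show ?thesis .
qed

definition natural_transformation ::
  "('o, 'm) cat \<Rightarrow> ('p, 'n) cat \<Rightarrow> ('o, 'm, 'p, 'n) fnctr \<Rightarrow> ('o, 'm, 'p, 'n) fnctr \<Rightarrow> ('o \<Rightarrow> 'n) \<Rightarrow> bool" where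
  "natural_transformation C D F G \<alpha> \<longleftrightarrow>
    (\<forall>a \<in> Obj C. \<alpha> a \<in> Arr D \<and> Dom D (\<alpha> a) = omap F a \<and> Cod D (\<alpha> a) = omap G a) \<and>
    (\<forall>f \<in> Arr C. Comp D (amap G f) (\<alpha> (Dom C f)) = Comp D (\<alpha> (Cod C f)) (amap F f))"

lemma terminal_comma_id:
  assumes D: "category D" and d: "d \<in> Obj D"
  shows "terminal (comma D D id_functor d) (d, Ident D d)"
proof -
  interpret category D by (rule D)
  have i: "Ident D d \<in> Arr D" "Dom D (Ident D d) = d" "Cod D (Ident D d) = d" using id_arr[OF d] by auto
  have id: "Comp D (Ident D d) q = q" if "q \<in> Arr D" "Cod D q = d" for q using comp_id_left[OF that(1)] that(2) by simp
  have "\<exists>!f. f \<in> Arr (comma D D id_functor d) \<and> Dom (comma D D id_functor d) f = x \<and>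
      Cod (comma D D id_functor d) f = (d, Ident D d)" if xO: "x \<in> Obj (comma D D id_functor d)" for x
  proof (rule ex1I)
    obtain a p where x: "x = (a, p)" "p \<in> Arr D" "Dom D p = a" "Cod D p = d"
      using xO unfolding comma_def by auto
    show "(x, snd x, (d, Ident D d)) \<in> Arr (comma D D id_functor d) \<and> Dom (comma D D id_functor d) (x, snd x, (d, Ident D d)) = x \<and>
        Cod (comma D D id_functor d) (x, snd x, (d, Ident D d)) = (d, Ident D d)"
      using x i id[of p] by (simp add: comma_def)
    fix f assume f: "f \<in> Arr (comma D D id_functor d) \<and> Dom (comma D D id_functor d) f = x \<and> Cod (comma D D id_functor d) f = (d, Ident D d)"
    then obtain q where q: "f = (x, q, (d, Ident D d))" by (cases f) (simp add: comma_def)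
    then have "q \<in> Arr D" "Cod D q = d" "p = Comp D (Ident D d) q" using f x by (auto simp: comma_def)
    then show "f = (x, snd x, (d, Ident D d))" using q x id by simp
  qed
  then show ?thesis using i d by (auto simp: terminal_def comma_def)
qed

lemma contractible_comma_id:
  assumes D: "category D" and d: "d \<in> Obj D"
  shows "contractible_space (BC (comma D D id_functor d))" "Obj (comma D D id_functor d) \<noteq> {}"
  using contractible_terminal[OF comma_category[OF D D is_functor_id] terminal_comma_id[OF assms]]
    terminal_comma_id[OF assms] by (auto simp: terminal_def)

text \<open>Both functors are carried by the comma categories of the identity of \<open>D\<close>
  over the objects \<open>G a\<close>: \<open>F\<close> through \<open>\<alpha>\<close>, and
  \<open>G\<close> through identities. These comma categories have terminal objects, which takes the
  place of a triangulation of prisms.\<close>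

lemma natural_transformation_homotopic:
  assumes C: "category C" and D: "category D" and F: "is_functor C D F" and G: "is_functor C D G"
    and \<alpha>: "natural_transformation C D F G \<alpha>"
  shows "homotopic_with (\<lambda>_. True) (BC C) (BC D) (Bmap D F) (Bmap D G)"
proof -
  interpret DD: category D by (rule D)
  interpret comma_diagram C D D id_functor G by (intro comma_diagram.intro C D G is_functor_id)
  have 1: "\<alpha> a \<in> Arr D \<and> Dom D (\<alpha> a) = omap id_functor (omap F a) \<and> Cod D (\<alpha> a) = omap G a" if "a \<in> Obj C" for a
    using \<alpha> that by (auto simp: natural_transformation_def)
  have 2: "Comp D (amap G f) (\<alpha> (Dom C f)) = Comp D (\<alpha> (Cod C f)) (amap id_functor (amap F f))" if "f \<in> Arr C" for f
    using \<alpha> that by (auto simp: natural_transformation_def)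
  let ?\<iota> = "\<lambda>a. Ident D (omap G a)"
  have 3: "?\<iota> a \<in> Arr D \<and> Dom D (?\<iota> a) = omap id_functor (omap G a) \<and> Cod D (?\<iota> a) = omap G a" if "a \<in> Obj C" for a
    using DD.id_arr[OF functorD(1)[OF G that]] by simp
  have 4: "Comp D (amap G f) (?\<iota> (Dom C f)) = Comp D (?\<iota> (Cod C f)) (amap id_functor (amap G f))" if "f \<in> Arr C" for f
    using DD.comp_id_left[OF functorD(2)[OF G that]] DD.comp_id_right[OF functorD(2)[OF G that]] functorD(3,4)[OF G that] by simp
  show ?thesis
  proof (rule homotopic_induced)
    show "contractible_space (BC (fibre b))" "Obj (fibre b) \<noteq> {}" if "b \<in> Obj C" for b
      unfolding fibre_def using contractible_comma_id[OF D functorD(1)[OF G that]] by auto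
    show "compatible (\<lambda>n x. Bcls (fibre (omap x n)) n (chain F \<alpha> n x))" by (rule compatible_chain[OF F 1 2])
    show "compatible (\<lambda>n x. Bcls (fibre (omap x n)) n (chain G ?\<iota> n x))" by (rule compatible_chain[OF G 3 4])
    fix n x assume x: "x \<in> functors (ordinal n) C"
    show "continuous_map (std n) (BC (fibre (omap x n))) (Bcls (fibre (omap x n)) n (chain F \<alpha> n x))"
      by (rule continuous_map_chain[OF F 1 2 x])
    show "continuous_map (std n) (BC (fibre (omap x n))) (Bcls (fibre (omap x n)) n (chain G ?\<iota> n x))"
      by (rule continuous_map_chain[OF G 3 4 x])
    fix t :: "nat \<Rightarrow> real" assume t: "t \<in> standard_simplex n"
    show "Bmap D F (Bcls C n x t) = Bmap D comma_proj (Bcls (fibre (omap x n)) n (chain F \<alpha> n x) t)"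
      by (rule proj_chain[OF F 1 2 x t, symmetric])
    show "Bmap D G (Bcls C n x t) = Bmap D comma_proj (Bcls (fibre (omap x n)) n (chain G ?\<iota> n x) t)"
      by (rule proj_chain[OF G 3 4 x t, symmetric])
  qed
qed

text \<open>A homotopy inverse and the two homotopies are obtained by acyclic
  carriers, the carrier of a simplex being the comma category over its last vertex.\<close>

theorem Theorem_A:
  assumes C: "category C" and D: "category D" and u: "is_functor C D u"
    and contr: "\<And>d. d \<in> Obj D \<Longrightarrow> contractible_space (BC (comma C D u d))"
    and ne: "\<And>d. d \<in> Obj D \<Longrightarrow> Obj (comma C D u d) \<noteq> {}"
  shows "weak_equivalence C D u"
proof -
  interpret DD: category D by (rule D)
  \<comment> \<open>\<open>M\<close> carries the inverse, \<open>N\<close> the homotopy on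
    \<open>D\<close> and \<open>P\<close> the homotopy on \<open>C\<close>.\<close>
  interpret M: comma_diagram D C D u id_functor by (intro comma_diagram.intro C D u is_functor_id)
  interpret N: comma_diagram D D D id_functor id_functor by (intro comma_diagram.intro D is_functor_id)
  interpret P: comma_diagram C C D u u by (intro comma_diagram.intro C D u)
  have Mf: "M.fibre d = comma C D u d" and Nf: "N.fibre d = comma D D id_functor d" for d
    by (simp_all add: M.fibre_def N.fibre_def)
  have Pf: "P.fibre a = M.fibre (omap u a)" for a by (simp add: M.fibre_def P.fibre_def)
  have "topspace (BC (M.fibre d)) \<noteq> {}" if "d \<in> Obj D" for d
    using BC_nonempty[OF M.category_fibre] ne[OF that] unfolding Mf by blast
  then obtain h where h: "M.compatible h"
    "\<And>n x. x \<in> functors (ordinal n) D \<Longrightarrow> continuous_map (std n) (BC (M.fibre (omap x n))) (h n x)"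
    using M.compatible_family_exists contr unfolding Mf by blast
  obtain G where G: "continuous_map (BC D) (BC C) G"
    "\<And>n x t. x \<in> functors (ordinal n) D \<Longrightarrow> t \<in> standard_simplex n \<Longrightarrow> G (Bcls D n x t) = Bmap C comma_proj (h n x t)"
    using M.induced_map[OF h] by blast
  \<comment> \<open>\<open>w\<close> applies \<open>u\<close> to the first components; it takes the
    carriers of the inverse to the slices of \<open>D\<close>.\<close>
  define w where "w = (\<lparr>omap = (\<lambda>(a, p). (omap u a, p)), amap = (\<lambda>((a, p), f, (b, q)). ((omap u a, p), amap u f, (omap u b, q)))\<rparr> ::
    ('a \<times> 'd, ('a \<times> 'd) \<times> 'b \<times> ('a \<times> 'd), 'c \<times> 'd, ('c \<times> 'd) \<times> 'd \<times> ('c \<times> 'd)) fnctr)"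
  have w: "is_functor (M.fibre d) (N.fibre d) w" for d
    using functorD[OF u] by (auto simp: is_functor_def Mf Nf comma_def w_def)
  have id1: "Ident D a \<in> Arr D \<and> Dom D (Ident D a) = omap id_functor (omap id_functor a) \<and> Cod D (Ident D a) = omap id_functor a"
    if "a \<in> Obj D" for a using DD.id_arr[OF that] by simp
  have id2: "Comp D (amap id_functor f) (Ident D (Dom D f)) = Comp D (Ident D (Cod D f)) (amap id_functor (amap id_functor f))"
    if "f \<in> Arr D" for f using DD.comp_id_left[OF that] DD.comp_id_right[OF that] by simp
  have idu1: "Ident D (omap u a) \<in> Arr D \<and> Dom D (Ident D (omap u a)) = omap u (omap id_functor a) \<and> Cod D (Ident D (omap u a)) = omap u a"
    if "a \<in> Obj C" for a using DD.id_arr[OF functorD(1)[OF u that]] by simp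
  have idu2: "Comp D (amap u f) (Ident D (omap u (Dom C f))) = Comp D (Ident D (omap u (Cod C f))) (amap u (amap id_functor f))"
    if "f \<in> Arr C" for f
    using DD.comp_id_left[OF functorD(2)[OF u that]] DD.comp_id_right[OF functorD(2)[OF u that]] functorD(3,4)[OF u that] by simp
  have idC: "Bmap C id_functor p = p" if "p \<in> topspace (BC C)" for p by (rule Bmap_id[OF is_functor_id _ _ that]) simp_all
  have idD: "Bmap D id_functor p = p" if "p \<in> topspace (BC D)" for p by (rule Bmap_id[OF is_functor_id _ _ that]) simp_all
  \<comment> \<open>Both maps are carried by the slices of \<open>D\<close>, which have terminal
    objects: the identity through chains, the composite through the image of \<open>h\<close> under
    \<open>w\<close>.\<close>
  have uG: "homotopic_with (\<lambda>_. True) (BC D) (BC D) id (Bmap D u \<circ> G)"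
  proof (rule N.homotopic_induced)
    show "contractible_space (BC (N.fibre b))" "Obj (N.fibre b) \<noteq> {}" if "b \<in> Obj D" for b
      unfolding Nf using contractible_comma_id[OF D that] by auto
    show "N.compatible (\<lambda>n x. Bcls (N.fibre (omap x n)) n (N.chain id_functor (Ident D) n x))"
      by (rule N.compatible_chain[OF is_functor_id id1 id2])
    show "N.compatible (\<lambda>n x t. Bmap (N.fibre (omap x n)) w (h n x t))"
      unfolding N.compatible_def
    proof (intro conjI allI ballI impI)
      show "Bmap (N.fibre (omap x n)) w (h n x t) \<in> topspace (BC (N.fibre (omap x n)))"
        if "x \<in> functors (ordinal n) D" "t \<in> standard_simplex n" for n x t
        using continuous_map_funspace[OF continuous_map_Bmap[OF w]] M.compatibleD(1)[OF h(1) that] by blast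
      fix m \<theta> n x t assume x: "x \<in> functors (ordinal n) D" and t: "t \<in> standard_simplex m" and \<theta>: "(m, \<theta>, n) \<in> Arr simplex_category"
      let ?x = "restr (nerve D) (m, \<theta>, n) x" and ?f = "amap x (\<theta> m, n)"
      have \<theta>m: "\<theta> m \<le> n" using simplex_arrD(1)[OF \<theta>] by simp
      note f = simplexD(2-4)[OF x \<theta>m order_refl]
      have om: "omap ?x m = Dom D ?f" using f by (simp add: restr_nerve[OF \<theta>])
      have p: "h m ?x t \<in> topspace (BC (M.fibre (Dom D ?f)))"
        using M.compatibleD(1)[OF h(1) restr_nerve_in[OF \<theta> x] t] om by simp
      have Mp: "is_functor (M.fibre (Dom D ?f)) (M.fibre (Cod D ?f)) (comma_push D ?f)"
        and Np: "is_functor (N.fibre (Dom D ?f)) (N.fibre (Cod D ?f)) (comma_push D ?f)"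
        using M.is_functor_push[OF f(1)] N.is_functor_push[OF f(1)] by simp_all
      have "Bmap (N.fibre (Cod D ?f)) (comma_push D ?f) (Bmap (N.fibre (Dom D ?f)) w (h m ?x t)) =
          Bmap (N.fibre (Cod D ?f)) w (Bmap (M.fibre (Cod D ?f)) (comma_push D ?f) (h m ?x t))"
        by (rule Bmap_commute[OF w Np Mp w _ _ p]) (auto simp: Mf comma_def comma_push_def w_def)
      also have "Bmap (M.fibre (Cod D ?f)) (comma_push D ?f) (h m ?x t) = h n x (simplex_push m \<theta> t)"
        using M.compatibleD(2)[OF h(1) x t \<theta>] by simp
      finally show "Bmap (N.fibre (Cod D ?f)) (comma_push D (amap id_functor ?f)) (Bmap (N.fibre (omap ?x m)) w (h m ?x t)) =
          Bmap (N.fibre (omap x n)) w (h n x (simplex_push m \<theta> t))"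
        using f om by simp
    qed
    fix n x assume x: "x \<in> functors (ordinal n) D"
    show "continuous_map (std n) (BC (N.fibre (omap x n))) (Bcls (N.fibre (omap x n)) n (N.chain id_functor (Ident D) n x))"
      by (rule N.continuous_map_chain[OF is_functor_id id1 id2 x])
    from continuous_map_compose[OF h(2)[OF x] continuous_map_Bmap[OF w]]
    show "continuous_map (std n) (BC (N.fibre (omap x n))) (\<lambda>t. Bmap (N.fibre (omap x n)) w (h n x t))"
      by (simp add: o_def)
    fix t :: "nat \<Rightarrow> real" assume t: "t \<in> standard_simplex n"
    show "id (Bcls D n x t) = Bmap D comma_proj (Bcls (N.fibre (omap x n)) n (N.chain id_functor (Ident D) n x) t)"
      using N.proj_chain[OF is_functor_id id1 id2 x t] idD[OF Bcls_in[OF x t]] by simp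
    have p: "h n x t \<in> topspace (BC (M.fibre (omap x n)))" by (rule M.compatibleD(1)[OF h(1) x t])
    have "Bmap D u (Bmap C comma_proj (h n x t)) = Bmap D comma_proj (Bmap (N.fibre (omap x n)) w (h n x t))"
      by (rule Bmap_commute[OF M.is_functor_proj u w N.is_functor_proj _ _ p]) (auto simp: Mf comma_def comma_proj_def w_def)
    then show "(Bmap D u \<circ> G) (Bcls D n x t) = Bmap D comma_proj (Bmap (N.fibre (omap x n)) w (h n x t))"
      using G(2)[OF x t] by simp
  qed
  \<comment> \<open>Both maps are carried by the comma categories over the objects
    \<open>u a\<close>, contractible by hypothesis; for the composite, \<open>h\<close> is evaluated
    on the image chain.\<close>
  have Gu: "homotopic_with (\<lambda>_. True) (BC C) (BC C) id (G \<circ> Bmap D u)"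
  proof (rule P.homotopic_induced)
    show "contractible_space (BC (P.fibre b))" "Obj (P.fibre b) \<noteq> {}" if "b \<in> Obj C" for b
      unfolding Pf Mf using contr ne functorD(1)[OF u that] by auto
    show "P.compatible (\<lambda>n x. Bcls (P.fibre (omap x n)) n (P.chain id_functor (\<lambda>a. Ident D (omap u a)) n x))"
      by (rule P.compatible_chain[OF is_functor_id idu1 idu2])
    have ou: "omap (nerve_map u n x) n = omap u (omap x n)" for n x by (simp add: nerve_map_eq)
    show "P.compatible (\<lambda>n x. h n (nerve_map u n x))"
      unfolding P.compatible_def
    proof (intro conjI allI ballI impI)
      show "h n (nerve_map u n x) t \<in> topspace (BC (P.fibre (omap x n)))"
        if "x \<in> functors (ordinal n) C" "t \<in> standard_simplex n" for n x t
        using M.compatibleD(1)[OF h(1) nerve_map_in[OF u that(1)] that(2)] by (simp add: Pf ou)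
      fix m \<theta> n x t assume x: "x \<in> functors (ordinal n) C" and t: "t \<in> standard_simplex m" and \<theta>: "(m, \<theta>, n) \<in> Arr simplex_category"
      let ?f = "amap x (\<theta> m, n)"
      have \<theta>m: "\<theta> m \<le> n" using simplex_arrD(1)[OF \<theta>] by simp
      note f = simplexD(2-4)[OF x \<theta>m order_refl]
      have a: "amap (nerve_map u n x) (\<theta> m, n) = amap u ?f" using \<theta>m by (simp add: nerve_map_eq)
      have r: "nerve_map u m (restr (nerve C) (m, \<theta>, n) x) = restr (nerve D) (m, \<theta>, n) (nerve_map u n x)"
        using sset_map_nerve_map[OF u] \<theta> x by (simp add: sset_map_def)
      show "Bmap (P.fibre (Cod C ?f)) (comma_push D (amap u ?f)) (h m (nerve_map u m (restr (nerve C) (m, \<theta>, n) x)) t) =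
          h n (nerve_map u n x) (simplex_push m \<theta> t)"
        using M.compatibleD(2)[OF h(1) nerve_map_in[OF u x] t \<theta>] functorD(4)[OF u f(1)] unfolding a r Pf by simp
    qed
    fix n x assume x: "x \<in> functors (ordinal n) C"
    show "continuous_map (std n) (BC (P.fibre (omap x n))) (Bcls (P.fibre (omap x n)) n (P.chain id_functor (\<lambda>a. Ident D (omap u a)) n x))"
      by (rule P.continuous_map_chain[OF is_functor_id idu1 idu2 x])
    show "continuous_map (std n) (BC (P.fibre (omap x n))) (h n (nerve_map u n x))"
      using h(2)[OF nerve_map_in[OF u x]] by (simp add: Pf ou)
    fix t :: "nat \<Rightarrow> real" assume t: "t \<in> standard_simplex n"
    show "id (Bcls C n x t) = Bmap C comma_proj (Bcls (P.fibre (omap x n)) n (P.chain id_functor (\<lambda>a. Ident D (omap u a)) n x) t)"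
      using P.proj_chain[OF is_functor_id idu1 idu2 x t] idC[OF Bcls_in[OF x t]] by simp
    show "(G \<circ> Bmap D u) (Bcls C n x t) = Bmap C comma_proj (h n (nerve_map u n x) t)"
      using G(2)[OF nerve_map_in[OF u x] t] Bmap_cls[OF u x t] by simp
  qed
  have "weak_homotopy_equivalence (BC C) (BC D) (Bmap D u)"
    by (rule homotopy_equivalence_imp_weak[OF continuous_map_Bmap[OF u] G(1) Gu uG])
  then show ?thesis
    using u sset_map_nerve_map[OF u] by (simp add: weak_equivalence_def sset_weak_equivalence_def)
qed

lemma contractible_zigzag:
  assumes C: "category C" and P: "is_functor C C P" and e: "e \<in> Obj C"
    and i: "natural_transformation C C id_functor P \<eta>"
    and j: "natural_transformation C C \<lparr>omap = \<lambda>_. e, amap = \<lambda>_. Ident C e\<rparr> P \<epsilon>"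
  shows "contractible_space (BC C)"
proof -
  interpret category C by (rule C)
  let ?K = "\<lparr>omap = \<lambda>_. e, amap = \<lambda>_. Ident C e\<rparr>"
  have ie: "Ident C e \<in> Arr C" "Dom C (Ident C e) = e" "Cod C (Ident C e) = e" "Comp C (Ident C e) (Ident C e) = Ident C e"
    using id_arr[OF e] comp_id_left[of "Ident C e"] by auto
  have K: "is_functor C C ?K" using e ie by (simp add: is_functor_def)
  define v where "v = mk_simplex 0 (\<lambda>_. e) (\<lambda>_ _. Ident C e)"
  define one where "one = (\<lambda>j::nat. if j = 0 then 1 else (0::real))"
  have v: "v \<in> functors (ordinal 0) C" unfolding v_def by (rule mk_simplexI) (use e ie in auto)
  \<comment> \<open>All simplices go to degenerate simplices on \<open>e\<close>, hence all points
    to one point.\<close>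
  have const: "Bmap C ?K p = Bcls C 0 v one" if p: "p \<in> topspace (BC C)" for p
  proof -
    obtain n x t where x: "x \<in> functors (ordinal n) C" and t: "t \<in> standard_simplex n" and p: "p = Bcls C n x t"
      by (rule BC_cases[OF p])
    have \<theta>: "(n, restrict (\<lambda>i. 0) {..n}, 0) \<in> Arr simplex_category" by (rule simplex_arrI) auto
    have "nerve_map ?K n x = restr (nerve C) (n, restrict (\<lambda>i. 0) {..n}, 0) v"
      unfolding restr_nerve[OF \<theta>] nerve_map_eq by (rule mk_simplex_cong) (simp_all add: v_def)
    moreover have "simplex_push n (restrict (\<lambda>i. 0) {..n}) t = one"
    proof -
      have "simplex_push n (restrict (\<lambda>i. 0) {..n}) t \<in> standard_simplex 0" by (rule simplex_push_in[OF \<theta> t])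
      then show ?thesis by (simp add: standard_simplex_0 one_def)
    qed
    ultimately show ?thesis using Bmap_cls[OF K x t] Bcls_glue[OF \<theta> v t] p by simp
  qed
  have "homotopic_with (\<lambda>_. True) (BC C) (BC C) (Bmap C id_functor) (Bmap C ?K)"
    using natural_transformation_homotopic[OF C C is_functor_id P i] natural_transformation_homotopic[OF C C K P j]
    by (meson homotopic_with_sym homotopic_with_trans)
  then have "homotopic_with (\<lambda>_. True) (BC C) (BC C) id (\<lambda>_. Bcls C 0 v one)"
  proof (rule homotopic_with_eq)
    show "id p = Bmap C id_functor p" if "p \<in> topspace (BC C)" for p
      using Bmap_id[OF is_functor_id _ _ that] by simp
    show "Bcls C 0 v one = Bmap C ?K p" if "p \<in> topspace (BC C)" for p using const[OF that] by simp
  qed simp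
  then show ?thesis unfolding contractible_space_def by blast
qed

section \<open>Test categories from a functor that adds a disjoint point\<close>

lemma presheafD:
  assumes "presheaf A X"
  shows "f \<in> Arr A \<Longrightarrow> x \<in> sections X (Cod A f) \<Longrightarrow> restr X f x \<in> sections X (Dom A f)"
    "a \<in> Obj A \<Longrightarrow> x \<in> sections X a \<Longrightarrow> restr X (Ident A a) x = x"
    "f \<in> Arr A \<Longrightarrow> g \<in> Arr A \<Longrightarrow> Dom A g = Cod A f \<Longrightarrow> x \<in> sections X (Cod A g) \<Longrightarrow>
      restr X (Comp A g f) x = restr X f (restr X g x)"
  using assms unfolding presheaf_def by blast+

lemma elements_category:
  assumes A: "category A" and X: "presheaf A X"
  shows "category (elements A X)"
proof -
  interpret category A by (rule A)
  note in_sec = presheafD(1)[OF X] and ident = presheafD(2)[OF X] and comp = presheafD(3)[OF X]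
  show ?thesis
  proof
    fix f assume f: "f \<in> Arr (elements A X)"
    then obtain h y where h: "f = ((Dom A h, restr X h y), h, (Cod A h, y))" "h \<in> Arr A" "y \<in> sections X (Cod A h)"
      by (auto simp: elements_def)
    show "Dom (elements A X) f \<in> Obj (elements A X) \<and> Cod (elements A X) f \<in> Obj (elements A X)"
      using h dom_cod[OF h(2)] in_sec[OF h(2,3)] by (simp add: elements_def)
    show "Comp (elements A X) f (Ident (elements A X) (Dom (elements A X) f)) = f"
      "Comp (elements A X) (Ident (elements A X) (Cod (elements A X) f)) f = f"
      using h comp_id_left[OF h(2)] comp_id_right[OF h(2)] by (simp_all add: elements_def)
    fix g assume g: "g \<in> Arr (elements A X)" "Dom (elements A X) g = Cod (elements A X) f"
    then obtain k z where k: "g = ((Cod A h, y), k, (Cod A k, z))" "k \<in> Arr A" "z \<in> sections X (Cod A k)"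
        "Dom A k = Cod A h" "y = restr X k z"
      using h by (auto simp: elements_def)
    show "Comp (elements A X) g f \<in> Arr (elements A X) \<and>
        Dom (elements A X) (Comp (elements A X) g f) = Dom (elements A X) f \<and>
        Cod (elements A X) (Comp (elements A X) g f) = Cod (elements A X) g"
      using h k comp_arr[OF h(2) k(2,4)] comp[OF h(2) k(2,4,3)] by (simp add: elements_def)
    fix l assume l: "l \<in> Arr (elements A X)" "Dom (elements A X) l = Cod (elements A X) g"
    then obtain m w where m: "l = ((Cod A k, z), m, w)" "m \<in> Arr A" "Dom A m = Cod A k"
      using k by (auto simp: elements_def)
    show "Comp (elements A X) l (Comp (elements A X) g f) = Comp (elements A X) (Comp (elements A X) l g) f"
      using h k m comp_assoc[OF h(2) k(2) m(2) k(4) m(3)] by (simp add: elements_def)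
  next
    fix p assume "p \<in> Obj (elements A X)"
    then obtain a x where p: "p = (a, x)" "a \<in> Obj A" "x \<in> sections X a" by (auto simp: elements_def)
    then show "Ident (elements A X) p \<in> Arr (elements A X) \<and> Dom (elements A X) (Ident (elements A X) p) = p \<and>
        Cod (elements A X) (Ident (elements A X) p) = p"
      using id_arr[OF p(2)] ident[OF p(2,3)] by (simp add: elements_def)
  qed
qed

lemma product_category_category:
  assumes "category C" "category D" shows "category (product_category C D)"
proof -
  interpret C: category C by (rule assms)
  interpret D: category D by (rule assms)
  let ?P = "product_category C D"
  have arr: "f \<in> Arr ?P \<longleftrightarrow> fst f \<in> Arr C \<and> snd f \<in> Arr D" and obj: "a \<in> Obj ?P \<longleftrightarrow> fst a \<in> Obj C \<and> snd a \<in> Obj D" for f a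
    by (simp_all add: product_category_def mem_Times_iff)
  have ops: "Dom ?P f = (Dom C (fst f), Dom D (snd f))" "Cod ?P f = (Cod C (fst f), Cod D (snd f))"
    "Ident ?P a = (Ident C (fst a), Ident D (snd a))" "Comp ?P g f = (Comp C (fst g) (fst f), Comp D (snd g) (snd f))" for f g a
    by (simp_all add: product_category_def case_prod_unfold)
  show ?thesis
  proof
    fix f assume f: "f \<in> Arr ?P"
    then have f': "fst f \<in> Arr C" "snd f \<in> Arr D" by (simp_all add: arr)
    show "Dom ?P f \<in> Obj ?P \<and> Cod ?P f \<in> Obj ?P" using C.dom_cod[OF f'(1)] D.dom_cod[OF f'(2)] by (simp add: obj ops)
    show "Comp ?P f (Ident ?P (Dom ?P f)) = f" "Comp ?P (Ident ?P (Cod ?P f)) f = f"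
      using C.comp_id_left[OF f'(1)] D.comp_id_left[OF f'(2)] C.comp_id_right[OF f'(1)] D.comp_id_right[OF f'(2)] by (simp_all add: ops)
    fix g assume g: "g \<in> Arr ?P" "Dom ?P g = Cod ?P f"
    then have g': "fst g \<in> Arr C" "snd g \<in> Arr D" "Dom C (fst g) = Cod C (fst f)" "Dom D (snd g) = Cod D (snd f)" by (simp_all add: arr ops)
    show "Comp ?P g f \<in> Arr ?P \<and> Dom ?P (Comp ?P g f) = Dom ?P f \<and> Cod ?P (Comp ?P g f) = Cod ?P g"
      using C.comp_arr[OF f'(1) g'(1,3)] D.comp_arr[OF f'(2) g'(2,4)] by (simp add: arr ops)
    fix h assume h: "h \<in> Arr ?P" "Dom ?P h = Cod ?P g"
    then have h': "fst h \<in> Arr C" "snd h \<in> Arr D" "Dom C (fst h) = Cod C (fst g)" "Dom D (snd h) = Cod D (snd g)" by (simp_all add: arr ops)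
    show "Comp ?P h (Comp ?P g f) = Comp ?P (Comp ?P h g) f"
      using C.comp_assoc[OF f'(1) g'(1) h'(1) g'(3) h'(3)] D.comp_assoc[OF f'(2) g'(2) h'(2) g'(4) h'(4)] by (simp add: ops)
  next
    fix a assume "a \<in> Obj ?P"
    then show "Ident ?P a \<in> Arr ?P \<and> Dom ?P (Ident ?P a) = a \<and> Cod ?P (Ident ?P a) = a"
      using C.id_arr[of "fst a"] D.id_arr[of "snd a"] by (simp add: arr obj ops)
  qed
qed

lemma product_presheaf_presheaf:
  assumes X: "presheaf A X" and Y: "presheaf A Y" shows "presheaf A (product_presheaf X Y)"
  using presheafD[OF X] presheafD[OF Y]
  unfolding presheaf_def by (simp add: product_presheaf_def Pi_iff case_prod_unfold mem_Times_iff)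

lemma slice_category:
  assumes A: "category A" shows "category (slice A a)"
proof -
  interpret category A by (rule A)
  show ?thesis
  proof
    fix f assume f: "f \<in> Arr (slice A a)"
    obtain x h y where [simp]: "f = (x, h, y)" by (metis prod.collapse)
    have h: "x \<in> Arr A" "Cod A x = a" "y \<in> Arr A" "Cod A y = a" "h \<in> Arr A" "Dom A h = Dom A x" "Cod A h = Dom A y" "Comp A y h = x"
      using f by (auto simp: slice_def)
    show "Dom (slice A a) f \<in> Obj (slice A a) \<and> Cod (slice A a) f \<in> Obj (slice A a)"
      using h by (simp add: slice_def)
    show "Comp (slice A a) f (Ident (slice A a) (Dom (slice A a) f)) = f"
      "Comp (slice A a) (Ident (slice A a) (Cod (slice A a) f)) f = f"
      using h comp_id_left[OF h(5)] comp_id_right[OF h(5)] by (simp_all add: slice_def)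
    fix g assume g: "g \<in> Arr (slice A a)" "Dom (slice A a) g = Cod (slice A a) f"
    then obtain k z where [simp]: "g = (y, k, z)" by (cases g) (auto simp: slice_def)
    have k: "z \<in> Arr A" "Cod A z = a" "k \<in> Arr A" "Dom A k = Dom A y" "Cod A k = Dom A z" "Comp A z k = y"
      using g by (auto simp: slice_def)
    show "Comp (slice A a) g f \<in> Arr (slice A a) \<and> Dom (slice A a) (Comp (slice A a) g f) = Dom (slice A a) f \<and>
        Cod (slice A a) (Comp (slice A a) g f) = Cod (slice A a) g"
      using h k comp_arr[OF h(5) k(3)] comp_assoc[OF h(5) k(3) k(1)] by (simp add: slice_def)
    fix l assume l: "l \<in> Arr (slice A a)" "Dom (slice A a) l = Cod (slice A a) g"
    then obtain m w where [simp]: "l = (z, m, w)" by (cases l) (auto simp: slice_def)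
    have m: "m \<in> Arr A" "Dom A m = Dom A z" using l by (auto simp: slice_def)
    show "Comp (slice A a) l (Comp (slice A a) g f) = Comp (slice A a) (Comp (slice A a) l g) f"
      using comp_assoc[OF h(5) k(3) m(1)] h k m by (simp add: slice_def)
  next
    fix f assume "f \<in> Obj (slice A a)"
    then have f: "f \<in> Arr A" "Cod A f = a" by (auto simp: slice_def)
    then show "Ident (slice A a) f \<in> Arr (slice A a) \<and> Dom (slice A a) (Ident (slice A a) f) = f \<and> Cod (slice A a) (Ident (slice A a) f) = f"
      using id_arr[of "Dom A f"] dom_cod[OF f(1)] comp_id_right[OF f(1)] by (simp add: slice_def)
  qed
qed

lemma functors_eqI:
  assumes "F \<in> functors C D" "G \<in> functors C D"
    and "\<And>a. a \<in> Obj C \<Longrightarrow> omap F a = omap G a" "\<And>f. f \<in> Arr C \<Longrightarrow> amap F f = amap G f"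
  shows "F = G"
proof -
  have "omap F = omap G" by (rule extensionalityI[of _ "Obj C"]) (use assms in \<open>auto simp: functors_def\<close>)
  moreover have "amap F = amap G" by (rule extensionalityI[of _ "Arr C"]) (use assms in \<open>auto simp: functors_def\<close>)
  ultimately show ?thesis by simp
qed

lemma functor_comp_simps:
  "a \<in> Obj C \<Longrightarrow> omap (functor_comp C G F) a = omap G (omap F a)"
  "f \<in> Arr C \<Longrightarrow> amap (functor_comp C G F) f = amap G (amap F f)"
  by (simp_all add: functor_comp_def compose_def)

lemma functor_comp_in:
  assumes C: "category C" and F: "is_functor C D F" and G: "is_functor D E G"
  shows "functor_comp C G F \<in> functors C E"
proof -
  interpret category C by (rule C)
  have "is_functor C E (functor_comp C G F)"
    unfolding is_functor_def
    using dom_cod id_arr comp_arr functorD[OF F] functorD[OF G] by (simp add: functor_comp_simps)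
  then show ?thesis by (simp add: functors_def functor_comp_def compose_def)
qed

section \<open>Presheaves of functors on slices, and the counit\<close>

context category begin

lemma slice_map_functor:
  assumes f: "f \<in> Arr C" shows "is_functor (slice C (Dom C f)) (slice C (Cod C f)) (slice_map C f)"
proof -
  have 1: "Comp C f g \<in> Arr C \<and> Dom C (Comp C f g) = Dom C g \<and> Cod C (Comp C f g) = Cod C f" if "g \<in> Arr C" "Cod C g = Dom C f" for g
    using comp_arr[OF that(1) f] that(2) by simp
  have 2: "Comp C (Comp C f g) h = Comp C f (Comp C g h)"
    if "g \<in> Arr C" "Cod C g = Dom C f" "h \<in> Arr C" "Cod C h = Dom C g" for g h
    using comp_assoc[OF that(3,1) f] that by simp
  show ?thesis
    unfolding is_functor_def slice_def slice_map_def using 1 2 by auto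
qed

lemma presheaf_slice_functors:
  fixes E :: "('c, 'd) cat"
  shows "presheaf C (slice_functors C E)"
  unfolding presheaf_def
proof (intro conjI ballI impI)
  fix f assume f: "f \<in> Arr C"
  show r: "restr (slice_functors C E) f \<in> sections (slice_functors C E) (Cod C f) \<rightarrow> sections (slice_functors C E) (Dom C f)"
    using functor_comp_in[OF slice_category[OF category_axioms] slice_map_functor[OF f]] by (auto simp: slice_functors_def functors_def)
next
  fix a x assume a: "a \<in> Obj C" and x: "x \<in> sections (slice_functors C E) a"
  note i = id_arr[OF a]
  have x: "x \<in> functors (slice C a) E" using x by (simp add: slice_functors_def)
  have m: "is_functor (slice C a) (slice C a) (slice_map C (Ident C a))" using slice_map_functor[of "Ident C a"] i by simp
  have il: "Comp C (Ident C a) f = f" if "f \<in> Arr C" "Cod C f = a" for f using comp_id_left[OF that(1)] that(2) by simp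
  have "functor_comp (slice C a) x (slice_map C (Ident C a)) = x"
  proof (rule functors_eqI[OF functor_comp_in[OF slice_category[OF category_axioms] m] x])
    show "is_functor (slice C a) E x" using x by (simp add: functors_def)
    show "omap (functor_comp (slice C a) x (slice_map C (Ident C a))) f = omap x f" if "f \<in> Obj (slice C a)" for f
      using that il by (simp add: functor_comp_simps) (simp add: slice_map_def slice_def)
    show "amap (functor_comp (slice C a) x (slice_map C (Ident C a))) f = amap x f" if "f \<in> Arr (slice C a)" for f
      using that il by (auto simp: functor_comp_simps) (auto simp: slice_map_def slice_def)
  qed
  then show "restr (slice_functors C E) (Ident C a) x = x" using i by (simp add: slice_functors_def)
next
  fix f g x assume f: "f \<in> Arr C" and g: "g \<in> Arr C" and fg: "Dom C g = Cod C f" and "x \<in> sections (slice_functors C E) (Cod C g)"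
  then have x: "is_functor (slice C (Cod C g)) E x" by (simp add: slice_functors_def functors_def)
  note gf = comp_arr[OF f g fg]
  note S = slice_category[OF category_axioms]
  have 1: "is_functor (slice C (Dom C f)) (slice C (Cod C g)) (slice_map C (Comp C g f))" using slice_map_functor[of "Comp C g f"] gf by simp
  have 2: "is_functor (slice C (Dom C f)) (slice C (Dom C g)) (slice_map C f)" using slice_map_functor[OF f] fg by simp
  have 3: "functor_comp (slice C (Dom C g)) x (slice_map C g) \<in> functors (slice C (Dom C g)) E"
    by (rule functor_comp_in[OF S slice_map_functor[OF g] x])
  have 4: "Comp C (Comp C g f) k = Comp C g (Comp C f k)" if "k \<in> Arr C" "Cod C k = Dom C f" for k
    using comp_assoc[OF that(1) f g] that(2) fg by simp
  have "functor_comp (slice C (Dom C f)) x (slice_map C (Comp C g f)) =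
      functor_comp (slice C (Dom C f)) (functor_comp (slice C (Dom C g)) x (slice_map C g)) (slice_map C f)"
  proof (rule functors_eqI[OF functor_comp_in[OF S 1 x] functor_comp_in[OF S 2]])
    show "is_functor (slice C (Dom C g)) E (functor_comp (slice C (Dom C g)) x (slice_map C g))" using 3 by (simp add: functors_def)
    fix k assume k: "k \<in> Obj (slice C (Dom C f))"
    show "omap (functor_comp (slice C (Dom C f)) x (slice_map C (Comp C g f))) k =
        omap (functor_comp (slice C (Dom C f)) (functor_comp (slice C (Dom C g)) x (slice_map C g)) (slice_map C f)) k"
      using k functorD(1)[OF 2 k] 4 by (simp add: functor_comp_simps) (simp add: slice_map_def slice_def)
  next
    fix k assume k: "k \<in> Arr (slice C (Dom C f))"
    show "amap (functor_comp (slice C (Dom C f)) x (slice_map C (Comp C g f))) k =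
        amap (functor_comp (slice C (Dom C f)) (functor_comp (slice C (Dom C g)) x (slice_map C g)) (slice_map C f)) k"
      using k functorD(2)[OF 2 k] 4 by (auto simp: functor_comp_simps) (auto simp: slice_map_def slice_def)
  qed
  then show "restr (slice_functors C E) (Comp C g f) x = restr (slice_functors C E) f (restr (slice_functors C E) g x)"
    using gf fg by (simp add: slice_functors_def)
qed

lemma slice_arr_iff:
  "(f, h, g) \<in> Arr (slice C a) \<longleftrightarrow> f \<in> Arr C \<and> Cod C f = a \<and> g \<in> Arr C \<and> Cod C g = a \<and>
     h \<in> Arr C \<and> Dom C h = Dom C f \<and> Cod C h = Dom C g \<and> Comp C g h = f"
  by (simp add: slice_def)

lemma elements_slice_functors_cases:
  assumes "f \<in> Arr (elements C (slice_functors C E))"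
  obtains h v where "f = ((Dom C h, functor_comp (slice C (Dom C h)) v (slice_map C h)), h, (Cod C h, v))" "h \<in> Arr C"
    "v \<in> functors (slice C (Cod C h)) E"
  using assms by (auto simp: elements_def slice_functors_def)

lemma is_functor_counit:
  "is_functor (elements C (slice_functors C E)) E (counit C)"
  unfolding is_functor_def
proof (intro conjI ballI impI)
  fix x assume "x \<in> Obj (elements C (slice_functors C E))"
  then obtain a v where x: "x = (a, v)" "a \<in> Obj C" "v \<in> functors (slice C a) E" by (auto simp: elements_def slice_functors_def)
  then have v: "is_functor (slice C a) E v" by (simp add: functors_def)
  have i: "Ident C a \<in> Obj (slice C a)" using id_arr[OF x(2)] by (simp add: slice_def)
  show "omap (counit C) x \<in> Obj E" using functorD(1)[OF v i] x by (simp add: counit_def)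
  show "amap (counit C) (Ident (elements C (slice_functors C E)) x) = Ident E (omap (counit C) x)"
    using functorD(5)[OF v i] x id_arr[OF x(2)] by (simp add: counit_def elements_def slice_def)
next
  fix f assume f: "f \<in> Arr (elements C (slice_functors C E))"
  obtain h v where h: "f = ((Dom C h, functor_comp (slice C (Dom C h)) v (slice_map C h)), h, (Cod C h, v))" "h \<in> Arr C"
    "v \<in> functors (slice C (Cod C h)) E"
    by (rule elements_slice_functors_cases[OF f])
  then have v: "is_functor (slice C (Cod C h)) E v" by (simp add: functors_def)
  note D = dom_cod[OF h(2)]
  have a: "(h, h, Ident C (Cod C h)) \<in> Arr (slice C (Cod C h))"
    using h(2) id_arr[of "Cod C h"] D comp_id_left[OF h(2)] by (simp add: slice_arr_iff)
  have i: "Ident C (Dom C h) \<in> Obj (slice C (Dom C h))" using id_arr[of "Dom C h"] D by (simp add: slice_def)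
  show "amap (counit C) f \<in> Arr E" using functorD(2)[OF v a] by (simp add: counit_def h(1))
  show "Dom E (amap (counit C) f) = omap (counit C) (Dom (elements C (slice_functors C E)) f)"
    using functorD(3)[OF v a] comp_id_right[OF h(2)]
    by (simp add: counit_def h(1) elements_def functor_comp_simps(1)[OF i]) (simp add: slice_def slice_map_def)
  show "Cod E (amap (counit C) f) = omap (counit C) (Cod (elements C (slice_functors C E)) f)"
    using functorD(4)[OF v a] by (simp add: counit_def h(1) elements_def slice_def)
  fix g assume g: "g \<in> Arr (elements C (slice_functors C E))" "Dom (elements C (slice_functors C E)) g = Cod (elements C (slice_functors C E)) f"
  obtain k w where k: "g = ((Dom C k, functor_comp (slice C (Dom C k)) w (slice_map C k)), k, (Cod C k, w))" "k \<in> Arr C"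
    "w \<in> functors (slice C (Cod C k)) E"
    by (rule elements_slice_functors_cases[OF g(1)])
  then have w: "is_functor (slice C (Cod C k)) E w" by (simp add: functors_def)
  have kv: "(Dom C k, functor_comp (slice C (Dom C k)) w (slice_map C k)) = (Cod C h, v)"
    using g(2) by (simp only: k(1) h(1) elements_def cat.simps case_prod_conv)
  note kh = prod.inject[THEN iffD1, OF kv, THEN conjunct1]
    and vw = prod.inject[THEN iffD1, OF kv, THEN conjunct2, symmetric]
  note c = comp_arr[OF h(2) k(2) kh] and Dk = dom_cod[OF k(2)]
  have b: "(k, k, Ident C (Cod C k)) \<in> Arr (slice C (Cod C k))"
    using k(2) id_arr[of "Cod C k"] Dk comp_id_left[OF k(2)] by (simp add: slice_arr_iff)
  have d: "(Comp C k h, h, k) \<in> Arr (slice C (Cod C k))" using c h(2) k(2) kh by (simp add: slice_arr_iff)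
  \<comment> \<open>Since \<open>v\<close> is \<open>w\<close> restricted along \<open>k\<close>,
    the value of \<open>v\<close> at this arrow is a value of \<open>w\<close> as well, and the
    composite can be formed in the slice over the codomain of \<open>k\<close>.\<close>
  have "amap v (h, h, Ident C (Cod C h)) = amap w (Comp C k h, h, k)"
    using a comp_id_right[OF k(2)] kh by (simp add: vw functor_comp_simps) (simp add: slice_map_def)
  moreover have "Comp (slice C (Cod C k)) (k, k, Ident C (Cod C k)) (Comp C k h, h, k) = (Comp C k h, Comp C k h, Ident C (Cod C k))"
    by (simp add: slice_def)
  ultimately show "amap (counit C) (Comp (elements C (slice_functors C E)) g f) = Comp E (amap (counit C) g) (amap (counit C) f)"
    using functorD(6)[OF w d b] by (simp add: counit_def h(1) k(1) elements_def) (simp add: slice_def)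
qed

end

text \<open>A functor \<open>P\<close> with natural transformations \<open>i : id \<Rightarrow> P\<close> and \<open>j : e \<Rightarrow> P\<close> such that \<open>i\<close> is the
  inclusion of a sieve, stable under the arrows \<open>P h\<close>, and no arrow into \<open>e\<close> lands in that sieve.\<close>

locale decalage = category A for A :: "('o, 'm) cat" +
  fixes P :: "('o, 'm, 'o, 'm) fnctr" and i :: "'o \<Rightarrow> 'm" and e :: 'o and j :: "'o \<Rightarrow> 'm"
  assumes P: "is_functor A A P" and e: "e \<in> Obj A"
    and i: "a \<in> Obj A \<Longrightarrow> i a \<in> Arr A \<and> Dom A (i a) = a \<and> Cod A (i a) = omap P a"
    and j: "a \<in> Obj A \<Longrightarrow> j a \<in> Arr A \<and> Dom A (j a) = e \<and> Cod A (j a) = omap P a"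
    and i_natural: "h \<in> Arr A \<Longrightarrow> Comp A (amap P h) (i (Dom A h)) = Comp A (i (Cod A h)) h"
    and j_natural: "h \<in> Arr A \<Longrightarrow> Comp A (amap P h) (j (Dom A h)) = j (Cod A h)"
    and i_mono: "\<lbrakk>f \<in> Arr A; g \<in> Arr A; Cod A f = a; Cod A g = a; a \<in> Obj A; Dom A f = Dom A g;
        Comp A (i a) f = Comp A (i a) g\<rbrakk> \<Longrightarrow> f = g"
    and i_reflect: "\<lbrakk>h \<in> Arr A; f \<in> Arr A; Cod A f = omap P (Dom A h); k \<in> Arr A; Cod A k = Cod A h;
        Comp A (amap P h) f = Comp A (i (Cod A h)) k\<rbrakk> \<Longrightarrow> \<exists>k'\<in>Arr A. Cod A k' = Dom A h \<and> f = Comp A (i (Dom A h)) k'"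
    and ij_disjoint: "\<lbrakk>a \<in> Obj A; f \<in> Arr A; Cod A f = e; k \<in> Arr A; Cod A k = a\<rbrakk> \<Longrightarrow> Comp A (j a) f \<noteq> Comp A (i a) k"
begin

section \<open>The sieve and the extension of functors across it\<close>

lemma P_arr:
  assumes "h \<in> Arr A"
  shows "amap P h \<in> Arr A" "Dom A (amap P h) = omap P (Dom A h)" "Cod A (amap P h) = omap P (Cod A h)"
  using functorD(2-4)[OF P assms] by auto

definition old :: "'o \<Rightarrow> 'm \<Rightarrow> bool" where
  "old a f \<longleftrightarrow> (\<exists>k \<in> Arr A. Cod A k = a \<and> f = Comp A (i a) k)"

definition factor :: "'o \<Rightarrow> 'm \<Rightarrow> 'm" where
  "factor a f = (SOME k. k \<in> Arr A \<and> Cod A k = a \<and> f = Comp A (i a) k)"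

lemma factor:
  assumes "old a f" shows "factor a f \<in> Arr A" "Cod A (factor a f) = a" "Comp A (i a) (factor a f) = f"
proof -
  have "\<exists>k. k \<in> Arr A \<and> Cod A k = a \<and> f = Comp A (i a) k" using assms by (auto simp: old_def)
  then have "factor a f \<in> Arr A \<and> Cod A (factor a f) = a \<and> f = Comp A (i a) (factor a f)"
    unfolding factor_def by (rule someI_ex)
  then show "factor a f \<in> Arr A" "Cod A (factor a f) = a" "Comp A (i a) (factor a f) = f" by auto
qed

lemma factor_dom: "old a f \<Longrightarrow> a \<in> Obj A \<Longrightarrow> Dom A (factor a f) = Dom A f"
  using factor[of a f] comp_arr[of "factor a f" "i a"] i[of a] by metis

lemma factor_comp:
  assumes a: "a \<in> Obj A" and k: "k \<in> Arr A" "Cod A k = a"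
  shows "old a (Comp A (i a) k)" "factor a (Comp A (i a) k) = k"
proof -
  show o: "old a (Comp A (i a) k)" using k by (auto simp: old_def)
  have "Dom A (factor a (Comp A (i a) k)) = Dom A k"
    using factor_dom[OF o a] comp_arr[OF k(1), of "i a"] i[OF a] k(2) by simp
  then show "factor a (Comp A (i a) k) = k" using i_mono[OF _ k(1) _ k(2) a] factor[OF o] by simp
qed

lemma old_comp:
  assumes a: "a \<in> Obj A" and g: "old a g" and h: "h \<in> Arr A" "Cod A h = Dom A g"
  shows "old a (Comp A g h)" "factor a (Comp A g h) = Comp A (factor a g) h"
proof -
  note F = factor[OF g]
  have dF: "Dom A (factor a g) = Cod A h" using factor_dom[OF g a] h by simp
  have "Comp A g h = Comp A (i a) (Comp A (factor a g) h)"
    using comp_assoc[OF h(1) F(1), of "i a"] i[OF a] F dF by simp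
  moreover have "Comp A (factor a g) h \<in> Arr A" "Cod A (Comp A (factor a g) h) = a" using comp_arr[OF h(1) F(1) dF] F by auto
  ultimately show "old a (Comp A g h)" "factor a (Comp A g h) = Comp A (factor a g) h"
    using factor_comp[OF a] by auto
qed

text \<open>A sieve that contains the identity contains every arrow into \<open>P a\<close>, in
  particular \<open>j a\<close>, which is excluded by disjointness.\<close>

lemma not_old_id: "a \<in> Obj A \<Longrightarrow> \<not> old a (Ident A (omap P a))"
proof
  assume a: "a \<in> Obj A" and "old a (Ident A (omap P a))"
  then have "old a (Comp A (Ident A (omap P a)) (j a))"
    using old_comp(1)[OF a _, of "Ident A (omap P a)" "j a"] j[OF a] id_arr[OF functorD(1)[OF P a]] by simp
  then have "old a (Comp A (j a) (Ident A e))"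
    using comp_id_left[of "j a"] comp_id_right[of "j a"] j[OF a] by simp
  then show False using ij_disjoint[OF a, of "Ident A e"] id_arr[OF e] by (auto simp: old_def)
qed

lemma not_old_j: "a \<in> Obj A \<Longrightarrow> f \<in> Arr A \<Longrightarrow> Cod A f = e \<Longrightarrow> \<not> old a (Comp A (j a) f)"
  using ij_disjoint by (auto simp: old_def)

text \<open>Naturality of \<open>i\<close> gives one inclusion between the sieve over the source of
  \<open>h\<close> and the preimage of the sieve over its target, and \<open>i_reflect\<close> gives
  the other. Extensions can therefore be compared along \<open>P h\<close>.\<close>

lemma old_P:
  assumes h: "h \<in> Arr A" and f: "f \<in> Arr A" "Cod A f = omap P (Dom A h)"
  shows "old (Cod A h) (Comp A (amap P h) f) \<longleftrightarrow> old (Dom A h) f"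
    and "old (Dom A h) f \<Longrightarrow> factor (Cod A h) (Comp A (amap P h) f) = Comp A h (factor (Dom A h) f)"
proof -
  note D = dom_cod[OF h]
  have *: "old (Cod A h) (Comp A (amap P h) f) \<and> factor (Cod A h) (Comp A (amap P h) f) = Comp A h (factor (Dom A h) f)"
    if o: "old (Dom A h) f"
  proof -
    note F = factor[OF o]
    note iD = i[of "Dom A h"] and iC = i[of "Cod A h"]
    have "Comp A (amap P h) f = Comp A (amap P h) (Comp A (i (Dom A h)) (factor (Dom A h) f))" using F by simp
    also have "\<dots> = Comp A (Comp A (i (Cod A h)) h) (factor (Dom A h) f)"
      using comp_assoc[OF F(1), of "i (Dom A h)" "amap P h"] iD D F P_arr[OF h] i_natural[OF h] by simp
    also have "\<dots> = Comp A (i (Cod A h)) (Comp A h (factor (Dom A h) f))"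
      using comp_assoc[OF F(1) h, of "i (Cod A h)"] iC D F by simp
    finally show ?thesis
      using factor_comp[of "Cod A h" "Comp A h (factor (Dom A h) f)"] comp_arr[OF F(1) h] F D by simp
  qed
  show "old (Cod A h) (Comp A (amap P h) f) \<longleftrightarrow> old (Dom A h) f"
  proof
    assume "old (Cod A h) (Comp A (amap P h) f)"
    then obtain k where "k \<in> Arr A" "Cod A k = Cod A h" "Comp A (amap P h) f = Comp A (i (Cod A h)) k" by (auto simp: old_def)
    then show "old (Dom A h) f" using i_reflect[OF h f] by (auto simp: old_def)
  qed (use * in blast)
  show "old (Dom A h) f \<Longrightarrow> factor (Cod A h) (Comp A (amap P h) f) = Comp A h (factor (Dom A h) f)" using * by blast
qed

lemma not_old_P: "h \<in> Arr A \<Longrightarrow> \<not> old (Cod A h) (amap P h)"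
  using old_P(1)[of h "Ident A (omap P (Dom A h))"] not_old_id[of "Dom A h"] dom_cod[of h] P_arr[of h]
    comp_id_right[of "amap P h"] id_arr[OF functorD(1)[OF P, of "Dom A h"]] by simp

text \<open>A functor \<open>v\<close> on \<open>A / a\<close> with an arrow \<open>p : v(id) \<rightarrow> c\<close> is extended to \<open>A / P a\<close> by the
  constant \<open>c\<close> outside the sieve \<open>A / a\<close>.\<close>

definition extend :: "('c, 'd) cat \<Rightarrow> 'o \<Rightarrow> ('m, 'm \<times> 'm \<times> 'm, 'c, 'd) fnctr \<Rightarrow> 'd \<Rightarrow> ('m, 'm \<times> 'm \<times> 'm, 'c, 'd) fnctr" where
  "extend C a v p =
    \<lparr>omap = restrict (\<lambda>f. if old a f then omap v (factor a f) else Cod C p) (Obj (slice A (omap P a))),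
     amap = restrict (\<lambda>(f, h, g).
       if old a g then amap v (factor a f, h, factor a g)
       else if old a f then Comp C p (amap v (factor a f, factor a f, Ident A a))
       else Ident C (Cod C p)) (Arr (slice A (omap P a)))\<rparr>"

lemma extend_omap:
  "f \<in> Arr A \<Longrightarrow> Cod A f = omap P a \<Longrightarrow> omap (extend C a v p) f = (if old a f then omap v (factor a f) else Cod C p)"
  by (simp add: extend_def slice_def)

lemma extend_amap:
  "(f, h, g) \<in> Arr (slice A (omap P a)) \<Longrightarrow> amap (extend C a v p) (f, h, g) =
     (if old a g then amap v (factor a f, h, factor a g)
       else if old a f then Comp C p (amap v (factor a f, factor a f, Ident A a))
       else Ident C (Cod C p))"
  by (simp add: extend_def)

lemma to_id_arr:
  assumes "a \<in> Obj A" "f \<in> Arr A" "Cod A f = a" shows "(f, f, Ident A a) \<in> Arr (slice A a)"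
  using assms id_arr[OF assms(1)] comp_id_left[OF assms(2)] by (simp add: slice_arr_iff)

lemma slice_ops:
  "Dom (slice A a) (f, h, g) = f" "Cod (slice A a) (f, h, g) = g" "Comp (slice A a) (f', h', g') (f, h, g) = (f, Comp A h' h, g')"
  "Ident (slice A a) f = (f, Ident A (Dom A f), f)" "f \<in> Obj (slice A a) \<longleftrightarrow> f \<in> Arr A \<and> Cod A f = a"
  by (simp_all add: slice_def)

text \<open>A sieve contains the source of an arrow whenever it contains the target, so only three
  kinds of arrows occur: inside the sieve, leaving it, and outside. Those that leave it are sent to
  the components of a cone from \<open>v\<close> to the codomain of \<open>p\<close>.\<close>

lemma extend_in:
  assumes C: "category C" and a: "a \<in> Obj A" and v: "v \<in> functors (slice A a) C"
    and p: "p \<in> Arr C" "Dom C p = omap v (Ident A a)"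
  shows "extend C a v p \<in> functors (slice A (omap P a)) C"
proof -
  interpret C: category C by (rule C)
  let ?w = "extend C a v p"
  have vF: "is_functor (slice A a) C v" using v by (simp add: functors_def)
  note V = functorD[OF vF]
  have pc: "Cod C p \<in> Obj C" using C.dom_cod[OF p(1)] by simp
  note ic = C.id_arr[OF pc]
  have cone: "Comp C p (amap v (f, f, Ident A a)) \<in> Arr C" "Dom C (Comp C p (amap v (f, f, Ident A a))) = omap v f"
    "Cod C (Comp C p (amap v (f, f, Ident A a))) = Cod C p" if "f \<in> Arr A" "Cod A f = a" for f
    using C.comp_arr[of "amap v (f, f, Ident A a)" p] V(2-4)[OF to_id_arr[OF a that]] p by (simp_all add: slice_ops)
  \<comment> \<open>The identity of \<open>a\<close> is terminal in the slice, so \<open>p\<close>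
    after the values of \<open>v\<close> at the arrows into it is a cone on
    \<open>v\<close>.\<close>
  have cone_comp: "Comp C (Comp C p (amap v (g, g, Ident A a))) (amap v (f, h, g)) = Comp C p (amap v (f, f, Ident A a))"
    if s: "(f, h, g) \<in> Arr (slice A a)" for f h g
  proof -
    have g: "g \<in> Arr A" "Cod A g = a" "Comp A g h = f" using s by (auto simp: slice_arr_iff)
    note t = to_id_arr[OF a g(1,2)]
    have "amap v (f, f, Ident A a) = Comp C (amap v (g, g, Ident A a)) (amap v (f, h, g))"
      using V(6)[OF s t] g(3) by (simp add: slice_ops)
    then show ?thesis
      using C.comp_assoc[OF V(2)[OF s] V(2)[OF t] p(1)] V(3,4)[OF t] V(4)[OF s] p(2) by (simp add: slice_ops)
  qed
  have fa: "(factor a f, h, factor a g) \<in> Arr (slice A a) \<and> old a f" if s: "(f, h, g) \<in> Arr (slice A (omap P a))" and o: "old a g" for f h g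
  proof -
    have h: "h \<in> Arr A" "Cod A h = Dom A g" "Comp A g h = f" "Dom A h = Dom A f" using s by (auto simp: slice_arr_iff)
    note oc = old_comp[OF a o h(1,2)]
    have of: "old a f" using oc(1) h(3) by simp
    have "factor a f = Comp A (factor a g) h" using oc(2) h(3) by simp
    then show ?thesis
      using factor[OF of] factor[OF o] h of factor_dom[OF o a] factor_dom[OF of a] by (simp add: slice_arr_iff)
  qed
  have ff: "factor a f \<in> Obj (slice A a)" if "old a f" for f using factor[OF that] by (simp add: slice_ops)
  have "is_functor (slice A (omap P a)) C ?w"
    unfolding is_functor_def
  proof (intro conjI ballI impI)
    fix f assume "f \<in> Obj (slice A (omap P a))"
    then have f: "f \<in> Arr A" "Cod A f = omap P a" by (simp_all add: slice_ops)
    show "omap ?w f \<in> Obj C" using V(1)[OF ff] pc by (simp add: extend_omap[OF f])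
    have "(f, Ident A (Dom A f), f) \<in> Arr (slice A (omap P a))"
      using f id_arr[of "Dom A f"] dom_cod[OF f(1)] comp_id_right[OF f(1)] by (simp add: slice_arr_iff)
    then show "amap ?w (Ident (slice A (omap P a)) f) = Ident C (omap ?w f)"
      using V(5)[OF ff, of f] factor_dom[OF _ a, of f] by (simp add: slice_ops extend_omap[OF f] extend_amap)
  next
    fix s assume s: "s \<in> Arr (slice A (omap P a))"
    obtain f h g where sd: "s = (f, h, g)" by (metis prod.collapse)
    note s = s[unfolded sd]
    have f: "f \<in> Arr A" "Cod A f = omap P a" and g: "g \<in> Arr A" "Cod A g = omap P a" using s by (auto simp: slice_arr_iff)
    have "amap ?w s \<in> Arr C \<and> Dom C (amap ?w s) = omap ?w f \<and> Cod C (amap ?w s) = omap ?w g"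
    proof (cases "old a g")
      case True
      then show ?thesis
        using fa[OF s True] V(2-4)[of "(factor a f, h, factor a g)"]
        by (simp add: sd extend_omap[OF f] extend_omap[OF g] extend_amap[OF s] slice_ops)
    next
      case False
      then show ?thesis
        using cone[of "factor a f"] factor[of a f] ic
        by (auto simp: sd extend_omap[OF f] extend_omap[OF g] extend_amap[OF s])
    qed
    then show "amap ?w s \<in> Arr C" "Dom C (amap ?w s) = omap ?w (Dom (slice A (omap P a)) s)"
      "Cod C (amap ?w s) = omap ?w (Cod (slice A (omap P a)) s)" by (simp_all add: sd slice_ops)
    fix t assume t: "t \<in> Arr (slice A (omap P a))" "Dom (slice A (omap P a)) t = Cod (slice A (omap P a)) s"
    then obtain k l where td: "t = (g, k, l)" by (cases t) (auto simp: sd slice_ops)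
    note t = t(1)[unfolded td]
    have st: "(f, Comp A k h, l) \<in> Arr (slice A (omap P a))"
    proof -
      interpret S: category "slice A (omap P a)" by (rule slice_category[OF category_axioms])
      show ?thesis using S.comp_arr[OF s t] by (simp add: slice_ops)
    qed
    have "amap ?w (f, Comp A k h, l) = Comp C (amap ?w (g, k, l)) (amap ?w (f, h, g))"
    proof (cases "old a l")
      case ol: True
      note t' = fa[OF t ol]
      note s' = fa[OF s t'[THEN conjunct2]]
      show ?thesis
        using ol t' s' V(6)[OF s'[THEN conjunct1] t'[THEN conjunct1]]
        by (simp add: extend_amap[OF s] extend_amap[OF t] extend_amap[OF st] slice_ops)
    next
      case nl: False
      show ?thesis
      proof (cases "old a g")
        case og: True
        note s' = fa[OF s og]
        show ?thesis
          using nl og s' cone_comp[OF s'[THEN conjunct1]]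
          by (simp add: extend_amap[OF s] extend_amap[OF t] extend_amap[OF st])
      next
        case ng: False
        show ?thesis
          using nl ng C.comp_id_left[of "Comp C p (amap v (factor a f, factor a f, Ident A a))"] cone[of "factor a f"] factor[of a f]
            C.comp_id_left[of "Ident C (Cod C p)"] ic
          by (auto simp: extend_amap[OF s] extend_amap[OF t] extend_amap[OF st])
      qed
    qed
    then show "amap ?w (Comp (slice A (omap P a)) t s) = Comp C (amap ?w t) (amap ?w s)" by (simp add: sd td slice_ops)
  qed
  then show ?thesis by (simp add: functors_def extend_def)
qed

lemma comma_elements_cases:
  assumes "s \<in> Arr (comma (elements A (slice_functors A C)) C (counit A) c)"
  obtains h w q where "h \<in> Arr A" "w \<in> functors (slice A (Cod A h)) C" "q \<in> Arr C" "Dom C q = omap w (Ident A (Cod A h))" "Cod C q = c"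
    "s = (((Dom A h, functor_comp (slice A (Dom A h)) w (slice_map A h)), Comp C q (amap w (h, h, Ident A (Cod A h)))),
      ((Dom A h, functor_comp (slice A (Dom A h)) w (slice_map A h)), h, (Cod A h, w)), ((Cod A h, w), q))"
  using assms by (auto simp: comma_def elements_def slice_functors_def counit_def)

text \<open>This makes \<open>i a\<close> an arrow in the category of elements, from
  \<open>v\<close> to its extension.\<close>

lemma restr_extend_i:
  assumes C: "category C" and a: "a \<in> Obj A" and v: "v \<in> functors (slice A a) C"
    and p: "p \<in> Arr C" "Dom C p = omap v (Ident A a)"
  shows "functor_comp (slice A a) (extend C a v p) (slice_map A (i a)) = v"
proof -
  note ia = i[OF a]
  have F: "is_functor (slice A a) (slice A (omap P a)) (slice_map A (i a))" using slice_map_functor[of "i a"] ia by simp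
  have E: "is_functor (slice A (omap P a)) C (extend C a v p)" using extend_in[OF C a v p] by (simp add: functors_def)
  show ?thesis
  proof (rule functors_eqI[OF functor_comp_in[OF slice_category[OF category_axioms] F E] v])
    fix f assume f: "f \<in> Obj (slice A a)"
    then have f': "f \<in> Arr A" "Cod A f = a" by (simp_all add: slice_ops)
    have "Comp A (i a) f \<in> Arr A" "Cod A (Comp A (i a) f) = omap P a" using comp_arr[OF f'(1), of "i a"] ia f' by auto
    then show "omap (functor_comp (slice A a) (extend C a v p) (slice_map A (i a))) f = omap v f"
      using factor_comp[OF a f'] by (simp add: functor_comp_simps(1)[OF f] slice_map_def extend_omap)
  next
    fix s assume s: "s \<in> Arr (slice A a)"
    obtain f h g where sd: "s = (f, h, g)" by (metis prod.collapse)
    have f: "f \<in> Arr A" "Cod A f = a" and g: "g \<in> Arr A" "Cod A g = a" using s sd by (auto simp: slice_arr_iff)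
    have "(Comp A (i a) f, h, Comp A (i a) g) \<in> Arr (slice A (omap P a))"
      using functorD(2)[OF F s] by (simp add: sd slice_map_def)
    then show "amap (functor_comp (slice A a) (extend C a v p) (slice_map A (i a))) s = amap v s"
      using factor_comp[OF a f] factor_comp[OF a g] by (simp add: functor_comp_simps(2)[OF s]) (simp add: sd slice_map_def extend_amap)
  qed
qed

text \<open>Extending commutes with restriction, where \<open>q\<close> is replaced by its composite
  with the value of \<open>w\<close> at \<open>h\<close>. This is what makes the contraction of the
  comma category functorial.\<close>

lemma restr_extend_P:
  assumes C: "category C" and h: "h \<in> Arr A" and w: "w \<in> functors (slice A (Cod A h)) C"
    and q: "q \<in> Arr C" "Dom C q = omap w (Ident A (Cod A h))"
  defines "v \<equiv> functor_comp (slice A (Dom A h)) w (slice_map A h)"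
    and "p \<equiv> Comp C q (amap w (h, h, Ident A (Cod A h)))"
  shows "functor_comp (slice A (omap P (Dom A h))) (extend C (Cod A h) w q) (slice_map A (amap P h)) = extend C (Dom A h) v p"
proof -
  interpret C: category C by (rule C)
  let ?a = "Dom A h" and ?b = "Cod A h"
  have ab: "?a \<in> Obj A" "?b \<in> Obj A" using dom_cod[OF h] by auto
  note S = slice_category[OF category_axioms]
  have wF: "is_functor (slice A ?b) C w" using w by (simp add: functors_def)
  have hF: "is_functor (slice A ?a) (slice A ?b) (slice_map A h)" by (rule slice_map_functor[OF h])
  have v: "v \<in> functors (slice A ?a) C" unfolding v_def by (rule functor_comp_in[OF S hF wF])
  have to: "(h, h, Ident A ?b) \<in> Arr (slice A ?b)" by (rule to_id_arr[OF ab(2) h refl])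
  note W = functorD(2-4)[OF wF to]
  have p: "p \<in> Arr C" "Cod C p = Cod C q" "Dom C p = omap w h"
    unfolding p_def using C.comp_arr[OF W(1) q(1)] W(2,3) q(2) by (simp_all add: slice_ops)
  have ia: "Ident A ?a \<in> Arr A" "Cod A (Ident A ?a) = ?a" "Dom A (Ident A ?a) = ?a" using id_arr[OF ab(1)] by auto
  have dp: "Dom C p = omap v (Ident A ?a)"
    using p(3) ia comp_id_right[OF h] by (simp add: v_def functor_comp_simps slice_ops slice_map_def)
  have E: "is_functor (slice A (omap P ?b)) C (extend C ?b w q)" using extend_in[OF C ab(2) w q] by (simp add: functors_def)
  have PF: "is_functor (slice A (omap P ?a)) (slice A (omap P ?b)) (slice_map A (amap P h))"
    using slice_map_functor[OF P_arr(1)[OF h]] P_arr[OF h] by simp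
  have vo: "omap v f = omap w (Comp A h f)" if "f \<in> Arr A" "Cod A f = ?a" for f
    using that by (simp add: v_def functor_comp_simps slice_ops slice_map_def)
  have va: "amap v (f, k, g) = amap w (Comp A h f, k, Comp A h g)" if "(f, k, g) \<in> Arr (slice A ?a)" for f k g
    using that by (simp add: v_def functor_comp_simps slice_map_def)
  show ?thesis
  proof (rule functors_eqI[OF functor_comp_in[OF S PF E] extend_in[OF C ab(1) v p(1) dp]])
    fix f assume f: "f \<in> Obj (slice A (omap P ?a))"
    then have f': "f \<in> Arr A" "Cod A f = omap P ?a" by (simp_all add: slice_ops)
    have "omap (functor_comp (slice A (omap P ?a)) (extend C ?b w q) (slice_map A (amap P h))) f = omap (extend C ?b w q) (Comp A (amap P h) f)"
      by (simp add: functor_comp_simps(1)[OF f]) (simp add: slice_map_def)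
    also have "\<dots> = omap (extend C ?a v p) f"
      using comp_arr[OF f'(1) P_arr(1)[OF h]] P_arr[OF h] f' old_P[OF h f'] p(2) vo factor[of ?a f]
      by (simp add: extend_omap)
    finally show "omap (functor_comp (slice A (omap P ?a)) (extend C ?b w q) (slice_map A (amap P h))) f = omap (extend C ?a v p) f" .
  next
    fix s assume s: "s \<in> Arr (slice A (omap P ?a))"
    obtain f k g where sd: "s = (f, k, g)" by (metis prod.collapse)
    have f: "f \<in> Arr A" "Cod A f = omap P ?a" and g: "g \<in> Arr A" "Cod A g = omap P ?a"
      and k: "k \<in> Arr A" "Cod A k = Dom A g" "Comp A g k = f" using s sd by (auto simp: slice_arr_iff)
    let ?f = "Comp A (amap P h) f" and ?g = "Comp A (amap P h) g"
    have s': "(?f, k, ?g) \<in> Arr (slice A (omap P ?b))" using functorD(2)[OF PF s] by (simp add: sd slice_map_def)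
    have "amap (functor_comp (slice A (omap P ?a)) (extend C ?b w q) (slice_map A (amap P h))) s = amap (extend C ?b w q) (?f, k, ?g)"
      by (simp add: functor_comp_simps(2)[OF s]) (simp add: sd slice_map_def)
    also have "\<dots> = amap (extend C ?a v p) (f, k, g)"
    proof (cases "old ?a g")
      case og: True
      note oc = old_comp[OF ab(1) og k(1,2)]
      have of: "old ?a f" using oc(1) k(3) by simp
      have ff: "factor ?a f = Comp A (factor ?a g) k" using oc(2) k(3) by simp
      have "(factor ?a f, k, factor ?a g) \<in> Arr (slice A ?a)"
        using factor[OF of] factor[OF og] factor_dom[OF og ab(1)] factor_dom[OF of ab(1)] k s sd ff by (simp add: slice_arr_iff)
      then show ?thesis
        using og of old_P[OF h f] old_P[OF h g] va s[unfolded sd] by (simp add: extend_amap[OF s'] extend_amap)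
    next
      case ng: False
      show ?thesis
      proof (cases "old ?a f")
        case of: True
        let ?k = "factor ?a f"
        have k': "?k \<in> Arr A" "Cod A ?k = ?a" using factor[OF of] by auto
        have hk: "Comp A h ?k \<in> Arr A" "Cod A (Comp A h ?k) = ?b" "Dom A (Comp A h ?k) = Dom A ?k" using comp_arr[OF k'(1) h] k' by auto
        have t1: "(Comp A h ?k, ?k, h) \<in> Arr (slice A ?b)" using hk k' h by (simp add: slice_arr_iff)
        have "amap w (Comp A h ?k, Comp A h ?k, Ident A ?b) = Comp C (amap w (h, h, Ident A ?b)) (amap w (Comp A h ?k, ?k, h))"
          using functorD(6)[OF wF t1 to] by (simp add: slice_ops)
        then have "Comp C q (amap w (Comp A h ?k, Comp A h ?k, Ident A ?b)) = Comp C p (amap w (Comp A h ?k, ?k, h))"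
          using C.comp_assoc[OF functorD(2)[OF wF t1] W(1) q(1)] functorD(4)[OF wF t1] W(2,3) q(2) by (simp add: p_def slice_ops)
        moreover have "amap v (?k, ?k, Ident A ?a) = amap w (Comp A h ?k, ?k, h)"
          using va[OF to_id_arr[OF ab(1) k']] comp_id_right[OF h] by simp
        ultimately show ?thesis
          using ng of old_P[OF h f] old_P(1)[OF h g] s[unfolded sd] by (simp add: extend_amap[OF s'] extend_amap)
      next
        case nf: False
        then show ?thesis
          using ng old_P(1)[OF h f] old_P(1)[OF h g] s[unfolded sd] p(2) by (simp add: extend_amap[OF s'] extend_amap)
      qed
    qed
    finally show "amap (functor_comp (slice A (omap P ?a)) (extend C ?b w q) (slice_map A (amap P h))) s = amap (extend C ?a v p) s"
      by (simp add: sd)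
  qed
qed

definition const_slice :: "('c, 'd) cat \<Rightarrow> 'c \<Rightarrow> ('m, 'm \<times> 'm \<times> 'm, 'c, 'd) fnctr" where
  "const_slice C c = \<lparr>omap = restrict (\<lambda>_. c) (Obj (slice A e)), amap = restrict (\<lambda>_. Ident C c) (Arr (slice A e))\<rparr>"

lemma const_slice_in:
  assumes C: "category C" and c: "c \<in> Obj C"
  shows "const_slice C c \<in> functors (slice A e) C"
proof -
  interpret C: category C by (rule C)
  interpret S: category "slice A e" by (rule slice_category[OF category_axioms])
  have "is_functor (slice A e) C (const_slice C c)"
    unfolding is_functor_def
    using c C.id_arr[OF c] C.comp_id_left[of "Ident C c"] S.dom_cod S.id_arr S.comp_arr by (simp add: const_slice_def)
  then show ?thesis by (simp add: functors_def const_slice_def)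
qed

text \<open>Arrows into \<open>e\<close> miss the sieve after composition with \<open>j a\<close>,
  so only the constant part of the extension is seen.\<close>

lemma restr_extend_j:
  assumes C: "category C" and a: "a \<in> Obj A" and v: "v \<in> functors (slice A a) C"
    and p: "p \<in> Arr C" "Dom C p = omap v (Ident A a)"
  shows "functor_comp (slice A e) (extend C a v p) (slice_map A (j a)) = const_slice C (Cod C p)"
proof -
  interpret C: category C by (rule C)
  note ja = j[OF a]
  have F: "is_functor (slice A e) (slice A (omap P a)) (slice_map A (j a))" using slice_map_functor[of "j a"] ja by simp
  have E: "is_functor (slice A (omap P a)) C (extend C a v p)" using extend_in[OF C a v p] by (simp add: functors_def)
  have c: "Cod C p \<in> Obj C" using C.dom_cod[OF p(1)] by simp
  show ?thesis
  proof (rule functors_eqI[OF functor_comp_in[OF slice_category[OF category_axioms] F E] const_slice_in[OF C c]])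
    fix f assume f: "f \<in> Obj (slice A e)"
    then have f': "f \<in> Arr A" "Cod A f = e" by (simp_all add: slice_ops)
    have "Comp A (j a) f \<in> Arr A" "Cod A (Comp A (j a) f) = omap P a" using comp_arr[OF f'(1), of "j a"] ja f' by auto
    then show "omap (functor_comp (slice A e) (extend C a v p) (slice_map A (j a))) f = omap (const_slice C (Cod C p)) f"
      using not_old_j[OF a f'] f by (simp add: functor_comp_simps(1)[OF f] slice_map_def extend_omap const_slice_def)
  next
    fix s assume s: "s \<in> Arr (slice A e)"
    obtain f h g where sd: "s = (f, h, g)" by (metis prod.collapse)
    have f: "f \<in> Arr A" "Cod A f = e" and g: "g \<in> Arr A" "Cod A g = e" using s sd by (auto simp: slice_arr_iff)
    have "(Comp A (j a) f, h, Comp A (j a) g) \<in> Arr (slice A (omap P a))"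
      using functorD(2)[OF F s] by (simp add: sd slice_map_def)
    then show "amap (functor_comp (slice A e) (extend C a v p) (slice_map A (j a))) s = amap (const_slice C (Cod C p)) s"
      using not_old_j[OF a f] not_old_j[OF a g] s
      by (simp add: functor_comp_simps(2)[OF s]) (simp add: sd slice_map_def extend_amap const_slice_def)
  qed
qed

section \<open>Contraction of the comma categories of the counit\<close>

lemma comma_counit_arrI:
  assumes "h \<in> Arr A" "w \<in> functors (slice A (Cod A h)) C" "v = functor_comp (slice A (Dom A h)) w (slice_map A h)"
    "q \<in> Arr C" "Dom C q = omap w (Ident A (Cod A h))" "Cod C q = c" "p = Comp C q (amap w (h, h, Ident A (Cod A h)))"
    "a = Dom A h" "b = Cod A h"
  shows "(((a, v), p), ((a, v), h, (b, w)), ((b, w), q)) \<in> Arr (comma (elements A (slice_functors A C)) C (counit A) c)"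
  using assms dom_cod[OF assms(1)] by (simp add: comma_def elements_def slice_functors_def counit_def)

lemma comma_counit_obj:
  "((a, v), p) \<in> Obj (comma (elements A (slice_functors A C)) C (counit A) c) \<longleftrightarrow>
    a \<in> Obj A \<and> v \<in> functors (slice A a) C \<and> p \<in> Arr C \<and> Dom C p = omap v (Ident A a) \<and> Cod C p = c"
  by (auto simp: comma_def elements_def slice_functors_def counit_def)

lemma contractible_comma_counit:
  assumes C: "category C" and c: "c \<in> Obj C"
  shows "contractible_space (BC (comma (elements A (slice_functors A C)) C (counit A) c))"
    and "Obj (comma (elements A (slice_functors A C)) C (counit A) c) \<noteq> {}"
proof -
  interpret C: category C by (rule C)
  note ic = C.id_arr[OF c]
  let ?E = "comma (elements A (slice_functors A C)) C (counit A) c"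
  have E: "category ?E"
    by (rule comma_category[OF elements_category[OF category_axioms presheaf_slice_functors] C is_functor_counit])
  \<comment> \<open>The identity of \<open>P a\<close> is outside the sieve, so the extension takes
    the value \<open>c\<close> there, and the new structure arrow can be the identity of
    \<open>c\<close>.\<close>
  define Qo where "Qo = (\<lambda>((a, v), p). ((omap P a, extend C a v p), Ident C c))"
  define Q where "Q = \<lparr>omap = Qo, amap = (\<lambda>s. (Qo (Dom ?E s), (fst (Qo (Dom ?E s)), amap P (fst (snd (fst (snd s)))), fst (Qo (Cod ?E s))), Qo (Cod ?E s)))\<rparr>"
  define e0 where "e0 = ((e, const_slice C c), Ident C c)"
  have e0: "e0 \<in> Obj ?E"
    using const_slice_in[OF C c] e ic id_arr[OF e] by (simp add: e0_def comma_counit_obj) (simp add: const_slice_def slice_ops)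
  have Qo: "Qo x \<in> Obj ?E" if x: "x \<in> Obj ?E" for x
  proof -
    obtain a v p where xd: "x = ((a, v), p)" by (metis prod.collapse)
    then have a: "a \<in> Obj A" and v: "v \<in> functors (slice A a) C" and p: "p \<in> Arr C" "Dom C p = omap v (Ident A a)" "Cod C p = c"
      using x by (simp_all add: comma_counit_obj)
    show ?thesis
      using extend_in[OF C a v p(1,2)] functorD(1)[OF P a] ic p id_arr[OF functorD(1)[OF P a]] not_old_id[OF a]
      by (simp add: Qo_def xd comma_counit_obj extend_omap)
  qed
  have QF: "is_functor ?E ?E Q"
    unfolding is_functor_def
  proof (intro conjI ballI impI)
    show "omap Q x \<in> Obj ?E" if "x \<in> Obj ?E" for x using Qo[OF that] by (simp add: Q_def)
    show "amap Q (Ident ?E x) = Ident ?E (omap Q x)" if "x \<in> Obj ?E" for x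
    proof -
      obtain a v p where xd: "x = ((a, v), p)" by (metis prod.collapse)
      then have "a \<in> Obj A" using that by (simp add: comma_counit_obj)
      then show ?thesis using functorD(5)[OF P] by (simp add: Q_def Qo_def xd comma_def elements_def)
    qed
  next
    fix s assume s: "s \<in> Arr ?E"
    obtain h w q where h: "h \<in> Arr A" and w: "w \<in> functors (slice A (Cod A h)) C"
      and q: "q \<in> Arr C" "Dom C q = omap w (Ident A (Cod A h))" "Cod C q = c"
      and sd: "s = (((Dom A h, functor_comp (slice A (Dom A h)) w (slice_map A h)), Comp C q (amap w (h, h, Ident A (Cod A h)))),
        ((Dom A h, functor_comp (slice A (Dom A h)) w (slice_map A h)), h, (Cod A h, w)), ((Cod A h, w), q))"
      by (rule comma_elements_cases[OF s])
    note Ph = P_arr[OF h] and D = dom_cod[OF h]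
    have m: "(amap P h, amap P h, Ident A (omap P (Cod A h))) \<in> Arr (slice A (omap P (Cod A h)))"
      using to_id_arr[OF functorD(1)[OF P D[THEN conjunct2]] Ph(1,3)] .
    have "amap (extend C (Cod A h) w q) (amap P h, amap P h, Ident A (omap P (Cod A h))) = Ident C c"
      using not_old_P[OF h] not_old_id[of "Cod A h"] D q(3) by (simp add: extend_amap[OF m])
    moreover have "omap (extend C (Cod A h) w q) (Ident A (omap P (Cod A h))) = c"
      using not_old_id[of "Cod A h"] D q(3) id_arr[OF functorD(1)[OF P D[THEN conjunct2]]] by (simp add: extend_omap)
    moreover have "Comp C (Ident C c) (Ident C c) = Ident C c" using C.comp_id_left[of "Ident C c"] ic by simp
    moreover have "extend C (Cod A h) w q \<in> functors (slice A (omap P (Cod A h))) C"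
      by (rule extend_in[OF C D[THEN conjunct2] w q(1,2)])
    ultimately have arr: "(((omap P (Dom A h), extend C (Dom A h) (functor_comp (slice A (Dom A h)) w (slice_map A h)) (Comp C q (amap w (h, h, Ident A (Cod A h))))), Ident C c),
        ((omap P (Dom A h), extend C (Dom A h) (functor_comp (slice A (Dom A h)) w (slice_map A h)) (Comp C q (amap w (h, h, Ident A (Cod A h))))), amap P h,
          (omap P (Cod A h), extend C (Cod A h) w q)), ((omap P (Cod A h), extend C (Cod A h) w q), Ident C c)) \<in> Arr ?E"
      by (intro comma_counit_arrI) (use restr_extend_P[OF C h w q(1,2)] Ph ic in simp_all)
    have Ds: "Dom ?E s = ((Dom A h, functor_comp (slice A (Dom A h)) w (slice_map A h)), Comp C q (amap w (h, h, Ident A (Cod A h))))"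
      "Cod ?E s = ((Cod A h, w), q)" by (simp_all add: sd comma_def)
    show "amap Q s \<in> Arr ?E" using arr unfolding Q_def fnctr.simps Ds by (simp add: Qo_def sd)
    show "Dom ?E (amap Q s) = omap Q (Dom ?E s)" "Cod ?E (amap Q s) = omap Q (Cod ?E s)"
      by (simp_all add: Q_def Qo_def sd comma_def)
    fix t assume t: "t \<in> Arr ?E" "Dom ?E t = Cod ?E s"
    obtain k w' q' where k: "k \<in> Arr A"
      and td: "t = (((Dom A k, functor_comp (slice A (Dom A k)) w' (slice_map A k)), Comp C q' (amap w' (k, k, Ident A (Cod A k)))),
        ((Dom A k, functor_comp (slice A (Dom A k)) w' (slice_map A k)), k, (Cod A k, w')), ((Cod A k, w'), q'))"
      by (rule comma_elements_cases[OF t(1)])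
    have "((Dom A k, functor_comp (slice A (Dom A k)) w' (slice_map A k)), Comp C q' (amap w' (k, k, Ident A (Cod A k)))) = ((Cod A h, w), q)"
      using t(2) by (simp only: sd td comma_def cat.simps case_prod_conv)
    then have "Dom A k = Cod A h" by (simp only: prod.inject)
    then show "amap Q (Comp ?E t s) = Comp ?E (amap Q t) (amap Q s)"
      using functorD(6)[OF P h k] by (simp add: Q_def Qo_def sd td comma_def elements_def)
  qed
  define \<eta> where "\<eta> = (\<lambda>x. (x, (fst x, i (fst (fst x)), fst (Qo x)), Qo x))"
  define \<epsilon> where "\<epsilon> = (\<lambda>x. (e0, (fst e0, j (fst (fst x)), fst (Qo x)), Qo x))"
  have \<eta>: "\<eta> x \<in> Arr ?E" and \<epsilon>: "\<epsilon> x \<in> Arr ?E" if x: "x \<in> Obj ?E" for x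
  proof -
    obtain a v p where xd: "x = ((a, v), p)" by (metis prod.collapse)
    then have a: "a \<in> Obj A" and v: "v \<in> functors (slice A a) C" and p: "p \<in> Arr C" "Dom C p = omap v (Ident A a)" "Cod C p = c"
      using x by (simp_all add: comma_counit_obj)
    have Pa: "omap P a \<in> Obj A" by (rule functorD(1)[OF P a])
    note ia = i[OF a] and ja = j[OF a]
    have id: "Ident A a \<in> Arr A" "Cod A (Ident A a) = a" using id_arr[OF a] by auto
    have vF: "is_functor (slice A a) C v" using v by (simp add: functors_def)
    have io: "Comp A (i a) (Ident A a) = i a" using comp_id_right[of "i a"] ia by simp
    have mi: "(i a, i a, Ident A (omap P a)) \<in> Arr (slice A (omap P a))" using to_id_arr[OF Pa] ia by simp
    have mj: "(j a, j a, Ident A (omap P a)) \<in> Arr (slice A (omap P a))" using to_id_arr[OF Pa] ja by simp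
    have "amap v (Ident A a, Ident A a, Ident A a) = Ident C (Dom C p)"
      using functorD(5)[OF vF, of "Ident A a"] id id_arr[OF a] p(2) by (simp add: slice_ops)
    \<comment> \<open>The extension sends \<open>i a\<close>, as an arrow to the identity of
      \<open>P a\<close>, to \<open>p\<close>; this is the commutativity demanded of an arrow over
      \<open>c\<close>.\<close>
    then have 1: "amap (extend C a v p) (i a, i a, Ident A (omap P a)) = p"
      using not_old_id[OF a] factor_comp[OF a id] C.comp_id_right[OF p(1)] by (simp add: extend_amap[OF mi] io)
    have "\<not> old a (Comp A (j a) (Ident A e))" using not_old_j[OF a] id_arr[OF e] by simp
    then have "\<not> old a (j a)" using comp_id_right[of "j a"] ja by simp
    \<comment> \<open>Along \<open>j a\<close> everything happens outside the sieve, so the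
      structure arrow obtained is the identity of \<open>c\<close>.\<close>
    then have 2: "amap (extend C a v p) (j a, j a, Ident A (omap P a)) = Ident C c"
      using not_old_id[OF a] p(3) by (simp add: extend_amap[OF mj])
    have 3: "omap (extend C a v p) (Ident A (omap P a)) = c"
      using not_old_id[OF a] p(3) id_arr[OF Pa] by (simp add: extend_omap)
    have 4: "extend C a v p \<in> functors (slice A (omap P a)) C" by (rule extend_in[OF C a v p(1,2)])
    have 5: "Comp C (Ident C c) p = p" "Comp C (Ident C c) (Ident C c) = Ident C c"
      using C.comp_id_left[OF p(1)] C.comp_id_left[of "Ident C c"] ic p(3) by auto
    show "\<eta> x \<in> Arr ?E"
      unfolding \<eta>_def Qo_def xd fst_conv case_prod_conv
      by (rule comma_counit_arrI) (use ia ic 1 3 4 5 restr_extend_i[OF C a v p(1,2)] in simp_all)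
    show "\<epsilon> x \<in> Arr ?E"
      unfolding \<epsilon>_def Qo_def xd e0_def fst_conv case_prod_conv
      by (rule comma_counit_arrI) (use ja ic 2 3 4 5 restr_extend_j[OF C a v p(1,2)] p(3) in simp_all)
  qed
  have n\<eta>: "natural_transformation ?E ?E id_functor Q \<eta>"
    unfolding natural_transformation_def
  proof (intro conjI ballI)
    show "\<eta> x \<in> Arr ?E" if "x \<in> Obj ?E" for x by (rule \<eta>[OF that])
    show "Dom ?E (\<eta> x) = omap id_functor x" "Cod ?E (\<eta> x) = omap Q x" for x by (simp_all add: \<eta>_def comma_def Q_def)
    fix s assume s: "s \<in> Arr ?E"
    obtain h w q where h: "h \<in> Arr A"
      and sd: "s = (((Dom A h, functor_comp (slice A (Dom A h)) w (slice_map A h)), Comp C q (amap w (h, h, Ident A (Cod A h)))),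
        ((Dom A h, functor_comp (slice A (Dom A h)) w (slice_map A h)), h, (Cod A h, w)), ((Cod A h, w), q))"
      by (rule comma_elements_cases[OF s])
    show "Comp ?E (amap Q s) (\<eta> (Dom ?E s)) = Comp ?E (\<eta> (Cod ?E s)) (amap id_functor s)"
      using i_natural[OF h] by (simp add: Q_def Qo_def \<eta>_def sd comma_def elements_def)
  qed
  have n\<epsilon>: "natural_transformation ?E ?E \<lparr>omap = \<lambda>_. e0, amap = \<lambda>_. Ident ?E e0\<rparr> Q \<epsilon>"
    unfolding natural_transformation_def
  proof (intro conjI ballI)
    show "\<epsilon> x \<in> Arr ?E" if "x \<in> Obj ?E" for x by (rule \<epsilon>[OF that])
    show "Dom ?E (\<epsilon> x) = omap \<lparr>omap = \<lambda>_. e0, amap = \<lambda>_. Ident ?E e0\<rparr> x" "Cod ?E (\<epsilon> x) = omap Q x" for x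
      by (simp_all add: \<epsilon>_def comma_def Q_def)
    fix s assume s: "s \<in> Arr ?E"
    obtain h w q where h: "h \<in> Arr A"
      and sd: "s = (((Dom A h, functor_comp (slice A (Dom A h)) w (slice_map A h)), Comp C q (amap w (h, h, Ident A (Cod A h)))),
        ((Dom A h, functor_comp (slice A (Dom A h)) w (slice_map A h)), h, (Cod A h, w)), ((Cod A h, w), q))"
      by (rule comma_elements_cases[OF s])
    have "Comp A (j (Cod A h)) (Ident A e) = j (Cod A h)" using comp_id_right[of "j (Cod A h)"] j[of "Cod A h"] dom_cod[OF h] by simp
    then show "Comp ?E (amap Q s) (\<epsilon> (Dom ?E s)) = Comp ?E (\<epsilon> (Cod ?E s)) (amap \<lparr>omap = \<lambda>_. e0, amap = \<lambda>_. Ident ?E e0\<rparr> s)"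
      using j_natural[OF h] by (simp add: Q_def Qo_def \<epsilon>_def e0_def sd comma_def elements_def)
  qed
  show "contractible_space (BC ?E)" by (rule contractible_zigzag[OF E QF e0 n\<eta> n\<epsilon>])
  show "Obj ?E \<noteq> {}" using e0 by blast
qed

theorem weak_test: "weak_test_category TYPE('c \<times> 'd) A"
  unfolding weak_test_category_def
proof (intro conjI allI impI)
  show "category A" by (rule category_axioms)
  fix C :: "('c, 'd) cat" assume C: "category C"
  show "weak_equivalence (elements A (slice_functors A C)) C (counit A)"
    by (rule Theorem_A[OF elements_category[OF category_axioms presheaf_slice_functors] C is_functor_counit
        contractible_comma_counit[OF C]])
qed

end

section \<open>Slices and products\<close>

text \<open>The retractions of closed trees are not natural, as a map of trees need not preserve
  roots; they only split \<open>i\<close>. This suffices because slices and spans have fixed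
  targets: \<open>hat\<close> extends an arrow along \<open>i\<close> without moving its
  target.\<close>

locale decalage_retract = decalage A P i e j
  for A :: "('o, 'm) cat" and P :: "('o, 'm, 'o, 'm) fnctr" and i :: "'o \<Rightarrow> 'm" and e :: 'o and j :: "'o \<Rightarrow> 'm" +
  fixes r :: "'o \<Rightarrow> 'm"
  assumes r: "a \<in> Obj A \<Longrightarrow> r a \<in> Arr A \<and> Dom A (r a) = omap P a \<and> Cod A (r a) = a"
    and r_i: "a \<in> Obj A \<Longrightarrow> Comp A (r a) (i a) = Ident A a"
begin

definition hat :: "'m \<Rightarrow> 'm" where
  "hat f = Comp A (r (Cod A f)) (amap P f)"

definition base :: "'o \<Rightarrow> 'm" where
  "base a = Comp A (r a) (j a)"

lemma base: "a \<in> Obj A \<Longrightarrow> base a \<in> Arr A \<and> Dom A (base a) = e \<and> Cod A (base a) = a"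
  using comp_arr[of "j a" "r a"] r[of a] j[of a] by (simp add: base_def)

lemma hat_arr:
  assumes "f \<in> Arr A"
  shows "hat f \<in> Arr A" "Dom A (hat f) = omap P (Dom A f)" "Cod A (hat f) = Cod A f"
  using comp_arr[of "amap P f" "r (Cod A f)"] P_arr[OF assms] r[of "Cod A f"] dom_cod[OF assms] by (auto simp: hat_def)

text \<open>Only the retraction at the target occurs on either side, so functoriality of
  \<open>P\<close> is what is needed.\<close>

lemma hat_comp:
  assumes "h \<in> Arr A" "g \<in> Arr A" "Dom A g = Cod A h"
  shows "hat (Comp A g h) = Comp A (hat g) (amap P h)"
  using comp_assoc[of "amap P h" "amap P g" "r (Cod A g)"] P_arr[OF assms(1)] P_arr[OF assms(2)] assms(3)
    r[of "Cod A g"] dom_cod[OF assms(2)] functorD(6)[OF P assms] comp_arr[OF assms] by (simp add: hat_def)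

lemma hat_i: "f \<in> Arr A \<Longrightarrow> Comp A (hat f) (i (Dom A f)) = f"
  using comp_assoc[of "i (Dom A f)" "amap P f" "r (Cod A f)"] comp_assoc[of f "i (Cod A f)" "r (Cod A f)"]
    i_natural[of f] P_arr[of f] i[of "Dom A f"] i[of "Cod A f"] r[of "Cod A f"] r_i[of "Cod A f"] dom_cod[of f] comp_id_left[of f]
  by (simp add: hat_def)

lemma hat_j: "f \<in> Arr A \<Longrightarrow> Comp A (hat f) (j (Dom A f)) = base (Cod A f)"
  using comp_assoc[of "j (Dom A f)" "amap P f" "r (Cod A f)"] j_natural[of f] P_arr[of f] j[of "Dom A f"] r[of "Cod A f"] dom_cod[of f]
  by (simp add: hat_def base_def)

text \<open>Objects of the slice are moved by \<open>hat\<close>, which keeps their target, and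
  \<open>base T\<close> is the new base object. The conditions on the sieve are inherited from
  \<open>A\<close>, since an arrow of the slice between given objects is an arrow of
  \<open>A\<close>.\<close>

lemma decalage_slice:
  assumes T: "T \<in> Obj A"
  shows "decalage (slice A T) \<lparr>omap = hat, amap = \<lambda>(f, h, g). (hat f, amap P h, hat g)\<rparr>
    (\<lambda>f. (f, i (Dom A f), hat f)) (base T) (\<lambda>f. (base T, j (Dom A f), hat f))"
    (is "decalage ?S ?P ?i _ ?j")
proof -
  interpret S: category ?S by (rule slice_category[OF category_axioms])
  have arr: "(hat f, amap P h, hat g) \<in> Arr ?S" if "(f, h, g) \<in> Arr ?S" for f h g
    using that P_arr[of h] hat_arr[of f] hat_arr[of g] hat_comp[of h g] by (auto simp: slice_arr_iff)
  show ?thesis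
  proof
    show "is_functor ?S ?S ?P"
      unfolding is_functor_def
    proof (intro conjI ballI impI)
      show "omap ?P f \<in> Obj ?S" if "f \<in> Obj ?S" for f using that hat_arr[of f] by (simp add: slice_ops)
      show "amap ?P (Ident ?S f) = Ident ?S (omap ?P f)" if "f \<in> Obj ?S" for f
        using that hat_arr[of f] functorD(5)[OF P, of "Dom A f"] dom_cod[of f] by (simp add: slice_ops)
      fix s assume s: "s \<in> Arr ?S"
      obtain f h g where sd: "s = (f, h, g)" by (metis prod.collapse)
      show "amap ?P s \<in> Arr ?S" "Dom ?S (amap ?P s) = omap ?P (Dom ?S s)" "Cod ?S (amap ?P s) = omap ?P (Cod ?S s)"
        using arr s by (simp_all add: sd slice_ops)
      fix t assume t: "t \<in> Arr ?S" "Dom ?S t = Cod ?S s"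
      obtain k l where td: "t = (g, k, l)" using t(2) by (cases t) (auto simp: sd slice_ops)
      have "h \<in> Arr A" "k \<in> Arr A" "Dom A k = Cod A h" using s t by (auto simp: sd td slice_arr_iff)
      then show "amap ?P (Comp ?S t s) = Comp ?S (amap ?P t) (amap ?P s)"
        using functorD(6)[OF P] by (simp add: sd td slice_ops)
    qed
    show "base T \<in> Obj ?S" using base[OF T] by (simp add: slice_ops)
    show "?i f \<in> Arr ?S \<and> Dom ?S (?i f) = f \<and> Cod ?S (?i f) = omap ?P f" if "f \<in> Obj ?S" for f
      using that hat_arr[of f] hat_i[of f] i[of "Dom A f"] dom_cod[of f] by (simp add: slice_ops slice_arr_iff)
    show "?j f \<in> Arr ?S \<and> Dom ?S (?j f) = base T \<and> Cod ?S (?j f) = omap ?P f" if "f \<in> Obj ?S" for f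
      using that hat_arr[of f] hat_j[of f] j[of "Dom A f"] dom_cod[of f] base[OF T] by (simp add: slice_ops slice_arr_iff)
    fix s assume s: "s \<in> Arr ?S"
    obtain f h g where sd: "s = (f, h, g)" by (metis prod.collapse)
    have h: "h \<in> Arr A" "Dom A h = Dom A f" "Cod A h = Dom A g" and g: "g \<in> Arr A" "Cod A g = T" "Comp A g h = f"
      using s by (auto simp: sd slice_arr_iff)
    show "Comp ?S (amap ?P s) (?i (Dom ?S s)) = Comp ?S (?i (Cod ?S s)) s"
      using i_natural[OF h(1)] h by (simp add: sd slice_ops)
    show "Comp ?S (amap ?P s) (?j (Dom ?S s)) = ?j (Cod ?S s)"
      using j_natural[OF h(1)] h by (simp add: sd slice_ops)
    fix t u assume t: "t \<in> Arr ?S" "Cod ?S t = omap ?P (Dom ?S s)" and u: "u \<in> Arr ?S" "Cod ?S u = Cod ?S s"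
      and eq: "Comp ?S (amap ?P s) t = Comp ?S (?i (Cod ?S s)) u"
    obtain x k where td: "t = (x, k, hat f)" using t(2) by (cases t) (auto simp: sd slice_ops)
    obtain y l where ud: "u = (y, l, g)" using u(2) by (cases u) (auto simp: sd slice_ops)
    have f: "f \<in> Arr A" "Cod A f = T" using s by (auto simp: sd slice_arr_iff)
    have k: "x \<in> Arr A" "Cod A x = T" "k \<in> Arr A" "Dom A k = Dom A x" "Cod A k = omap P (Dom A h)" "Comp A (hat f) k = x"
      using t(1) hat_arr[OF f(1)] h by (auto simp: td slice_arr_iff)
    have l: "l \<in> Arr A" "Cod A l = Cod A h" using u(1) h by (auto simp: ud slice_arr_iff)
    have "Comp A (amap P h) k = Comp A (i (Cod A h)) l" using eq h by (simp add: sd td ud slice_ops)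
    then obtain k' where k': "k' \<in> Arr A" "Cod A k' = Dom A h" "k = Comp A (i (Dom A h)) k'"
      using i_reflect[OF h(1) k(3,5) l] by blast
    have iD: "i (Dom A f) \<in> Arr A" "Dom A (i (Dom A f)) = Dom A f" "Cod A (i (Dom A f)) = omap P (Dom A f)"
      using i[of "Dom A f"] dom_cod[OF f(1)] by auto
    \<comment> \<open>The factorisation found in \<open>A\<close> lies over \<open>T\<close> because
      \<open>hat f\<close> restricts to \<open>f\<close> along \<open>i\<close>.\<close>
    have "Comp A f k' = Comp A (Comp A (hat f) (i (Dom A f))) k'" using hat_i[OF f(1)] by simp
    also have "\<dots> = Comp A (hat f) k"
      using comp_assoc[OF k'(1) iD(1) hat_arr(1)[OF f(1)]] k' h iD hat_arr[OF f(1)] by simp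
    finally have fx: "Comp A f k' = x" using k(6) by simp
    have "Dom A k' = Dom A x" using comp_arr[OF k'(1) f(1)] k' h fx by simp
    then have "(x, k', f) \<in> Arr ?S" using k k' f fx h by (simp add: slice_arr_iff)
    then show "\<exists>k'\<in>Arr ?S. Cod ?S k' = Dom ?S s \<and> t = Comp ?S (?i (Dom ?S s)) k'"
      by (intro bexI[of _ "(x, k', f)"]) (use k'(3) h in \<open>simp_all add: sd td slice_ops\<close>)
  next
    fix s t f assume s: "s \<in> Arr ?S" "Cod ?S s = f" and t: "t \<in> Arr ?S" "Cod ?S t = f" and f: "f \<in> Obj ?S"
      and d: "Dom ?S s = Dom ?S t" and eq: "Comp ?S (?i f) s = Comp ?S (?i f) t"
    obtain x h where sd: "s = (x, h, f)" using s(2) by (cases s) (auto simp: slice_ops)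
    obtain k where td: "t = (x, k, f)" using t(2) d by (cases t) (auto simp: sd slice_ops)
    have "h \<in> Arr A" "k \<in> Arr A" "Cod A h = Dom A f" "Cod A k = Dom A f" "Dom A h = Dom A k"
      using s(1) t(1) by (auto simp: sd td slice_arr_iff)
    moreover have "Dom A f \<in> Obj A" using f dom_cod by (simp add: slice_ops)
    ultimately have "h = k" using eq i_mono by (simp add: sd td slice_ops)
    then show "s = t" by (simp add: sd td)
  next
    fix f s t assume f: "f \<in> Obj ?S" and s: "s \<in> Arr ?S" "Cod ?S s = base T" and t: "t \<in> Arr ?S" "Cod ?S t = f"
    obtain x h where sd: "s = (x, h, base T)" using s(2) by (cases s) (auto simp: slice_ops)
    obtain y k where td: "t = (y, k, f)" using t(2) by (cases t) (auto simp: slice_ops)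
    have "h \<in> Arr A" "Cod A h = e" "k \<in> Arr A" "Cod A k = Dom A f"
      using s(1) t(1) base[OF T] by (auto simp: sd td slice_arr_iff)
    moreover have "Dom A f \<in> Obj A" using f dom_cod by (simp add: slice_ops)
    ultimately show "Comp ?S (?j f) s \<noteq> Comp ?S (?i f) t"
      using ij_disjoint by (simp add: sd td slice_ops)
  qed
qed

lemma is_functor_elements_product_map:
  assumes X: "presheaf A X" and Y: "presheaf A Y"
  shows "is_functor (elements A (product_presheaf X Y)) (product_category (elements A X) (elements A Y)) elements_product_map"
  by (auto simp: is_functor_def elements_def product_presheaf_def product_category_def elements_product_map_def)

text \<open>An object of the comma category of \<open>A / (X \<times> Y) \<rightarrow> A / X \<times> A / Y\<close> over \<open>((a, x), (b, y))\<close> is a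
  span \<open>a \<leftarrow> c \<rightarrow> b\<close>; the components in \<open>X\<close> and \<open>Y\<close> are determined by it.\<close>

definition span_obj where
  "span_obj X Y x y f g =
    ((Dom A f, (restr X f x, restr Y g y)),
     (((Dom A f, restr X f x), f, (Cod A f, x)), ((Dom A f, restr Y g y), g, (Cod A g, y))))"

definition span_arr where
  "span_arr X Y x y f g h = (span_obj X Y x y (Comp A f h) (Comp A g h),
     (fst (span_obj X Y x y (Comp A f h) (Comp A g h)), h, fst (span_obj X Y x y f g)), span_obj X Y x y f g)"

abbreviation (input) span_comma where
  "span_comma X Y a x b y \<equiv> comma (elements A (product_presheaf X Y)) (product_category (elements A X) (elements A Y))
     elements_product_map ((a, x), (b, y))"

lemma span_comma_obj:
  assumes X: "presheaf A X" and Y: "presheaf A Y"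
  shows "p \<in> Obj (span_comma X Y a x b y) \<longleftrightarrow> x \<in> sections X a \<and> y \<in> sections Y b \<and>
    (\<exists>f g. f \<in> Arr A \<and> g \<in> Arr A \<and> Dom A g = Dom A f \<and> Cod A f = a \<and> Cod A g = b \<and> p = span_obj X Y x y f g)"
  (is "?L = ?R")
proof
  assume ?L
  then show ?R
    by (auto simp: comma_def elements_def product_presheaf_def product_category_def elements_product_map_def span_obj_def)
next
  assume ?R
  then obtain f g where f: "f \<in> Arr A" "g \<in> Arr A" "Dom A g = Dom A f" "Cod A f = a" "Cod A g = b" "p = span_obj X Y x y f g"
    and x: "x \<in> sections X a" "y \<in> sections Y b" by blast
  then show ?L
    using presheafD(1)[OF X f(1), of x] presheafD(1)[OF Y f(2), of y] dom_cod[OF f(1)]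
    by (simp add: comma_def elements_def product_presheaf_def product_category_def elements_product_map_def span_obj_def)
qed

text \<open>An arrow of spans is determined by its target and the arrow \<open>h\<close> between the
  apices, since the legs of its source are composites with \<open>h\<close>.\<close>

lemma span_comma_arr:
  assumes X: "presheaf A X" and Y: "presheaf A Y" and x: "x \<in> sections X a" "y \<in> sections Y b"
  shows "s \<in> Arr (span_comma X Y a x b y) \<longleftrightarrow>
    (\<exists>f g h. f \<in> Arr A \<and> g \<in> Arr A \<and> h \<in> Arr A \<and> Dom A g = Dom A f \<and> Cod A h = Dom A f \<and> Cod A f = a \<and> Cod A g = b \<and>
      s = span_arr X Y x y f g h)" (is "?L = ?R")
proof
  assume L: ?L
  obtain p m q where sd: "s = (p, m, q)" by (metis prod.collapse)
  interpret E: category "span_comma X Y a x b y"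
    by (intro comma_category product_category_category elements_category category_axioms product_presheaf_presheaf X Y
        is_functor_elements_product_map)
  have "q \<in> Obj (span_comma X Y a x b y)" using E.dom_cod[OF L] by (simp add: sd comma_def)
  then obtain f g where f: "f \<in> Arr A" "g \<in> Arr A" "Dom A g = Dom A f" "Cod A f = a" "Cod A g = b" "q = span_obj X Y x y f g"
    unfolding span_comma_obj[OF X Y] by blast
  obtain h where h: "h \<in> Arr A" "Cod A h = Dom A f"
    "m = ((Dom A h, (restr X h (restr X f x), restr Y h (restr Y g y))), h, (Dom A f, (restr X f x, restr Y g y)))"
    using L by (auto simp: sd f(6) comma_def elements_def product_presheaf_def span_obj_def)
  note fh = comp_arr[OF h(1) f(1)] and gh = comp_arr[OF h(1) f(2)]
  have rX: "restr X h (restr X f x) = restr X (Comp A f h) x" using presheafD(3)[OF X h(1) f(1)] x f h by simp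
  have rY: "restr Y h (restr Y g y) = restr Y (Comp A g h) y" using presheafD(3)[OF Y h(1) f(2)] x f h by simp
  have "s = span_arr X Y x y f g h"
    using L fh gh f h rX rY
    by (auto simp: sd span_arr_def comma_def elements_def product_presheaf_def product_category_def elements_product_map_def span_obj_def)
  then show ?R using f h by blast
next
  assume ?R
  then obtain f g h where f: "f \<in> Arr A" "g \<in> Arr A" "Dom A g = Dom A f" "Cod A f = a" "Cod A g = b"
    and h: "h \<in> Arr A" "Cod A h = Dom A f" and s: "s = span_arr X Y x y f g h" by blast
  note fh = comp_arr[OF h(1) f(1)] and gh = comp_arr[OF h(1) f(2)]
  have rX: "restr X (Comp A f h) x = restr X h (restr X f x)" using presheafD(3)[OF X h(1) f(1)] x f h by simp
  have rY: "restr Y (Comp A g h) y = restr Y h (restr Y g y)" using presheafD(3)[OF Y h(1) f(2)] x f h by simp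
  have "restr X f x \<in> sections X (Dom A f)" "restr Y g y \<in> sections Y (Dom A f)"
    using presheafD(1)[OF X f(1), of x] presheafD(1)[OF Y f(2), of y] x f by auto
  then show ?L
    using f h fh gh rX rY x
    by (simp add: s span_arr_def comma_def elements_def product_presheaf_def product_category_def elements_product_map_def span_obj_def)
qed

text \<open>A span is moved to the span with legs \<open>hat f\<close> and \<open>hat g\<close>. The
  maps \<open>i\<close> lead from the old span to the new one, and the maps \<open>j\<close> lead to
  it from the fixed span of \<open>base a\<close> and \<open>base b\<close>.\<close>

lemma contractible_comma_product:
  assumes X: "presheaf A X" and Y: "presheaf A Y" and ab: "a \<in> Obj A" "b \<in> Obj A" and x: "x \<in> sections X a" "y \<in> sections Y b"
  shows "contractible_space (BC (span_comma X Y a x b y))" and "Obj (span_comma X Y a x b y) \<noteq> {}"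
proof -
  let ?E = "span_comma X Y a x b y"
  have E: "category ?E"
    by (intro comma_category product_category_category elements_category category_axioms product_presheaf_presheaf X Y
        is_functor_elements_product_map)
  let ?o = "span_obj X Y x y" and ?a = "span_arr X Y x y"
  \<comment> \<open>The legs are read off from the encoded object, so that \<open>Q\<close> can be
    given by a formula.\<close>
  define left where "left p = fst (snd (fst (snd p)))" for p :: "('o \<times> 'a \<times> 'b) \<times> (('o \<times> 'a) \<times> 'm \<times> ('o \<times> 'a)) \<times> (('o \<times> 'b) \<times> 'm \<times> ('o \<times> 'b))"
  define right where "right p = fst (snd (snd (snd p)))" for p :: "('o \<times> 'a \<times> 'b) \<times> (('o \<times> 'a) \<times> 'm \<times> ('o \<times> 'a)) \<times> (('o \<times> 'b) \<times> 'm \<times> ('o \<times> 'b))"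
  have lr: "left (?o f g) = f" "right (?o f g) = g" for f g by (simp_all add: span_obj_def left_def right_def)
  have ops: "Dom ?E (?a f g h) = ?o (Comp A f h) (Comp A g h)" "Cod ?E (?a f g h) = ?o f g" for f g h
    by (simp_all add: span_arr_def comma_def)
  have comp: "Comp ?E (?a f g h) (?a f' g' h') = ?a f g (Comp A h h')"
    if "f' = Comp A f h" "g' = Comp A g h" "f \<in> Arr A" "g \<in> Arr A" "h \<in> Arr A" "h' \<in> Arr A" "Dom A f = Cod A h" "Dom A g = Cod A h" "Dom A h = Cod A h'"
    for f g h f' g' h'
    using comp_assoc[OF that(6,5,3,9,7)] comp_assoc[OF that(6,5,4,9,8)] that(1,2)
    by (simp add: span_arr_def comma_def elements_def)
  have obj: "?o f g \<in> Obj ?E" if "f \<in> Arr A" "g \<in> Arr A" "Dom A g = Dom A f" "Cod A f = a" "Cod A g = b" for f g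
    using that x unfolding span_comma_obj[OF X Y] by blast
  have arr: "?a f g h \<in> Arr ?E" if "f \<in> Arr A" "g \<in> Arr A" "h \<in> Arr A" "Dom A g = Dom A f" "Cod A h = Dom A f" "Cod A f = a" "Cod A g = b" for f g h
    using that unfolding span_comma_arr[OF X Y x] by blast
  have ident: "Ident ?E (?o f g) = ?a f g (Ident A (Dom A f))" if "f \<in> Arr A" "g \<in> Arr A" "Dom A g = Dom A f" for f g
    using comp_id_right[OF that(1)] comp_id_right[OF that(2)] that(3)
    by (simp add: span_arr_def span_obj_def comma_def elements_def)
  define Q where "Q = \<lparr>omap = (\<lambda>p. ?o (hat (left p)) (hat (right p))),
     amap = (\<lambda>s. ?a (hat (left (Cod ?E s))) (hat (right (Cod ?E s))) (amap P (fst (snd (fst (snd s))))))\<rparr>"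
  have Qo: "omap Q (?o f g) = ?o (hat f) (hat g)" for f g by (simp add: Q_def lr)
  have Qa: "amap Q (?a f g h) = ?a (hat f) (hat g) (amap P h)" for f g h
    by (simp add: Q_def ops lr) (simp add: span_arr_def)
  define e0 where "e0 = ?o (base a) (base b)"
  have e0: "e0 \<in> Obj ?E" unfolding e0_def by (rule obj) (use base ab in auto)
  have QF: "is_functor ?E ?E Q"
    unfolding is_functor_def
  proof (intro conjI ballI impI)
    fix p assume "p \<in> Obj ?E"
    then obtain f g where f: "f \<in> Arr A" "g \<in> Arr A" "Dom A g = Dom A f" "Cod A f = a" "Cod A g = b" "p = ?o f g"
      unfolding span_comma_obj[OF X Y] by blast
    show "omap Q p \<in> Obj ?E" unfolding f(6) Qo by (rule obj) (use f hat_arr in auto)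
    show "amap Q (Ident ?E p) = Ident ?E (omap Q p)"
      using f hat_arr[OF f(1)] hat_arr[OF f(2)] functorD(5)[OF P, of "Dom A f"] dom_cod[OF f(1)]
      by (simp add: f(6) ident Qo Qa)
  next
    fix s assume "s \<in> Arr ?E"
    then obtain f g h where f: "f \<in> Arr A" "g \<in> Arr A" "h \<in> Arr A" "Dom A g = Dom A f" "Cod A h = Dom A f" "Cod A f = a" "Cod A g = b"
      "s = ?a f g h" unfolding span_comma_arr[OF X Y x] by blast
    show "amap Q s \<in> Arr ?E" unfolding f(8) Qa by (rule arr) (use f hat_arr P_arr in auto)
    show "Dom ?E (amap Q s) = omap Q (Dom ?E s)" "Cod ?E (amap Q s) = omap Q (Cod ?E s)"
      using f hat_comp[OF f(3,1)] hat_comp[OF f(3,2)] by (simp_all add: f(8) Qa Qo ops)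
    fix t assume "t \<in> Arr ?E" and ts: "Dom ?E t = Cod ?E s"
    then obtain f' g' h' where f': "f' \<in> Arr A" "g' \<in> Arr A" "h' \<in> Arr A" "Dom A g' = Dom A f'" "Cod A h' = Dom A f'" "Cod A f' = a" "Cod A g' = b"
      "t = ?a f' g' h'" unfolding span_comma_arr[OF X Y x] by blast
    have "?o (Comp A f' h') (Comp A g' h') = ?o f g" using ts by (simp only: f(8) f'(8) ops)
    then have fg: "f = Comp A f' h'" "g = Comp A g' h'" using lr by metis+
    have hh: "Dom A h' = Cod A h" using f(5) fg comp_arr[OF f'(3,1)] f'(5) by simp
    have "Comp ?E t s = ?a f' g' (Comp A h' h)"
      unfolding f(8) f'(8) by (rule comp) (use fg f f' hh in auto)
    moreover have "Comp ?E (amap Q t) (amap Q s) = ?a (hat f') (hat g') (Comp A (amap P h') (amap P h))"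
      unfolding f(8) f'(8) Qa
      by (rule comp) (use fg f f' hh hat_comp[OF f'(3,1)] hat_comp[OF f'(3,2)] hat_arr P_arr in auto)
    ultimately show "amap Q (Comp ?E t s) = Comp ?E (amap Q t) (amap Q s)"
      using functorD(6)[OF P f(3) f'(3) hh] by (simp add: Qa)
  qed
  define \<eta> where "\<eta> = (\<lambda>p. ?a (hat (left p)) (hat (right p)) (i (Dom A (left p))))"
  define \<epsilon> where "\<epsilon> = (\<lambda>p. ?a (hat (left p)) (hat (right p)) (j (Dom A (left p))))"
  have n\<eta>: "natural_transformation ?E ?E id_functor Q \<eta>"
    unfolding natural_transformation_def
  proof (intro conjI ballI)
    fix p assume "p \<in> Obj ?E"
    then obtain f g where f: "f \<in> Arr A" "g \<in> Arr A" "Dom A g = Dom A f" "Cod A f = a" "Cod A g = b" "p = ?o f g"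
      unfolding span_comma_obj[OF X Y] by blast
    have \<eta>p: "\<eta> p = ?a (hat f) (hat g) (i (Dom A f))" by (simp add: \<eta>_def f(6) lr)
    show "\<eta> p \<in> Arr ?E" unfolding \<eta>p by (rule arr) (use f hat_arr i dom_cod in auto)
    show "Dom ?E (\<eta> p) = omap id_functor p" unfolding \<eta>p ops using hat_i[OF f(1)] hat_i[OF f(2)] f(3) by (simp add: f(6))
    show "Cod ?E (\<eta> p) = omap Q p" unfolding \<eta>p ops by (simp add: f(6) Qo)
  next
    fix s assume "s \<in> Arr ?E"
    then obtain f g h where f: "f \<in> Arr A" "g \<in> Arr A" "h \<in> Arr A" "Dom A g = Dom A f" "Cod A h = Dom A f" "Cod A f = a" "Cod A g = b"
      "s = ?a f g h" unfolding span_comma_arr[OF X Y x] by blast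
    note fh = comp_arr[OF f(3,1)]
    have iD: "i (Dom A h) \<in> Arr A" "Cod A (i (Dom A h)) = omap P (Dom A h)" "i (Dom A f) \<in> Arr A" "Dom A (i (Dom A f)) = Dom A f"
        "Cod A (i (Dom A f)) = omap P (Dom A f)"
      using i[of "Dom A h"] i[of "Dom A f"] dom_cod[OF f(3)] dom_cod[OF f(1)] by auto
    have "Comp ?E (amap Q s) (\<eta> (Dom ?E s)) = ?a (hat f) (hat g) (Comp A (amap P h) (i (Dom A h)))"
      unfolding f(8) Qa ops \<eta>_def lr
      by (subst comp) (use f fh hat_comp[OF f(3,1)] hat_comp[OF f(3,2)] hat_arr P_arr iD in auto)
    also have "\<dots> = Comp ?E (\<eta> (Cod ?E s)) s"
      unfolding f(8) ops \<eta>_def lr i_natural[OF f(3)] f(5)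
      by (subst comp) (use f hat_i[OF f(1)] hat_i[OF f(2)] hat_arr iD in auto)
    finally show "Comp ?E (amap Q s) (\<eta> (Dom ?E s)) = Comp ?E (\<eta> (Cod ?E s)) (amap id_functor s)" by simp
  qed
  have n\<epsilon>: "natural_transformation ?E ?E \<lparr>omap = \<lambda>_. e0, amap = \<lambda>_. Ident ?E e0\<rparr> Q \<epsilon>"
    unfolding natural_transformation_def
  proof (intro conjI ballI)
    fix p assume "p \<in> Obj ?E"
    then obtain f g where f: "f \<in> Arr A" "g \<in> Arr A" "Dom A g = Dom A f" "Cod A f = a" "Cod A g = b" "p = ?o f g"
      unfolding span_comma_obj[OF X Y] by blast
    have \<epsilon>p: "\<epsilon> p = ?a (hat f) (hat g) (j (Dom A f))" by (simp add: \<epsilon>_def f(6) lr)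
    show "\<epsilon> p \<in> Arr ?E" unfolding \<epsilon>p by (rule arr) (use f hat_arr j dom_cod in auto)
    show "Dom ?E (\<epsilon> p) = omap \<lparr>omap = \<lambda>_. e0, amap = \<lambda>_. Ident ?E e0\<rparr> p"
      unfolding \<epsilon>p ops using hat_j[OF f(1)] hat_j[OF f(2)] f by (simp add: e0_def)
    show "Cod ?E (\<epsilon> p) = omap Q p" unfolding \<epsilon>p ops by (simp add: f(6) Qo)
  next
    fix s assume "s \<in> Arr ?E"
    then obtain f g h where f: "f \<in> Arr A" "g \<in> Arr A" "h \<in> Arr A" "Dom A g = Dom A f" "Cod A h = Dom A f" "Cod A f = a" "Cod A g = b"
      "s = ?a f g h" unfolding span_comma_arr[OF X Y x] by blast
    note fh = comp_arr[OF f(3,1)]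
    have jD: "j (Dom A h) \<in> Arr A" "Cod A (j (Dom A h)) = omap P (Dom A h)" "j (Dom A f) \<in> Arr A" "Dom A (j (Dom A f)) = e"
        "Cod A (j (Dom A f)) = omap P (Dom A f)" "Comp A (j (Dom A f)) (Ident A e) = j (Dom A f)"
      using j[of "Dom A h"] j[of "Dom A f"] dom_cod[OF f(3)] dom_cod[OF f(1)] comp_id_right[of "j (Dom A f)"] by auto
    have bs: "base a \<in> Arr A" "base b \<in> Arr A" "Dom A (base a) = e" "Dom A (base b) = e" using base ab by auto
    have "Comp ?E (amap Q s) (\<epsilon> (Dom ?E s)) = ?a (hat f) (hat g) (Comp A (amap P h) (j (Dom A h)))"
      unfolding f(8) Qa ops \<epsilon>_def lr
      by (subst comp) (use f fh hat_comp[OF f(3,1)] hat_comp[OF f(3,2)] hat_arr P_arr jD in auto)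
    also have "\<dots> = ?a (hat f) (hat g) (Comp A (j (Dom A f)) (Ident A e))"
      using j_natural[OF f(3)] f(5) jD(6) by simp
    also have "\<dots> = Comp ?E (\<epsilon> (Cod ?E s)) (Ident ?E e0)"
      unfolding f(8) ops \<epsilon>_def lr e0_def ident[OF bs(1,2) bs(4)[unfolded bs(3)[symmetric]]] bs(3)
      by (subst comp) (use f hat_j[OF f(1)] hat_j[OF f(2)] hat_arr jD id_arr[OF e] in auto)
    finally show "Comp ?E (amap Q s) (\<epsilon> (Dom ?E s)) =
        Comp ?E (\<epsilon> (Cod ?E s)) (amap \<lparr>omap = \<lambda>_. e0, amap = \<lambda>_. Ident ?E e0\<rparr> s)" by simp
  qed
  show "contractible_space (BC ?E)" by (rule contractible_zigzag[OF E QF e0 n\<eta> n\<epsilon>])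
  show "Obj ?E \<noteq> {}" using e0 by blast
qed

theorem strict_test: "strict_test_category TYPE('c \<times> 'd) TYPE('x \<times> 'y) A"
  unfolding strict_test_category_def test_category_def local_test_category_def
proof (intro conjI allI ballI impI weak_test)
  show "category A" by (rule category_axioms)
  show "weak_test_category TYPE('c \<times> 'd) (slice A T)" if "T \<in> Obj A" for T
    by (rule decalage.weak_test[OF decalage_slice[OF that]])
  fix X :: "('o, 'm, 'x) psh" and Y :: "('o, 'm, 'y) psh"
  assume X: "presheaf A X" and Y: "presheaf A Y"
  show "weak_equivalence (elements A (product_presheaf X Y)) (product_category (elements A X) (elements A Y)) elements_product_map"
  proof (rule Theorem_A)
    fix d assume "d \<in> Obj (product_category (elements A X) (elements A Y))"
    then obtain a x b y where d: "d = ((a, x), (b, y))" "a \<in> Obj A" "b \<in> Obj A" "x \<in> sections X a" "y \<in> sections Y b"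
      by (auto simp: product_category_def elements_def)
    show "contractible_space (BC (comma (elements A (product_presheaf X Y)) (product_category (elements A X) (elements A Y)) elements_product_map d))"
      "Obj (comma (elements A (product_presheaf X Y)) (product_category (elements A X) (elements A Y)) elements_product_map d) \<noteq> {}"
      unfolding d(1) using contractible_comma_product[OF X Y d(2-5)] by auto
  qed (intro product_category_category elements_category category_axioms product_presheaf_presheaf X Y
      is_functor_elements_product_map)+
qed

end

section \<open>The category of closed trees\<close>

definition tree_map :: "'e tree \<Rightarrow> 'e tree \<Rightarrow> ('e \<Rightarrow> 'e) \<Rightarrow> bool" where
  "tree_map S T f \<longleftrightarrow> f \<in> Edges S \<rightarrow>\<^sub>E Edges T \<and>
    (\<forall>es e. (es, e) \<in> Ops (tree_operad S) \<longrightarrow> (map f es, f e) \<in> Ops (tree_operad T))"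

definition tree_arr :: "'e tree \<Rightarrow> ('e \<Rightarrow> 'e) \<Rightarrow> 'e tree \<Rightarrow> 'e tree_arrow" where
  "tree_arr S f T = (S, (f, \<lambda>p\<in>Ops (tree_operad S). (map f (fst p), f (snd p))), T)"

lemma tree_arr_inject: "tree_arr S f T = tree_arr S' f' T' \<longleftrightarrow> S = S' \<and> f = f' \<and> T = T'"
  by (auto simp: tree_arr_def)

lemma Ops_edges: "(es, e) \<in> Ops (tree_operad T) \<Longrightarrow> set es \<subseteq> Edges T \<and> e \<in> Edges T"
  by (auto simp: tree_operad_def subtree_def is_root_def leaves_def)

lemma Ops_compose:
  assumes T: "is_tree T" and "(es, e) \<in> Ops (tree_operad T)" "([e], r) \<in> Ops (tree_operad T)"
  shows "(es, r) \<in> Ops (tree_operad T)"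
  using graftable_tree_operad[OF T, of "([e], r)" "[(es, e)]"] assms(2,3)
  by (simp add: graftable_def) (simp add: tree_operad_def)

lemma tree_operad_simps [simp]:
  "Colours (tree_operad T) = Edges T" "Ins (tree_operad T) = fst" "Out (tree_operad T) = snd"
  "Unit (tree_operad T) e = ([e], e)" "Graft (tree_operad T) p qs = (concat (map fst qs), snd p)"
  "Perm (tree_operad T) p \<sigma> = (permute_list \<sigma> (fst p), snd p)"
  by (simp_all add: tree_operad_def case_prod_unfold)

lemma downwardsI: "v \<in> Vertices T \<Longrightarrow> y \<in> fst v \<Longrightarrow> (y, snd v) \<in> downwards T"
  unfolding downwards_def by blast

lemma Ops_unit: "is_tree T \<Longrightarrow> e \<in> Edges T \<Longrightarrow> ([e], e) \<in> Ops (tree_operad T)"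
  using operad.unit[OF operad_tree_operad, of T e] by (simp add: tree_operad_def)

text \<open>An operation of a tree operad is its profile. A morphism is therefore determined by its
  map on edges, and it respects units, grafting and permutations as soon as operations go to
  operations.\<close>

lemma operad_homs_tree:
  assumes S: "is_tree S" and T: "is_tree T"
  shows "h \<in> operad_homs (tree_operad S) (tree_operad T) \<longleftrightarrow> (\<exists>f. tree_map S T f \<and> (S, h, T) = tree_arr S f T)"
proof
  assume h: "h \<in> operad_homs (tree_operad S) (tree_operad T)"
  obtain f g where hd: "h = (f, g)" by fastforce
  have f: "f \<in> Edges S \<rightarrow>\<^sub>E Edges T" and g: "g \<in> Ops (tree_operad S) \<rightarrow>\<^sub>E Ops (tree_operad T)"
    and gp: "\<And>p. p \<in> Ops (tree_operad S) \<Longrightarrow> fst (g p) = map f (fst p) \<and> snd (g p) = f (snd p)"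
    using h by (auto simp: hd operad_homs_def)
  have gp': "g p = (map f (fst p), f (snd p))" if "p \<in> Ops (tree_operad S)" for p using gp[OF that] by (metis prod.collapse)
  have "g = (\<lambda>p\<in>Ops (tree_operad S). (map f (fst p), f (snd p)))"
    by (rule extensionalityI[of _ "Ops (tree_operad S)"]) (use g gp' in \<open>auto simp: PiE_def\<close>)
  moreover have "tree_map S T f"
    unfolding tree_map_def using f gp' g by (fastforce simp: PiE_iff)
  ultimately show "\<exists>f. tree_map S T f \<and> (S, h, T) = tree_arr S f T" by (auto simp: tree_arr_def hd)
next
  assume "\<exists>f. tree_map S T f \<and> (S, h, T) = tree_arr S f T"
  then obtain f where f: "tree_map S T f" and h: "h = (f, \<lambda>p\<in>Ops (tree_operad S). (map f (fst p), f (snd p)))"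
    by (auto simp: tree_arr_def)
  let ?g = "\<lambda>p\<in>Ops (tree_operad S). (map f (fst p), f (snd p))"
  let ?P = "tree_operad S" and ?Q = "tree_operad T"
  have "f \<in> Colours ?P \<rightarrow>\<^sub>E Colours ?Q" using f by (simp add: tree_map_def tree_operad_def)
  moreover have "?g \<in> Ops ?P \<rightarrow>\<^sub>E Ops ?Q" using f by (auto simp: tree_map_def)
  moreover have "\<forall>p \<in> Ops ?P. Ins ?Q (?g p) = map f (Ins ?P p) \<and> Out ?Q (?g p) = f (Out ?P p)"
    by (simp add: tree_operad_def)
  moreover have "\<forall>c \<in> Colours ?P. ?g (Unit ?P c) = Unit ?Q (f c)"
  proof
    fix c assume c: "c \<in> Colours ?P"
    then have "Unit ?P c \<in> Ops ?P" using operad.unit[OF operad_tree_operad[OF S]] by blast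
    then show "?g (Unit ?P c) = Unit ?Q (f c)" by simp
  qed
  moreover have "\<forall>p qs. graftable ?P p qs \<longrightarrow> ?g (Graft ?P p qs) = Graft ?Q (?g p) (map ?g qs)"
  proof (intro allI impI)
    fix p qs assume gr: "graftable ?P p qs"
    have G: "Graft ?P p qs \<in> Ops ?P" using operad.graft[OF operad_tree_operad[OF S] gr] by blast
    have p: "p \<in> Ops ?P" and qs: "set qs \<subseteq> Ops ?P" using gr by (auto simp: graftable_def)
    have "map ?g qs = map (\<lambda>p. (map f (fst p), f (snd p))) qs" using qs by auto
    then have "map fst (map ?g qs) = map (map f) (map fst qs)" by (simp only: map_map o_def fst_conv)
    then show "?g (Graft ?P p qs) = Graft ?Q (?g p) (map ?g qs)"
      using G p by (simp add: map_concat del: map_map)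
  qed
  moreover have "\<forall>p \<in> Ops ?P. \<forall>\<sigma>. \<sigma> permutes {..<length (Ins ?P p)} \<longrightarrow> ?g (Perm ?P p \<sigma>) = Perm ?Q (?g p) \<sigma>"
  proof (intro ballI allI impI)
    fix p \<sigma> assume p: "p \<in> Ops ?P" and \<sigma>: "\<sigma> permutes {..<length (Ins ?P p)}"
    have "Perm ?P p \<sigma> \<in> Ops ?P" using operad.perm[OF operad_tree_operad[OF S] p \<sigma>] by blast
    then show "?g (Perm ?P p \<sigma>) = Perm ?Q (?g p) \<sigma>"
      using p permute_list_map[of \<sigma> "fst p" f] \<sigma> by simp
  qed
  ultimately show "h \<in> operad_homs ?P ?Q" unfolding operad_homs_def h by blast
qed

abbreviation closed_tree :: "'e tree \<Rightarrow> bool" where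
  "closed_tree T \<equiv> is_tree T \<and> leaves T = {}"

lemma closed_Omega_obj: "T \<in> Obj closed_Omega \<longleftrightarrow> closed_tree T"
  by (simp add: closed_Omega_def full_subcategory_def Omega_def)

lemma closed_Omega_arr:
  "s \<in> Arr closed_Omega \<longleftrightarrow> (\<exists>S f T. closed_tree S \<and> closed_tree T \<and> tree_map S T f \<and> s = tree_arr S f T)"
proof -
  obtain S h T where s: "s = (S, h, T)" by (metis prod.collapse)
  have "s \<in> Arr closed_Omega \<longleftrightarrow> closed_tree S \<and> closed_tree T \<and> h \<in> operad_homs (tree_operad S) (tree_operad T)"
    by (auto simp: closed_Omega_def full_subcategory_def Omega_def s)
  then show ?thesis
    using operad_homs_tree[of S T h] by (auto simp: s tree_arr_def)
qed

lemma closed_Omega_dom [simp]: "Dom closed_Omega (tree_arr S f T) = S" "Cod closed_Omega (tree_arr S f T) = T"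
  by (simp_all add: closed_Omega_def full_subcategory_def Omega_def tree_arr_def)

lemma closed_Omega_comp:
  assumes f: "tree_map S T f"
  shows "Comp closed_Omega (tree_arr T g U) (tree_arr S f T) = tree_arr S (compose (Edges S) g f) U"
proof -
  have "compose (Ops (tree_operad S)) (\<lambda>p\<in>Ops (tree_operad T). (map g (fst p), g (snd p)))
      (\<lambda>p\<in>Ops (tree_operad S). (map f (fst p), f (snd p))) =
    (\<lambda>p\<in>Ops (tree_operad S). (map (compose (Edges S) g f) (fst p), compose (Edges S) g f (snd p)))"
  proof
    fix p :: "'a list \<times> 'a"
    obtain es e where p: "p = (es, e)" by fastforce
    show "compose (Ops (tree_operad S)) (\<lambda>p\<in>Ops (tree_operad T). (map g (fst p), g (snd p)))
      (\<lambda>p\<in>Ops (tree_operad S). (map f (fst p), f (snd p))) p =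
      (\<lambda>p\<in>Ops (tree_operad S). (map (compose (Edges S) g f) (fst p), compose (Edges S) g f (snd p))) p"
    proof (cases "p \<in> Ops (tree_operad S)")
      case True
      then have "(map f es, f e) \<in> Ops (tree_operad T)" "set es \<subseteq> Edges S" "e \<in> Edges S"
        using f Ops_edges[of es e S] by (auto simp: tree_map_def p)
      then show ?thesis using True by (auto simp: compose_def p)
    qed (simp add: compose_def)
  qed
  then show ?thesis
    by (simp add: closed_Omega_def full_subcategory_def Omega_def tree_arr_def)
qed

lemma tree_map_compose:
  assumes f: "tree_map S T f" and g: "tree_map T U g"
  shows "tree_map S U (compose (Edges S) g f)"
  unfolding tree_map_def
proof (intro conjI allI impI)
  show "compose (Edges S) g f \<in> Edges S \<rightarrow>\<^sub>E Edges U"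
    using f g by (auto simp: tree_map_def compose_def)
  fix es e assume p: "(es, e) \<in> Ops (tree_operad S)"
  then have "(map g (map f es), g (f e)) \<in> Ops (tree_operad U)" using f g unfolding tree_map_def by blast
  moreover have "map (compose (Edges S) g f) es = map g (map f es)" "compose (Edges S) g f e = g (f e)"
    using Ops_edges[OF p] by (auto simp: compose_def)
  ultimately show "(map (compose (Edges S) g f) es, compose (Edges S) g f e) \<in> Ops (tree_operad U)" by (simp only:)
qed

lemma tree_map_inclusion:
  assumes "Edges S \<subseteq> Edges T" "Ops (tree_operad S) \<subseteq> Ops (tree_operad T)"
  shows "tree_map S T (\<lambda>e\<in>Edges S. e)"
  unfolding tree_map_def
proof (intro conjI allI impI)
  fix es e assume p: "(es, e) \<in> Ops (tree_operad S)"
  have "map (\<lambda>e\<in>Edges S. e) es = es" by (rule map_idI) (use Ops_edges[OF p] in auto)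
  then show "(map (\<lambda>e\<in>Edges S. e) es, (\<lambda>e\<in>Edges S. e) e) \<in> Ops (tree_operad T)"
    using p assms(2) Ops_edges[OF p] by auto
qed (use assms in auto)

lemma closed_Omega_ident:
  assumes "is_tree T" shows "Ident closed_Omega T = tree_arr T (\<lambda>e\<in>Edges T. e) T"
proof -
  have "(\<lambda>p\<in>Ops (tree_operad T). p) = (\<lambda>p\<in>Ops (tree_operad T). (map (\<lambda>e\<in>Edges T. e) (fst p), (\<lambda>e\<in>Edges T. e) (snd p)))"
  proof (rule restrict_ext)
    fix p assume "p \<in> Ops (tree_operad T)"
    then obtain es e where p: "p = (es, e)" "set es \<subseteq> Edges T" "e \<in> Edges T" using Ops_edges by (metis prod.collapse)
    then show "p = (map (\<lambda>e\<in>Edges T. e) (fst p), (\<lambda>e\<in>Edges T. e) (snd p))" by (auto intro!: map_idI[symmetric])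
  qed
  then show ?thesis
    by (simp add: closed_Omega_def full_subcategory_def Omega_def tree_arr_def)
qed

lemma compose_restrict_id:
  assumes "tree_map S T f"
  shows "compose (Edges S) (\<lambda>e\<in>Edges T. e) f = f" "compose (Edges S) f (\<lambda>e\<in>Edges S. e) = f"
proof -
  have f: "f \<in> extensional (Edges S)" "\<And>e. e \<in> Edges S \<Longrightarrow> f e \<in> Edges T" using assms by (auto simp: tree_map_def PiE_def)
  show "compose (Edges S) (\<lambda>e\<in>Edges T. e) f = f" "compose (Edges S) f (\<lambda>e\<in>Edges S. e) = f"
    by (rule extensionalityI[of _ "Edges S"]; use f in \<open>simp add: compose_def\<close>)+
qed

lemma category_closed_Omega: "category closed_Omega"
proof
  fix s :: "'e tree_arrow" assume "s \<in> Arr closed_Omega"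
  then obtain S f T where s: "closed_tree S" "closed_tree T" "tree_map S T f" "s = tree_arr S f T"
    unfolding closed_Omega_arr by blast
  show "Dom closed_Omega s \<in> Obj closed_Omega \<and> Cod closed_Omega s \<in> Obj closed_Omega"
    using s by (simp add: closed_Omega_obj)
  have "tree_map S S (\<lambda>e\<in>Edges S. e)" by (rule tree_map_inclusion) auto
  then show "Comp closed_Omega s (Ident closed_Omega (Dom closed_Omega s)) = s"
    using s compose_restrict_id(2)[OF s(3)] by (simp add: closed_Omega_ident closed_Omega_comp)
  show "Comp closed_Omega (Ident closed_Omega (Cod closed_Omega s)) s = s"
    using s compose_restrict_id(1)[OF s(3)] by (simp add: closed_Omega_ident closed_Omega_comp)
  fix t assume "t \<in> Arr closed_Omega" "Dom closed_Omega t = Cod closed_Omega s"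
  then obtain g U where t: "closed_tree U" "tree_map T U g" "t = tree_arr T g U"
    unfolding closed_Omega_arr s(4) by auto
  show "Comp closed_Omega t s \<in> Arr closed_Omega \<and> Dom closed_Omega (Comp closed_Omega t s) = Dom closed_Omega s \<and>
      Cod closed_Omega (Comp closed_Omega t s) = Cod closed_Omega t"
    using s t tree_map_compose[OF s(3) t(2)] by (auto simp: closed_Omega_comp closed_Omega_arr)
  fix u assume "u \<in> Arr closed_Omega" "Dom closed_Omega u = Cod closed_Omega t"
  then obtain h V where u: "tree_map U V h" "u = tree_arr U h V"
    unfolding closed_Omega_arr t(3) by auto
  have "compose (Edges S) h (compose (Edges S) g f) = compose (Edges S) (compose (Edges T) h g) f"
    using s(3) by (auto simp: compose_def tree_map_def fun_eq_iff)
  then show "Comp closed_Omega u (Comp closed_Omega t s) = Comp closed_Omega (Comp closed_Omega u t) s"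
    using tree_map_compose[OF s(3) t(2)] by (simp add: s(4) t(3) u(2) closed_Omega_comp[OF s(3)] closed_Omega_comp[OF t(2)] closed_Omega_comp)
next
  fix T :: "'e tree" assume "T \<in> Obj closed_Omega"
  then have T: "closed_tree T" by (simp add: closed_Omega_obj)
  have "tree_map T T (\<lambda>e\<in>Edges T. e)" by (rule tree_map_inclusion) auto
  then show "Ident closed_Omega T \<in> Arr closed_Omega \<and> Dom closed_Omega (Ident closed_Omega T) = T \<and> Cod closed_Omega (Ident closed_Omega T) = T"
    using T by (auto simp: closed_Omega_ident closed_Omega_arr)
qed

section \<open>Unary operations to the root\<close>

definition root :: "'e tree \<Rightarrow> 'e" where
  "root T = (THE r. is_root T r)"

lemma is_root_root: "is_tree T \<Longrightarrow> is_root T (root T)"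
  unfolding root_def using tree_root by (rule theI')

lemma root_eqI: "is_tree T \<Longrightarrow> is_root T r \<Longrightarrow> root T = r"
  using tree_root is_root_root by blast

text \<open>In a closed tree, cutting above the edge \<open>x\<close> leaves a subtree with \<open>x\<close> as its only leaf.\<close>

lemma Ops_to_root:
  assumes T: "closed_tree T" and x: "x \<in> Edges T"
  shows "([x], root T) \<in> Ops (tree_operad T)"
proof -
  have Tt: "is_tree T" using T by simp
  \<comment> \<open>Edges strictly above \<open>x\<close> are removed, so \<open>x\<close> stays;
    vertices whose output is \<open>x\<close> or above it are removed, so \<open>x\<close> becomes a
    leaf.\<close>
  define U where "U = \<lparr>Edges = {y \<in> Edges T. (y, x) \<notin> (downwards T)\<^sup>+}, Vertices = {v \<in> Vertices T. (snd v, x) \<notin> (downwards T)\<^sup>*}\<rparr>"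
  let ?r = "root T"
  have r: "is_root T ?r" by (rule is_root_root[OF Tt])
  have vertex: "fst v \<subseteq> Edges U \<and> snd v \<in> Edges U" if v: "v \<in> Vertices U" for v
  proof -
    have vT: "v \<in> Vertices T" "(snd v, x) \<notin> (downwards T)\<^sup>*" using v by (auto simp: U_def)
    have "(y, x) \<notin> (downwards T)\<^sup>+" if y: "y \<in> fst v" for y
    proof
      assume "(y, x) \<in> (downwards T)\<^sup>+"
      then obtain z where z: "(y, z) \<in> downwards T" "(z, x) \<in> (downwards T)\<^sup>*" by (metis tranclD)
      have "(y, snd v) \<in> downwards T" by (rule downwardsI[OF vT(1) y])
      then show False using downwards_unique[OF Tt z(1)] z(2) vT(2) by blast
    qed
    then show ?thesis using tree_vertex[OF Tt vT(1)] vT(2) by (auto simp: U_def dest: trancl_into_rtrancl)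
  qed
  have up: "v \<in> Vertices U" if v: "v \<in> Vertices T" "y \<in> fst v" and y: "y \<in> Edges U" for v y
  proof -
    have "(y, snd v) \<in> downwards T" by (rule downwardsI[OF v])
    then show ?thesis using v(1) y by (auto simp: U_def dest: rtrancl_into_trancl2)
  qed
  have rU: "is_root U ?r"
  proof -
    have "(?r, x) \<notin> (downwards T)\<^sup>+" using root_no_down[OF r] by (meson tranclD)
    then show ?thesis using r by (auto simp: is_root_def U_def)
  qed
  have uniq: "y = ?r" if y: "is_root U y" for y
  proof -
    have "y \<in> Edges U" "\<And>v. v \<in> Vertices U \<Longrightarrow> y \<notin> fst v" using y by (auto simp: is_root_def)
    then have "is_root T y" using up[of _ y] unfolding is_root_def by (auto simp: U_def)
    then show ?thesis using root_eqI[OF Tt] by simp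
  qed
  have reach: "y \<in> Edges U \<Longrightarrow> (y, ?r) \<in> (downwards U)\<^sup>*" if "(y, ?r) \<in> (downwards T)\<^sup>*" for y
    using that
  proof (induction rule: converse_rtrancl_induct)
    case (step y z)
    obtain v where v: "v \<in> Vertices T" "y \<in> fst v" "z = snd v" using step.hyps(1) unfolding downwards_def by blast
    have vU: "v \<in> Vertices U" by (rule up[OF v(1,2) step.prems])
    then have "(y, z) \<in> downwards U" using downwardsI[OF vU v(2)] v(3) by simp
    moreover have "z \<in> Edges U" using vertex[OF vU] v by simp
    ultimately show ?case using step.IH by (meson converse_rtrancl_into_rtrancl)
  qed simp
  have sub: "Edges U \<subseteq> Edges T" "Vertices U \<subseteq> Vertices T" by (auto simp: U_def)
  have "is_tree U"
    unfolding is_tree_def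
  proof (intro conjI)
    show "finite (Edges U)" "finite (Vertices U)" using sub Tt finite_subset by (auto simp: is_tree_def)
    show "Edges U \<noteq> {}" using rU by (auto simp: is_root_def)
    show "\<forall>v\<in>Vertices U. fst v \<subseteq> Edges U \<and> snd v \<in> Edges U" using vertex by blast
    show "\<forall>v\<in>Vertices U. \<forall>w\<in>Vertices U. snd v = snd w \<longrightarrow> v = w" using sub(2) tree_outputs[OF Tt] by blast
    show "\<forall>v\<in>Vertices U. \<forall>w\<in>Vertices U. fst v \<inter> fst w \<noteq> {} \<longrightarrow> v = w" using sub(2) tree_inputs[OF Tt] by blast
    show "\<exists>!r. is_root U r" using rU uniq by blast
    show "\<forall>y\<in>Edges U. \<forall>r. is_root U r \<longrightarrow> (y, r) \<in> (downwards U)\<^sup>*"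
    proof (intro ballI allI impI)
      fix y r' assume y: "y \<in> Edges U" and "is_root U r'"
      then have "r' = ?r" using uniq by blast
      moreover have "(y, ?r) \<in> (downwards T)\<^sup>*" using tree_root_reach[OF Tt r] y sub by blast
      ultimately show "(y, r') \<in> (downwards U)\<^sup>*" using reach y by blast
    qed
  qed
  moreover have "leaves U = {x}"
  proof (intro equalityI subsetI)
    fix y assume y: "y \<in> leaves U"
    then have yT: "y \<in> Edges T" "(y, x) \<notin> (downwards T)\<^sup>+" by (auto simp: leaves_def U_def)
    \<comment> \<open>Closedness enters here: every edge kept in \<open>U\<close> is the output of a
      vertex of \<open>T\<close>, and this vertex is removed only if the edge is
      \<open>x\<close>.\<close>
    then obtain v where v: "v \<in> Vertices T" "y = snd v" using T unfolding leaves_def by blast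
    have "v \<notin> Vertices U" using y v(2) by (auto simp: leaves_def)
    then have "(y, x) \<in> (downwards T)\<^sup>*" using v by (simp add: U_def)
    then show "y \<in> {x}" using yT(2) by (simp add: rtrancl_eq_or_trancl)
  next
    fix y assume "y \<in> {x}"
    then show "y \<in> leaves U" using x tree_acyclic[OF Tt, of x] by (auto simp: leaves_def U_def)
  qed
  ultimately show ?thesis using sub rU by (auto simp: tree_operad_def subtree_def)
qed

section \<open>Adding an edge below the root\<close>

definition fresh :: "'e tree \<Rightarrow> 'e" where
  "fresh T = (SOME x. x \<notin> Edges T)"

definition grow :: "'e tree \<Rightarrow> 'e tree" where
  "grow T = \<lparr>Edges = insert (fresh T) (Edges T), Vertices = insert ({root T}, fresh T) (Vertices T)\<rparr>"

lemma fresh: "is_tree (T :: 'e::infinite tree) \<Longrightarrow> fresh T \<notin> Edges T"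
  unfolding fresh_def by (rule someI_ex, rule ex_new_if_finite[OF infinite_UNIV]) (simp add: is_tree_def)

lemma grow_tree:
  fixes T :: "'e::infinite tree"
  assumes T: "is_tree T"
  shows "is_tree (grow T)" "is_root (grow T) (fresh T)" "leaves (grow T) = leaves T" "root (grow T) = fresh T"
proof -
  let ?r = "root T" and ?x = "fresh T" and ?G = "grow T"
  have r: "is_root T ?r" "?r \<in> Edges T" using is_root_root[OF T] by (auto simp: is_root_def)
  have x: "?x \<notin> Edges T" by (rule fresh[OF T])
  have vT: "fst v \<subseteq> Edges T" "snd v \<in> Edges T" if "v \<in> Vertices T" for v using tree_vertex[OF T that] by auto
  show root: "is_root ?G ?x" using x vT r(2) by (auto simp: is_root_def grow_def)
  have uniq: "y = ?x" if y: "is_root ?G y" for y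
  proof (rule ccontr)
    assume "y \<noteq> ?x"
    then have "is_root T y" "y \<noteq> ?r" using y by (auto simp: is_root_def grow_def)
    then show False using root_eqI[OF T] by blast
  qed
  have d: "downwards T \<subseteq> downwards ?G" by (rule downwards_mono) (auto simp: grow_def)
  have reach: "(y, ?x) \<in> (downwards ?G)\<^sup>*" if "y \<in> Edges ?G" for y
  proof (cases "y = ?x")
    case False
    then have "y \<in> Edges T" using that by (simp add: grow_def)
    then have "(y, ?r) \<in> (downwards ?G)\<^sup>*" using tree_root_reach[OF T r(1)] rtrancl_mono[OF d] by blast
    moreover have "(?r, ?x) \<in> downwards ?G" by (auto simp: downwards_def grow_def)
    ultimately show ?thesis by (rule rtrancl_into_rtrancl)
  qed simp
  show tree: "is_tree ?G"
    unfolding is_tree_def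
  proof (intro conjI)
    show "finite (Edges ?G)" "finite (Vertices ?G)" "Edges ?G \<noteq> {}" using T by (auto simp: grow_def is_tree_def)
    show "\<forall>v\<in>Vertices ?G. fst v \<subseteq> Edges ?G \<and> snd v \<in> Edges ?G" using vT r(2) by (auto simp: grow_def)
    have "?x \<noteq> snd v" if "v \<in> Vertices T" for v using vT(2)[OF that] x by auto
    then show "\<forall>v\<in>Vertices ?G. \<forall>w\<in>Vertices ?G. snd v = snd w \<longrightarrow> v = w"
      using tree_outputs[OF T] unfolding grow_def by simp metis
    have "?r \<notin> fst v" if "v \<in> Vertices T" for v using r(1) that by (auto simp: is_root_def)
    then show "\<forall>v\<in>Vertices ?G. \<forall>w\<in>Vertices ?G. fst v \<inter> fst w \<noteq> {} \<longrightarrow> v = w"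
      using tree_inputs[OF T] unfolding grow_def by simp blast
    show "\<exists>!r. is_root ?G r" using root uniq by blast
    show "\<forall>y\<in>Edges ?G. \<forall>r. is_root ?G r \<longrightarrow> (y, r) \<in> (downwards ?G)\<^sup>*" using reach uniq by blast
  qed
  show "leaves ?G = leaves T" using x by (auto simp: leaves_def grow_def)
  show "root ?G = ?x" by (rule root_eqI[OF tree root])
qed

lemma Ops_subset_grow:
  "Ops (tree_operad T) \<subseteq> Ops (tree_operad (grow T))"
  by (auto simp: tree_operad_def subtree_def grow_def)

text \<open>The operation is composed with the unary operation given by the new vertex.\<close>

lemma Ops_fresh:
  fixes T :: "'e::infinite tree"
  assumes T: "is_tree T" and p: "(es, root T) \<in> Ops (tree_operad T)"
  shows "(es, fresh T) \<in> Ops (tree_operad (grow T))"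
proof -
  let ?r = "root T" and ?x = "fresh T"
  have r: "?r \<in> Edges T" using is_root_root[OF T] by (simp add: is_root_def)
  have rx: "?r \<noteq> ?x" using r fresh[OF T] by auto
  let ?C = "\<lparr>Edges = {?r, ?x}, Vertices = {({?r}, ?x)}\<rparr>"
  have root: "is_root ?C y \<longleftrightarrow> y = ?x" for y using rx by (auto simp: is_root_def)
  have "(?r, ?x) \<in> downwards ?C" by (auto simp: downwards_def)
  then have "is_tree ?C" using rx by (auto simp: is_tree_def root)
  moreover have "leaves ?C = {?r}" using rx by (auto simp: leaves_def)
  ultimately have "([?r], ?x) \<in> Ops (tree_operad (grow T))"
    using r root by (auto simp: tree_operad_def subtree_def grow_def intro!: exI[of _ ?C])
  then show ?thesis using Ops_compose[OF grow_tree(1)[OF T]] p Ops_subset_grow by blast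
qed

text \<open>A subtree of \<open>grow T\<close> avoids the new edge, or consists of it alone, or
  contains the new vertex. This decides which operations the maps out of \<open>grow T\<close> have
  to respect.\<close>

lemma Ops_grow_cases:
  fixes T :: "'e::infinite tree"
  assumes T: "is_tree T" and p: "(es, e) \<in> Ops (tree_operad (grow T))"
  obtains "(es, e) \<in> Ops (tree_operad T)" | "e = fresh T" "es = [fresh T]" | "e = fresh T" "(es, root T) \<in> Ops (tree_operad T)"
proof -
  let ?r = "root T" and ?x = "fresh T" and ?G = "grow T"
  have x: "?x \<notin> Edges T" by (rule fresh[OF T])
  note G = grow_tree[OF T]
  obtain U where U: "subtree U ?G" "is_root U e" "leaves U = set es" and es: "distinct es"
    using p by (auto simp: tree_operad_def)
  have Ut: "is_tree U" and UE: "Edges U \<subseteq> insert ?x (Edges T)" and UV: "Vertices U \<subseteq> insert ({?r}, ?x) (Vertices T)"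
    using U(1) by (auto simp: subtree_def grow_def)
  have vT: "snd v \<noteq> ?x" if "v \<in> Vertices T" for v using tree_vertex[OF T that] x by auto
  show thesis
  proof (cases "?x \<in> Edges U")
    case False
    have "Vertices U \<subseteq> Vertices T"
    proof
      fix v assume v: "v \<in> Vertices U"
      then have "snd v \<noteq> ?x" using tree_vertex[OF Ut v] False by auto
      then show "v \<in> Vertices T" using UV v by auto
    qed
    then have "subtree U T" using Ut UE False by (auto simp: subtree_def)
    then show thesis using U es by (intro that(1)) (auto simp: tree_operad_def)
  next
    case True
    have "(?x, e) \<in> (downwards ?G)\<^sup>*" by (rule subtree_reach[OF U(1,2) True])
    then have ex: "e = ?x" using root_no_down[OF G(2)] by (metis converse_rtranclE)
    show thesis
    proof (cases "({?r}, ?x) \<in> Vertices U")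
      case False
      then have "Vertices U \<subseteq> Vertices T" using UV by blast
      then have xl: "?x \<in> leaves U" using True vT by (fastforce simp: leaves_def)
      have "l = ?x" if "l \<in> Edges U" for l
        using subtree_leaf[OF G(1) U(1) that xl] subtree_reach[OF U(1,2) that] ex by simp
      then have "set es = {?x}" using U(3) xl by (auto simp: leaves_def)
      then have "es = [?x]" using es by (cases es) (auto simp: insert_eq_iff subset_singleton_iff)
      then show thesis using ex by (rule that(2)[rotated])
    next
      case vU: True
      \<comment> \<open>Cutting off the new edge and its vertex leaves a subtree of \<open>T\<close>
        with the same leaves, rooted at the old root.\<close>
      define U' where "U' = \<lparr>Edges = Edges U - {?x}, Vertices = Vertices U - {({?r}, ?x)}\<rparr>"
      have UV': "Vertices U' \<subseteq> Vertices T" "Vertices U' \<subseteq> Vertices U" using UV by (auto simp: U'_def)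
      have rE: "?r \<in> Edges U'"
        using tree_vertex[OF Ut vU] is_root_root[OF T] x by (auto simp: U'_def is_root_def)
      have xin: "?x \<notin> fst v" if "v \<in> Vertices U" for v using U(2) that by (auto simp: ex is_root_def)
      have vertex: "fst v \<subseteq> Edges U' \<and> snd v \<in> Edges U'" if v: "v \<in> Vertices U'" for v
        using tree_vertex[OF Ut, of v] xin[of v] vT[of v] v UV' by (auto simp: U'_def)
      have rU: "is_root U' ?r"
      proof -
        have "?r \<notin> fst v" if "v \<in> Vertices U'" for v
          using is_root_root[OF T] that UV'(1) by (auto simp: is_root_def)
        then show ?thesis using rE by (auto simp: is_root_def)
      qed
      have uniq: "y = ?r" if y: "is_root U' y" for y
      proof (rule ccontr)
        assume "y \<noteq> ?r"
        then have "is_root U y" using y by (auto simp: is_root_def U'_def)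
        then have "y = ?x" using U(2) ex tree_root[OF Ut] by blast
        then show False using y by (simp add: is_root_def U'_def)
      qed
      have reach: "y \<noteq> ?x \<Longrightarrow> (y, ?r) \<in> (downwards U')\<^sup>*" if "(y, ?x) \<in> (downwards U)\<^sup>*" for y
        using that
      proof (induction rule: converse_rtrancl_induct)
        case (step y z)
        obtain v where v: "v \<in> Vertices U" "y \<in> fst v" "z = snd v" using step.hyps(1) by (auto simp: downwards_def)
        show ?case
        proof (cases "v = ({?r}, ?x)")
          case True then show ?thesis using v by simp
        next
          case False
          then have v': "v \<in> Vertices U'" using v by (simp add: U'_def)
          then have "(y, z) \<in> downwards U'" "z \<noteq> ?x" using v vertex[OF v'] by (auto simp: downwards_def U'_def)
          then show ?thesis using step.IH by (meson converse_rtrancl_into_rtrancl)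
        qed
      qed simp
      have "is_tree U'"
        unfolding is_tree_def
      proof (intro conjI)
        show "finite (Edges U')" "finite (Vertices U')" using Ut by (auto simp: U'_def is_tree_def)
        show "Edges U' \<noteq> {}" using rE by blast
        show "\<forall>v\<in>Vertices U'. fst v \<subseteq> Edges U' \<and> snd v \<in> Edges U'" using vertex by blast
        show "\<forall>v\<in>Vertices U'. \<forall>w\<in>Vertices U'. snd v = snd w \<longrightarrow> v = w" using UV'(2) tree_outputs[OF Ut] by blast
        show "\<forall>v\<in>Vertices U'. \<forall>w\<in>Vertices U'. fst v \<inter> fst w \<noteq> {} \<longrightarrow> v = w" using UV'(2) tree_inputs[OF Ut] by blast
        show "\<exists>!r. is_root U' r" using rU uniq by blast
        show "\<forall>y\<in>Edges U'. \<forall>r. is_root U' r \<longrightarrow> (y, r) \<in> (downwards U')\<^sup>*"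
        proof (intro ballI allI impI)
          fix y r' assume y: "y \<in> Edges U'" and "is_root U' r'"
          then have "r' = ?r" using uniq by blast
          moreover have "(y, ?x) \<in> (downwards U)\<^sup>*" "y \<noteq> ?x" using tree_root_reach[OF Ut U(2)] y ex by (auto simp: U'_def)
          ultimately show "(y, r') \<in> (downwards U')\<^sup>*" using reach by blast
        qed
      qed
      then have "subtree U' T" using UE UV' by (auto simp: subtree_def U'_def)
      moreover have "leaves U' = leaves U" using vU by (auto simp: leaves_def U'_def)
      ultimately have "(es, ?r) \<in> Ops (tree_operad T)" using U(3) es rU by (auto simp: tree_operad_def)
      then show thesis by (rule that(3)[OF ex])
    qed
  qed
qed

definition grow_map :: "'e tree \<Rightarrow> 'e tree \<Rightarrow> ('e \<Rightarrow> 'e) \<Rightarrow> 'e \<Rightarrow> 'e" where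
  "grow_map S T f = (\<lambda>e\<in>Edges (grow S). if e = fresh S then fresh T else f e)"

text \<open>As \<open>f\<close> need not preserve the root, the new vertex cannot simply go to the
  new vertex. It goes to the composite of the unary operation from \<open>f (root S)\<close> to the
  root of \<open>T\<close>, which exists because \<open>T\<close> is closed, with the new vertex
  below \<open>T\<close>.\<close>

lemma tree_map_grow:
  fixes S T :: "'e::infinite tree"
  assumes S: "is_tree S" and T: "closed_tree T" and f: "tree_map S T f"
  shows "tree_map (grow S) (grow T) (grow_map S T f)"
  unfolding tree_map_def
proof (intro conjI allI impI)
  have Tt: "is_tree T" using T by simp
  have fE: "\<And>e. e \<in> Edges S \<Longrightarrow> f e \<in> Edges T" using f by (auto simp: tree_map_def)
  have old: "map (grow_map S T f) es = map f es \<and> grow_map S T f e = f e" if "set es \<subseteq> Edges S" "e \<in> Edges S" for es e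
    using that fresh[OF S] by (auto simp: grow_map_def grow_def)
  have new: "grow_map S T f (fresh S) = fresh T" by (simp add: grow_map_def grow_def)
  show "grow_map S T f \<in> Edges (grow S) \<rightarrow>\<^sub>E Edges (grow T)" using fE by (auto simp: grow_map_def grow_def)
  fix es e assume p: "(es, e) \<in> Ops (tree_operad (grow S))"
  show "(map (grow_map S T f) es, grow_map S T f e) \<in> Ops (tree_operad (grow T))"
  proof (cases rule: Ops_grow_cases[OF S p])
    case 1
    then have "(map f es, f e) \<in> Ops (tree_operad T)" using f by (auto simp: tree_map_def)
    moreover have "map (grow_map S T f) es = map f es \<and> grow_map S T f e = f e" using old Ops_edges[OF 1] by blast
    ultimately show ?thesis using Ops_subset_grow[of T] by (simp only:) blast
  next
    case 2
    then show ?thesis using Ops_unit[OF grow_tree(1)[OF Tt], of "fresh T"] by (simp add: new) (simp add: grow_def)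
  next
    case 3
    then have "(map f es, f (root S)) \<in> Ops (tree_operad T)" using f by (auto simp: tree_map_def)
    then have "(map f es, root T) \<in> Ops (tree_operad T)"
      by (rule Ops_compose[OF Tt _ Ops_to_root[OF T]]) (use fE Ops_edges[OF 3(2)] in simp)
    moreover have "map (grow_map S T f) es = map f es" using old[of es "root S"] Ops_edges[OF 3(2)] by blast
    ultimately show ?thesis using Ops_fresh[OF Tt] by (simp only: 3(1) new)
  qed
qed

definition retract_map :: "'e tree \<Rightarrow> 'e \<Rightarrow> 'e" where
  "retract_map T = (\<lambda>e\<in>Edges (grow T). if e = fresh T then root T else e)"

text \<open>The new vertex goes to the unit of the old root, so an operation into the new edge
  becomes the operation with the same inputs into the old root, or a unit.\<close>

lemma tree_map_retract:
  fixes T :: "'e::infinite tree"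
  assumes T: "is_tree T"
  shows "tree_map (grow T) T (retract_map T)"
  unfolding tree_map_def
proof (intro conjI allI impI)
  have r: "root T \<in> Edges T" using is_root_root[OF T] by (simp add: is_root_def)
  have old: "map (retract_map T) es = es \<and> retract_map T e = e" if "set es \<subseteq> Edges T" "e \<in> Edges T" for es e
    using that fresh[OF T] by (auto simp: retract_map_def grow_def intro!: map_idI)
  have new: "retract_map T (fresh T) = root T" by (simp add: retract_map_def grow_def)
  show "retract_map T \<in> Edges (grow T) \<rightarrow>\<^sub>E Edges T" using r by (auto simp: retract_map_def grow_def)
  fix es e assume p: "(es, e) \<in> Ops (tree_operad (grow T))"
  show "(map (retract_map T) es, retract_map T e) \<in> Ops (tree_operad T)"
  proof (cases rule: Ops_grow_cases[OF T p])
    case 1 then show ?thesis using old[of es e] Ops_edges[OF 1] by (simp only:)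
  next
    case 2 then show ?thesis using Ops_unit[OF T r] by (simp add: new)
  next
    case 3 then show ?thesis using old[of es "root T"] Ops_edges[OF 3(2)] by (simp add: new)
  qed
qed

section \<open>The stump and the decalage of closed trees\<close>

text \<open>The single edge is capped by a vertex without inputs, because the tree without vertices
  has a leaf and is not closed. The name of the edge is arbitrary.\<close>

definition stump :: "'e tree" where
  "stump = \<lparr>Edges = {undefined}, Vertices = {({}, undefined)}\<rparr>"

lemma closed_stump: "closed_tree stump"
proof -
  have "is_root stump y \<longleftrightarrow> y = undefined" for y :: 'a by (auto simp: is_root_def stump_def)
  then show ?thesis by (auto simp: is_tree_def) (auto simp: stump_def leaves_def)
qed

lemma tree_map_stump:
  fixes T :: "'e::infinite tree"
  assumes T: "closed_tree T"
  shows "tree_map stump (grow T) (\<lambda>e\<in>Edges stump. fresh T)"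
  unfolding tree_map_def
proof (intro conjI allI impI)
  have Tt: "is_tree T" using T by simp
  note G = grow_tree[OF Tt]
  show "(\<lambda>e\<in>Edges stump. fresh T) \<in> Edges stump \<rightarrow>\<^sub>E Edges (grow T)" by (auto simp: grow_def)
  fix es e assume p: "(es, e) \<in> Ops (tree_operad (stump :: 'e tree))"
  have "distinct es" using p by (auto simp: tree_operad_def)
  moreover have "set es \<subseteq> {undefined}" "e = undefined" using Ops_edges[OF p] by (auto simp: stump_def)
  ultimately have "es = [] \<or> es = [undefined]" by (cases es) (auto simp: subset_singleton_iff)
  moreover have "([fresh T], fresh T) \<in> Ops (tree_operad (grow T))"
    by (rule Ops_unit[OF G(1)]) (simp add: grow_def)
  \<comment> \<open>The witness is the whole tree \<open>grow T\<close>, which has no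
    leaves.\<close>
  moreover have "([], fresh T) \<in> Ops (tree_operad (grow T))"
    using G T by (auto simp: tree_operad_def subtree_def intro!: exI[of _ "grow T"])
  ultimately show "(map (\<lambda>e\<in>Edges stump. fresh T) es, (\<lambda>e\<in>Edges stump. fresh T) e) \<in> Ops (tree_operad (grow T))"
    using \<open>e = undefined\<close> by (auto simp: stump_def)
qed

definition grow_functor :: "('e tree, 'e tree_arrow, 'e tree, 'e tree_arrow) fnctr" where
  "grow_functor = \<lparr>omap = grow, amap = (\<lambda>(S, (f, _), T). tree_arr (grow S) (grow_map S T f) (grow T))\<rparr>"

lemma amap_grow_functor: "amap grow_functor (tree_arr S f T) = tree_arr (grow S) (grow_map S T f) (grow T)"
  by (simp add: grow_functor_def) (simp add: tree_arr_def)

lemma omap_grow_functor [simp]: "omap grow_functor = grow"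
  by (simp add: grow_functor_def)

lemma closed_grow: "closed_tree (T :: 'e::infinite tree) \<Longrightarrow> closed_tree (grow T)"
  using grow_tree[of T] by simp

text \<open>An arrow into \<open>grow T\<close> belongs to the sieve exactly when it avoids the new
  edge, and \<open>grow_map\<close> reflects this because only the new edge goes to the new edge.
  Every tree has an edge, so an arrow that sends all edges to the new one never belongs to the
  sieve.\<close>

theorem decalage_closed_Omega:
  "decalage_retract (closed_Omega :: ('e::infinite tree, 'e tree_arrow) cat) grow_functor
    (\<lambda>T. tree_arr T (\<lambda>e\<in>Edges T. e) (grow T)) stump
    (\<lambda>T. tree_arr stump (\<lambda>e\<in>Edges stump. fresh T) (grow T))
    (\<lambda>T. tree_arr (grow T) (retract_map T) T)"
    (is "decalage_retract ?A ?P ?i _ ?j ?r")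
proof -
  interpret category ?A by (rule category_closed_Omega)
  have incl: "tree_map T (grow T) (\<lambda>e\<in>Edges T. e)" for T :: "'e tree"
    by (rule tree_map_inclusion[OF _ Ops_subset_grow]) (auto simp: grow_def)
  have arrI: "tree_arr S f T \<in> Arr ?A" if "closed_tree S" "closed_tree T" "tree_map S T f" for S T :: "'e tree" and f
    using that unfolding closed_Omega_arr by blast
  have fE: "f e \<in> Edges T" if "tree_map S T f" "e \<in> Edges S" for S T :: "'e tree" and f e
    using that by (auto simp: tree_map_def)
  show ?thesis
  proof
    show "is_functor ?A ?A ?P"
      unfolding is_functor_def
    proof (intro conjI ballI impI)
      show "omap ?P T \<in> Obj ?A" if "T \<in> Obj ?A" for T
        using that closed_grow by (simp add: closed_Omega_obj)
      show "amap ?P (Ident ?A T) = Ident ?A (omap ?P T)" if "T \<in> Obj ?A" for T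
      proof -
        have T: "is_tree T" using that by (simp add: closed_Omega_obj)
        have "grow_map T T (\<lambda>e\<in>Edges T. e) = (\<lambda>e\<in>Edges (grow T). e)"
          by (auto simp: grow_map_def grow_def fun_eq_iff)
        then show ?thesis
          using grow_tree(1)[OF T] by (simp add: closed_Omega_ident[OF T] closed_Omega_ident amap_grow_functor)
      qed
      fix s assume "s \<in> Arr ?A"
      then obtain S f T where s: "closed_tree S" "closed_tree T" "tree_map S T f" "s = tree_arr S f T"
        unfolding closed_Omega_arr by blast
      have gf: "tree_map (grow S) (grow T) (grow_map S T f)" using tree_map_grow s by blast
      show "amap ?P s \<in> Arr ?A" unfolding s(4) amap_grow_functor by (rule arrI) (use s closed_grow gf in auto)
      show "Dom ?A (amap ?P s) = omap ?P (Dom ?A s)" "Cod ?A (amap ?P s) = omap ?P (Cod ?A s)"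
        by (simp_all add: s(4) amap_grow_functor)
      fix t assume "t \<in> Arr ?A" "Dom ?A t = Cod ?A s"
      then obtain g U where t: "closed_tree U" "tree_map T U g" "t = tree_arr T g U"
        unfolding closed_Omega_arr s(4) by auto
      have "grow_map S U (compose (Edges S) g f) = compose (Edges (grow S)) (grow_map T U g) (grow_map S T f)"
        using fE[OF s(3)] fresh[of T] s(2) by (fastforce simp: grow_map_def grow_def compose_def fun_eq_iff)
      then show "amap ?P (Comp ?A t s) = Comp ?A (amap ?P t) (amap ?P s)"
        by (simp add: s(4) t(3) closed_Omega_comp[OF s(3)] closed_Omega_comp[OF gf] amap_grow_functor)
    qed
    show "stump \<in> Obj ?A" using closed_stump by (simp add: closed_Omega_obj)
    show "?i T \<in> Arr ?A \<and> Dom ?A (?i T) = T \<and> Cod ?A (?i T) = omap ?P T" if "T \<in> Obj ?A" for T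
      using that arrI[OF _ _ incl[of T]] closed_grow[of T] by (simp add: closed_Omega_obj)
    show "?j T \<in> Arr ?A \<and> Dom ?A (?j T) = stump \<and> Cod ?A (?j T) = omap ?P T" if "T \<in> Obj ?A" for T
      using that arrI[OF closed_stump _ tree_map_stump[of T]] closed_grow[of T] by (simp add: closed_Omega_obj)
    show "?r T \<in> Arr ?A \<and> Dom ?A (?r T) = omap ?P T \<and> Cod ?A (?r T) = T" if "T \<in> Obj ?A" for T
      using that arrI[OF _ _ tree_map_retract[of T]] closed_grow[of T] by (simp add: closed_Omega_obj)
    show "Comp ?A (?r T) (?i T) = Ident ?A T" if "T \<in> Obj ?A" for T
    proof -
      have T: "is_tree T" using that by (simp add: closed_Omega_obj)
      have "compose (Edges T) (retract_map T) (\<lambda>e\<in>Edges T. e) = (\<lambda>e\<in>Edges T. e)"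
        using fresh[OF T] by (auto simp: compose_def retract_map_def grow_def fun_eq_iff)
      then show ?thesis by (simp add: closed_Omega_comp[OF incl] closed_Omega_ident[OF T])
    qed
  next
    fix s assume "s \<in> Arr ?A"
    then obtain S f T where s: "closed_tree S" "closed_tree T" "tree_map S T f" "s = tree_arr S f T"
      unfolding closed_Omega_arr by blast
    have "compose (Edges S) (grow_map S T f) (\<lambda>e\<in>Edges S. e) = compose (Edges S) (\<lambda>e\<in>Edges T. e) f"
      using fE[OF s(3)] fresh[of S] s(1) by (auto simp: compose_def grow_map_def grow_def fun_eq_iff)
    then show "Comp ?A (amap ?P s) (?i (Dom ?A s)) = Comp ?A (?i (Cod ?A s)) s"
      by (simp add: s(4) amap_grow_functor closed_Omega_comp[OF incl] closed_Omega_comp[OF s(3)])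
    have "compose (Edges (stump :: 'e tree)) (grow_map S T f) (\<lambda>e\<in>Edges stump. fresh S) = (\<lambda>e\<in>Edges stump. fresh T)"
      by (auto simp: compose_def grow_map_def grow_def fun_eq_iff)
    then show "Comp ?A (amap ?P s) (?j (Dom ?A s)) = ?j (Cod ?A s)"
      by (simp only: s(4) amap_grow_functor closed_Omega_comp[OF tree_map_stump[OF s(1)]] closed_Omega_dom)
    fix u k assume u: "u \<in> Arr ?A" "Cod ?A u = omap ?P (Dom ?A s)" and k: "k \<in> Arr ?A" "Cod ?A k = Cod ?A s"
      and eq: "Comp ?A (amap ?P s) u = Comp ?A (?i (Cod ?A s)) k"
    obtain R g where g: "closed_tree R" "tree_map R (grow S) g" "u = tree_arr R g (grow S)"
      using u unfolding closed_Omega_arr s(4) by auto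
    obtain R' l where l: "tree_map R' T l" "k = tree_arr R' l T"
      using k unfolding closed_Omega_arr s(4) by auto
    have "R = R'" and gl: "compose (Edges R) (grow_map S T f) g = compose (Edges R') (\<lambda>e\<in>Edges T. e) l"
      using eq unfolding s(4) g(3) l(2) amap_grow_functor closed_Omega_dom closed_Omega_comp[OF g(2)] closed_Omega_comp[OF l(1)] tree_arr_inject
      by auto
    have ne: "g e \<noteq> fresh S" if e: "e \<in> Edges R" for e
    proof
      assume "g e = fresh S"
      then have "fresh T = l e"
        using fun_cong[OF gl, of e] e fE[OF l(1), of e] by (simp add: compose_def grow_map_def grow_def \<open>R = R'\<close>)
      then show False using fE[OF l(1), of e] e fresh[of T] s(2) \<open>R = R'\<close> by auto
    qed
    have g': "tree_map R S g"
      unfolding tree_map_def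
    proof (intro conjI allI impI)
      have "g e \<in> Edges S" if "e \<in> Edges R" for e using fE[OF g(2) that] ne[OF that] by (simp add: grow_def)
      then show "g \<in> Edges R \<rightarrow>\<^sub>E Edges S" using g(2) by (auto simp: tree_map_def PiE_iff)
      fix es e assume p: "(es, e) \<in> Ops (tree_operad R)"
      then have "(map g es, g e) \<in> Ops (tree_operad (grow S))" using g(2) by (auto simp: tree_map_def)
      moreover have "g e \<noteq> fresh S" using ne Ops_edges[OF p] by blast
      moreover have "is_tree S" using s(1) by simp
      \<comment> \<open>The other two cases of \<open>Ops_grow_cases\<close> have the new edge as
        output.\<close>
      ultimately show "(map g es, g e) \<in> Ops (tree_operad S)" by (metis Ops_grow_cases)
    qed
    show "\<exists>k'\<in>Arr ?A. Cod ?A k' = Dom ?A s \<and> u = Comp ?A (?i (Dom ?A s)) k'"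
    proof (intro bexI conjI)
      show "tree_arr R g S \<in> Arr ?A" by (rule arrI) (use g s g' in auto)
      show "Cod ?A (tree_arr R g S) = Dom ?A s" by (simp add: s(4))
      show "u = Comp ?A (?i (Dom ?A s)) (tree_arr R g S)"
        using compose_restrict_id(1)[OF g'] by (simp add: s(4) g(3) closed_Omega_comp[OF g'])
    qed
  next
    fix s t T assume s: "s \<in> Arr ?A" "Cod ?A s = T" and t: "t \<in> Arr ?A" "Cod ?A t = T"
      and eq: "Comp ?A (?i T) s = Comp ?A (?i T) t"
    obtain S f where f: "tree_map S T f" "s = tree_arr S f T" using s unfolding closed_Omega_arr by auto
    obtain R g where g: "tree_map R T g" "t = tree_arr R g T" using t unfolding closed_Omega_arr by auto
    show "s = t"
      using eq compose_restrict_id(1)[OF f(1)] compose_restrict_id(1)[OF g(1)]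
      by (simp add: f(2) g(2) closed_Omega_comp[OF f(1)] closed_Omega_comp[OF g(1)] tree_arr_inject)
  next
    fix T s t assume T: "T \<in> Obj ?A" and s: "s \<in> Arr ?A" "Cod ?A s = stump" and t: "t \<in> Arr ?A" "Cod ?A t = T"
    obtain S f where f: "closed_tree S" "tree_map S stump f" "s = tree_arr S f stump" using s unfolding closed_Omega_arr by auto
    obtain R g where g: "tree_map R T g" "t = tree_arr R g T" using t unfolding closed_Omega_arr by auto
    show "Comp ?A (?j T) s \<noteq> Comp ?A (?i T) t"
    proof
      assume "Comp ?A (?j T) s = Comp ?A (?i T) t"
      then have "S = R" and fg: "compose (Edges S) (\<lambda>e\<in>Edges stump. fresh T) f = compose (Edges R) (\<lambda>e\<in>Edges T. e) g"
        unfolding f(3) g(2) closed_Omega_comp[OF f(2)] closed_Omega_comp[OF g(1)] tree_arr_inject by auto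
      obtain e where e: "e \<in> Edges S" using f(1) by (auto simp: is_tree_def)
      have "fresh T = g e"
        using fun_cong[OF fg, of e] e fE[OF f(2) e] fE[OF g(1), of e] \<open>S = R\<close> by (simp add: compose_def)
      then show False using fE[OF g(1), of e] e \<open>S = R\<close> fresh[of T] T by (auto simp: closed_Omega_obj)
    qed
  qed
qed

theorem mainTheorem5:
  shows "strict_test_category TYPE('c \<times> 'd) TYPE('x \<times> 'y)
           (closed_Omega :: ('e::infinite tree, 'e tree_arrow) cat)"
  by (rule decalage_retract.strict_test[OF decalage_closed_Omega])

end
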